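(* Let $\ell\geq3$, $m\geq2\ell$ and $r\geq 2$ be integers, and let $\mathcal{F}=\{F_1,F_2,F_3,F_4\}$, where $F_1=(P_\ell\cup\overline{K_m})\bigotimes T(m(r-1),r-1)$, $F_2=mK_2\bigotimes mK_2\bigotimes T(m(r-2),r-2)$, $F_3=(2K_{\ell-1}\cup\overline{K_m})\bigotimes(K_2\cup\overline{K_m})\bigotimes T(m(r-2),r-2)$, $F_4=(K_{\ell-1}\cup\overline{K_m})\bigotimes(K_{\ell-1}\cup\overline{K_m})\bigotimes T(m(r-2),r-2)$. Then for sufficiently large $n$, every $G\in{\rm EX}(n,\mathcal{F})$ is of the form $G=H\bigotimes T(n-|H|,r-1)$, where $H\in{\rm EX}(|H|,P_\ell)$ (i.e., $H$ is a $P_\ell$-free graph with the maximum number of edges among $P_\ell$-free graphs on $|H|$ vertices).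
   Context: All graphs are finite and simple; $\mathcal{F}$-free means containing no member of $\mathcal{F}$ as a subgraph, and ${\rm EX}(n,\mathcal{F})$ is the set of $\mathcal{F}$-free $n$-vertex graphs with maximum number of edges. $\cup$ is disjoint union, $tH$ is $t$ disjoint copies of $H$, $\bigotimes$ is the join (disjoint union plus all edges between different factors). $P_\ell$ is the path on $\ell$ vertices, $K_s$ the complete graph, $\overline{K_m}$ the edgeless graph on $m$ vertices. $T(n,r)$ is the Turán graph (complete $r$-partite on $n$ vertices, part sizes $\lfloor n/r\rfloor$ or $\lceil n/r\rceil$), $T(n,1)=\overline{K_n}$, $T(n,0)$ is the empty graph. *)

theory Defs
  imports Main "HOL-Library.Countable"
begin

section \<open>Finite simple graphs\<close>

record 'a graph =
  verts :: "'a set"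
  edges :: "'a set set"

definition simple_graph :: "'a graph \<Rightarrow> bool" where
  "simple_graph G \<longleftrightarrow>
     finite (verts G) \<and> (\<forall>e\<in>edges G. e \<subseteq> verts G \<and> card e = 2)"

text \<open>Containment as a (not necessarily induced) subgraph, up to isomorphism.\<close>

definition contains_graph :: "'a graph \<Rightarrow> 'b graph \<Rightarrow> bool" where
  "contains_graph G F \<longleftrightarrow>
     (\<exists>f. inj_on f (verts F) \<and> f ` verts F \<subseteq> verts G \<and> (\<forall>e\<in>edges F. f ` e \<in> edges G))"

definition graph_iso :: "'a graph \<Rightarrow> 'b graph \<Rightarrow> bool" (infix "\<cong>\<^sub>g" 50) where
  "G \<cong>\<^sub>g H \<longleftrightarrow>
     (\<exists>f. bij_betw f (verts G) (verts H) \<and> (\<lambda>e. f ` e) ` edges G = edges H)"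

definition family_free :: "'b graph set \<Rightarrow> 'a graph \<Rightarrow> bool" where
  "family_free \<F> G \<longleftrightarrow> (\<forall>F\<in>\<F>. \<not> contains_graph G F)"

text \<open>The set \<open>EX(n, \<F>)\<close>. Every finite graph is isomorphic to one whose vertices are natural
  numbers, so host graphs are taken with vertices in \<^typ>\<open>nat\<close>; the vertex set may be any
  \<open>n\<close>-element set.\<close>

definition extremal_graphs :: "nat \<Rightarrow> 'b graph set \<Rightarrow> nat graph set" where
  "extremal_graphs n \<F> =
     {G. simple_graph G \<and> card (verts G) = n \<and> family_free \<F> G \<and>
         (\<forall>G' :: nat graph. simple_graph G' \<and> card (verts G') = n \<and> family_free \<F> G' \<longrightarrow>
            card (edges G') \<le> card (edges G))}"


section \<open>Constructions\<close>

definition path_graph :: "nat \<Rightarrow> nat graph" where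
  "path_graph l = \<lparr>verts = {..<l}, edges = {{i, Suc i} | i. Suc i < l}\<rparr>"

definition complete_graph :: "nat \<Rightarrow> nat graph" where
  "complete_graph s = \<lparr>verts = {..<s}, edges = {{i, j} | i j. i < s \<and> j < s \<and> i \<noteq> j}\<rparr>"

definition edgeless_graph :: "nat \<Rightarrow> nat graph" where
  "edgeless_graph m = \<lparr>verts = {..<m}, edges = {}\<rparr>"

text \<open>The parts of the Turan graph \<open>T(n, r)\<close> are the residue classes modulo \<open>r\<close> on
  \<open>{0, ..., n - 1}\<close>; for \<open>r > 0\<close> these have the right sizes by \<open>turan_part_card\<close> below.
  \<open>T(n, 0)\<close> is the graph without vertices.\<close>

definition turan_graph :: "nat \<Rightarrow> nat \<Rightarrow> nat graph" where
  "turan_graph n r =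
     (if r = 0 then \<lparr>verts = {}, edges = {}\<rparr>
      else \<lparr>verts = {..<n}, edges = {{i, j} | i j. i < n \<and> j < n \<and> i mod r \<noteq> j mod r}\<rparr>)"

definition disj_union :: "'a graph \<Rightarrow> 'b graph \<Rightarrow> ('a + 'b) graph" (infixl "\<union>\<^sub>g" 65) where
  "G \<union>\<^sub>g H =
     \<lparr>verts = verts G <+> verts H,
      edges = (\<lambda>e. Inl ` e) ` edges G \<union> (\<lambda>e. Inr ` e) ` edges H\<rparr>"

definition graph_join :: "'a graph \<Rightarrow> 'b graph \<Rightarrow> ('a + 'b) graph" (infixl "\<otimes>\<^sub>g" 60) where
  "G \<otimes>\<^sub>g H =
     \<lparr>verts = verts G <+> verts H,
      edges = edges (G \<union>\<^sub>g H) \<union> {{Inl u, Inr v} | u v. u \<in> verts G \<and> v \<in> verts H}\<rparr>"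

definition copies :: "nat \<Rightarrow> 'a graph \<Rightarrow> (nat \<times> 'a) graph" where
  "copies t H =
     \<lparr>verts = {..<t} \<times> verts H,
      edges = {Pair i ` e | i e. i < t \<and> e \<in> edges H}\<rparr>"

text \<open>Isomorphic copy with vertices in \<^typ>\<open>nat\<close>, so that graphs built on different sum and
  product types can be collected in one family.\<close>

definition nat_copy :: "'a::countable graph \<Rightarrow> nat graph" where
  "nat_copy G = \<lparr>verts = to_nat ` verts G, edges = (\<lambda>e. to_nat ` e) ` edges G\<rparr>"


section \<open>The forbidden family\<close>

definition F1 :: "nat \<Rightarrow> nat \<Rightarrow> nat \<Rightarrow> nat graph" where
  "F1 l m r =
     nat_copy ((path_graph l \<union>\<^sub>g edgeless_graph m) \<otimes>\<^sub>g turan_graph (m * (r - 1)) (r - 1))"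

definition F2 :: "nat \<Rightarrow> nat \<Rightarrow> nat graph" where
  "F2 m r =
     nat_copy (copies m (complete_graph 2) \<otimes>\<^sub>g copies m (complete_graph 2)
       \<otimes>\<^sub>g turan_graph (m * (r - 2)) (r - 2))"

definition F3 :: "nat \<Rightarrow> nat \<Rightarrow> nat \<Rightarrow> nat graph" where
  "F3 l m r =
     nat_copy ((copies 2 (complete_graph (l - 1)) \<union>\<^sub>g edgeless_graph m)
       \<otimes>\<^sub>g (complete_graph 2 \<union>\<^sub>g edgeless_graph m)
       \<otimes>\<^sub>g turan_graph (m * (r - 2)) (r - 2))"

definition F4 :: "nat \<Rightarrow> nat \<Rightarrow> nat \<Rightarrow> nat graph" where
  "F4 l m r =
     nat_copy ((complete_graph (l - 1) \<union>\<^sub>g edgeless_graph m)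
       \<otimes>\<^sub>g (complete_graph (l - 1) \<union>\<^sub>g edgeless_graph m)
       \<otimes>\<^sub>g turan_graph (m * (r - 2)) (r - 2))"


section \<open>Sanity checks\<close>

lemma turan_part_card:
  assumes "i < r"
  shows "card {v. v < n \<and> v mod r = i} = (if i < n mod r then n div r + 1 else n div r)"
proof -
  have "{v. v < n \<and> v mod r = i} = (\<lambda>k. i + r * k) ` {k. i + r * k < n}"
  proof (intro equalityI subsetI)
    fix v assume "v \<in> {v. v < n \<and> v mod r = i}"
    then have v: "v = i + r * (v div r)" "v < n" by auto
    then have "v div r \<in> {k. i + r * k < n}" by simp
    then have "i + r * (v div r) \<in> (\<lambda>k. i + r * k) ` {k. i + r * k < n}" by blast
    then show "v \<in> (\<lambda>k. i + r * k) ` {k. i + r * k < n}" using v(1) by simp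
  qed (use assms in auto)
  moreover have "inj (\<lambda>k. i + r * k)" using assms by (auto intro!: injI)
  ultimately have c: "card {v. v < n \<and> v mod r = i} = card {k. i + r * k < n}"
    by (simp add: card_image inj_on_subset)
  have n: "n = r * (n div r) + n mod r" by simp
  have "{k. i + r * k < n} = {..<(if i < n mod r then n div r + 1 else n div r)}"
  proof (intro set_eqI)
    fix k
    have "i + r * k < n \<longleftrightarrow> k < (if i < n mod r then n div r + 1 else n div r)"
    proof (cases "k < n div r")
      case True
      then have "r * Suc k \<le> r * (n div r)" by (intro mult_le_mono) auto
      then have "i + r * k < n" using assms n unfolding mult_Suc_right by linarith
      then show ?thesis using True by auto
    next
      case False
      show ?thesis
      proof (cases "k = n div r")
        case True
        have "i + r * (n div r) < n \<longleftrightarrow> i < n mod r" using n by linarith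
        then show ?thesis using True by auto
      next
        case neq: False
        then have "r * Suc (n div r) \<le> r * k" using False by (intro mult_le_mono) auto
        moreover have "n mod r < r" using assms by simp
        ultimately have "\<not> i + r * k < n" using n unfolding mult_Suc_right by linarith
        then show ?thesis using neq False by auto
      qed
    qed
    then show "k \<in> {k. i + r * k < n} \<longleftrightarrow>
        k \<in> {..<(if i < n mod r then n div r + 1 else n div r)}" by auto
  qed
  then show ?thesis using c by simp
qed

lemma nat_copy_iso: "G \<cong>\<^sub>g nat_copy G"
  unfolding graph_iso_def nat_copy_def by (intro exI[of _ to_nat]) (auto simp: bij_betw_def)

lemma simple_constructions:
  "simple_graph (path_graph l)" "simple_graph (complete_graph s)"
  "simple_graph (edgeless_graph m)" "simple_graph (turan_graph n r)"
  by (auto simp: simple_graph_def path_graph_def complete_graph_def edgeless_graph_def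
      turan_graph_def card_insert_if)

lemma simple_disj_union:
  "simple_graph G \<Longrightarrow> simple_graph H \<Longrightarrow> simple_graph (G \<union>\<^sub>g H)"
  by (fastforce simp: simple_graph_def disj_union_def card_image)

lemma simple_graph_join:
  assumes "simple_graph G" "simple_graph H" shows "simple_graph (G \<otimes>\<^sub>g H)"
  using simple_disj_union[OF assms] assms
  by (auto simp: simple_graph_def graph_join_def disj_union_def)

lemma simple_copies: "simple_graph H \<Longrightarrow> simple_graph (copies t H)"
  by (fastforce simp: simple_graph_def copies_def card_image inj_on_def)

lemma simple_nat_copy: "simple_graph G \<Longrightarrow> simple_graph (nat_copy G)"
  by (auto simp: simple_graph_def nat_copy_def card_image inj_on_subset[OF inj_to_nat])

lemma simple_family:
  "simple_graph (F1 l m r)" "simple_graph (F2 m r)"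
  "simple_graph (F3 l m r)" "simple_graph (F4 l m r)"
  unfolding F1_def F2_def F3_def F4_def
  by (intro simple_nat_copy simple_graph_join simple_disj_union simple_copies
      simple_constructions)+

end

theory Submission
 imports Defs Complex_Main
begin

text \<open>
Call a graph good if its vertices can be coloured with \<open>r\<close> colours so that the colours \<open>1, ..., r - 1\<close>
are independent and colour \<open>0\<close> contains no path on \<open>l\<close> vertices. Good graphs contain no member of the
family, so it suffices that every large extremal graph is good: optimality then forces all edges
between colours, an extremal graph in colour \<open>0\<close> and balanced sizes of the others.

This is a progressive induction. By the gap theorem a graph with at least as many edges as the best
good graph contains a forbidden graph or a core: a complete \<open>r\<close>-partite graph with parts of size \<open>k\<close>
where one part consists of disjoint cliques \<open>K_{l-1}\<close>, or (for even \<open>l\<close>) where \<open>l div 2 - 1\<close> further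
vertices are joined to everything. Either the core forces a good colouring of the whole graph, or its
deletion costs fewer edges than the best good graph loses from \<open>n\<close> to \<open>n - r * k\<close> vertices. In
the latter case the surplus of the extremal graph over the best good graph has dropped on the way
from \<open>n - r * k\<close> to \<open>n\<close>, which can happen only finitely often.

The gap theorem is an induction on \<open>r\<close>. For \<open>r = 1\<close> it is a stability version of the Erdos-Gallai bound.
For the step, all but one of the \<open>r\<close> classes of an almost extremal graph have only small matchings. Such
a class has a small cover by vertices, in which the others have few different neighbourhoods, and a set
of vertices with equal neighbourhoods is split off; its common neighbourhood is subject to the induction
hypothesis.
\<close>

section \<open>Paths and the Erdos-Gallai bound\<close>

text \<open>The edges between the colours are fixed up to lower order by balance; the decisive
  linear term comes from colour \<open>0\<close>, where the path-free condition allows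
  \<open>l - 2\<close> ordered pairs per vertex. A large class close to this bound must contain many
  disjoint \<open>K_{l-1}\<close> or, for even \<open>l\<close>, many vertices joined to the same
  \<open>l div 2 - 1\<close> hubs. These two alternatives are the origin of the two cores. Each
  forbidden graph has one task. \<open>F1\<close> keeps the classes free of the path and bounds the
  number of vertices with many neighbours in all classes; \<open>F2\<close> leaves large matchings
  to one class only; \<open>F3\<close> makes the other classes independent next to a clique core;
  \<open>F4\<close> keeps two classes from carrying cliques next to a hub core. The part size
  \<open>k\<close> of a core is a multiple of \<open>l - 1\<close>, so that colour \<open>0\<close>
  of the best good graph can absorb \<open>k\<close> vertices as whole cliques, without any loss by
  rounding. All asymptotic statements range over the vertex sets \<open>V\<close> of one fixed
  relation \<open>E\<close>. Induced subgraphs are then mere subsets, and a threshold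
  \<open>n0\<close> does not depend on \<open>V\<close>.\<close>

text \<open>\<open>pe S S\<close> counts ordered pairs, hence is twice the number of edges inside \<open>S\<close>.\<close>

locale sgraph =
 fixes E :: "'a => 'a => bool"
 assumes E_sym: "E x y ==> E y x" and E_irrefl: "~ E x x"
begin

definition nb :: "'a => 'a set => 'a set" where "nb v S = {x\<in>S. E v x}"
definition dg :: "'a => 'a set => nat" where "dg v S = card (nb v S)"
definition pe :: "'a set => 'a set => nat" where "pe S T = (\<Sum>x\<in>S. dg x T)"
definition cmpl :: "'a set => 'a set => bool" where "cmpl S T \<longleftrightarrow> (\<forall>x\<in>S. \<forall>y\<in>T. E x y)"
definition ispath :: "'a set => 'a list => bool" where
 "ispath S xs \<longleftrightarrow> distinct xs & set xs \<subseteq> S & successively E xs"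
definition pfree :: "nat => 'a set => bool" where
 "pfree l S \<longleftrightarrow> (\<forall>xs. ispath S xs --> length xs ~= l)"
text \<open>Connectedness by cuts: an edge leaving a proper subset is what the extension and
  component arguments need. Paths are recovered in \<open>conn_path\<close>.\<close>

definition conn :: "'a set => bool" where
 "conn Q \<longleftrightarrow> Q ~= {} & (\<forall>S. S \<subset> Q --> S ~= {} --> (\<exists>x\<in>S. \<exists>y\<in>Q - S. E x y))"
definition sep :: "'a set => 'a set => bool" where "sep S T \<longleftrightarrow> (\<forall>x\<in>S. \<forall>y\<in>T. ~ E x y)"
definition clique :: "'a set => bool" where "clique Q \<longleftrightarrow> (\<forall>x\<in>Q. \<forall>y\<in>Q. x ~= y --> E x y)"

lemma E_sym': "E x y = E y x" using E_sym by blast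

section \<open>Degrees and ordered pair counts\<close>

lemma finite_nb[simp]: "finite S ==> finite (nb v S)" by (simp add: nb_def)
lemma nb_subset: "nb v S \<subseteq> S" by (auto simp: nb_def)
lemma mem_nb[simp]: "x \<in> nb v S \<longleftrightarrow> x \<in> S & E v x" by (simp add: nb_def)
lemma dg_le_card: "finite S ==> dg v S <= card S" by (simp add: dg_def card_mono nb_subset)
lemma dg_mono: "finite T ==> S \<subseteq> T ==> dg v S <= dg v T"
 unfolding dg_def by (rule card_mono) auto
lemma dg_empty[simp]: "dg v {} = 0" by (simp add: dg_def nb_def)
lemma dg_Un: "finite S ==> finite T ==> S Int T = {} ==> dg v (S Un T) = dg v S + dg v T"
 unfolding dg_def by (subst card_Un_disjoint[symmetric]) (auto simp: nb_def intro!: arg_cong[where f=card])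
lemma dg_self_less: assumes "finite S" "v \<in> S" shows "dg v S < card S"
proof -
 have "nb v S \<subset> S" using assms E_irrefl by (auto simp: nb_def)
 thus ?thesis unfolding dg_def using assms psubset_card_mono by blast
qed
lemma dg_sep: assumes "sep {v} S" shows "dg v S = 0"
proof -
 have "nb v S = {}" using assms by (auto simp: sep_def)
 thus ?thesis by (simp add: dg_def)
qed

lemma pe_empty[simp]: "pe {} T = 0" "pe S {} = 0" by (auto simp: pe_def)
lemma pe_Un1: "finite S ==> finite S' ==> S Int S' = {} ==> pe (S Un S') T = pe S T + pe S' T"
 by (simp add: pe_def sum.union_disjoint)
lemma pe_Un2: "finite T ==> finite T' ==> T Int T' = {} ==> pe S (T Un T') = pe S T + pe S T'"
 by (simp add: pe_def dg_Un sum.distrib)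
lemma dg_sum: "finite S ==> dg v S = (\<Sum>x\<in>S. if E v x then 1 else 0)"
 unfolding dg_def nb_def by (simp add: sum.If_cases Int_def)
lemma pe_sym: assumes "finite S" "finite T" shows "pe S T = pe T S"
proof -
 have "pe S T = (\<Sum>x\<in>S. \<Sum>y\<in>T. if E x y then 1 else 0)" using assms by (simp add: pe_def dg_sum)
 also have "... = (\<Sum>y\<in>T. \<Sum>x\<in>S. if E x y then 1 else 0)" by (rule sum.swap)
 also have "... = pe T S" using assms by (simp add: pe_def dg_sum E_sym')
 finally show ?thesis .
qed
lemma pe_mono: assumes "finite S'" "finite T'" "S \<subseteq> S'" "T \<subseteq> T'" shows "pe S T <= pe S' T'"
proof -
 have "pe S T <= (\<Sum>x\<in>S. dg x T')" unfolding pe_def by (rule sum_mono) (use assms dg_mono in auto)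
 also have "... <= pe S' T'" unfolding pe_def by (rule sum_mono2) (use assms in auto)
 finally show ?thesis .
qed
lemma pe_le: assumes "finite S" "finite T" shows "pe S T <= card S * card T"
proof -
 have "pe S T <= (\<Sum>x\<in>S. card T)" unfolding pe_def by (rule sum_mono) (use assms dg_le_card in auto)
 thus ?thesis by simp
qed
lemma pe_sep: assumes "sep S T" shows "pe S T = 0"
proof -
 have "dg x T = 0" if "x \<in> S" for x using assms that by (intro dg_sep) (auto simp: sep_def)
 thus ?thesis by (simp add: pe_def)
qed
lemma pe_cmpl: assumes "cmpl S T" shows "pe S T = card S * card T"
proof -
 have "!!x. x \<in> S ==> nb x T = T" using assms by (auto simp: cmpl_def)
 thus ?thesis by (simp add: pe_def dg_def)
qed
lemma cmpl_sym: "cmpl S T ==> cmpl T S" unfolding cmpl_def using E_sym by blast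
lemma cmpl_mono: "cmpl S T ==> S' \<subseteq> S ==> T' \<subseteq> T ==> cmpl S' T'" unfolding cmpl_def by blast
lemma cmpl_disj: "cmpl S T ==> S Int T = {}" unfolding cmpl_def using E_irrefl by blast

lemma pe_split: assumes "finite V" "T \<subseteq> V"
 shows "pe V V = pe (V - T) (V - T) + 2 * pe T (V - T) + pe T T"
proof -
 have f: "finite T" "finite (V - T)" using assms finite_subset by auto
 have V: "V = T Un (V - T)" using assms by auto
 have "pe V V = pe T (T Un (V - T)) + pe (V - T) (T Un (V - T))"
  using pe_Un1[OF f, of "T Un (V - T)"] V by auto
 also have "pe T (T Un (V - T)) = pe T T + pe T (V - T)" by (rule pe_Un2) (use f in auto)
 also have "pe (V - T) (T Un (V - T)) = pe (V - T) T + pe (V - T) (V - T)" by (rule pe_Un2) (use f in auto)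
 finally show ?thesis using pe_sym[OF f] by simp
qed
lemma pe_delete: assumes "finite V" "v \<in> V" shows "pe V V = pe (V - {v}) (V - {v}) + 2 * dg v V"
proof -
 have "pe {v} {v} = 0" using E_irrefl by (auto simp: pe_def dg_def nb_def)
 moreover have "dg v V = dg v ({v} Un (V - {v}))" using assms by (simp add: insert_absorb)
 moreover have "... = dg v {v} + dg v (V - {v})" by (rule dg_Un) (use assms in auto)
 moreover have "dg v {v} = 0" using E_irrefl by (auto simp: dg_def nb_def)
 ultimately show ?thesis using pe_split[of V "{v}"] assms by (simp add: pe_def)
qed
lemma pe_sep_split: assumes "finite V" "S \<subseteq> V" "sep S (V - S)"
 shows "pe V V = pe S S + pe (V - S) (V - S)"
 using pe_split[OF assms(1,2)] pe_sep[OF assms(3)] by simp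

section \<open>Paths as vertex lists\<close>

lemma ispath_mono: "ispath S xs ==> S \<subseteq> T ==> ispath T xs" by (auto simp: ispath_def)
lemma pfree_mono: "pfree l T ==> S \<subseteq> T ==> pfree l S" unfolding pfree_def using ispath_mono by blast
lemma ispath_take: assumes "ispath S xs" shows "ispath S (take k xs)"
proof -
 have "successively E (take k xs @ drop k xs)" using assms by (simp add: ispath_def)
 hence "successively E (take k xs)" unfolding successively_append_iff by blast
 thus ?thesis using assms set_take_subset[of k xs] by (auto simp: ispath_def)
qed
lemma pfree_short: assumes "pfree l S" "ispath S xs" shows "length xs < l"
proof (rule ccontr)
 assume "~ length xs < l"
 hence "length (take l xs) = l" by simp
 thus False using ispath_take[OF assms(2), of l] assms(1) unfolding pfree_def by blast
qed
lemma successively_rev_E: "successively E xs ==> successively E (rev xs)"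
 unfolding successively_rev by (erule successively_mono) (rule E_sym)
lemma ispath_rev: "ispath S xs ==> ispath S (rev xs)"
 by (simp add: ispath_def successively_rev_E del: successively_rev)
lemma ispath_append: assumes "ispath S xs" "ispath T ys" "set xs Int set ys = {}"
  "xs = [] \<or> ys = [] \<or> E (last xs) (hd ys)" shows "ispath (S Un T) (xs @ ys)"
 using assms by (auto simp: ispath_def successively_append_iff)
lemma ispath_Nil[simp]: "ispath S []" by (simp add: ispath_def)
lemma ispath_single: "x \<in> S ==> ispath S [x]" by (simp add: ispath_def)
lemma clique_ispath: assumes "clique Q" "distinct xs" "set xs \<subseteq> Q" shows "ispath Q xs"
proof -
 have "successively E xs" using assms(2,3)
 proof (induction xs)
  case (Cons a xs)
  thus ?case using assms(1) by (cases xs) (auto simp: clique_def)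
 qed simp
 thus ?thesis using assms by (simp add: ispath_def)
qed

text \<open>A cycle that does not exhaust a connected set can be opened next to a vertex outside it.\<close>

lemma cycle_extend:
 assumes "conn Q" "ispath Q ys" "ys ~= []" "E (last ys) (hd ys)" "set ys ~= Q"
 shows "\<exists>zs. ispath Q zs & length zs = Suc (length ys)"
proof -
 have "set ys \<subset> Q" "set ys ~= {}" using assms by (auto simp: ispath_def)
 then obtain x y where xy: "x \<in> set ys" "y \<in> Q - set ys" "E x y" using assms(1) unfolding conn_def by meson
 obtain us vs where s: "ys = us @ x # vs" using xy(1) split_list by metis
 have y: "successively E us" "successively E (x # vs)" "us = [] \<or> E (last us) x"
  using assms(2) unfolding ispath_def s by (auto simp: successively_append_iff)
 have v: "successively E vs" using y(2) by (cases vs) auto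
 have ux: "successively E (us @ [x])" using y by (auto simp: successively_append_iff)
 have c: "vs ~= [] ==> E (last vs) (hd (us @ [x]))" using assms(4) unfolding s by (cases us) auto
 have vx: "successively E (vs @ (us @ [x]))" unfolding successively_append_iff[of _ vs] using v ux c by blast
 have "successively E ((vs @ us @ [x]) @ [y])"
  unfolding successively_append_iff[of _ "vs @ us @ [x]"] using vx xy(3) by auto
 moreover have "distinct ((vs @ us @ [x]) @ [y])" "set ((vs @ us @ [x]) @ [y]) \<subseteq> Q"
  using assms(2) xy unfolding ispath_def s by auto
 ultimately have "ispath Q ((vs @ us @ [x]) @ [y])" unfolding ispath_def by blast
 thus ?thesis using s by (intro exI[of _ "(vs @ us @ [x]) @ [y]"]) auto
qed

lemma longest_path_ex: assumes "finite Q" "Q ~= {}"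
 obtains xs where "ispath Q xs" "xs ~= []" "!!ys. ispath Q ys ==> length ys <= length xs"
proof -
 obtain x where x: "x \<in> Q" using assms by blast
 have b: "\<forall>ys. ispath Q ys --> length ys < Suc (card Q)"
  using assms(1) by (auto simp: ispath_def less_Suc_eq_le) (metis card_mono distinct_card)
 obtain xs where xs: "ispath Q xs" "!!ys. ispath Q ys ==> length ys <= length xs"
  using ex_has_greatest_nat[of "ispath Q" "[x]" length "Suc (card Q)"] b ispath_single[OF x] by (metis less_imp_le)
 have "length [x] <= length xs" using xs(2)[OF ispath_single[OF x]] .
 hence "xs ~= []" by auto
 thus ?thesis using that xs by blast
qed

section \<open>The Erdos-Gallai bound and its equality case\<close>

text \<open>Rotation of a longest path. All neighbours of its two ends lie on it. If the first end
  were joined to the successor of a neighbour of the last end, the vertices of the path would form a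
  cycle, which connectedness opens into a longer path. So the degrees of the two ends add up to at
  most \<open>l - 2\<close>, and one of them is at most half of that.\<close>

lemma conn_low_degree:
 assumes "finite Q" "conn Q" "pfree l Q" "l <= card Q" "2 <= l"
 shows "\<exists>v\<in>Q. 2 * dg v Q <= l - 2"
proof -
 have ne: "Q ~= {}" using assms(2) by (simp add: conn_def)
 obtain xs where xs: "ispath Q xs" "xs ~= []" and mx: "!!ys. ispath Q ys ==> length ys <= length xs"
  using longest_path_ex[OF assms(1) ne] by blast
 define p where "p = length xs"
 have p: "p < l" "0 < p" using pfree_short[OF assms(3) xs(1)] xs(2) by (auto simp: p_def)
 have d: "distinct xs" "set xs \<subseteq> Q" "successively E xs" using xs(1) by (auto simp: ispath_def)
 have cs: "card (set xs) = p" using d(1) by (simp add: distinct_card p_def)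
 define a b where "a = hd xs" and "b = last xs"
 have ab: "a \<in> Q" "b \<in> Q" using d(2) xs(2) by (auto simp: a_def b_def)
 have na: "nb a Q \<subseteq> set xs"
 proof
  fix y assume y: "y \<in> nb a Q"
  show "y \<in> set xs"
  proof (rule ccontr)
   assume n: "y \<notin> set xs"
   have "ispath Q (y # xs)" using n y d E_sym xs(2) by (cases xs) (auto simp: ispath_def a_def)
   from mx[OF this] show False by simp
  qed
 qed
 have nbb: "nb b Q \<subseteq> set xs"
 proof
  fix y assume y: "y \<in> nb b Q"
  show "y \<in> set xs"
  proof (rule ccontr)
   assume n: "y \<notin> set xs"
   have "ispath Q (xs @ [y])" using n y d E_sym xs(2) by (auto simp: ispath_def b_def successively_append_iff)
   from mx[OF this] show False by simp
  qed
 qed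
 define I where "I = {i. i < p & E a (xs ! i)}"
 define J where "J = {i. i < p & E b (xs ! i)}"
 have inj: "inj_on ((!) xs) {i. i < p}" using d(1) by (auto simp: inj_on_def p_def nth_eq_iff_index_eq)
 have cI: "card I = dg a Q"
 proof -
  have "(!) xs ` I = nb a Q"
   using na d(2) by (auto simp: I_def p_def set_conv_nth image_def) (metis (mono_tags, lifting) in_set_conv_nth mem_Collect_eq mem_nb subsetD set_conv_nth)
  moreover have "inj_on ((!) xs) I" by (rule inj_on_subset[OF inj]) (auto simp: I_def)
  ultimately show ?thesis unfolding dg_def by (metis card_image)
 qed
 have cJ: "card J = dg b Q"
 proof -
  have "(!) xs ` J = nb b Q"
   using nbb d(2) by (auto simp: J_def p_def set_conv_nth image_def) (metis (mono_tags, lifting) in_set_conv_nth mem_Collect_eq mem_nb subsetD set_conv_nth)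
  moreover have "inj_on ((!) xs) J" by (rule inj_on_subset[OF inj]) (auto simp: J_def)
  ultimately show ?thesis unfolding dg_def by (metis card_image)
 qed
 have a0: "a = xs ! 0" and bp: "b = xs ! (p - 1)" using xs(2) by (auto simp: a_def b_def hd_conv_nth last_conv_nth p_def)
 have nc: "Suc j \<notin> I" if j: "j \<in> J" for j
 proof
  assume i: "Suc j \<in> I"
  have jp: "Suc j < p" using i by (simp add: I_def)
  \<comment> \<open>The rotated order: up to position \<open>j\<close>, across to the last vertex,
    and back to position \<open>Suc j\<close>, whose edge to \<open>a\<close> closes the
    cycle.\<close>
  define ys where "ys = take (Suc j) xs @ rev (drop (Suc j) xs)"
  have ds: "drop (Suc j) xs ~= []" "take (Suc j) xs ~= []" using jp xs(2) by (auto simp: p_def)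
  have "successively E (take (Suc j) xs @ drop (Suc j) xs)" using d(3) by simp
  hence s: "successively E (take (Suc j) xs)" "successively E (drop (Suc j) xs)"
   unfolding successively_append_iff by blast+
  have s2: "successively E (rev (drop (Suc j) xs))" using s(2) by (rule successively_rev_E)
  have lt: "last (take (Suc j) xs) = xs ! j" using jp by (simp add: take_Suc_conv_app_nth p_def)
  have hr: "hd (rev (drop (Suc j) xs)) = b" using ds(1) by (simp add: hd_rev b_def p_def)
  have "E (xs ! j) b" using j E_sym by (auto simp: J_def)
  hence "successively E ys" unfolding ys_def successively_append_iff using s s2 lt hr by auto
  moreover have "distinct ys" unfolding ys_def using d(1)
   by (simp add: set_take_disj_set_drop_if_distinct)
  moreover have sy: "set ys = set xs" unfolding ys_def using set_append[of "take (Suc j) xs" "drop (Suc j) xs"] by simp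
  ultimately have py: "ispath Q ys" using d(2) by (simp add: ispath_def)
  have "hd ys = a" using ds(2) xs(2) by (simp add: ys_def a_def)
  moreover have "last ys = xs ! Suc j" using ds(1) jp by (simp add: ys_def last_rev hd_drop_conv_nth p_def)
  ultimately have cyc: "E (last ys) (hd ys)" using i E_sym by (auto simp: I_def)
  have "set ys ~= Q" using cs sy p assms(4) by auto
  moreover have "ys ~= []" using ds by (simp add: ys_def)
  ultimately obtain zs where "ispath Q zs" "length zs = Suc (length ys)"
   using cycle_extend[OF assms(2) py _ cyc] by blast
  moreover have "length ys = length xs" by (simp add: ys_def)
  ultimately show False using mx by force
 qed
 have i0: "0 \<notin> I" using E_irrefl by (auto simp: I_def a0)
 have jl: "p - 1 \<notin> J" using E_irrefl by (auto simp: J_def bp)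
 \<comment> \<open>Shifting \<open>J\<close> by one turns the excluded pattern into disjointness
   inside the \<open>p - 1\<close> positions other than \<open>0\<close>.\<close>
 have "Suc ` J Int I = {}" using nc by auto
 moreover have "Suc ` J Un I \<subseteq> {1..p-1}"
 proof
  fix i assume "i \<in> Suc ` J Un I"
  thus "i \<in> {1..p-1}"
  proof
   assume "i \<in> I" thus ?thesis using i0 by (cases i) (auto simp: I_def)
  next
   assume "i \<in> Suc ` J"
   then obtain j where j: "i = Suc j" "j \<in> J" by auto
   hence "j ~= p - 1" "j < p" using jl by (auto simp: J_def)
   thus ?thesis using j by auto
  qed
 qed
 moreover have fin: "finite I" "finite J" by (auto simp: I_def J_def)
 ultimately have "card (Suc ` J) + card I <= card {1..p-1}"
  by (metis card_Un_disjoint card_mono finite_atLeastAtMost finite_imageI)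
 hence "dg b Q + dg a Q <= p - 1" using cI cJ by (simp add: card_image)
 hence "2 * dg b Q <= l - 2 \<or> 2 * dg a Q <= l - 2" using p by linarith
 thus ?thesis using ab by blast
qed

lemma not_conn_split: assumes "V ~= {}" "~ conn V"
 obtains S where "S \<subset> V" "S ~= {}" "sep S (V - S)"
 using assms unfolding conn_def sep_def by blast

text \<open>Induction on the size: a disconnected set splits, a connected one with at least
  \<open>l\<close> vertices loses a vertex of small degree, and with fewer vertices every degree is
  at most \<open>l - 2\<close> anyway.\<close>

lemma erdos_gallai: assumes "finite V" "pfree l V" "2 <= l" shows "pe V V <= (l - 2) * card V"
 using assms
proof (induction "card V" arbitrary: V rule: less_induct)
 case less
 show ?case
 proof (cases "V = {}")
  case False
  show ?thesis
  proof (cases "conn V")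
   case nc: False
   obtain S where S: "S \<subset> V" "S ~= {}" "sep S (V - S)" using not_conn_split[OF False nc] .
   have c: "card S < card V" "card (V - S) < card V" using S less.prems(1)
    by (auto intro!: psubset_card_mono)
   have f: "finite S" "finite (V - S)" using S less.prems(1) finite_subset by auto
   have "pe S S <= (l - 2) * card S" by (rule less.hyps) (use S c f less.prems pfree_mono in auto)
   moreover have "pe (V - S) (V - S) <= (l - 2) * card (V - S)"
    by (rule less.hyps) (use S c f less.prems pfree_mono[OF less.prems(2), of "V - S"] in auto)
   moreover have "card V = card S + card (V - S)" using S f less.prems(1)
    by (metis card_Diff_subset card_mono le_add_diff_inverse less_imp_le psubset_eq)
   ultimately show ?thesis using pe_sep_split[of V S] S less.prems(1) by (simp add: algebra_simps)
  next
   case c: True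
   show ?thesis
   proof (cases "l <= card V")
    case True
    obtain v where v: "v \<in> V" "2 * dg v V <= l - 2"
     using conn_low_degree[OF less.prems(1) c less.prems(2) True less.prems(3)] by blast
    have cc: "card (V - {v}) < card V" using v less.prems(1) by (meson card_Diff1_less)
    have "pe (V - {v}) (V - {v}) <= (l - 2) * card (V - {v})"
     by (rule less.hyps) (use cc less.prems pfree_mono[OF less.prems(2), of "V - {v}"] in auto)
    moreover have "card V = Suc (card (V - {v}))" using v less.prems(1) by (metis card_Suc_Diff1)
    ultimately show ?thesis using pe_delete[OF less.prems(1) v(1)] v(2) by simp
   next
    case f: False
    have "pe V V <= (\<Sum>x\<in>V. l - 2)" unfolding pe_def
    proof (rule sum_mono)
     fix x assume "x \<in> V"
     thus "dg x V <= l - 2" using dg_self_less[OF less.prems(1), of x] f by simp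
    qed
    thus ?thesis by (simp add: mult.commute)
   qed
  qed
 qed simp
qed

lemma comp_ex: assumes "finite V" "u \<in> V"
 shows "\<exists>Q. Q \<subseteq> V & u \<in> Q & conn Q & sep Q (V - Q)"
 using assms
proof (induction "card V" arbitrary: V rule: less_induct)
 case less
 show ?case
 proof (cases "conn V")
  case True thus ?thesis using less.prems by (intro exI[of _ V]) (auto simp: sep_def)
 next
  case False
  obtain S where S: "S \<subset> V" "S ~= {}" "sep S (V - S)" using not_conn_split[OF _ False] less.prems by blast
  show ?thesis
  proof (cases "u \<in> S")
   case True
   have "card S < card V" "finite S" using S less.prems finite_subset by (auto intro: psubset_card_mono)
   then obtain Q where Q: "Q \<subseteq> S" "u \<in> Q" "conn Q" "sep Q (S - Q)" using less.hyps[of S] True by blast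
   have "sep Q (V - Q)" using Q S(3) unfolding sep_def by blast
   thus ?thesis using S Q by (intro exI[of _ Q]) auto
  next
   case F: False
   have "card (V - S) < card V" "finite (V - S)" using S less.prems by (auto intro!: psubset_card_mono)
   then obtain Q where Q: "Q \<subseteq> V - S" "u \<in> Q" "conn Q" "sep Q ((V - S) - Q)" using less.hyps[of "V - S"] F less.prems by blast
   have "sep Q (V - Q)" using Q S(3) E_sym unfolding sep_def by blast
   thus ?thesis using Q by (intro exI[of _ Q]) auto
  qed
 qed
qed

lemma clique_path_ex: assumes "clique Q" "finite Q" "u \<in> Q"
 shows "\<exists>xs. ispath Q xs & xs ~= [] & hd xs = u & set xs = Q & length xs = card Q"
proof -
 obtain ys where ys: "set ys = Q - {u}" "distinct ys" using finite_distinct_list[of "Q - {u}"] assms by auto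
 have "ispath Q (u # ys)" by (rule clique_ispath[OF assms(1)]) (use ys assms in auto)
 moreover have "set (u # ys) = Q" using ys assms by auto
 moreover have "length (u # ys) = card Q" using ys assms
  by (metis calculation(2) distinct_card distinct.simps(2) Diff_iff singletonI)
 ultimately show ?thesis by (intro exI[of _ "u # ys"]) auto
qed

text \<open>With \<open>l\<close> or more vertices tightness is impossible: deleting a vertex
  \<open>v\<close> of small degree leaves a tight set, so a component next to \<open>v\<close> is
  tight and by induction a clique \<open>K_{l-1}\<close>, and entering this clique from
  \<open>v\<close> gives a path on \<open>l\<close> vertices. Below \<open>l\<close> vertices
  tightness forces all degrees to be maximal.\<close>

lemma erdos_gallai_eq: assumes "finite V" "pfree l V" "3 <= l" "conn V" "(l - 2) * card V <= pe V V"
 shows "card V = l - 1 & clique V"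
 using assms
proof (induction "card V" arbitrary: V rule: less_induct)
 case less
 have ne: "V ~= {}" using less.prems by (simp add: conn_def)
 have "~ l <= card V"
 proof
  assume True: "l <= card V"
  obtain v where v: "v \<in> V" "2 * dg v V <= l - 2"
   using conn_low_degree[OF less.prems(1) less.prems(4) less.prems(2) True] less.prems(3) by auto
  let ?V = "V - {v}"
  have cc: "card ?V < card V" "card V = Suc (card ?V)" using v less.prems(1) by (meson card_Diff1_less, metis card_Suc_Diff1)
  have e: "(l - 2) * card ?V <= pe ?V ?V" using pe_delete[OF less.prems(1) v(1)] v(2) less.prems(5) cc(2) by simp
  have "card ?V ~= 0" using cc(2) True less.prems(3) by linarith
  hence "?V ~= {}" by force
  hence "{v} \<subset> V" using v by auto
  then obtain u where u: "u \<in> ?V" "E v u" using less.prems(4) unfolding conn_def by blast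
  obtain Q where Q: "Q \<subseteq> ?V" "u \<in> Q" "conn Q" "sep Q (?V - Q)" using comp_ex[of ?V u] u less.prems(1) by auto
  have fQ: "finite Q" "finite (?V - Q)" using Q less.prems(1) finite_subset by auto
  have pf: "pfree l Q" "pfree l (?V - Q)" using less.prems(2) pfree_mono Q by (meson Diff_subset subset_trans)+
  have 1: "pe ?V ?V = pe Q Q + pe (?V - Q) (?V - Q)" using pe_sep_split[of ?V Q] Q less.prems(1) by auto
  have 2: "pe (?V - Q) (?V - Q) <= (l - 2) * card (?V - Q)" using erdos_gallai[OF fQ(2) pf(2)] less.prems(3) by simp
  have 3: "card ?V = card Q + card (?V - Q)" using Q fQ less.prems(1)
   by (metis card_Diff_subset card_mono finite_Diff le_add_diff_inverse)
  \<comment> \<open>The other components obey the bound, so the tightness of the whole must be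
    present in \<open>Q\<close>.\<close>
  have "(l - 2) * card Q <= pe Q Q" using e 1 2 3 by (simp add: algebra_simps)
  moreover have "card Q < card V" using Q cc(1) less.prems(1) by (meson card_mono finite_Diff le_less_trans)
  ultimately have cl: "card Q = l - 1" "clique Q" using less.hyps[of Q] fQ pf Q less.prems(3) by auto
  obtain xs where xs: "ispath Q xs" "xs ~= []" "hd xs = u" "set xs = Q" "length xs = card Q"
   using clique_path_ex[OF cl(2) fQ(1) Q(2)] by blast
  have "ispath V (v # xs)" using xs u v Q by (cases xs) (auto simp: ispath_def)
  moreover have "length (v # xs) = l" using xs cl less.prems(3) by simp
  ultimately show False using less.prems(2) unfolding pfree_def by blast
 qed
 hence cl: "card V <= l - 1" by simp
 have d1: "dg x V <= card V - 1" if "x \<in> V" for x using dg_self_less[OF less.prems(1) that] by simp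
 hence "pe V V <= (\<Sum>x\<in>V. card V - 1)" unfolding pe_def by (rule sum_mono)
 hence "pe V V <= (card V - 1) * card V" by (simp add: mult.commute)
 hence "(l - 2) * card V <= (card V - 1) * card V" using less.prems(5) by linarith
 moreover have c0: "card V > 0" using ne less.prems(1) by (simp add: card_gt_0_iff)
 ultimately have "l - 2 <= card V - 1" by (metis mult_le_cancel2 neq0_conv)
 hence cV: "card V = l - 1" using cl less.prems(3) c0 by linarith
 have "pe V V = (\<Sum>x\<in>V. card V - 1)"
 proof -
  have c: "card V - 1 = l - 2" using cV by simp
  show ?thesis using \<open>pe V V <= (card V - 1) * card V\<close> less.prems(5) unfolding sum_constant c by (simp add: mult.commute)
 qed
 hence dgx: "dg x V = card V - 1" if "x \<in> V" for x
  using sum_mono_inv[of "%x. dg x V" V "%_. card V - 1" x] d1 that less.prems(1) by (simp add: pe_def)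
 have "E x y" if "x \<in> V" "y \<in> V" "x ~= y" for x y
 proof -
  have a: "nb x V \<subseteq> V - {x}" using E_irrefl by auto
  have b: "card (nb x V) = card (V - {x})" using dgx[OF that(1)] that less.prems(1) by (simp add: dg_def)
  have c: "finite (V - {x})" using less.prems(1) by simp
  have "nb x V = V - {x}" using card_subset_eq[OF c a b] .
  hence "y \<in> nb x V" using that by blast
  thus ?thesis by simp
 qed
 thus ?case using cV by (auto simp: clique_def)
qed

section \<open>Stability of the Erdos-Gallai bound\<close>

definition comps :: "'a set => 'a set set" where
 "comps V = {Q. Q \<subseteq> V & conn Q & sep Q (V - Q)}"

lemma finite_comps: "finite V ==> finite (comps V)"
 by (rule finite_subset[of _ "Pow V"]) (auto simp: comps_def)

lemma Union_comps: assumes "finite V" shows "\<Union>(comps V) = V"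
proof
 show "V \<subseteq> \<Union>(comps V)" using comp_ex[OF assms] by (auto simp: comps_def)
qed (auto simp: comps_def)

lemma conn_subset_closed: assumes "conn Q" "Q Int S ~= {}" "sep (Q Int S) (Q - S)" shows "Q \<subseteq> S"
proof (rule ccontr)
 assume "~ Q \<subseteq> S"
 hence "Q Int S \<subset> Q" by auto
 then obtain x y where "x \<in> Q Int S" "y \<in> Q - Q Int S" "E x y" using assms(1,2) unfolding conn_def by meson
 thus False using assms(3) unfolding sep_def by auto
qed

lemma comps_disj: assumes "Q \<in> comps V" "Q' \<in> comps V" "Q ~= Q'" shows "Q Int Q' = {}"
proof (rule ccontr)
 assume n: "Q Int Q' ~= {}"
 have "Q \<subseteq> Q'" by (rule conn_subset_closed) (use assms n in "auto simp: comps_def sep_def")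
 moreover have "Q' \<subseteq> Q" by (rule conn_subset_closed) (use assms n in "auto simp: comps_def sep_def")
 ultimately show False using assms by auto
qed

lemma card_comps_sum: assumes "finite V" shows "card V = (\<Sum>Q\<in>comps V. card Q)"
proof -
 have "card (\<Union>(comps V)) = (\<Sum>Q\<in>comps V. card Q)"
  by (rule card_Union_disjoint) (use assms comps_disj finite_subset in "auto simp: disjnt_def pairwise_def comps_def")
 thus ?thesis using Union_comps[OF assms] by simp
qed

lemma conn_path:
 assumes "conn Q" "x \<in> Q" "y \<in> Q"
 shows "\<exists>xs. ispath Q xs & xs ~= [] & hd xs = x & last xs = y"
proof -
 define S where "S = {y\<in>Q. \<exists>xs. ispath Q xs & xs ~= [] & hd xs = x & last xs = y}"
 have xS: "x \<in> S" using assms ispath_single[of x Q] by (auto simp: S_def intro!: exI[of _ "[x]"])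
 have "Q \<subseteq> S"
 proof (rule conn_subset_closed[OF assms(1)])
  show "Q Int S ~= {}" using xS assms by auto
  show "sep (Q Int S) (Q - S)" unfolding sep_def
  proof (intro ballI notI)
   fix u w assume u: "u \<in> Q Int S" and w: "w \<in> Q - S" and e: "E u w"
   obtain xs where xs: "ispath Q xs" "xs ~= []" "hd xs = x" "last xs = u" using u by (auto simp: S_def)
   show False
   proof (cases "w \<in> set xs")
    case True
    then obtain ys zs where s: "xs = ys @ w # zs" using split_list by metis
    have "ispath Q (take (Suc (length ys)) xs)" by (rule ispath_take[OF xs(1)])
    hence "ispath Q (ys @ [w])" by (simp add: s)
    moreover have "hd (ys @ [w]) = x" using xs(3) by (cases ys) (auto simp: s)
    ultimately have "w \<in> S" using w by (auto simp: S_def intro!: exI[of _ "ys @ [w]"])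
    thus False using w by auto
   next
    case False
    have "ispath Q (xs @ [w])" using xs False w e by (auto simp: ispath_def successively_append_iff)
    hence "w \<in> S" using w xs by (auto simp: S_def intro!: exI[of _ "xs @ [w]"])
    thus False using w by auto
   qed
  qed
 qed
 thus ?thesis using assms by (auto simp: S_def)
qed

text \<open>Walk from \<open>v\<close> to the first vertex \<open>u\<close> that lies on
  \<open>ps\<close>, then follow the longer side of \<open>ps\<close> from \<open>u\<close>; both
  sides count \<open>u\<close>, whence the extra one.\<close>

lemma conn_path_from:
 assumes "conn Q" "v \<in> Q" "ispath Q ps" "ps ~= []"
 shows "\<exists>xs. ispath Q xs & xs ~= [] & hd xs = v & Suc (length ps) <= 2 * length xs"
proof -
 have "hd ps \<in> Q" using assms(3,4) by (cases ps) (auto simp: ispath_def)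
 then obtain xs where xs: "ispath Q xs" "xs ~= []" "hd xs = v" "last xs = hd ps"
  using conn_path[OF assms(1,2)] by blast
 have "\<exists>u\<in>set xs. u \<in> set ps" using xs assms(4) by (metis last_in_set list.set_sel(1))
 then obtain as u bs where s: "xs = as @ u # bs" "u \<in> set ps" "\<forall>y\<in>set as. y \<notin> set ps"
  using split_list_first_prop[of xs "%u. u \<in> set ps"] by blast
 have pa: "ispath Q as" using ispath_take[OF xs(1), of "length as"] by (simp add: s)
 have e: "as = [] \<or> E (last as) u" using xs(1) by (auto simp: s ispath_def successively_append_iff)
 have hv: "hd (as @ u # zs) = v" for zs using xs(3) by (cases as) (auto simp: s)
 obtain us vs where p: "ps = us @ u # vs" using split_list s(2) by metis
 have "ispath Q (u # vs)" using assms(3) unfolding ispath_def p by (auto simp: successively_append_iff)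
 hence 1: "ispath Q (as @ u # vs)" using ispath_append[of Q as Q "u # vs"] pa e s(3) p by auto
 have "ispath Q (us @ [u])" using ispath_take[OF assms(3), of "Suc (length us)"] by (simp add: p)
 from ispath_rev[OF this] have "ispath Q (u # rev us)" by simp
 hence 2: "ispath Q (as @ u # rev us)" using ispath_append[of Q as Q "u # rev us"] pa e s(3) p by auto
 show ?thesis
 proof (cases "length us <= length vs")
  case True thus ?thesis using 1 hv by (intro exI[of _ "as @ u # vs"]) (auto simp: p)
 next
  case False thus ?thesis using 2 hv by (intro exI[of _ "as @ u # rev us"]) (auto simp: p)
 qed
qed

section \<open>Long paths through a small set of hubs\<close>

definition att :: "'a set => 'a set => 'a set" where "att Q A = {a\<in>A. \<exists>q\<in>Q. E a q}"

text \<open>The path visits the hubs in the order of \<open>as\<close>, crosses one set of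
  \<open>\<Q>\<close> between consecutive hubs and ends with a tail of \<open>x\<close> vertices
  inside a further set. Every crossing has at least one vertex, which explains
  \<open>2 * length as - 1 + x\<close>.\<close>

lemma chain_path:
 assumes "as ~= []" "distinct as" "finite \<Q>" "length as <= card \<Q>"
  "!!Q Q'. Q \<in> \<Q> ==> Q' \<in> \<Q> ==> Q ~= Q' ==> Q Int Q' = {}"
  "!!Q. Q \<in> \<Q> ==> conn Q & Q Int set as = {} & set as \<subseteq> att Q A"
  "!!Q a. Q \<in> \<Q> ==> a \<in> set as ==> \<exists>xs. ispath Q xs & xs ~= [] & E a (hd xs) & x <= length xs"
 shows "\<exists>ys. ispath (set as Un \<Union>\<Q>) ys & ys ~= [] & hd ys = hd as & 2 * length as - 1 + x <= length ys"
 using assms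
proof (induction as arbitrary: \<Q>)
 case (Cons a as)
 have "\<Q> ~= {}" using Cons.prems(4) by auto
 then obtain Q where Q: "Q \<in> \<Q>" by blast
 show ?case
 proof (cases "as = []")
  case True
  obtain xs where xs: "ispath Q xs" "xs ~= []" "E a (hd xs)" "x <= length xs" using Cons.prems(7)[OF Q, of a] by auto
  have "ispath ({a} Un Q) ([a] @ xs)" by (rule ispath_append) (use xs Cons.prems(6)[OF Q] ispath_single[of a "{a}"] in "auto simp: ispath_def")
  hence "ispath (set (a # as) Un \<Union>\<Q>) (a # xs)" using Q by (auto elim!: ispath_mono)
  thus ?thesis using True xs by (intro exI[of _ "a # xs"]) auto
 next
  case False
  let ?\<Q> = "\<Q> - {Q}"
  have "\<exists>ys. ispath (set as Un \<Union>?\<Q>) ys & ys ~= [] & hd ys = hd as & 2 * length as - 1 + x <= length ys"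
  proof (rule Cons.IH[OF False])
   show "length as <= card ?\<Q>" using Cons.prems(3,4) Q by simp
   show "distinct as" using Cons.prems(2) by simp
   show "finite ?\<Q>" using Cons.prems(3) by simp
   show "conn Q' & Q' Int set as = {} & set as \<subseteq> att Q' A" if "Q' \<in> ?\<Q>" for Q'
    using Cons.prems(6)[of Q'] that by auto
   show "\<exists>xs. ispath Q' xs & xs ~= [] & E b (hd xs) & x <= length xs" if "Q' \<in> ?\<Q>" "b \<in> set as" for Q' b
    using Cons.prems(7)[of Q' b] that by auto
   show "Q' Int Q'' = {}" if "Q' \<in> ?\<Q>" "Q'' \<in> ?\<Q>" "Q' ~= Q''" for Q' Q'' using Cons.prems(5)[of Q' Q''] that by auto
  qed
  then obtain ys where ys: "ispath (set as Un \<Union>?\<Q>) ys" "ys ~= []" "hd ys = hd as" "2 * length as - 1 + x <= length ys" by blast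
  have hb: "hd as \<in> set as" using False by simp
  have at: "a \<in> att Q A" "hd as \<in> att Q A" using Cons.prems(6)[OF Q] hb by auto
  obtain u w where uw: "u \<in> Q" "E a u" "w \<in> Q" "E (hd as) w" using at by (auto simp: att_def)
  obtain zs where zs: "ispath Q zs" "zs ~= []" "hd zs = u" "last zs = w" using conn_path uw Cons.prems(6)[OF Q] by blast
  have Qd: "Q Int (set as Un \<Union>?\<Q>) = {}" using Cons.prems(5)[OF Q] Cons.prems(6)[OF Q] by fastforce
  have an: "a \<notin> Q" "a \<notin> set as Un \<Union>?\<Q>" using Cons.prems(2) Cons.prems(6) Q by auto
  have 1: "ispath (Q Un (set as Un \<Union>?\<Q>)) (zs @ ys)"
   by (rule ispath_append) (use zs ys Qd uw E_sym in "auto simp: ispath_def")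
  have 2: "ispath ({a} Un (Q Un (set as Un \<Union>?\<Q>))) ([a] @ (zs @ ys))"
   by (rule ispath_append[OF ispath_single 1]) (use zs an 1 uw in "auto simp: ispath_def")
  hence "ispath (set (a # as) Un \<Union>\<Q>) (a # zs @ ys)" using Q by (auto elim!: ispath_mono)
  moreover have "2 * length (a # as) - 1 + x <= length (a # zs @ ys)"
  proof -
   have "length zs \<ge> 1" "length as \<ge> 1" using zs(2) False by (auto simp: Suc_le_eq)
   thus ?thesis using ys(4) by simp
  qed
  ultimately show ?thesis by (intro exI[of _ "a # zs @ ys"]) auto
 qed
qed simp

text \<open>One set is kept free of the chain, and a second tail inside it is reversed and put in
  front. The result has at least \<open>2 * card A' - 1 + 2 * x\<close> vertices, which must stay
  below \<open>l\<close>.\<close>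

lemma hub_path:
 assumes "finite A'" "A' ~= {}" "finite \<Q>" "card A' < card \<Q>"
  "!!Q Q'. Q \<in> \<Q> ==> Q' \<in> \<Q> ==> Q ~= Q' ==> Q Int Q' = {}"
  "!!Q. Q \<in> \<Q> ==> conn Q & Q Int A' = {} & A' \<subseteq> att Q A"
  "!!Q a. Q \<in> \<Q> ==> a \<in> A' ==> \<exists>xs. ispath Q xs & xs ~= [] & E a (hd xs) & x <= length xs"
  "pfree l (A' Un \<Union>\<Q>)"
 shows "2 * card A' + 2 * x <= l"
proof -
 obtain as where as: "set as = A'" "distinct as" using finite_distinct_list assms(1) by blast
 have la: "length as = card A'" using as distinct_card by force
 have ne: "as ~= []" using as assms(2) by auto
 obtain Q where Q: "Q \<in> \<Q>" using assms(4) by fastforce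
 obtain ys where ys: "ispath (set as Un \<Union>(\<Q> - {Q})) ys" "ys ~= []" "hd ys = hd as" "2 * length as - 1 + x <= length ys"
 proof -
  have "\<exists>ys. ispath (set as Un \<Union>(\<Q> - {Q})) ys & ys ~= [] & hd ys = hd as & 2 * length as - 1 + x <= length ys"
  proof (rule chain_path[OF ne as(2)])
   show "length as <= card (\<Q> - {Q})" using assms(3,4) Q la by simp
   show "Q' Int Q'' = {}" if "Q' \<in> \<Q> - {Q}" "Q'' \<in> \<Q> - {Q}" "Q' ~= Q''" for Q' Q''
    using assms(5)[of Q' Q''] that by blast
   show "conn Q' & Q' Int set as = {} & set as \<subseteq> att Q' A" if "Q' \<in> \<Q> - {Q}" for Q'
    using assms(6)[of Q'] that as by blast
   show "\<exists>xs. ispath Q' xs & xs ~= [] & E a (hd xs) & x <= length xs" if "Q' \<in> \<Q> - {Q}" "a \<in> set as" for Q' a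
    using assms(7)[of Q' a] that as by blast
  qed (use assms(3) in simp)
  thus ?thesis using that by blast
 qed
 have hb: "hd as \<in> A'" using ne as by auto
 obtain xs where xs: "ispath Q xs" "xs ~= []" "E (hd as) (hd xs)" "x <= length xs" using assms(7)[OF Q hb] by blast
 have "ispath (Q Un (set as Un \<Union>(\<Q> - {Q}))) (rev xs @ ys)"
 proof (rule ispath_append[OF ispath_rev[OF xs(1)] ys(1)])
  have "Q Int (set as Un \<Union>(\<Q> - {Q})) = {}" using assms(5)[OF Q] assms(6)[OF Q] as by fastforce
  thus "set (rev xs) Int set ys = {}" using xs(1) ys(1) by (auto simp: ispath_def)
  show "rev xs = [] \<or> ys = [] \<or> E (last (rev xs)) (hd ys)" using xs ys E_sym by (simp add: last_rev)
 qed
 hence "ispath (A' Un \<Union>\<Q>) (rev xs @ ys)" using as Q by (auto elim!: ispath_mono)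
 from pfree_short[OF assms(8) this] have "length xs + length ys < l" by simp
 moreover have "1 <= length as" using ne by (simp add: Suc_le_eq)
 ultimately show ?thesis using xs(4) ys(4) la by linarith
qed

text \<open>The two configurations that come close to the Erdos-Gallai bound: here disjoint cliques,
  in \<open>hasKt\<close> a complete bipartite graph with \<open>l div 2 - 1\<close> vertices on one
  side, which is available for even \<open>l\<close> only.\<close>

definition hasJK :: "nat => nat => 'a set => bool" where
 "hasJK l N V \<longleftrightarrow> (\<exists>\<C>. finite \<C> & card \<C> = N & (\<forall>Q\<in>\<C>. Q \<subseteq> V & clique Q & card Q = l - 1) &
   (\<forall>Q\<in>\<C>. \<forall>Q'\<in>\<C>. Q ~= Q' --> Q Int Q' = {}))"
definition hasKt :: "nat => nat => 'a set => bool" where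
 "hasKt l M V \<longleftrightarrow> (\<exists>X Y. X \<subseteq> V & Y \<subseteq> V & finite Y & cmpl X Y & 2 * card X + 2 = l & finite X & card Y = M)"

lemma hasJK_mono: "hasJK l N S ==> S \<subseteq> T ==> hasJK l N T"
 unfolding hasJK_def by (elim exE, rule exI) (auto 0 3 dest: subsetD)
lemma hasKt_mono: assumes "hasKt l M S" "S \<subseteq> T" shows "hasKt l M T"
proof -
 obtain X Y where "X \<subseteq> S" "Y \<subseteq> S" "finite Y & cmpl X Y & 2 * card X + 2 = l & finite X & card Y = M"
  using assms(1) unfolding hasKt_def by blast
 moreover have "X \<subseteq> T" "Y \<subseteq> T" using calculation assms(2) by blast+
 ultimately show ?thesis unfolding hasKt_def by blast
qed

lemma pigeonhole_card:
 assumes "finite X" "finite Y" "f ` X \<subseteq> Y" "card Y * k < card X"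
 shows "\<exists>y\<in>Y. k < card {x\<in>X. f x = y}"
proof (rule ccontr)
 assume "~ ?thesis"
 hence le: "!!y. y \<in> Y ==> card {x\<in>X. f x = y} <= k" by force
 have "card X = card (\<Union>y\<in>Y. {x\<in>X. f x = y})" using assms(3) by (intro arg_cong[where f=card]) auto
 also have "... <= (\<Sum>y\<in>Y. card {x\<in>X. f x = y})" by (rule card_UN_le[OF assms(2)])
 also have "... <= (\<Sum>y\<in>Y. k)" by (rule sum_mono) (rule le)
 finally show False using assms(4) by simp
qed

lemma conn_edge_path: assumes "conn Q" "u \<in> Q" "Q ~= {u}"
 shows "\<exists>xs. ispath Q xs & xs ~= [] & hd xs = u & 2 <= length xs"
proof -
 have "{u} \<subset> Q" using assms by auto
 then obtain w where w: "w \<in> Q - {u}" "E u w" using assms(1) unfolding conn_def by blast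
 thus ?thesis using assms(2) by (intro exI[of _ "[u, w]"]) (auto simp: ispath_def)
qed

text \<open>At most \<open>card Q * card A'\<close> pairs lead to \<open>A'\<close>, so
  \<open>Q\<close> alone reaches the Erdos-Gallai bound for \<open>l' = l - 2 * card A'\<close>.
  Either it is a clique on \<open>l' - 1\<close> vertices, traversed from \<open>u\<close>, or it
  has a path on \<open>l'\<close> vertices, half of which can be followed from \<open>u\<close>. For
  \<open>l' \<le> 3\<close> a single edge is long enough.\<close>

lemma heavy_end_path:
 assumes "3 <= l" "finite Q" "conn Q" "card Q ~= 1" "finite A'"
  "(l - 2) * card Q <= pe Q Q + 2 * pe Q A'" "u \<in> Q"
 shows "\<exists>xs. ispath Q xs & xs ~= [] & hd xs = u & l + 1 <= 2 * length xs + 2 * card A'"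
proof (cases "l <= 2 * card A' + 3")
 case True
 have "Q ~= {u}" using assms(4) by auto
 then obtain xs where "ispath Q xs & xs ~= [] & hd xs = u & 2 <= length xs" using conn_edge_path assms by blast
 thus ?thesis using True by (intro exI[of _ xs]) auto
next
 case False
 define l' where "l' = l - 2 * card A'"
 have l': "4 <= l'" "l = l' + 2 * card A'" using False by (auto simp: l'_def)
 have "pe Q A' <= card Q * card A'" by (rule pe_le[OF assms(2,5)])
 hence h: "(l' - 2) * card Q <= pe Q Q"
 proof -
  have "(l - 2) * card Q = (l' - 2) * card Q + 2 * (card Q * card A')"
   using l' by (simp add: algebra_simps diff_mult_distrib)
  thus ?thesis using assms(6) \<open>pe Q A' <= card Q * card A'\<close> by linarith
 qed
 show ?thesis
 proof (cases "pfree l' Q")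
  case True
  have "card Q = l' - 1 & clique Q" by (rule erdos_gallai_eq[OF assms(2) True _ assms(3) h]) (use l' in simp)
  then obtain xs where "ispath Q xs" "xs ~= []" "hd xs = u" "length xs = l' - 1"
   using clique_path_ex[of Q u] assms by metis
  thus ?thesis using l' by (intro exI[of _ xs]) auto
 next
  case False
  then obtain ps where "ispath Q ps" "length ps = l'" unfolding pfree_def by blast
  then obtain xs where "ispath Q xs & xs ~= [] & hd xs = u & Suc l' <= 2 * length xs"
   using conn_path_from[OF assms(3,7), of ps] l' by fastforce
  thus ?thesis using l' by (intro exI[of _ xs]) auto
 qed
qed

text \<open>Pigeonhole on the attachment sets. Many heavy sets with the same attachment
  \<open>A'\<close> are cliques \<open>K_{l-1}\<close> if \<open>A'\<close> is empty. Otherwise the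
  non-singletons among them would give too long a path through \<open>A'\<close>, and the singletons
  force \<open>2 * card A' + 2 = l\<close> and thus a complete bipartite graph.\<close>

lemma heavy_few:
 assumes l: "3 <= l" and A: "finite A" "card A <= a" and Qf: "finite \<Q>"
  and dis: "!!Q Q'. Q \<in> \<Q> ==> Q' \<in> \<Q> ==> Q ~= Q' ==> Q Int Q' = {}"
  and Q: "!!Q. Q \<in> \<Q> ==> finite Q & conn Q & Q Int A = {} & (l - 2) * card Q <= pe Q Q + 2 * pe Q A"
  and pf: "pfree l V" and sub: "A Un \<Union>\<Q> \<subseteq> V" and nK: "~ hasJK l N V" and nt: "~ hasKt l M V"
 shows "card \<Q> <= 2 ^ a * (N + M + 2 * a + 2)"
proof (rule ccontr)
 assume "~ ?thesis"
 hence big: "2 ^ a * (N + M + 2 * a + 2) < card \<Q>" by simp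
 have "card (Pow A) <= 2 ^ a" using A by (simp add: card_Pow)
 hence "card (Pow A) * (N + M + 2 * a + 2) < card \<Q>" using big by (meson le_less_trans mult_le_mono1)
 note b2 = this
 have im: "(%Q. att Q A) ` \<Q> \<subseteq> Pow A" by (auto simp: att_def)
 have fPow: "finite (Pow A)" using A by simp
 obtain A' where A': "A' \<in> Pow A" "N + M + 2 * a + 2 < card {Q\<in>\<Q>. att Q A = A'}"
  using pigeonhole_card[OF Qf fPow im b2] by blast
 define \<R> where "\<R> = {Q\<in>\<Q>. att Q A = A'}"
 have R: "finite \<R>" "N + M + 2 * a + 2 < card \<R>" "\<R> \<subseteq> \<Q>" using A' Qf by (auto simp: \<R>_def)
 have fA': "finite A'" "card A' <= a" using A' A by (auto dest: finite_subset) (meson card_mono le_trans)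
 have peA: "pe Q A = pe Q A'" if "Q \<in> \<R>" for Q
 proof -
  have "dg x A = dg x A'" if "x \<in> Q" for x
  proof -
   have "A' = att Q A" using \<open>Q \<in> \<R>\<close> by (simp add: \<R>_def)
   hence "nb x A = nb x A'" using that E_sym by (auto simp: att_def nb_def)
   thus ?thesis by (simp add: dg_def)
  qed
  thus ?thesis by (simp add: pe_def)
 qed
 have hv: "(l - 2) * card Q <= pe Q Q + 2 * pe Q A'" if "Q \<in> \<R>" for Q using Q[of Q] peA[OF that] that R(3) by auto
 show False
 proof (cases "A' = {}")
  case True
  have "card Q = l - 1 & clique Q" if "Q \<in> \<R>" for Q
  proof (rule erdos_gallai_eq[OF _ pfree_mono[OF pf] l])
   show "Q \<subseteq> V" using that R(3) sub by blast
  qed (use Q[of Q] hv[OF that] that R(3) True in auto)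
  moreover obtain \<C> where "\<C> \<subseteq> \<R>" "card \<C> = N" using obtain_subset_with_card_n[of N \<R>] R by auto
  ultimately have "hasJK l N V" unfolding hasJK_def using R(1,3) sub dis
   by (intro exI[of _ \<C>]) (auto dest: finite_subset, blast+)
  thus False using nK by simp
 next
  case ne: False
  define \<S> where "\<S> = {Q\<in>\<R>. card Q = 1}"
  have fS: "finite \<S>" "finite (\<R> - \<S>)" using R by (auto simp: \<S>_def)
  have cR: "card \<R> = card \<S> + card (\<R> - \<S>)" using R(1)
   by (metis (no_types, lifting) \<S>_def card_Diff_subset card_mono fS(1) le_add_diff_inverse mem_Collect_eq subsetI)
  have gen: "2 * card A' + 2 * x <= l" if T: "\<T> \<subseteq> \<R>" "a < card \<T>"
   "!!Q a. Q \<in> \<T> ==> a \<in> A' ==> \<exists>xs. ispath Q xs & xs ~= [] & E a (hd xs) & x <= length xs" for x \<T>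
  proof (rule hub_path[OF fA'(1) ne, of \<T> A])
   show "finite \<T>" using T R finite_subset by blast
   show "card A' < card \<T>" using T fA' by simp
   show "Q' Int Q'' = {}" if "Q' \<in> \<T>" "Q'' \<in> \<T>" "Q' ~= Q''" for Q' Q'' using dis that T R(3) by blast
   show "conn Q' & Q' Int A' = {} & A' \<subseteq> att Q' A" if "Q' \<in> \<T>" for Q'
   proof -
    have "Q' \<in> \<R>" "Q' \<in> \<Q>" using that T R(3) by blast+
    thus ?thesis using Q[of Q'] A'(1) by (auto simp: \<R>_def)
   qed
   show "pfree l (A' Un \<Union> \<T>)" by (rule pfree_mono[OF pf]) (use T(1) R(3) A'(1) sub in blast)
  qed (rule T(3))
  have nbr: "\<exists>q\<in>Q. E c q" if "Q \<in> \<R>" "c \<in> A'" for Q c using that by (auto simp: \<R>_def att_def)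
  show False
  proof (cases "a < card (\<R> - \<S>)")
   case True
   \<comment> \<open>Half of \<open>l + 1\<close>, rounded up, less the hubs: two tails of this
     length and the hubs together exceed \<open>l\<close>.\<close>
   define x where "x = (l + 2) div 2 - card A'"
   have "2 * card A' + 2 * x <= l"
   proof (rule gen[OF _ True])
    fix Q c assume Qc: "Q \<in> \<R> - \<S>" "c \<in> A'"
    obtain q where q: "q \<in> Q" "E c q" using nbr Qc by blast
    have QQ: "finite Q" "conn Q" "card Q ~= 1" using Q[of Q] Qc R(3) by (auto simp: \<S>_def)
    obtain xs where "ispath Q xs" "xs ~= []" "hd xs = q" "l + 1 <= 2 * length xs + 2 * card A'"
     using heavy_end_path[OF l QQ fA'(1) _ q(1)] hv Qc by blast
    thus "\<exists>xs. ispath Q xs & xs ~= [] & E c (hd xs) & x <= length xs" using q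
     by (intro exI[of _ xs]) (auto simp: x_def)
   qed simp
   thus False unfolding x_def by linarith
  next
   case False
   hence cS: "N + M + a + 2 < card \<S>" using cR R by simp
   have "2 * card A' + 2 * 1 <= l"
   proof (rule gen[of \<S>])
    fix Q c assume Qc: "Q \<in> \<S>" "c \<in> A'"
    obtain q where q: "q \<in> Q" "E c q" using nbr Qc by (auto simp: \<S>_def)
    thus "\<exists>xs. ispath Q xs & xs ~= [] & E c (hd xs) & 1 <= length xs"
     by (intro exI[of _ "[q]"]) (auto simp: ispath_def)
   qed (use cS in \<open>auto simp: \<S>_def\<close>)
   \<comment> \<open>A single vertex has no inner pairs, so heaviness bounds \<open>l - 2\<close> by
     \<open>2 * card A'\<close>.\<close>
   moreover have "l <= 2 * card A' + 2"
   proof -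
    obtain Q where q: "Q \<in> \<S>" using cS by fastforce
    then obtain u where u: "Q = {u}" by (auto simp: \<S>_def card_1_singleton_iff)
    have "pe Q Q = 0" using E_irrefl by (simp add: u pe_def dg_def nb_def)
    moreover have "pe Q A' <= card A'" using pe_le[of Q A'] fA' u by simp
    ultimately show ?thesis using hv[of Q] q u by (auto simp: \<S>_def)
   qed
   ultimately have lt: "2 * card A' + 2 = l" by simp
   have us: "\<Union>\<S> \<subseteq> V" using sub R by (auto simp: \<S>_def)
   have "cmpl A' (\<Union>\<S>)" unfolding cmpl_def
   proof (intro ballI)
    fix c y assume c: "c \<in> A'" "y \<in> \<Union>\<S>"
    then obtain Q where "Q \<in> \<S>" "y \<in> Q" by blast
    moreover obtain u where "Q = {u}" using \<open>Q \<in> \<S>\<close> by (auto simp: \<S>_def card_1_singleton_iff)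
    ultimately show "E c y" using nbr[of Q c] c by (auto simp: \<S>_def)
   qed
   moreover have "card (\<Union>\<S>) = (\<Sum>Q\<in>\<S>. card Q)"
    by (rule card_Union_disjoint) (use dis R(3) Q in \<open>auto simp: \<S>_def pairwise_def disjnt_def\<close>)
   hence cU: "card (\<Union>\<S>) = card \<S>" by (simp add: \<S>_def)
   moreover obtain Y where Y: "Y \<subseteq> \<Union>\<S>" "card Y = M" "finite Y"
    using obtain_subset_with_card_n[of M "\<Union>\<S>"] cU cS by auto
   ultimately have "hasKt l M V" unfolding hasKt_def
    using lt us A' sub fA' by (intro exI[of _ A'] exI[of _ Y]) (auto intro: cmpl_mono)
   thus False using nt by simp
  qed
 qed
qed

section \<open>Light sets and the gap for one class\<close>

text \<open>Depth measure for the induction in \<open>light_ex\<close>. In a set without a path on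
  \<open>l\<close> vertices it holds with \<open>p = l\<close> for any choice of roots.\<close>

definition rooted :: "nat => 'a set => bool" where
 "rooted p R \<longleftrightarrow> (\<forall>Q\<in>comps R. \<exists>v\<in>Q. \<forall>xs. ispath Q xs & xs ~= [] & hd xs = v --> length xs < p)"

text \<open>Finds a set \<open>T\<close> of bounded size whose deletion costs fewer than
  \<open>l - 2\<close> pairs per vertex. If some component of \<open>R\<close> is large, its root
  moves into \<open>A\<close>, and the remaining pieces are rooted at neighbours of the old root
  with smaller depth. If all components are small, there are many of them, and by
  \<open>heavy_few\<close> one is light.\<close>

lemma light_ex:
 assumes l: "3 <= l"
 shows "\<exists>h B. \<forall>A R. finite A --> finite R --> A Int R = {} --> card A <= a --> pfree l (A Un R) -->
   ~ hasJK l N (A Un R) --> ~ hasKt l M (A Un R) --> rooted p R --> h <= card R -->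
   (\<exists>T. T \<subseteq> R & T ~= {} & card T <= B & pe T T + 2 * pe T (A Un R - T) < (l - 2) * card T)"
proof (induction p arbitrary: a)
 case 0
 have "R = {}" if "finite R" "rooted 0 R" for R
 proof (rule ccontr)
  assume "R ~= {}"
  then obtain Q where "Q \<in> comps R" using Union_comps[OF \<open>finite R\<close>] by blast
  then obtain v where "v \<in> Q" "\<forall>xs. ispath Q xs & xs ~= [] & hd xs = v --> length xs < 0" using \<open>rooted 0 R\<close> by (auto simp: rooted_def)
  thus False using ispath_single[of v Q] by force
 qed
 note e = this
 show ?case
 proof (rule exI[of _ 1], rule exI[of _ 0], intro allI impI)
  fix A R :: "'a set" assume "finite R" "rooted 0 R" "1 <= card R"
  thus "\<exists>T. T \<subseteq> R & T ~= {} & card T <= 0 & pe T T + 2 * pe T (A Un R - T) < (l - 2) * card T"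
   using e[of R] by simp
 qed
next
 case (Suc p)
 obtain h B where hB: "!!A R. finite A ==> finite R ==> A Int R = {} ==> card A <= Suc a ==> pfree l (A Un R) ==>
   ~ hasJK l N (A Un R) ==> ~ hasKt l M (A Un R) ==> rooted p R ==> h <= card R ==>
   (\<exists>T. T \<subseteq> R & T ~= {} & card T <= B & pe T T + 2 * pe T (A Un R - T) < (l - 2) * card T)"
  using Suc.IH[of "Suc a"] by blast
 define K where "K = 2 ^ a * (N + M + 2 * a + 2)"
 show ?case
 \<comment> \<open>If all components have at most \<open>h\<close> vertices, this size leaves more
   than \<open>K\<close> of them, beyond the bound of \<open>heavy_few\<close>.
   \<open>max h B\<close> covers a small component as well as a set found in a large one.\<close>
 proof (rule exI[of _ "h * K + 1"], rule exI[of _ "max h B"], intro allI impI)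
  fix A R assume as: "finite A" "finite R" "A Int R = {}" "card A <= a" "pfree l (A Un R)"
   "~ hasJK l N (A Un R)" "~ hasKt l M (A Un R)" "rooted (Suc p) R" "h * K + 1 <= card R"
  have cR: "Q \<subseteq> R" "finite Q" "conn Q" "sep Q (R - Q)" if "Q \<in> comps R" for Q
   using that as(2) by (auto simp: comps_def dest: finite_subset)
  show "\<exists>T. T \<subseteq> R & T ~= {} & card T <= max h B & pe T T + 2 * pe T (A Un R - T) < (l - 2) * card T"
  proof (cases "\<exists>Q\<in>comps R. h + 1 <= card Q")
   case True
   then obtain Q where Q: "Q \<in> comps R" "h + 1 <= card Q" by blast
   obtain v where v: "v \<in> Q" and vp: "!!xs. ispath Q xs ==> xs ~= [] ==> hd xs = v ==> length xs < Suc p"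
    using as(8) Q(1) unfolding rooted_def by blast
   let ?R = "Q - {v}" and ?A = "insert v A"
   have u: "?A Un ?R = A Un Q" using v by auto
   have sub: "A Un Q \<subseteq> A Un R" using cR[OF Q(1)] by auto
   have "\<exists>T. T \<subseteq> ?R & T ~= {} & card T <= B & pe T T + 2 * pe T (?A Un ?R - T) < (l - 2) * card T"
   proof (rule hB)
    show "finite ?A" "finite ?R" using as cR[OF Q(1)] by auto
    show "?A Int ?R = {}" using as(3) cR[OF Q(1)] by auto
    show "card ?A <= Suc a" using as(1,4) by (simp add: card_insert_if)
    show "pfree l (?A Un ?R)" unfolding u by (rule pfree_mono[OF as(5) sub])
    show "~ hasJK l N (?A Un ?R)" unfolding u using as(6) hasJK_mono[OF _ sub] by blast
    show "~ hasKt l M (?A Un ?R)" unfolding u using as(7) hasKt_mono[OF _ sub] by blast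
    show "h <= card ?R" using Q(2) v cR[OF Q(1)] by simp
    show "rooted p ?R" unfolding rooted_def
    proof
     fix Q' assume Q': "Q' \<in> comps ?R"
     hence q: "Q' \<subset> Q" "Q' ~= {}" "sep Q' (?R - Q')" using v by (auto simp: comps_def conn_def)
     then obtain x y where xy: "x \<in> Q'" "y \<in> Q - Q'" "E x y" using cR(3)[OF Q(1)] unfolding conn_def by meson
     have "y = v" using xy q(3) by (auto simp: sep_def)
     hence ev: "E v x" using xy E_sym by blast
     show "\<exists>v\<in>Q'. \<forall>xs. ispath Q' xs & xs ~= [] & hd xs = v --> length xs < p"
     proof (intro bexI[of _ x] allI impI)
      fix xs assume xs: "ispath Q' xs & xs ~= [] & hd xs = x"
      have "v \<notin> Q'" using Q' by (auto simp: comps_def)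
      hence "ispath Q (v # xs)" using xs ev v q(1) by (cases xs) (auto simp: ispath_def)
      thus "length xs < p" using vp[of "v # xs"] by simp
     qed (rule xy)
    qed
   qed
   then obtain T where T: "T \<subseteq> ?R" "T ~= {}" "card T <= B" "pe T T + 2 * pe T (A Un Q - T) < (l - 2) * card T"
    unfolding u by blast
   have TR: "T \<subseteq> R" using T cR[OF Q(1)] by auto
   have "dg x (A Un R - T) = dg x (A Un Q - T)" if "x \<in> T" for x
   proof -
    have "nb x (A Un R - T) = nb x (A Un Q - T)" using that T(1) cR[OF Q(1)] unfolding sep_def nb_def by blast
    thus ?thesis by (simp add: dg_def)
   qed
   hence "pe T (A Un R - T) = pe T (A Un Q - T)" by (simp add: pe_def)
   thus ?thesis using T TR by (intro exI[of _ T]) auto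
  next
   case False
   hence small: "!!Q. Q \<in> comps R ==> card Q <= h" by force
   have "card R <= (\<Sum>Q\<in>comps R. h)" unfolding card_comps_sum[OF as(2)] by (rule sum_mono) (rule small)
   hence "card R <= h * card (comps R)" by (simp add: mult.commute)
   hence "h * K < h * card (comps R)" using as(9) by linarith
   hence many: "K < card (comps R)" by (metis mult_less_cancel1)
   have "\<exists>Q\<in>comps R. ~ (l - 2) * card Q <= pe Q Q + 2 * pe Q A"
   proof (rule ccontr)
    assume nh: "~ (\<exists>Q\<in>comps R. ~ (l - 2) * card Q <= pe Q Q + 2 * pe Q A)"
    have "card (comps R) <= 2 ^ a * (N + M + 2 * a + 2)"
    proof (intro heavy_few[OF l as(1,4) finite_comps[OF as(2)] comps_disj _ as(5) _ as(6,7)])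
     fix Q assume "Q \<in> comps R"
     thus "finite Q & conn Q & Q Int A = {} & (l - 2) * card Q <= pe Q Q + 2 * pe Q A"
      using cR[of Q] as(3) nh by blast
    qed (use cR(1) in blast)+
    thus False using many by (simp add: K_def)
   qed
   then obtain Q where Q: "Q \<in> comps R" "pe Q Q + 2 * pe Q A < (l - 2) * card Q" by force
   have "dg x (A Un R - Q) = dg x A" if "x \<in> Q" for x
   proof -
    have "nb x (A Un R - Q) = nb x A" using that cR[OF Q(1)] as(3) unfolding sep_def nb_def by blast
    thus ?thesis by (simp add: dg_def)
   qed
   hence "pe Q (A Un R - Q) = pe Q A" by (simp add: pe_def)
   thus ?thesis using Q cR[OF Q(1)] small[OF Q(1)] by (intro exI[of _ Q]) (auto simp: conn_def)
  qed
 qed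
qed

text \<open>Light sets are peeled off one after another. Each has at most \<open>B\<close> vertices
  and saves at least one pair against \<open>l - 2\<close> per vertex, so a positive fraction per
  vertex is saved in total; multiplying by the bound on the size keeps the inequality in the
  naturals.\<close>

lemma base_gap:
 assumes l: "3 <= l"
 shows "\<exists>B C. B > 0 & (\<forall>V. finite V --> pfree l V --> ~ hasJK l N V --> ~ hasKt l M V -->
   B * pe V V + card V <= B * (l - 2) * card V + C)"
proof -
 obtain h B where hB: "!!R. finite R ==> pfree l R ==>
   ~ hasJK l N R ==> ~ hasKt l M R ==> rooted l R ==> h <= card R ==>
   (\<exists>T. T \<subseteq> R & T ~= {} & card T <= B & pe T T + 2 * pe T (R - T) < (l - 2) * card T)"
  using light_ex[OF l, of 0 N M l] by (metis (no_types, lifting) card.empty finite.emptyI inf_bot_left le_refl sup_bot_left)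
 \<comment> \<open>Bounds the left-hand side for sets with fewer than \<open>h\<close> vertices,
   where no light set is guaranteed.\<close>
 define C where "C = (B+1) * h * h + h"
 have "(B + 1) * pe V V + card V <= (B + 1) * (l - 2) * card V + C"
  if "finite V" "pfree l V" "~ hasJK l N V" "~ hasKt l M V" for V
  using that
 proof (induction "card V" arbitrary: V rule: less_induct)
  case less
  show ?case
  proof (cases "h <= card V")
   case False
   have "pe V V <= card V * card V" by (rule pe_le) (use less in auto)
   also have "... <= h * h" using False by (intro mult_le_mono) auto
   finally have "(B + 1) * pe V V <= (B+1) * (h * h)" by (rule mult_le_mono2)
   moreover have "card V <= h" using False by simp
   ultimately have "(B + 1) * pe V V + card V <= C" unfolding C_def by (simp only: mult.assoc)
   thus ?thesis by linarith
  next
   case True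
   have "rooted l V" unfolding rooted_def
   proof
    fix Q assume "Q \<in> comps V"
    hence "Q \<subseteq> V" "Q ~= {}" by (auto simp: comps_def conn_def)
    thus "\<exists>v\<in>Q. \<forall>xs. ispath Q xs & xs ~= [] & hd xs = v --> length xs < l"
     using pfree_short[OF pfree_mono[OF less.prems(2)]] by blast
   qed
   then obtain T where T: "T \<subseteq> V" "T ~= {}" "card T <= B" "pe T T + 2 * pe T (V - T) < (l - 2) * card T"
    using hB[OF less.prems] True by blast
   have fT: "finite T" using T less.prems finite_subset by auto
   have cV: "card V = card T + card (V - T)" using T fT less.prems(1)
    by (metis card_Diff_subset card_mono le_add_diff_inverse)
   have cT: "0 < card T" using T fT by (simp add: card_gt_0_iff)
   have "(B + 1) * pe (V - T) (V - T) + card (V - T) <= (B + 1) * (l - 2) * card (V - T) + C"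
   proof (rule less.hyps)
    show "card (V - T) < card V" using cV cT by simp
    show "pfree l (V - T)" using less.prems(2) pfree_mono by blast
    show "~ hasJK l N (V - T)" using less.prems(3) hasJK_mono[of l N "V - T" V] by blast
    show "~ hasKt l M (V - T)" using less.prems(4) hasKt_mono[of l M "V - T" V] by blast
   qed (use less in auto)
   moreover have "pe V V = pe (V - T) (V - T) + 2 * pe T (V - T) + pe T T" by (rule pe_split) (use less T in auto)
   moreover have "(B + 1) * (pe T T + 2 * pe T (V - T) + 1) <= (B + 1) * ((l - 2) * card T)"
    by (rule mult_le_mono2) (use T in auto)
   moreover define k where "k = l - 2"
   ultimately have 1: "(B + 1) * pe (V - T) (V - T) + card (V - T) <= (B + 1) * k * card (V - T) + C"
    "(B + 1) * (pe T T + 2 * pe T (V - T) + 1) <= (B + 1) * (k * card T)"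
    "pe V V = pe (V - T) (V - T) + 2 * pe T (V - T) + pe T T" by simp_all
   show ?thesis using 1(1,2) cV T(3) unfolding 1(3) cV k_def[symmetric] by (simp add: algebra_simps)
  qed
 qed
 note a = this
 show ?thesis by (rule exI[of _ "B + 1"], rule exI[of _ C]) (use a in simp)
qed

section \<open>Almost extremal graphs\<close>

definition ms :: "'a => 'a set => nat" where "ms v S = card {x\<in>S. ~ E v x}"

lemma dg_ms: "finite S ==> dg v S + ms v S = card S"
 unfolding dg_def ms_def nb_def by (subst card_Un_disjoint[symmetric]) (auto intro!: arg_cong[where f=card])

lemma ms_mono: "finite T ==> S \<subseteq> T ==> ms v S <= ms v T"
 unfolding ms_def by (rule card_mono) auto

text \<open>Pattern of the complete multipartite graph. Nothing is said about edges inside a part,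
  so that a part can carry a path, a matching or cliques.\<close>

definition blow :: "nat => (nat => 'a set) => 'a set => bool" where
 "blow r S V \<longleftrightarrow> (\<forall>i<r. S i \<subseteq> V & finite (S i)) & (\<forall>i<r. \<forall>j<r. i ~= j --> cmpl (S i) (S j))"
text \<open>\<open>forb1\<close> to \<open>forb4\<close> are \<open>F1\<close> to \<open>F4\<close> seen as vertex sets of the host graph, up to irrelevant sizes.\<close>

definition forb1 :: "nat => nat => nat => 'a set => bool" where
 "forb1 r l m V \<longleftrightarrow> (\<exists>S i0. i0 < r & blow r S V & (\<forall>i<r. i ~= i0 --> m <= card (S i)) &
   l + m <= card (S i0) & ~ pfree l (S i0))"

text \<open>The path starts in \<open>B\<close> and alternates, hence \<open>A\<close> receives the
  half that is rounded down. The position of the last vertex is carried along for later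
  extensions.\<close>

lemma bip_path:
 assumes "finite A" "finite B" "cmpl A B"
 shows "l div 2 <= card A ==> (l + 1) div 2 <= card B ==>
  \<exists>xs. ispath (A Un B) xs & length xs = l & card (set xs Int A) = l div 2 & card (set xs Int B) = (l + 1) div 2 &
   (xs ~= [] --> last xs \<in> (if even l then A else B))"
proof (induction l)
 case 0 show ?case by (intro exI[of _ "[]"]) auto
next
 case (Suc l)
 have "l div 2 <= card A" "(l + 1) div 2 <= card B" using Suc.prems by linarith+
 from Suc.IH[OF this] obtain xs where xs: "ispath (A Un B) xs" "length xs = l" "card (set xs Int A) = l div 2"
  "card (set xs Int B) = (l + 1) div 2" "xs ~= [] --> last xs \<in> (if even l then A else B)" by blast
 have disj: "A Int B = {}" by (rule cmpl_disj[OF assms(3)])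
 define C where "C = (if even l then B else A)"
 have "card (set xs Int C) < card C"
 proof (cases "even l")
  case True thus ?thesis using xs(4) Suc.prems(2) by (simp add: C_def)
 next
  case False thus ?thesis using xs(3) Suc.prems(1) by (simp add: C_def)
 qed
 hence "~ C \<subseteq> set xs" by (metis Int_absorb1 less_irrefl)
 then obtain y where y: "y \<in> C" "y \<notin> set xs" by blast
 have yAB: "y \<in> A Un B" using y(1) by (auto simp: C_def split: if_splits)
 have e: "xs ~= [] ==> E (last xs) y" using xs(5) y(1) assms(3) E_sym unfolding C_def cmpl_def by (auto split: if_splits)
 have "ispath (A Un B) (xs @ [y])" using xs(1) y(2) yAB e by (auto simp: ispath_def successively_append_iff)
 moreover have "card (set (xs @ [y]) Int A) = Suc l div 2"
 proof (cases "even l")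
  case True
  hence "set (xs @ [y]) Int A = set xs Int A" using y(1) disj by (auto simp: C_def)
  thus ?thesis using xs(3) True by simp
 next
  case False
  hence "set (xs @ [y]) Int A = insert y (set xs Int A)" using y(1) by (auto simp: C_def)
  thus ?thesis using xs(3) y(2) False by simp
 qed
 moreover have "card (set (xs @ [y]) Int B) = (Suc l + 1) div 2"
 proof (cases "even l")
  case False
  hence "set (xs @ [y]) Int B = set xs Int B" using y(1) disj by (auto simp: C_def)
  thus ?thesis using xs(4) False by simp
 next
  case True
  hence "set (xs @ [y]) Int B = insert y (set xs Int B)" using y(1) by (auto simp: C_def)
  thus ?thesis using xs(4) y(2) True by simp
 qed
 ultimately show ?case using xs(2) y(1) by (intro exI[of _ "xs @ [y]"]) (auto simp: C_def)
qed

lemma bip_not_pfree: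
 assumes "finite A" "finite B" "cmpl A B" "l div 2 <= card A" "(l + 1) div 2 <= card B"
 shows "~ pfree l (A Un B)"
 using bip_path[OF assms] unfolding pfree_def by blast

lemma pigeonhole_weak:
 assumes "finite X" "finite Y" "f ` X \<subseteq> Y" "Y ~= {}"
 shows "\<exists>y\<in>Y. card X <= card Y * card {x\<in>X. f x = y}"
proof (rule ccontr)
 assume "~ ?thesis"
 hence lt: "!!y. y \<in> Y ==> card Y * card {x\<in>X. f x = y} < card X" by force
 have "card X = card (\<Union>y\<in>Y. {x\<in>X. f x = y})" using assms(3) by (intro arg_cong[where f=card]) auto
 also have "... <= (\<Sum>y\<in>Y. card {x\<in>X. f x = y})" by (rule card_UN_le[OF assms(2)])
 finally have "card Y * card X <= (\<Sum>y\<in>Y. card Y * card {x\<in>X. f x = y})"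
  by (simp add: sum_distrib_left[symmetric])
 also have "... < (\<Sum>y\<in>Y. card X)" by (rule sum_strict_mono) (use assms lt in auto)
 finally show False by simp
qed

text \<open>Double counting shows that at least \<open>z / 2 * n\<close> vertices of
  \<open>X\<close> see a fraction \<open>z / 2\<close> of \<open>Y\<close>. They have at most
  \<open>2 ^ card Y\<close> different neighbourhoods in \<open>Y\<close>, and the most frequent one
  provides the complete pair.\<close>

lemma trace:
 assumes "finite X" "finite Y" "Y ~= {}" "0 < z" "real (card X) <= n"
  "!!y. y \<in> Y ==> z * n <= real (dg y X)" "0 < n"
 shows "\<exists>Y' X'. Y' \<subseteq> Y & X' \<subseteq> X & cmpl X' Y' & z / 2 * card Y <= real (card Y') &
   z / 2 * n <= 2 ^ card Y * real (card X')"
proof -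
 define X1 where "X1 = {x\<in>X. z / 2 * card Y <= real (dg x Y)}"
 have f1: "finite X1" "X1 \<subseteq> X" using assms(1) by (auto simp: X1_def)
 have cY: "0 < card Y" using assms(2,3) by (simp add: card_gt_0_iff)
 have "real (card Y) * (z * n) = (\<Sum>y\<in>Y. z * n)" by simp
 also have "... <= (\<Sum>y\<in>Y. real (dg y X))" by (rule sum_mono) (rule assms(6))
 also have "... = real (pe Y X)" by (simp add: pe_def)
 also have "pe Y X = pe X Y" by (rule pe_sym[OF assms(2,1)])
 also have "real (pe X Y) = (\<Sum>x\<in>X1. real (dg x Y)) + (\<Sum>x\<in>X - X1. real (dg x Y))"
  unfolding pe_def using sum.subset_diff[OF f1(2) assms(1), of "%x. real (dg x Y)"] by simp
 also have "... <= (\<Sum>x\<in>X1. real (card Y)) + (\<Sum>x\<in>X - X1. z / 2 * card Y)"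
  by (intro add_mono sum_mono) (auto simp: X1_def dg_le_card[OF assms(2)])
 also have "... = real (card X1) * card Y + real (card (X - X1)) * (z / 2 * card Y)" by simp
 also have "... <= real (card X1) * card Y + n * (z / 2 * card Y)"
 proof -
  have "real (card (X - X1)) <= n" using assms(5) card_mono[OF assms(1), of "X - X1"] by fastforce
  thus ?thesis using assms(4) by (intro add_left_mono mult_right_mono) auto
 qed
 finally have "real (card Y) * (z * n) <= real (card Y) * (card X1 + z / 2 * n)" by (simp add: algebra_simps)
 hence "z * n <= card X1 + z / 2 * n" using cY by simp
 hence c1: "z / 2 * n <= card X1" by (simp add: field_simps)
 have im: "(%x. nb x Y) ` X1 \<subseteq> Pow Y" by auto
 obtain T where T: "T \<in> Pow Y" "card X1 <= card (Pow Y) * card {x\<in>X1. nb x Y = T}"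
  using pigeonhole_weak[OF f1(1) _ im] assms(2) by blast
 define X' where "X' = {x\<in>X1. nb x Y = T}"
 have e: "z / 2 * n <= 2 ^ card Y * real (card X')"
 proof -
  have "real (card X1) <= real (2 ^ card Y * card X')" using T(2) card_Pow[OF assms(2)] by (simp add: X'_def del: of_nat_mult of_nat_power)
  thus ?thesis using c1 by simp
 qed
 have "0 < z / 2 * n" using assms(4,7) by simp
 hence "X' ~= {}" using e by auto
 then obtain x where x: "x \<in> X'" by blast
 hence "z / 2 * card Y <= card T" by (auto simp: X'_def X1_def dg_def)
 moreover have "cmpl X' T" by (auto simp: X'_def cmpl_def)
 moreover have "X' \<subseteq> X" by (auto simp: X'_def X1_def)
 ultimately show ?thesis using T(1) e by (intro exI[of _ T] exI[of _ X']) auto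
qed

text \<open>One class after another is traced against the survivors in \<open>Y\<close>, each time
  at the price of a factor \<open>z / 2\<close>. The survivors only shrink, so
  \<open>2 ^ card Y\<close> bounds the number of neighbourhoods in every round.\<close>

lemma trace_iter:
 assumes "finite Y" "0 < z" "z <= 1" "0 < n"
  "!!i. i < r ==> finite (P i) & real (card (P i)) <= n"
  "!!i y. i < r ==> y \<in> Y ==> z * n <= real (dg y (P i))" "Y ~= {}"
 shows "\<exists>Y' X. Y' \<subseteq> Y & (z / 2) ^ r * card Y <= real (card Y') &
   (\<forall>i<r. X i \<subseteq> P i & cmpl (X i) Y' & z / 2 * n <= 2 ^ card Y * real (card (X i)))"
 using assms(5,6)
proof (induction r)
 case 0 show ?case by (intro exI[of _ Y]) auto
next
 case (Suc r)
 obtain Y' X where Y': "Y' \<subseteq> Y" "(z / 2) ^ r * card Y <= real (card Y')"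
  "!!i. i < r ==> X i \<subseteq> P i & cmpl (X i) Y' & z / 2 * n <= 2 ^ card Y * real (card (X i))"
  using Suc.IH Suc.prems by (metis less_Suc_eq)
 have fY': "finite Y'" using Y' assms(1) finite_subset by blast
 have "0 < (z / 2) ^ r * card Y" using assms(1,2,7) by (simp add: card_gt_0_iff)
 hence ne: "Y' ~= {}" using Y'(2) by auto
 obtain Y2 X2 where Y2: "Y2 \<subseteq> Y'" "X2 \<subseteq> P r" "cmpl X2 Y2" "z / 2 * card Y' <= real (card Y2)"
   "z / 2 * n <= 2 ^ card Y' * real (card X2)"
 proof -
  have "finite (P r)" "real (card (P r)) <= n" using Suc.prems(1)[of r] by auto
  moreover have "z * n <= real (dg y (P r))" if "y \<in> Y'" for y using Suc.prems(2)[of r y] Y'(1) that by auto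
  ultimately show ?thesis using trace[OF _ fY' ne assms(2) _ _ assms(4), of "P r"] that by blast
 qed
 have "z / 2 * n <= 2 ^ card Y * real (card X2)"
 proof -
  have "(2::real) ^ card Y' <= 2 ^ card Y" using Y'(1) assms(1) by (intro power_increasing card_mono) auto
  thus ?thesis using Y2(5) by (meson mult_right_mono of_nat_0_le_iff order_trans)
 qed
 moreover have "(z / 2) ^ Suc r * card Y <= real (card Y2)"
 proof -
  have "(z / 2) ^ Suc r * card Y = z / 2 * ((z / 2) ^ r * card Y)" by simp
  also have "... <= z / 2 * card Y'" using Y'(2) assms(2) by (intro mult_left_mono) auto
  finally show ?thesis using Y2(4) by simp
 qed
 moreover have "cmpl (X i) Y2" if "i < r" for i using Y'(3)[OF that] Y2(1) cmpl_mono by blast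
 ultimately show ?case using Y2 Y'
  by (intro exI[of _ Y2] exI[of _ "X(r := X2)"]) (auto simp: less_Suc_eq)
qed

text \<open>When class \<open>k\<close> is treated, at most \<open>r * (s + N)\<close> vertices of
  other classes have to be respected, and each of them misses at most \<open>e\<close> vertices of
  \<open>P k\<close>. Hence \<open>X k\<close> still contains \<open>N\<close> vertices joined to
  all of them.\<close>

lemma greedy:
 assumes "k <= r" "!!i. i < r ==> finite (P i)"
  "!!i j v. i < r ==> j < r ==> i ~= j ==> v \<in> P i ==> real (ms v (P j)) <= e"
  "!!i. i < r ==> S i \<subseteq> P i & card (S i) <= s"
  "!!i. i < r ==> X i \<subseteq> P i & real (r * (s + N)) * e + N <= card (X i)" "0 <= e"
 shows "\<exists>Z. \<forall>i<k. Z i \<subseteq> X i & card (Z i) = N & (\<forall>j<k. i ~= j --> cmpl (Z i) (Z j)) & (\<forall>j<r. i ~= j --> cmpl (Z i) (S j))"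
 using assms(1)
proof (induction k)
 case (Suc k)
 obtain Z where Z: "!!i. i < k ==> Z i \<subseteq> X i & card (Z i) = N & (\<forall>j<k. i ~= j --> cmpl (Z i) (Z j)) & (\<forall>j<r. i ~= j --> cmpl (Z i) (S j))"
  using Suc by auto
 have k: "k < r" using Suc.prems by simp
 define U where "U = (\<Union>j<k. Z j) Un (\<Union>j\<in>{..<r} - {k}. S j)"
 have UP: "\<exists>i<r. i ~= k & v \<in> P i" if v: "v \<in> U" for v
 proof -
  consider j where "j < k" "v \<in> Z j" | j where "j < r" "j ~= k" "v \<in> S j" using v by (auto simp: U_def)
  thus ?thesis
  proof cases
   case 1 thus ?thesis using Z[of j] assms(5)[of j] k by (intro exI[of _ j]) auto
  next
   case 2 thus ?thesis using assms(4)[of j] by (intro exI[of _ j]) auto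
  qed
 qed
 have fin: "finite (Z j)" if "j < k" for j using Z[OF that] assms(2,5)[of j] that k by (meson finite_subset less_trans)
 have finS: "finite (S j)" if "j < r" for j using assms(2,4)[OF that] finite_subset by blast
 have fU: "finite U" using fin finS by (auto simp: U_def)
 have cU: "card U <= r * (s + N)"
 proof -
  have "card U <= card (\<Union>j<k. Z j) + card (\<Union>j\<in>{..<r} - {k}. S j)" unfolding U_def by (rule card_Un_le)
  also have "card (\<Union>j<k. Z j) <= (\<Sum>j<k. card (Z j))" by (rule card_UN_le) simp
  also have "... = k * N" using Z by simp
  also have "card (\<Union>j\<in>{..<r} - {k}. S j) <= (\<Sum>j\<in>{..<r} - {k}. card (S j))" by (rule card_UN_le) simp
  also have "... <= (\<Sum>j\<in>{..<r} - {k}. s)" by (rule sum_mono) (use assms(4) in auto)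
  also have "... <= r * s" using card_mono[of "{..<r}" "{..<r} - {k}"] by (simp del: card_Diff_insert)
  also have "k * N <= r * N" using k by simp
  finally show ?thesis by (simp add: algebra_simps)
 qed
 define Y where "Y = {y\<in>X k. \<forall>u\<in>U. E u y}"
 have fX: "finite (X k)" using assms(2,5)[OF k] finite_subset by blast
 have "X k \<subseteq> Y Un (\<Union>u\<in>U. {y\<in>P k. ~ E u y})" using assms(5)[OF k] by (auto simp: Y_def)
 hence "card (X k) <= card (Y Un (\<Union>u\<in>U. {y\<in>P k. ~ E u y}))"
  by (rule card_mono[rotated]) (use fX assms(2)[OF k] fU in "auto simp: Y_def")
 also have "... <= card Y + card (\<Union>u\<in>U. {y\<in>P k. ~ E u y})" by (rule card_Un_le)
 also have "card (\<Union>u\<in>U. {y\<in>P k. ~ E u y}) <= (\<Sum>u\<in>U. ms u (P k))" unfolding ms_def by (rule card_UN_le[OF fU])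
 finally have "real (card (X k)) <= card Y + (\<Sum>u\<in>U. real (ms u (P k)))" by (simp flip: of_nat_sum of_nat_add)
 also have "(\<Sum>u\<in>U. real (ms u (P k))) <= (\<Sum>u\<in>U. e)"
  by (rule sum_mono) (use UP assms(3)[OF _ k] in blast)
 also have "... <= real (r * (s + N)) * e" using cU assms(6)
  by simp (metis cU mult_right_mono of_nat_mono of_nat_mult of_nat_add)
 finally have "N <= card Y" using assms(5)[OF k] by linarith
 then obtain Zk where Zk: "Zk \<subseteq> Y" "card Zk = N" using obtain_subset_with_card_n by metis
 have a: "cmpl Zk U" using Zk(1) E_sym by (auto simp: cmpl_def Y_def)
 show ?case
 proof (intro exI[of _ "Z(k := Zk)"] allI impI)
  fix i assume i: "i < Suc k"
  show "(Z(k := Zk)) i \<subseteq> X i & card ((Z(k := Zk)) i) = N &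
     (\<forall>j<Suc k. i ~= j --> cmpl ((Z(k := Zk)) i) ((Z(k := Zk)) j)) & (\<forall>j<r. i ~= j --> cmpl ((Z(k := Zk)) i) (S j))"
  proof (cases "i = k")
   case True
   have "cmpl Zk (Z j)" if "j < k" for j by (rule cmpl_mono[OF a]) (use that in "auto simp: U_def")
   moreover have "cmpl Zk (S j)" if "j < r" "j ~= k" for j by (rule cmpl_mono[OF a]) (use that in "auto simp: U_def")
   moreover have "Zk \<subseteq> X k" using Zk(1) by (auto simp: Y_def)
   ultimately show ?thesis using True Zk(2) by auto
  next
   case False
   hence ik: "i < k" using i by simp
   have "cmpl (Z i) Zk" by (rule cmpl_sym, rule cmpl_mono[OF a]) (use ik in "auto simp: U_def")
   thus ?thesis using False ik Z[OF ik] by (auto simp: less_Suc_eq)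
  qed
 qed
qed simp

section \<open>A minimum degree form of the Erdos-Stone theorem\<close>

text \<open>Counting the edges at the \<open>j\<close> given parts shows that many outside vertices
  have \<open>M\<close> neighbours in every part. By pigeonhole \<open>M\<close> of them have the
  same neighbourhood in \<open>U\<close>; they form the new part.\<close>

lemma es_step:
 fixes j r :: nat
 assumes r: "0 < j" "j < r"
  and IH: "!!M. \<exists>n0. \<forall>V. finite V --> n0 <= card V --> (\<forall>v\<in>V. (1 - 1 / r) * card V - 1 <= real (dg v V)) -->
   (\<exists>B. blow j B V & (\<forall>i<j. card (B i) = M))"
 shows "\<exists>n0. \<forall>V. finite V --> n0 <= card V --> (\<forall>v\<in>V. (1 - 1 / r) * card V - 1 <= real (dg v V)) -->
   (\<exists>B. blow (Suc j) B V & (\<forall>i<Suc j. card (B i) = M))"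
proof (cases "M = 0")
 case True
 show ?thesis unfolding blow_def cmpl_def
  by (intro exI[of _ 0] allI impI exI[of _ "%_. {}"]) (auto simp: True)
next
 case M0: False
 \<comment> \<open>For \<open>j < r\<close> parts of this size the degree condition exceeds what a
   vertex poor in one part can contribute, on average by at least
   \<open>M' / r - M = M\<close>.\<close>
 define M' where "M' = 2 * r * M"
 obtain n0 where n0: "!!V. finite V ==> n0 <= card V ==> (\<forall>v\<in>V. (1 - 1 / r) * card V - 1 <= real (dg v V)) ==>
   (\<exists>B. blow j B V & (\<forall>i<j. card (B i) = M'))" using IH[of M'] by blast
 \<comment> \<open>Beyond this size the count leaves more than \<open>2 ^ (j * M') * M\<close> rich
   vertices, enough for the pigeonhole over the subsets of \<open>U\<close>.\<close>
 define L where "L = (j * M') * (2 ^ (j * M') * M) + j * M' + (j * M') * (j * M')"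
 show ?thesis
 proof (intro exI[of _ "max n0 (Suc L)"] allI impI)
  fix V :: "'a set" assume V: "finite V" "max n0 (Suc L) <= card V" "\<forall>v\<in>V. (1 - 1 / r) * card V - 1 <= real (dg v V)"
  obtain B where B: "blow j B V" "!!i. i < j ==> card (B i) = M'" using n0[OF V(1) _ V(3)] V(2) by auto
  define n where "n = real (card V)"
  define U where "U = (\<Union>i<j. B i)"
  have fB: "finite (B i)" "B i \<subseteq> V" if "i < j" for i using B(1) that by (auto simp: blow_def)
  have fU: "finite U" "U \<subseteq> V" using fB by (auto simp: U_def)
  have dB: "B i Int B k = {}" if "i < j" "k < j" "i ~= k" for i k
   using B(1) that cmpl_disj by (auto simp: blow_def)
  have cU: "card U = j * M'"
  proof -
   have "card U = (\<Sum>i<j. card (B i))" unfolding U_def by (rule card_UN_disjoint) (use fB dB in auto)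
   thus ?thesis using B(2) by simp
  qed
  have dU: "dg v U = (\<Sum>i<j. dg v (B i))" for v
  proof -
   have "nb v U = (\<Union>i<j. nb v (B i))" by (auto simp: U_def)
   moreover have "card (\<Union>i<j. nb v (B i)) = (\<Sum>i<j. card (nb v (B i)))"
   proof (rule card_UN_disjoint)
    show "\<forall>i\<in>{..<j}. \<forall>k\<in>{..<j}. i ~= k --> nb v (B i) Int nb v (B k) = {}"
     using dB unfolding nb_def by blast
   qed (use fB in auto)
   ultimately show ?thesis by (simp add: dg_def)
  qed
  define R where "R = {v\<in>V - U. \<forall>i<j. M <= dg v (B i)}"
  have fR: "finite R" using V(1) by (simp add: R_def)
  have nonrich: "real (dg v U) <= (real j - 1) * M' + M" if v: "v \<in> (V - U) - R" for v
  proof -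
   obtain i where i: "i < j" "dg v (B i) < M" using v by (auto simp: R_def)
   have "dg v U = dg v (B i) + (\<Sum>k\<in>{..<j} - {i}. dg v (B k))" unfolding dU by (rule sum.remove) (use i in auto)
   also have "(\<Sum>k\<in>{..<j} - {i}. dg v (B k)) <= (\<Sum>k\<in>{..<j} - {i}. M')"
    by (rule sum_mono) (metis B(2) DiffD1 dg_le_card fB(1) lessThan_iff)
   also have "... = (j - 1) * M'" using i by simp
   finally have "dg v U <= M + (j - 1) * M'" using i by linarith
   hence "real (dg v U) <= real (M + (j - 1) * M')" by (simp only: of_nat_le_iff)
   thus ?thesis using r by (simp add: of_nat_diff)
  qed
  have split: "V = (R Un ((V - U) - R)) Un U" using fU by (auto simp: R_def)
  have "real (j * M') * ((1 - 1 / r) * n - 1) = (\<Sum>u\<in>U. (1 - 1 / r) * n - 1)" using cU by simp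
  also have "... <= (\<Sum>u\<in>U. real (dg u V))" by (rule sum_mono) (use V(3) fU in "auto simp: n_def")
  also have "... = real (pe U V)" by (simp add: pe_def)
  also have "pe U V = pe V U" by (rule pe_sym[OF fU(1) V(1)])
  also have "pe V U = pe R U + pe ((V - U) - R) U + pe U U"
  proof -
   have "pe V U = pe (R Un ((V - U) - R)) U + pe U U" by (subst (1) split, rule pe_Un1) (use fU fR V(1) in "auto simp: R_def")
   also have "pe (R Un ((V - U) - R)) U = pe R U + pe ((V - U) - R) U" by (rule pe_Un1) (use fR V(1) in auto)
   finally show ?thesis .
  qed
  also have "real ... <= real (card R) * real (j * M') + n * ((real j - 1) * M' + M) + real ((j * M') * (j * M'))"
  proof -
   have "real (pe R U) <= real (card R) * real (j * M')" using pe_le[OF fR fU(1)] cU by (metis of_nat_le_iff of_nat_mult)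
   moreover have "real (pe ((V - U) - R) U) <= (\<Sum>v\<in>(V - U) - R. (real j - 1) * M' + M)"
    unfolding pe_def of_nat_sum by (rule sum_mono) (rule nonrich)
   moreover have "(\<Sum>v\<in>(V - U) - R. (real j - 1) * M' + M) <= n * ((real j - 1) * M' + M)"
   proof -
    have "card ((V - U) - R) <= card V" by (rule card_mono) (use V(1) in auto)
    thus ?thesis using r by (simp add: n_def mult_right_mono)
   qed
   moreover have "real (pe U U) <= real ((j * M') * (j * M'))" using pe_le[OF fU(1) fU(1)] cU by (metis of_nat_le_iff)
   ultimately show ?thesis by simp
  qed
  finally have 1: "real (j * M') * ((1 - 1 / r) * n - 1) <= real (card R) * real (j * M') + n * ((real j - 1) * M' + M) + real ((j * M') * (j * M'))" .
  have 2: "n * M <= real (j * M') * ((1 - 1 / r) * n) - n * ((real j - 1) * M' + M)"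
  proof -
   have "real j * M' * (1 - 1/r) - ((real j - 1) * M' + M) = M' - real j * M' / r - M" by (simp add: algebra_simps)
   also have "... \<ge> M' - (real r - 1) * M' / r - M"
   proof -
    have "real j <= real r - 1" using r by linarith
    hence "real j * M' / r <= (real r - 1) * M' / r" by (intro divide_right_mono mult_right_mono) auto
    thus ?thesis by simp
   qed
   also have "M' - (real r - 1) * M' / r - M = M" using r by (simp add: M'_def field_simps)
   finally have "M <= real j * M' * (1 - 1/r) - ((real j - 1) * M' + M)" by simp
   hence "n * M <= n * (real j * M' * (1 - 1/r) - ((real j - 1) * M' + M))" by (intro mult_left_mono) (auto simp: n_def)
   thus ?thesis by (simp add: algebra_simps)
  qed
  have "n * M <= real (card R) * real (j * M') + real (j * M') + real ((j * M') * (j * M'))"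
   using 1 2 by (simp add: algebra_simps)
  moreover have "real L < n * M"
  proof -
   have "real L < n" using V(2) by (simp add: n_def)
   also have "n <= n * M" using M0 mult_left_mono[of 1 "real M" n] by (simp add: n_def)
   finally show ?thesis .
  qed
  ultimately have "real L < real (card R * (j * M') + j * M' + (j * M') * (j * M'))" by simp
  hence "L < card R * (j * M') + j * M' + (j * M') * (j * M')" by (simp only: of_nat_less_iff)
  hence "(j * M') * (2 ^ (j * M') * M) < (j * M') * card R" unfolding L_def by (simp only: mult.commute add_less_cancel_right)
  hence "2 ^ (j * M') * M < card R" by (metis mult_less_cancel1)
  hence cR: "card (Pow U) * M < card R" using card_Pow[OF fU(1)] cU by simp
  have im: "(%v. nb v U) ` R \<subseteq> Pow U" by auto
  obtain T where T: "T \<in> Pow U" "M < card {v\<in>R. nb v U = T}"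
   using pigeonhole_card[OF fR _ im cR] fU(1) by auto
  obtain Z where Z: "Z \<subseteq> {v\<in>R. nb v U = T}" "card Z = M" "finite Z" using obtain_subset_with_card_n[OF less_imp_le[OF T(2)]] by blast
  have "Z ~= {}" using Z(2) M0 by auto
  then obtain z where z: "z \<in> R" "nb z U = T" using Z(1) by blast
  have "\<exists>C. C \<subseteq> T Int B i & card C = M" if i: "i < j" for i
  proof -
   have "nb z (B i) = T Int B i" using z(2) i by (auto simp: U_def)
   hence "M <= card (T Int B i)" using z(1) i by (auto simp: R_def dg_def)
   thus ?thesis using obtain_subset_with_card_n by metis
  qed
  then obtain C where C: "!!i. i < j ==> C i \<subseteq> T Int B i & card (C i) = M" by metis
  have ZT: "cmpl Z T" using Z(1) by (auto simp: cmpl_def)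
  have ZC: "cmpl Z (C i)" if "i < j" for i by (rule cmpl_mono[OF ZT]) (use C[OF that] in auto)
  have CC: "cmpl (C i) (C k)" if "i < j" "k < j" "i ~= k" for i k
   by (rule cmpl_mono[of "B i" "B k"]) (use B(1) that C[of i] C[of k] in "auto simp: blow_def")
  have "blow (Suc j) (C(j := Z)) V" unfolding blow_def
  proof (intro conjI allI impI)
   fix i assume i: "i < Suc j"
   show "(C(j := Z)) i \<subseteq> V" using i C[of i] fB[of i] Z(1) by (auto simp: less_Suc_eq R_def)
   show "finite ((C(j := Z)) i)" using i C[of i] fB[of i] Z(3) by (auto simp: less_Suc_eq dest: finite_subset)
   fix k assume k: "k < Suc j" "i ~= k"
   show "cmpl ((C(j := Z)) i) ((C(j := Z)) k)"
    using i k CC[of i k] ZC[of i] ZC[of k] by (auto simp: less_Suc_eq cmpl_sym)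
  qed
  moreover have "\<forall>i<Suc j. card ((C(j := Z)) i) = M" using C Z(2) by (auto simp: less_Suc_eq)
  ultimately show "\<exists>B. blow (Suc j) B V & (\<forall>i<Suc j. card (B i) = M)" by blast
 qed
qed

lemma es:
 fixes j r :: nat
 assumes "1 <= j" "j <= r"
 shows "\<exists>n0. \<forall>V. finite V --> n0 <= card V --> (\<forall>v\<in>V. (1 - 1 / r) * card V - 1 <= real (dg v V)) -->
   (\<exists>B. blow j B V & (\<forall>i<j. card (B i) = M))"
 using assms
proof (induction j arbitrary: M)
 case (Suc j)
 show ?case
 proof (cases "j = 0")
  case True
  show ?thesis
  proof (intro exI[of _ M] allI impI)
   fix V :: "'a set" assume "finite V" "M <= card V"
   then obtain B where "B \<subseteq> V" "card B = M" "finite B" using obtain_subset_with_card_n by metis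
   thus "\<exists>B. blow (Suc j) B V & (\<forall>i<Suc j. card (B i) = M)"
    by (intro exI[of _ "%_. B"]) (auto simp: blow_def True)
  qed
 next
  case False
  show ?thesis by (rule es_step) (use False Suc in auto)
 qed
qed simp

definition cn :: "'a set => 'a set => 'a set" where "cn A S = {x\<in>S. \<forall>u\<in>A. E u x}"

lemma cn_subset: "cn A S \<subseteq> S" by (auto simp: cn_def)
lemma cmpl_cn: "cmpl A (cn A S)" by (auto simp: cmpl_def cn_def)

lemma card_cn: assumes "finite S" "finite A"
 shows "card S <= card (cn A S) + (\<Sum>a\<in>A. ms a S)"
proof -
 have "S \<subseteq> cn A S Un (\<Union>a\<in>A. {x\<in>S. ~ E a x})" by (auto simp: cn_def)
 hence "card S <= card (cn A S Un (\<Union>a\<in>A. {x\<in>S. ~ E a x}))"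
  by (rule card_mono[rotated]) (use assms in "auto simp: cn_def")
 also have "... <= card (cn A S) + card (\<Union>a\<in>A. {x\<in>S. ~ E a x})" by (rule card_Un_le)
 also have "card (\<Union>a\<in>A. {x\<in>S. ~ E a x}) <= (\<Sum>a\<in>A. ms a S)" unfolding ms_def by (rule card_UN_le[OF assms(2)])
 finally show ?thesis by simp
qed

lemma dg_UN: assumes "!!i. i < r ==> finite (B i)" "!!i j. i < r ==> j < r ==> i ~= j ==> B i Int B j = {}"
 shows "dg v (\<Union>i\<in>{..<r::nat}. B i) = (\<Sum>i<r. dg v (B i))"
proof -
 have "nb v (\<Union>i<r. B i) = (\<Union>i<r. nb v (B i))" by auto
 moreover have "card (\<Union>i<r. nb v (B i)) = (\<Sum>i<r. card (nb v (B i)))"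
 proof (rule card_UN_disjoint)
  show "\<forall>i\<in>{..<r}. \<forall>j\<in>{..<r}. i ~= j --> nb v (B i) Int nb v (B j) = {}"
   using assms(2) unfolding nb_def by blast
 qed (use assms in auto)
 ultimately show ?thesis by (simp add: dg_def)
qed

lemma blow_disj: "blow r B V ==> i < r ==> j < r ==> i ~= j ==> B i Int B j = {}"
 using cmpl_disj by (auto simp: blow_def)

text \<open>By pigeonhole, \<open>l div 2\<close> such vertices would share enough neighbours to yield \<open>F1\<close>.\<close>

lemma few_universal:
 assumes "finite V" "blow r B V" "0 < r" "~ forb1 r l m V" "3 <= l" "card (\<Union>i<r. B i) <= b"
 shows "card {v\<in>V - (\<Union>i<r. B i). \<forall>i<r. l + m <= dg v (B i)} <= 2 ^ b * l"
proof (rule ccontr)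
 define U where "U = (\<Union>i<r. B i)"
 define W where "W = {v\<in>V - U. \<forall>i<r. l + m <= dg v (B i)}"
 assume "~ ?thesis"
 hence "2 ^ b * l < card W" by (simp add: W_def U_def)
 have fB: "finite (B i)" "B i \<subseteq> V" if "i < r" for i using assms(2) that by (auto simp: blow_def)
 have fU: "finite U" using fB by (auto simp: U_def)
 have fW: "finite W" using assms(1) by (simp add: W_def)
 have "card (Pow U) <= 2 ^ b" using card_Pow[OF fU] assms(6) by (simp add: U_def)
 hence big: "card (Pow U) * l < card W" using \<open>2 ^ b * l < card W\<close> by (meson le_less_trans mult_le_mono1)
 have im: "(%v. nb v U) ` W \<subseteq> Pow U" by auto
 obtain T where T: "T \<in> Pow U" "l < card {v\<in>W. nb v U = T}"
  using pigeonhole_card[OF fW _ im big] fU by auto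
 obtain Z where Z: "Z \<subseteq> {v\<in>W. nb v U = T}" "card Z = l" "finite Z" using obtain_subset_with_card_n[OF less_imp_le[OF T(2)]] by blast
 have "Z ~= {}" using Z(2) assms(5) by auto
 then obtain z where z: "z \<in> W" "nb z U = T" using Z(1) by blast
 define C where "C = (%i. T Int B i)"
 have cC: "l + m <= card (C i)" if i: "i < r" for i
 proof -
  have "nb z (B i) = T Int B i" using z(2) i by (auto simp: U_def)
  thus ?thesis using z(1) i by (auto simp: W_def dg_def C_def)
 qed
 have ZT: "cmpl Z T" using Z(1) by (auto simp: cmpl_def)
 have ZC: "cmpl Z (C i)" for i by (rule cmpl_mono[OF ZT]) (auto simp: C_def)
 have fC: "finite (C i)" if "i < r" for i using fB[OF that] by (simp add: C_def)
 have np: "~ pfree l (Z Un C 0)"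
 proof (rule bip_not_pfree[OF Z(3) fC[OF assms(3)] ZC])
  show "l div 2 <= card Z" using Z(2) by simp
  show "(l + 1) div 2 <= card (C 0)" using cC[OF assms(3)] assms(5) by linarith
 qed
 have "forb1 r l m V" unfolding forb1_def
 proof (rule exI[of _ "C(0 := Z Un C 0)"], rule exI[of _ 0], intro conjI allI impI)
  have CC: "cmpl (C i) (C k)" if "i < r" "k < r" "i ~= k" for i k
   by (rule cmpl_mono[of "B i" "B k"]) (use assms(2) that in "auto simp: blow_def C_def")
  have CZ: "cmpl (C i) Z" for i by (rule cmpl_sym[OF ZC])
  show "blow r (C(0 := Z Un C 0)) V" unfolding blow_def
  proof (intro conjI allI impI)
   fix i assume i: "i < r"
   show "(C(0 := Z Un C 0)) i \<subseteq> V" using fB[OF i] fB[OF assms(3)] Z(1) by (auto simp: C_def W_def)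
   show "finite ((C(0 := Z Un C 0)) i)" using fC[OF i] fC[OF assms(3)] Z(3) by auto
   fix k assume k: "k < r" "i ~= k"
   have un: "cmpl (X Un Y) T'" if "cmpl X T'" "cmpl Y T'" for X Y T' using that by (auto simp: cmpl_def)
   have un': "cmpl T' (X Un Y)" if "cmpl T' X" "cmpl T' Y" for X Y T' using that by (auto simp: cmpl_def)
   show "cmpl ((C(0 := Z Un C 0)) i) ((C(0 := Z Un C 0)) k)"
    using CC[OF i k] CC ZC CZ k un un' i assms(3) by auto
  qed
  show "m <= card ((C(0 := Z Un C 0)) i)" if "i < r" "i ~= 0" for i using cC[OF that(1)] that by simp
  show "l + m <= card ((C(0 := Z Un C 0)) 0)"
  proof -
   have "card (C 0) <= card (Z Un C 0)" by (rule card_mono) (use fC[OF assms(3)] Z(3) in auto)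
   thus ?thesis using cC[OF assms(3)] by simp
  qed
  show "~ pfree l ((C(0 := Z Un C 0)) 0)" using np by simp
 qed (rule assms(3))
 thus False using assms(4) by simp
qed

section \<open>Partition into almost independent classes\<close>

text \<open>A fixed blow-up \<open>B\<close> with parts of constant size \<open>M\<close> classifies
  the vertices. Apart from boundedly many, each vertex misses almost all of some \<open>B i\<close>;
  apart from a small fraction, it sees nearly everything in the other parts, and \<open>i\<close>
  becomes its class. Only boundedly many vertices have many neighbours in their own class, since
  otherwise a complete bipartite graph inside the class could be completed to
  \<open>F1\<close>.\<close>

lemma cores:
 fixes r l m :: nat and e :: real
 assumes r: "0 < r" and l: "3 <= l" and e: "0 < e" "e <= 1"
 shows "\<exists>n0. \<forall>V. finite V --> n0 <= card V --> (\<forall>v\<in>V. (1 - 1 / r) * card V - 1 <= real (dg v V)) --> ~ forb1 r l m V -->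
  (\<exists>P. (\<forall>i<r. P i \<subseteq> V) & (\<forall>i<r. \<forall>j<r. i ~= j --> P i Int P j = {}) &
   (\<forall>i<r. \<forall>v\<in>P i. real (dg v (P i)) <= e * card V & (\<forall>j<r. j ~= i --> real (ms v (P j)) <= e * card V)) &
   (\<forall>i<r. real (card V) / r - e * card V <= card (P i)) & real (card (V - (\<Union>i<r. P i))) <= e * card V)"
proof -
 define N1 where "N1 = l + m"
 have N1: "3 <= N1" using l by (simp add: N1_def)
 define t where "t = e / (16 * (real r + 2) * N1)"
 have t0: "0 < t" using e N1 by (simp add: t_def)
 have tN: "2 * real N1 * t <= 1 / 2" "(real r + 2) * t <= e / 8" "t <= 1/8"
 proof -
  define R where "R = real r + 2"
  have R: "R > 0" "real N1 ~= 0" using N1 by (auto simp: R_def)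
  have t: "t = e / (16 * R * N1)" by (simp add: t_def R_def)
  have a: "2 * real N1 * t = e / (8 * R)" using R by (simp add: t field_simps)
  show b: "2 * real N1 * t <= 1 / 2" unfolding a using e by (simp add: field_simps R_def)
  have c: "(real r + 2) * t = e / (16 * real N1)" using R by (simp add: t field_simps flip: R_def)
  show "(real r + 2) * t <= e / 8" unfolding c using e N1 by (intro divide_left_mono) auto
  have "4 * t <= 2 * real N1 * t" using N1 t0 by (intro mult_right_mono) auto
  thus "t <= 1/8" using b by linarith
 qed
 \<comment> \<open>A typical vertex sees less than the fraction \<open>h\<close> of its own part.
   The averaging that bounds \<open>Bad\<close> divides by \<open>t / 2\<close>, and
   \<open>2 * h / t = t / 2\<close> is again small.\<close>
 define h where "h = t\<^sup>2 / 4"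
 have h0: "0 < h" using t0 by (simp add: h_def)
 have ht: "h <= t / 32"
 proof -
  have "t * t <= t * (1/8)" using tN(3) t0 by (intro mult_left_mono) auto
  thus ?thesis by (simp add: h_def power2_eq_square)
 qed
 define z where "z = e / 2"
 have z0: "0 < z" using e by (simp add: z_def)
 \<comment> \<open>From this many vertices \<open>trace\<close> with density \<open>z\<close> keeps
   at least \<open>N1\<close>.\<close>
 define K2 where "K2 = nat \<lceil>2 * real N1 / z\<rceil>"
 have K2: "2 * real N1 / z <= K2" unfolding K2_def by linarith
 \<comment> \<open>Makes fewer than \<open>N1\<close> neighbours in \<open>B i\<close> less than the
   fraction \<open>h\<close> of this part.\<close>
 define M where "M = nat \<lceil>real N1 / h\<rceil>"
 have M: "real N1 <= h * M"
 proof -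
  have "real N1 / h <= M" unfolding M_def by linarith
  thus ?thesis using h0 by (simp add: field_simps)
 qed
 have M0: "0 < M" using M N1 h0 by (cases "M = 0") auto
 have M2: "2 * real N1 <= M"
 proof -
  have "h <= 1/2" using ht tN(3) by simp
  hence "h * M <= 1/2 * M" by (intro mult_right_mono) auto
  thus ?thesis using M by simp
 qed
 define c1 where "c1 = 2 ^ (r * M) * l"
 \<comment> \<open>Collects those terms in the count of \<open>Bad\<close> that do not grow with the
   number of vertices.\<close>
 define D where "D = (real r + real (r * r * M) + real (c1 * r)) * 2 / t"
 have D0: "0 <= D" using t0 by (simp add: D_def)
 define C where "C = D + real (r * M) + real c1 + real (r * K2) + 2 ^ K2 * real N1 * 2 / z + 2"
 obtain n0 where n0: "!!V. finite V ==> n0 <= card V ==> (\<forall>v\<in>V. (1 - 1 / r) * card V - 1 <= real (dg v V)) ==>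
   (\<exists>B. blow r B V & (\<forall>i<r. card (B i) = M))" using es[of r r M] r by auto
 show ?thesis
 proof (intro exI[of _ "max n0 (nat \<lceil>C / (t / 2)\<rceil>)"] allI impI)
  fix V :: "'a set" assume V: "finite V" "max n0 (nat \<lceil>C / (t / 2)\<rceil>) <= card V"
   "\<forall>v\<in>V. (1 - 1 / r) * card V - 1 <= real (dg v V)" "~ forb1 r l m V"
  define n where "n = real (card V)"
  have "C / (t / 2) <= n" using V(2) unfolding n_def by linarith
  hence Cn: "C <= t / 2 * n" using t0 by (simp add: field_simps)
  have c2: "0 <= 2 ^ K2 * real N1 * 2 / z" using z0 by simp
  have cc: "D + real (r * M) + real c1 <= t / 2 * n" "real (r * K2) <= t / 2 * n" "2 ^ K2 * real N1 * 2 / z <= t / 2 * n" "2 <= t / 2 * n"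
  proof -
   have "0 <= real (r * M)" "0 <= real c1" "0 <= real (r * K2)" by (rule of_nat_0_le_iff)+
   thus "D + real (r * M) + real c1 <= t / 2 * n" "real (r * K2) <= t / 2 * n" "2 ^ K2 * real N1 * 2 / z <= t / 2 * n" "2 <= t / 2 * n"
    using Cn D0 c2 unfolding C_def by linarith+
  qed
  have n1: "0 < n"
  proof (rule ccontr)
   assume "~ 0 < n"
   hence "t / 2 * n <= 0" using t0 by (intro mult_nonneg_nonpos) auto
   thus False using cc(4) by simp
  qed
  obtain B where B: "blow r B V" "!!i. i < r ==> card (B i) = M" using n0[OF V(1) _ V(3)] V(2) by auto
  define U where "U = (\<Union>i<r. B i)"
  have fB: "finite (B i)" "B i \<subseteq> V" if "i < r" for i using B(1) that by (auto simp: blow_def)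
  have fU: "finite U" "U \<subseteq> V" using fB by (auto simp: U_def)
  have dB: "B i Int B k = {}" if "i < r" "k < r" "i ~= k" for i k by (rule blow_disj[OF B(1) that])
  have cU: "card U = r * M"
  proof -
   have "card U = (\<Sum>i<r. card (B i))" unfolding U_def by (rule card_UN_disjoint) (use fB dB in auto)
   thus ?thesis using B(2) by simp
  qed
  have dU: "dg v U = (\<Sum>i<r. dg v (B i))" for v unfolding U_def by (rule dg_UN) (use fB dB in auto)
  define W1 where "W1 = {v\<in>V - U. \<forall>i<r. l + m <= dg v (B i)}"
  have cW1: "card W1 <= c1" unfolding W1_def U_def c1_def
   by (rule few_universal[OF V(1) B(1) r V(4) l]) (use cU in "simp add: U_def")
  have low: "\<exists>i<r. real (dg v (B i)) < h * M" if vv: "v \<in> V - U - W1" for v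
  proof -
   obtain i where "i < r" "dg v (B i) < N1" using vv by (auto simp: W1_def N1_def not_le)
   thus ?thesis using M by (intro exI[of _ i]) auto
  qed
  have dBM: "dg v (B i) <= M" if "i < r" for v i using dg_le_card[OF fB(1)[OF that], of v] B(2)[OF that] by simp
  have low2: "real (dg v U) <= (real r - 1) * M + h * M" if v: "v \<in> V - U - W1" for v
  proof -
   obtain i where i: "i < r" "real (dg v (B i)) < h * M" using low[OF v] by blast
   have "dg v U = dg v (B i) + (\<Sum>k\<in>{..<r} - {i}. dg v (B k))" unfolding dU by (rule sum.remove) (use i in auto)
   also have "real ... <= h * M + (\<Sum>k\<in>{..<r} - {i}. real M)"
    unfolding of_nat_add of_nat_sum by (intro add_mono sum_mono) (use i dBM in auto)
   also have "... = (real r - 1) * M + h * M" using i r by (simp add: of_nat_diff)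
   finally show ?thesis .
  qed
  \<comment> \<open>Vertices lacking more than \<open>t / 2 * M\<close> neighbours beyond one full
    part. They are few, because the degree condition keeps the average degree into \<open>U\<close>
    near \<open>(r - 1) * M\<close>, and outside the bounded set \<open>W1\<close> hardly any vertex
    exceeds it.\<close>
  define Bad where "Bad = {v\<in>V - U - W1. real (dg v U) < (real r - 1) * M - t / 2 * M}"
  define Gd where "Gd = V - U - W1 - Bad"
  have fin: "finite W1" "finite Bad" "finite Gd" using V(1) by (auto simp: W1_def Bad_def Gd_def)
  have "real (r * M) * ((1 - 1 / r) * n - 1) = (\<Sum>u\<in>U. (1 - 1 / r) * n - 1)" using cU by simp
  also have "... <= (\<Sum>u\<in>U. real (dg u V))" by (rule sum_mono) (use V(3) fU in "auto simp: n_def")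
  also have "... = real (pe V U)" using pe_sym[OF fU(1) V(1)] by (simp add: pe_def flip: of_nat_sum)
  also have "pe V U = pe U U + (pe W1 U + (pe Bad U + pe Gd U))"
  proof -
   have "V = U Un (W1 Un (Bad Un Gd))" using fU(2) by (auto simp: W1_def Bad_def Gd_def)
   hence "pe V U = pe (U Un (W1 Un (Bad Un Gd))) U" by simp
   also have "... = pe U U + pe (W1 Un (Bad Un Gd)) U" by (rule pe_Un1) (use fin fU in "auto simp: W1_def Bad_def Gd_def")
   also have "pe (W1 Un (Bad Un Gd)) U = pe W1 U + pe (Bad Un Gd) U" by (rule pe_Un1) (use fin in "auto simp: W1_def Bad_def Gd_def")
   also have "pe (Bad Un Gd) U = pe Bad U + pe Gd U" by (rule pe_Un1) (use fin in "auto simp: W1_def Bad_def Gd_def")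
   finally show ?thesis .
  qed
  also have "real ... <= real ((r * M) * (r * M)) + (real (c1 * (r * M)) + (real (card Bad) * ((real r - 1) * M - t / 2 * M) + real (card Gd) * ((real r - 1) * M + h * M)))"
  proof -
   have "pe U U <= (r * M) * (r * M)" using pe_le[OF fU(1) fU(1)] cU by simp
   hence "real (pe U U) <= real ((r * M) * (r * M))" by (simp only: of_nat_le_iff)
   moreover have "pe W1 U <= c1 * (r * M)"
   proof -
    have "card W1 * card U <= c1 * card U" by (rule mult_le_mono1[OF cW1])
    from le_trans[OF pe_le[OF fin(1) fU(1)] this] show ?thesis unfolding cU .
   qed
   hence "real (pe W1 U) <= real (c1 * (r * M))" by (simp only: of_nat_le_iff)
   moreover have "real (pe Bad U) <= (\<Sum>v\<in>Bad. (real r - 1) * M - t / 2 * M)"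
    unfolding pe_def of_nat_sum by (rule sum_mono) (auto simp: Bad_def)
   moreover have "real (pe Gd U) <= (\<Sum>v\<in>Gd. (real r - 1) * M + h * M)"
    unfolding pe_def of_nat_sum by (rule sum_mono) (use low2 in "auto simp: Gd_def")
   ultimately show ?thesis unfolding of_nat_add sum_constant by linarith
  qed
  finally have 1: "real (r * M) * ((1 - 1 / r) * n - 1) <= real ((r * M) * (r * M)) + (real (c1 * (r * M)) + (real (card Bad) * ((real r - 1) * M - t / 2 * M) + real (card Gd) * ((real r - 1) * M + h * M)))" .
  have bg: "real (card Bad) + real (card Gd) <= n"
  proof -
   have "card Bad + card Gd = card (Bad Un Gd)" by (rule card_Un_disjoint[symmetric]) (use fin in "auto simp: Gd_def")
   also have "... <= card V" by (rule card_mono) (use V(1) in "auto simp: Gd_def Bad_def")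
   finally show ?thesis by (simp add: n_def)
  qed
  have badle: "real (card Bad) <= t / 2 * n + D"
  proof -
   define k where "k = (real r - 1) * M + h * M"
   have k0: "0 <= k" using r h0 by (simp add: k_def)
   have L: "real (r * M) * ((1 - 1 / r) * n - 1) = (real r - 1) * M * n - real (r * M)" using r by (simp add: field_simps)
   have "(real (card Bad) + real (card Gd)) * k <= n * k" by (rule mult_right_mono[OF bg k0])
   hence "real (card Bad) * k + real (card Gd) * k <= n * k" by (simp only: distrib_right)
   moreover have "real (card Bad) * ((real r - 1) * M - t / 2 * M) <= real (card Bad) * (k - t / 2 * M)"
    using h0 by (intro mult_left_mono) (auto simp: k_def)
   hence "real (card Bad) * ((real r - 1) * M - t / 2 * M) <= real (card Bad) * k - real (card Bad) * (t / 2 * M)" by (simp only: right_diff_distrib)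
   ultimately have "(real r - 1) * M * n - real (r * M) <= real ((r * M) * (r * M)) + real (c1 * (r * M)) + n * k - real (card Bad) * (t / 2 * M)"
    using 1 unfolding k_def[symmetric] L by linarith
   hence "real (card Bad) * (t / 2 * M) <= n * h * M + real (r * M) + real ((r * M) * (r * M)) + real (c1 * (r * M))"
    by (simp add: k_def algebra_simps)
   also have "... = M * (n * h + (real r + real (r * r * M) + real (c1 * r)))" by (simp add: algebra_simps)
   finally have "M * (real (card Bad) * (t / 2)) <= M * (n * h + (real r + real (r * r * M) + real (c1 * r)))" by (simp add: algebra_simps)
   hence "real (card Bad) * (t / 2) <= n * h + (real r + real (r * r * M) + real (c1 * r))" using M0 by simp
   hence "real (card Bad) <= (n * h + (real r + real (r * r * M) + real (c1 * r))) / (t / 2)" using t0 by (simp add: pos_le_divide_eq)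
   also have "... = t / 2 * n + D" using t0 by (simp add: D_def h_def field_simps power2_eq_square)
   finally show ?thesis .
  qed
  define V' where "V' = (%i. {v\<in>Gd. real (dg v (B i)) < h * M})"
  have V'V: "V' i \<subseteq> V" for i by (auto simp: V'_def Gd_def)
  have fV': "finite (V' i)" for i using V'V V(1) finite_subset by blast
  have hi: "real (ms v (B j)) <= t * M" if v: "v \<in> V' i" and ij: "i < r" "j < r" "i ~= j" for v i j
  proof -
   have "dg v U = dg v (B i) + (\<Sum>k\<in>{..<r} - {i}. dg v (B k))" unfolding dU by (rule sum.remove) (use ij in auto)
   also have "(\<Sum>k\<in>{..<r} - {i}. dg v (B k)) = dg v (B j) + (\<Sum>k\<in>{..<r} - {i} - {j}. dg v (B k))"
    by (rule sum.remove) (use ij in auto)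
   also have "(\<Sum>k\<in>{..<r} - {i} - {j}. dg v (B k)) <= (\<Sum>k\<in>{..<r} - {i} - {j}. M)" by (rule sum_mono) (use dBM in auto)
   also have "... = (r - 2) * M" using ij by (simp add: numeral_2_eq_2)
   finally have "real (dg v U) <= real (dg v (B i)) + (real (dg v (B j)) + real ((r - 2) * M))" by linarith
   moreover have "real ((r - 2) * M) = (real r - 2) * M" using ij by (auto simp: of_nat_diff)
   moreover have "(real r - 1) * M - t / 2 * M <= real (dg v U)" using v by (auto simp: V'_def Gd_def Bad_def)
   moreover have "real (dg v (B i)) < h * M" using v by (simp add: V'_def)
   moreover have "h * M <= t / 32 * M" using ht by (intro mult_right_mono) auto
   moreover have "real (dg v (B j)) + real (ms v (B j)) = M" using dg_ms[OF fB(1)[OF ij(2)], of v] B(2)[OF ij(2)] by (simp flip: of_nat_add)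
   moreover have "0 <= t * M" using t0 by simp
   ultimately show ?thesis by (simp add: algebra_simps)
  qed
  have disjV': "V' i Int V' j = {}" if ij: "i < r" "j < r" "i ~= j" for i j
  proof (rule ccontr)
   assume "~ ?thesis"
   then obtain v where v: "v \<in> V' i" "v \<in> V' j" by blast
   have "real (dg v (B j)) + real (ms v (B j)) = M" using dg_ms[OF fB(1)[OF ij(2)], of v] B(2)[OF ij(2)] by (simp flip: of_nat_add)
   moreover have "real (dg v (B j)) < h * M" using v by (simp add: V'_def)
   moreover have "h * M <= 1/4 * M" using ht tN(3) by (intro mult_right_mono) auto
   moreover have "t * M <= 1/4 * M" using tN(3) by (intro mult_right_mono) auto
   ultimately show False using hi[OF v(1) ij] M0 by simp
  qed
  have covV': "Gd \<subseteq> (\<Union>i<r. V' i)" using low by (fastforce simp: V'_def Gd_def)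
  \<comment> \<open>The vertices of \<open>B i\<close> have degree about
    \<open>(1 - 1 / r) * n\<close> but on average hardly any neighbours in
    \<open>V' i\<close>.\<close>
  have upV': "real (card (V' i)) <= n / r + t * n" if i: "i < r" for i
  proof -
   have "M * ((1 - 1 / r) * n - 1) = (\<Sum>u\<in>B i. (1 - 1 / r) * n - 1)" using B(2)[OF i] by simp
   also have "... <= (\<Sum>u\<in>B i. real (dg u V))" by (rule sum_mono) (use V(3) fB(2)[OF i] in "auto simp: n_def")
   also have "... = real (pe V (B i))" using pe_sym[OF fB(1)[OF i] V(1)] by (simp add: pe_def flip: of_nat_sum)
   also have "pe V (B i) = pe (V' i) (B i) + pe (V - V' i) (B i)"
   proof -
    have "V = V' i Un (V - V' i)" using V'V by auto
    hence "pe V (B i) = pe (V' i Un (V - V' i)) (B i)" by simp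
    also have "... = pe (V' i) (B i) + pe (V - V' i) (B i)" by (rule pe_Un1) (use fV' V(1) in auto)
    finally show ?thesis .
   qed
   also have "real ... <= real (card (V' i)) * (h * M) + (n - real (card (V' i))) * M"
   proof -
    have "real (pe (V' i) (B i)) <= (\<Sum>v\<in>V' i. h * M)" unfolding pe_def of_nat_sum by (rule sum_mono) (auto simp: V'_def)
    moreover have "pe (V - V' i) (B i) <= card (V - V' i) * M" using pe_le[of "V - V' i" "B i"] V(1) fB(1)[OF i] B(2)[OF i] by simp
    hence "real (pe (V - V' i) (B i)) <= real (card (V - V' i)) * M" by (simp only: of_nat_le_iff flip: of_nat_mult)
    moreover have "real (card (V - V' i)) = n - card (V' i)" using V'V V(1) fV' by (simp add: card_Diff_subset card_mono of_nat_diff n_def)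
    ultimately show ?thesis by simp
   qed
   finally have "M * ((1 - 1 / r) * n - 1) <= M * (card (V' i) * h + (n - card (V' i)))" by (simp add: algebra_simps)
   hence "(1 - 1 / r) * n - 1 <= card (V' i) * h + (n - card (V' i))" using M0 by simp
   hence "card (V' i) * (1 - h) <= n / r + 1" by (simp add: algebra_simps)
   moreover have "card (V' i) * h <= n * (t / 32)"
   proof (rule mult_mono)
    show "real (card (V' i)) <= n" unfolding n_def using card_mono[OF V(1) V'V] by simp
   qed (use ht h0 n1 in auto)
   ultimately show ?thesis using cc(4) t0 n1 by (simp add: algebra_simps)
  qed
  \<comment> \<open>Vertices with many neighbours in their own class; they are moved to the
    remainder.\<close>
  define Y where "Y = (%i. {v\<in>V' i. z * n <= real (dg v (V' i))})"
  have cY: "card (Y i) <= K2" if i: "i < r" for i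
  proof (rule ccontr)
   assume "~ ?thesis"
   then obtain Y0 where Y0: "Y0 \<subseteq> Y i" "card Y0 = K2" "finite Y0" using obtain_subset_with_card_n[of K2 "Y i"] by (auto simp: not_le)
   have Y0ne: "Y0 ~= {}"
   proof
    assume "Y0 = {}"
    hence "2 * real N1 / z <= 0" using Y0(2) K2 by simp
    thus False using N1 z0 by (simp add: field_simps)
   qed
   obtain Y' X' where YX: "Y' \<subseteq> Y0" "X' \<subseteq> V' i" "cmpl X' Y'" "z / 2 * card Y0 <= real (card Y')" "z / 2 * n <= 2 ^ card Y0 * real (card X')"
   proof -
    have "real (card (V' i)) <= n" using card_mono[OF V(1) V'V, of i] by (simp add: n_def)
    moreover have "z * n <= real (dg y (V' i))" if "y \<in> Y0" for y using that Y0(1) by (auto simp: Y_def)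
    ultimately show ?thesis using trace[OF fV' Y0(3) Y0ne z0 _ _ n1, of i] that by blast
   qed
   have "real N1 <= z / 2 * K2" using K2 z0 by (simp add: field_simps)
   hence cY': "N1 <= card Y'" using YX(4) Y0(2) by simp
   have cX': "N1 <= card X'"
   proof -
    have "t / 2 * n <= 1 * n" using tN(3) n1 by (intro mult_right_mono) auto
    hence "2 ^ K2 * real N1 * 2 / z <= n" using cc(3) by simp
    hence "2 ^ K2 * real N1 <= z / 2 * n" using z0 by (simp add: field_simps)
    moreover have "z / 2 * n <= 2 ^ K2 * real (card X')" using YX(5) Y0(2) by simp
    ultimately have "2 ^ K2 * real N1 <= 2 ^ K2 * real (card X')" by linarith
    thus ?thesis by simp
   qed
   obtain A1 where A1: "A1 \<subseteq> X'" "card A1 = N1" "finite A1" using obtain_subset_with_card_n[OF cX'] by blast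
   obtain A2 where A2: "A2 \<subseteq> Y'" "card A2 = N1" "finite A2" using obtain_subset_with_card_n[OF cY'] by blast
   have AA: "cmpl A1 A2" using cmpl_mono[OF YX(3) A1(1) A2(1)] .
   define A where "A = A1 Un A2"
   have AV: "A \<subseteq> V' i" using A1(1) A2(1) YX(1,2) Y0(1) by (auto simp: A_def Y_def)
   have fA: "finite A" "card A = 2 * N1" using A1 A2 cmpl_disj[OF AA] by (auto simp: A_def card_Un_disjoint)
   have np: "~ pfree l A" unfolding A_def
    by (rule bip_not_pfree[OF A1(3) A2(3) AA]) (use A1(2) A2(2) l in "auto simp: N1_def")
   have cS: "N1 <= card (cn A (B j))" if j: "j < r" "j ~= i" for j
   proof -
    have "real (card (B j)) <= card (cn A (B j)) + (\<Sum>a\<in>A. real (ms a (B j)))"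
     using card_cn[OF fB(1)[OF j(1)] fA(1)] by (simp flip: of_nat_sum of_nat_add)
    also have "(\<Sum>a\<in>A. real (ms a (B j))) <= (\<Sum>a\<in>A. t * M)" by (rule sum_mono) (use hi[OF _ i j(1)] AV j in auto)
    also have "... = (2 * real N1 * t) * M" using fA by simp
    also have "... <= 1/2 * M" using tN(1) by (intro mult_right_mono) auto
    finally show ?thesis using M2 B(2)[OF j(1)] by simp
   qed
   have "forb1 r l m V" unfolding forb1_def
   proof (rule exI[of _ "(%j. cn A (B j))(i := A)"], rule exI[of _ i], intro conjI allI impI)
    have cB: "cmpl (cn A (B j)) (cn A (B k))" if "j < r" "k < r" "j ~= k" for j k
     by (rule cmpl_mono[of "B j" "B k"]) (use B(1) that cn_subset in "auto simp: blow_def")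
    show "blow r ((%j. cn A (B j))(i := A)) V" unfolding blow_def
    proof (intro conjI allI impI)
     fix j assume j: "j < r"
     show "((%j. cn A (B j))(i := A)) j \<subseteq> V" using fB[OF j] cn_subset[of A "B j"] AV V'V[of i] by auto
     show "finite (((%j. cn A (B j))(i := A)) j)" using fB[OF j] cn_subset[of A "B j"] fA by (auto dest: finite_subset)
     fix k assume k: "k < r" "j ~= k"
     show "cmpl (((%j. cn A (B j))(i := A)) j) (((%j. cn A (B j))(i := A)) k)"
      using cB[OF j k] cmpl_cn cmpl_sym[OF cmpl_cn] k by auto
    qed
    show "m <= card (((%j. cn A (B j))(i := A)) j)" if "j < r" "j ~= i" for j using cS[OF that] that by (simp add: N1_def)
   qed (use i fA np in "auto simp: N1_def")
   thus False using V(4) by simp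
  qed
  define P where "P = (%i. V' i - Y i)"
  have PV: "P i \<subseteq> V" for i using V'V by (auto simp: P_def)
  have fP: "finite (P i)" for i using PV V(1) finite_subset by blast
  have dP: "P i Int P j = {}" if "i < r" "j < r" "i ~= j" for i j using disjV'[OF that] by (auto simp: P_def)
  have rest: "real (card (V - (\<Union>i<r. P i))) <= 2 * t * n"
  proof -
   have "V - (\<Union>i<r. P i) \<subseteq> U Un W1 Un Bad Un (\<Union>i<r. Y i)"
    using covV' by (auto simp: P_def Gd_def)
   hence "card (V - (\<Union>i<r. P i)) <= card (U Un W1 Un Bad Un (\<Union>i<r. Y i))"
    by (rule card_mono[rotated]) (use fU fin fV' in "auto simp: Y_def")
   also have "... <= card U + card W1 + card Bad + card (\<Union>i<r. Y i)"
    by (meson card_Un_le le_trans add_mono order_refl)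
   also have "card (\<Union>i<r. Y i) <= (\<Sum>i<r. card (Y i))" by (rule card_UN_le) simp
   also have "... <= (\<Sum>i<r. K2)" by (rule sum_mono) (use cY in auto)
   finally have "card (V - (\<Union>i<r. P i)) <= r * M + c1 + card Bad + r * K2" using cU cW1 by simp
   hence "real (card (V - (\<Union>i<r. P i))) <= real (r * M) + real c1 + real (card Bad) + real (r * K2)" by (simp only: of_nat_le_iff flip: of_nat_add)
   thus ?thesis using badle cc(1,2) by (simp add: algebra_simps)
  qed
  have upP: "real (card (P i)) <= n / r + t * n" if "i < r" for i
  proof -
   have "card (P i) <= card (V' i)" by (rule card_mono[OF fV']) (auto simp: P_def)
   thus ?thesis using upV'[OF that] by simp
  qed
  \<comment> \<open>No other class is too large and the remainder is small, so this class is not too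
    small.\<close>
  have loP: "n / r - (real r + 2) * t * n <= card (P i)" if i: "i < r" for i
  proof -
   have "V = (V - (\<Union>i<r. P i)) Un (\<Union>i<r. P i)" using PV by blast
   hence "card V = card ((V - (\<Union>i<r. P i)) Un (\<Union>i<r. P i))" by simp
   also have "... <= card (V - (\<Union>i<r. P i)) + card (\<Union>i<r. P i)" by (rule card_Un_le)
   also have "card (\<Union>i<r. P i) <= (\<Sum>j<r. card (P j))" by (rule card_UN_le) simp
   also have "... = card (P i) + (\<Sum>j\<in>{..<r} - {i}. card (P j))" by (rule sum.remove) (use i in auto)
   finally have "n <= real (card (V - (\<Union>i<r. P i))) + (card (P i) + (\<Sum>j\<in>{..<r} - {i}. real (card (P j))))"
    unfolding n_def by (simp flip: of_nat_sum of_nat_add)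
   also have "(\<Sum>j\<in>{..<r} - {i}. real (card (P j))) <= (\<Sum>j\<in>{..<r} - {i}. n / r + t * n)" by (rule sum_mono) (use upP in auto)
   also have "... = (real r - 1) * (n / r + t * n)" using i r by (simp add: of_nat_diff)
   also have "... = n - n / r + (real r - 1) * t * n" using r by (simp add: field_simps)
   finally have "n <= 2 * t * n + (card (P i) + (n - n / r + (real r - 1) * t * n))" using rest by linarith
   moreover have "0 <= t * n" using t0 n1 by simp
   ultimately show ?thesis by (simp add: algebra_simps)
  qed
  have te: "(real r + 2) * t * n <= e / 8 * n" using tN(2) n1 by (intro mult_right_mono) auto
  have own: "real (dg v (P i)) <= z * n" if v: "v \<in> P i" for v i
  proof -
   have "dg v (P i) <= dg v (V' i)" by (rule dg_mono[OF fV']) (auto simp: P_def)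
   moreover have "real (dg v (V' i)) < z * n" using v by (auto simp: P_def Y_def)
   ultimately show ?thesis by simp
  qed
  \<comment> \<open>An own degree of at most \<open>z * n\<close> and a total degree of about
    \<open>(1 - 1 / r) * n\<close> leave little room for missing neighbours in other
    classes.\<close>
  have mis: "real (ms v (P j)) <= e * n" if v: "v \<in> P i" and ij: "i < r" "j < r" "j ~= i" for v i j
  proof -
   have "(1 - 1 / r) * n - 1 <= real (dg v V)" using V(3) v PV by (auto simp: n_def)
   moreover have "dg v V = dg v (P i) + dg v (V - P i)"
   proof -
    have "V = P i Un (V - P i)" using PV by auto
    hence "dg v V = dg v (P i Un (V - P i))" by simp
    also have "... = dg v (P i) + dg v (V - P i)" by (rule dg_Un) (use fP V(1) in auto)
    finally show ?thesis .
   qed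
   moreover have "dg v (V - P i) + ms v (V - P i) = card (V - P i)" by (rule dg_ms) (use V(1) in simp)
   moreover have "real (card (V - P i)) = n - card (P i)" using PV V(1) fP by (simp add: card_Diff_subset card_mono of_nat_diff n_def)
   moreover have "ms v (P j) <= ms v (V - P i)" by (rule ms_mono) (use V(1) PV dP[OF ij(2,1,3)] in auto)
   ultimately have "real (ms v (P j)) <= n - card (P i) - ((1 - 1 / r) * n - 1 - z * n)" using own[OF v] by linarith
   also have "... <= (real r + 2) * t * n + 1 + z * n" using loP[OF ij(1)] by (simp add: algebra_simps)
   also have "1 <= e / 8 * n"
   proof -
    have "t <= (real r + 2) * t" using t0 by simp
    hence "t * n <= (real r + 2) * t * n" using n1 by (intro mult_right_mono) auto
    thus ?thesis using cc(4) te by simp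
   qed
   finally show ?thesis using te e n1 unfolding z_def by (simp add: algebra_simps)
  qed
  have e2: "z * n <= e * n" "2 * t * n <= e * n" "e / 8 * n <= e * n"
  proof -
   show "z * n <= e * n" unfolding z_def using e n1 by simp
   show 3: "e / 8 * n <= e * n" using e n1 by simp
   have "2 * t * n <= (real r + 2) * t * n" using t0 n1 by (intro mult_right_mono) auto
   thus "2 * t * n <= e * n" using te 3 by linarith
  qed
  show "\<exists>P. (\<forall>i<r. P i \<subseteq> V) & (\<forall>i<r. \<forall>j<r. i ~= j --> P i Int P j = {}) &
   (\<forall>i<r. \<forall>v\<in>P i. real (dg v (P i)) <= e * card V & (\<forall>j<r. j ~= i --> real (ms v (P j)) <= e * card V)) &
   (\<forall>i<r. real (card V) / r - e * card V <= card (P i)) & real (card (V - (\<Union>i<r. P i))) <= e * card V"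
  proof (rule exI[of _ P], intro conjI allI impI ballI)
   fix i assume i: "i < r"
   show "real (card V) / r - e * card V <= card (P i)" using loP[OF i] te e2(3) by (simp add: n_def)
   fix v assume v: "v \<in> P i"
   show "real (dg v (P i)) <= e * card V" using own[OF v] e2(1) by (simp add: n_def)
   show "real (ms v (P j)) <= e * card V" if "j < r" "j ~= i" for j using mis[OF v i that] by (simp add: n_def)
  qed (use PV dP rest e2(2) in "auto simp: n_def")
 qed
qed

text \<open>The degree condition satisfied by a smallest counterexample in \<open>gap_step\<close>;
  the slack \<open>1\<close> pays for the discrete derivative of the quadratic bound.\<close>

definition mindeg :: "nat => 'a set => bool" where
 "mindeg r V \<longleftrightarrow> (\<forall>v\<in>V. (1 - 1 / r) * card V - 1 <= real (dg v V))"

definition clpart :: "nat => real => 'a set => 'a set => (nat => 'a set) => bool" where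
 "clpart r z V W P \<longleftrightarrow> finite V & W \<subseteq> V & V = W Un (\<Union>i<r. P i) & (\<forall>i<r. P i Int W = {}) &
   (\<forall>i<r. \<forall>j<r. i ~= j --> P i Int P j = {}) &
   (\<forall>i<r. \<forall>v\<in>P i. real (dg v (P i)) <= z * card V & (\<forall>j<r. j ~= i --> real (ms v (P j)) <= z * card V)) &
   (\<forall>i<r. \<bar>real (card (P i)) - real (card V) / r\<bar> <= z * card V)"

text \<open>Reduces the remainder of \<open>cores\<close> from a fraction of all vertices to a
  bounded number. A remaining vertex with few neighbours in some class joins that class. The others
  have many neighbours in every class, and \<open>l\<close> of them with large common neighbourhoods
  would yield \<open>F1\<close>.\<close>

lemma class_partition:
 fixes r l m :: nat and z :: real
 assumes r: "0 < r" and l: "3 <= l" and z: "0 < z" "z <= 1"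
 shows "\<exists>K n0. \<forall>V. finite V --> n0 <= card V --> mindeg r V --> ~ forb1 r l m V -->
  (\<exists>W P. card W <= K & clpart r z V W P)"
proof -
 define N1 where "N1 = l + m"
 have N1: "3 <= N1" using l by (simp add: N1_def)
 \<comment> \<open>Tracing with density \<open>z / 2\<close> against \<open>r\<close> classes keeps
   the fraction \<open>(z / 4) ^ r\<close>, and \<open>l\<close> vertices have to survive.\<close>
 define K where "K = nat \<lceil>l * (4 / z) ^ r\<rceil>"
 have K: "real l <= (z / 2 / 2) ^ r * K"
 proof -
  have "l * (4 / z) ^ r <= K" unfolding K_def by linarith
  hence "(z / 4) ^ r * (l * (4 / z) ^ r) <= (z / 4) ^ r * K" using z by (intro mult_left_mono) auto
  moreover have "(z / 4) ^ r * (l * (4 / z) ^ r) = l" using z by (simp add: power_divide)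
  ultimately show ?thesis by simp
 qed
 \<comment> \<open>The fraction of all vertices that \<open>trace_iter\<close> guarantees for each
   of the common neighbourhoods.\<close>
 define c where "c = z / 4 / 2 ^ K"
 have c0: "0 < c" using z by (simp add: c_def)
 define e where "e = min (c / (2 * r * N1)) (z / (8 * r))"
 have e0: "0 < e" using c0 z r N1 by (simp add: e_def)
 have e1: "real r * N1 * e <= c / 2" "r * e <= z / 8" "e <= z / 8"
 proof -
  have "e <= c / (2 * r * N1)" by (simp add: e_def)
  thus "real r * N1 * e <= c / 2" using r N1 by (simp add: field_simps)
  have "e <= z / (8 * r)" by (simp add: e_def)
  thus a: "r * e <= z / 8" using r by (simp add: field_simps)
  have "1 * e <= r * e" using r e0 by (intro mult_right_mono) auto
  thus "e <= z / 8" using a by simp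
 qed
 have e2: "e <= 1" using e1(3) z by simp
 obtain n0 where n0: "!!V. finite V ==> n0 <= card V ==> mindeg r V ==> ~ forb1 r l m V ==>
  (\<exists>P. (\<forall>i<r. P i \<subseteq> V) & (\<forall>i<r. \<forall>j<r. i ~= j --> P i Int P j = {}) &
   (\<forall>i<r. \<forall>v\<in>P i. real (dg v (P i)) <= e * card V & (\<forall>j<r. j ~= i --> real (ms v (P j)) <= e * card V)) &
   (\<forall>i<r. real (card V) / r - e * card V <= card (P i)) & real (card (V - (\<Union>i<r. P i))) <= e * card V)"
  using cores[OF r l e0 e2, of m, folded mindeg_def]
  by (elim exE) (rule that, drule spec, drule mp, assumption, drule mp, assumption, drule mp, assumption, erule mp)
 show ?thesis
 proof (rule exI[of _ K], rule exI[of _ "max n0 (nat \<lceil>2 * N1 / c + 8 / z\<rceil>)"], intro allI impI)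
  fix V :: "'a set" assume V: "finite V" "max n0 (nat \<lceil>2 * N1 / c + 8 / z\<rceil>) <= card V" "mindeg r V" "~ forb1 r l m V"
  define n where "n = real (card V)"
  have "2 * N1 / c + 8 / z <= n" using V(2) unfolding n_def by linarith
  moreover have "0 <= 2 * N1 / c" "0 <= 8 / z" using c0 z by auto
  ultimately have "2 * N1 / c <= n" "8 / z <= n" by linarith+
  hence n1: "real N1 <= c / 2 * n" "1 <= z / 8 * n" using c0 z by (simp_all add: field_simps)
  have np: "0 < n" using zero_less_mult_pos[of "z / 8" n] n1(2) z by linarith
  obtain P0 where P0: "!!i. i < r ==> P0 i \<subseteq> V" "!!i j. i < r ==> j < r ==> i ~= j ==> P0 i Int P0 j = {}"
   "!!i v. i < r ==> v \<in> P0 i ==> real (dg v (P0 i)) <= e * n"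
   "!!i v j. i < r ==> v \<in> P0 i ==> j < r ==> j ~= i ==> real (ms v (P0 j)) <= e * n"
   "!!i. i < r ==> n / r - e * n <= card (P0 i)" "real (card (V - (\<Union>i<r. P0 i))) <= e * n"
  proof -
   have "n0 <= card V" using V(2) by simp
   from n0[OF V(1) this V(3,4)] obtain P where P: "\<forall>i<r. P i \<subseteq> V" "\<forall>i<r. \<forall>j<r. i ~= j --> P i Int P j = {}"
    "\<forall>i<r. \<forall>v\<in>P i. real (dg v (P i)) <= e * n & (\<forall>j<r. j ~= i --> real (ms v (P j)) <= e * n)"
    "\<forall>i<r. n / r - e * n <= card (P i)" "real (card (V - (\<Union>i<r. P i))) <= e * n" unfolding n_def by (elim exE conjE)
   show ?thesis by (rule that[of P]) (simp_all add: P)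
  qed
  have fP0: "finite (P0 i)" if "i < r" for i using P0(1)[OF that] V(1) finite_subset by blast
  define Z where "Z = V - (\<Union>i<r. P0 i)"
  define W where "W = {v\<in>Z. \<forall>i<r. z / 2 * n <= real (dg v (P0 i))}"
  have fZ: "finite Z" "Z \<subseteq> V" "finite W" using V(1) by (auto simp: Z_def W_def)
  have cW: "card W <= K"
  proof (rule ccontr)
   assume "~ ?thesis"
   then obtain Y where Y: "Y \<subseteq> W" "card Y = K" "finite Y" using obtain_subset_with_card_n[of K W] by (metis nat_le_linear)
   have "Y ~= {}" using Y(2) K l by auto
   moreover have "finite (P0 i) & real (card (P0 i)) <= n" if "i < r" for i
    using fP0[OF that] card_mono[OF V(1) P0(1)[OF that]] by (simp add: n_def)
   moreover have "z / 2 * n <= real (dg y (P0 i))" if "i < r" "y \<in> Y" for i y using that Y(1) by (auto simp: W_def)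
   ultimately obtain Y' X where YX: "Y' \<subseteq> Y" "(z / 2 / 2) ^ r * card Y <= real (card Y')"
    "!!i. i < r ==> X i \<subseteq> P0 i & cmpl (X i) Y' & z / 2 / 2 * n <= 2 ^ card Y * real (card (X i))"
    using trace_iter[OF Y(3), of "z / 2" n r P0] z np by auto
   have fY': "finite Y'" using YX(1) Y(3) finite_subset by blast
   have cY': "l <= card Y'" using YX(2) K Y(2) by simp
   have cX: "real (r * (0 + N1)) * (e * n) + N1 <= card (X i)" if i: "i < r" for i
   proof -
    have "z / 4 * n <= 2 ^ K * real (card (X i))" using YX(3)[OF i] Y(2) by simp
    hence "c * n <= card (X i)" unfolding c_def by (simp add: field_simps)
    moreover have "real r * N1 * e * n <= c / 2 * n" using e1(1) np by (intro mult_right_mono) auto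
    ultimately show ?thesis using n1(1) by (simp add: algebra_simps)
   qed
   have "\<exists>Zs. \<forall>i<r. Zs i \<subseteq> X i & card (Zs i) = N1 & (\<forall>j<r. i ~= j --> cmpl (Zs i) (Zs j)) & (\<forall>j<r. i ~= j --> cmpl (Zs i) {})"
   proof (rule greedy[where e="e * n" and P=P0 and S="%_. {}" and s=0])
    show "X i \<subseteq> P0 i & real (r * (0 + N1)) * (e * n) + N1 <= card (X i)" if "i < r" for i
     using cX[OF that] YX(3)[OF that] by blast
    show "0 <= e * n" using e0 np by simp
    show "real (ms v (P0 j)) <= e * n" if "i < r" "j < r" "i ~= j" "v \<in> P0 i" for i j v using P0(4)[OF that(1,4,2)] that by auto
   qed (use fP0 in auto)
   then obtain Zs where Zs: "!!i. i < r ==> Zs i \<subseteq> X i & card (Zs i) = N1" "!!i j. i < r ==> j < r ==> i ~= j ==> cmpl (Zs i) (Zs j)" by blast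
   have ZY: "cmpl (Zs i) Y'" if "i < r" for i using YX(3)[OF that] Zs(1)[OF that] cmpl_mono by blast
   have fZs: "finite (Zs i)" if "i < r" for i using Zs(1)[OF that] N1 by (metis card.infinite not_numeral_le_zero)
   have ZV: "Zs i \<subseteq> V" if "i < r" for i using Zs(1)[OF that] YX(3)[OF that] P0(1)[OF that] by blast
   have YV: "Y' \<subseteq> V" using YX(1) Y(1) fZ by (auto simp: W_def)
   have np: "~ pfree l (Y' Un Zs 0)"
    by (rule bip_not_pfree[OF fY' fZs[OF r] cmpl_sym[OF ZY[OF r]]]) (use cY' Zs(1)[OF r] l in "auto simp: N1_def")
   have "forb1 r l m V" unfolding forb1_def
   proof (rule exI[of _ "Zs(0 := Y' Un Zs 0)"], rule exI[of _ 0], intro conjI allI impI)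
    have un: "cmpl (X Un Y) T'" if "cmpl X T'" "cmpl Y T'" for X Y T' using that by (auto simp: cmpl_def)
    have un': "cmpl T' (X Un Y)" if "cmpl T' X" "cmpl T' Y" for X Y T' using that by (auto simp: cmpl_def)
    show "blow r (Zs(0 := Y' Un Zs 0)) V" unfolding blow_def
    proof (intro conjI allI impI)
     fix i assume i: "i < r"
     show "(Zs(0 := Y' Un Zs 0)) i \<subseteq> V" using ZV[OF i] ZV[OF r] YV by auto
     show "finite ((Zs(0 := Y' Un Zs 0)) i)" using fZs[OF i] fZs[OF r] fY' by auto
     fix k assume k: "k < r" "i ~= k"
     show "cmpl ((Zs(0 := Y' Un Zs 0)) i) ((Zs(0 := Y' Un Zs 0)) k)"
      using Zs(2)[OF i k] Zs(2)[OF r k(1)] Zs(2)[OF i r] ZY[OF i] cmpl_sym[OF ZY[OF k(1)]] k un un' i by auto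
    qed
    show "m <= card ((Zs(0 := Y' Un Zs 0)) i)" if "i < r" "i ~= 0" for i using Zs(1)[OF that(1)] that by (simp add: N1_def)
    have "card (Zs 0) <= card (Y' Un Zs 0)" by (rule card_mono) (use fZs[OF r] fY' in auto)
    thus "l + m <= card ((Zs(0 := Y' Un Zs 0)) 0)" using Zs(1)[OF r] by (simp add: N1_def)
    show "~ pfree l ((Zs(0 := Y' Un Zs 0)) 0)" using np by simp
   qed (rule r)
   thus False using V(4) by simp
  qed
  define ii where "ii = (%v. SOME i. i < r & real (dg v (P0 i)) < z / 2 * n)"
  have ii: "ii v < r & real (dg v (P0 (ii v))) < z / 2 * n" if "v \<in> Z - W" for v
   unfolding ii_def by (rule someI_ex) (use that in "auto simp: W_def not_le")
  define P where "P = (%i. P0 i Un {v\<in>Z - W. ii v = i})"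
  have PV: "P i \<subseteq> V" if "i < r" for i using P0(1)[OF that] fZ by (auto simp: P_def)
  have fP: "finite (P i)" if "i < r" for i using PV[OF that] V(1) finite_subset by blast
  have dP: "P i Int P j = {}" if "i < r" "j < r" "i ~= j" for i j
   using P0(2)[OF that] that by (auto simp: P_def Z_def)
  have PW: "P i Int W = {}" if "i < r" for i using that by (auto simp: P_def W_def Z_def)
  have cov: "V = W Un (\<Union>i<r. P i)"
  proof
   show "V \<subseteq> W Un (\<Union>i<r. P i)"
   proof
    fix v assume v: "v \<in> V"
    show "v \<in> W Un (\<Union>i<r. P i)"
    proof (cases "v \<in> Z - W")
     case True thus ?thesis using ii[OF True] by (auto simp: P_def)
    next
     case False thus ?thesis using v by (auto simp: P_def Z_def)
    qed
   qed
  qed (use PV fZ in "auto simp: W_def")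
  \<comment> \<open>At most \<open>z / 2\<close> comes from the class before its extension and
    \<open>z / 8\<close> from the vertices of \<open>Z\<close>.\<close>
  have own: "real (dg v (P i)) <= 5 / 8 * z * n" if v: "v \<in> P i" and i: "i < r" for v i
  proof -
   have a: "real (dg v (P0 i)) <= z / 2 * n"
   proof (cases "v \<in> P0 i")
    case True
    have "e * n <= z / 8 * n" using e1(3) np by (intro mult_right_mono) auto
    moreover have "0 <= z * n" using z np by simp
    ultimately show ?thesis using P0(3)[OF i True] by simp
   next
    case False
    hence "v \<in> Z - W" "ii v = i" using v by (auto simp: P_def)
    thus ?thesis using ii[of v] by auto
   qed
   have "dg v (P i) <= dg v (P0 i Un Z)" by (rule dg_mono) (use fP0[OF i] fZ in "auto simp: P_def")
   also have "... = dg v (P0 i) + dg v Z" by (rule dg_Un) (use fP0[OF i] fZ i in "auto simp: Z_def")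
   also have "dg v Z <= card Z" by (rule dg_le_card[OF fZ(1)])
   finally have "real (dg v (P i)) <= z / 2 * n + real (card Z)" using a by simp
   also have "real (card Z) <= e * n" using P0(6) by (simp add: Z_def)
   also have "e * n <= z / 8 * n" using e1(3) np by (intro mult_right_mono) auto
   finally show ?thesis by (simp add: algebra_simps)
  qed
  have lo: "n / r - e * n <= card (P i)" if i: "i < r" for i
  proof -
   have "card (P0 i) <= card (P i)" by (rule card_mono[OF fP[OF i]]) (auto simp: P_def)
   thus ?thesis using P0(5)[OF i] by simp
  qed
  have up: "card (P i) <= n / r + z / 8 * n" if i: "i < r" for i
  proof -
   have "card (P i) + (\<Sum>j\<in>{..<r} - {i}. card (P j)) = (\<Sum>j<r. card (P j))" by (rule sum.remove[symmetric]) (use i in auto)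
   also have "... = card (\<Union>j<r. P j)" by (rule card_UN_disjoint[symmetric]) (use fP dP in auto)
   also have "... <= card V" by (rule card_mono[OF V(1)]) (use PV in auto)
   finally have "real (card (P i)) + (\<Sum>j\<in>{..<r} - {i}. real (card (P j))) <= n" unfolding n_def by (simp flip: of_nat_sum of_nat_add)
   moreover have "(\<Sum>j\<in>{..<r} - {i}. n / r - e * n) <= (\<Sum>j\<in>{..<r} - {i}. real (card (P j)))" by (rule sum_mono) (use lo in auto)
   moreover have "(\<Sum>j\<in>{..<r} - {i}. n / r - e * n) = (real r - 1) * (n / r - e * n)" using i r by (simp add: of_nat_diff)
   moreover have "(real r - 1) * (n / r - e * n) = n - n / r - (r * e - e) * n" using r by (simp add: field_simps)
   moreover have "(r * e - e) * n <= z / 8 * n" using e1(2) e0 np by (intro mult_right_mono) auto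
   ultimately show ?thesis by linarith
  qed
  have mis: "real (ms v (P j)) <= z * n" if v: "v \<in> P i" and ij: "i < r" "j < r" "j ~= i" for v i j
  proof -
   have "(1 - 1 / r) * n - 1 <= real (dg v V)" using V(3) v PV[OF ij(1)] by (auto simp: n_def mindeg_def)
   moreover have "dg v V = dg v (P i) + dg v (V - P i)"
   proof -
    have "V = P i Un (V - P i)" using PV[OF ij(1)] by auto
    hence "dg v V = dg v (P i Un (V - P i))" by simp
    also have "... = dg v (P i) + dg v (V - P i)" by (rule dg_Un) (use fP[OF ij(1)] V(1) in auto)
    finally show ?thesis .
   qed
   moreover have "dg v (V - P i) + ms v (V - P i) = card (V - P i)" by (rule dg_ms) (use V(1) in simp)
   moreover have "real (card (V - P i)) = n - card (P i)" using PV[OF ij(1)] V(1) fP[OF ij(1)] by (simp add: card_Diff_subset card_mono of_nat_diff n_def)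
   moreover have "ms v (P j) <= ms v (V - P i)" by (rule ms_mono) (use V(1) PV[OF ij(2)] dP[OF ij(2,1,3)] in auto)
   ultimately have "real (ms v (P j)) <= n - card (P i) - ((1 - 1 / r) * n - 1 - 5 / 8 * z * n)" using own[OF v ij(1)] by linarith
   also have "... <= e * n + 1 + 5 / 8 * z * n" using lo[OF ij(1)] by (simp add: algebra_simps)
   also have "e * n <= z / 8 * n" using e1(3) np by (intro mult_right_mono) auto
   finally have "real (ms v (P j)) <= z / 8 * n + z / 8 * n + 5 / 8 * z * n" using n1(2) by linarith
   moreover have "0 <= z * n" using z np by simp
   ultimately show ?thesis by (simp add: algebra_simps)
  qed
  have zn: "0 <= z * n" using z np by simp
  have en: "e * n <= z / 8 * n" using e1(3) np by (intro mult_right_mono) auto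
  have "clpart r z V W P" unfolding clpart_def
  proof (intro conjI allI impI ballI)
   fix i assume i: "i < r"
   show "\<bar>real (card (P i)) - real (card V) / r\<bar> <= z * card V" using lo[OF i] up[OF i] en zn by (simp add: n_def abs_le_iff)
   fix v assume v: "v \<in> P i"
   show "real (dg v (P i)) <= z * card V" using own[OF v i] zn by (simp add: n_def)
   show "real (ms v (P j)) <= z * card V" if "j < r" "j ~= i" for j using mis[OF v i that] by (simp add: n_def)
  qed (use V(1) cov dP PW fZ in "auto simp: W_def")
  thus "\<exists>W P. card W <= K & clpart r z V W P" using cW by blast
 qed
qed

section \<open>Classes without large matchings\<close>

definition hasmat :: "nat => 'a set => bool" where
 "hasmat k S \<longleftrightarrow> (\<exists>f g. (\<forall>i<k. f i \<in> S & g i \<in> S & E (f i) (g i)) & inj_on f {..<k::nat} & inj_on g {..<k} &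
   f ` {..<k} Int g ` {..<k} = {})"
definition forb2 :: "nat => nat => 'a set => bool" where
 "forb2 r m V \<longleftrightarrow> (\<exists>S i0 i1. i0 < r & i1 < r & i0 ~= i1 & blow r S V & (\<forall>i<r. m <= card (S i)) &
   hasmat m (S i0) & hasmat m (S i1))"

lemma hasmat_mono: assumes "hasmat k S" "S \<subseteq> T" shows "hasmat k T"
proof -
 obtain f g where f: "\<forall>i<k. f i \<in> S & g i \<in> S & E (f i) (g i)" "inj_on f {..<k} & inj_on g {..<k} & f ` {..<k} Int g ` {..<k} = {}"
  using assms(1) unfolding hasmat_def by (elim exE conjE) blast
 show ?thesis unfolding hasmat_def
  by (rule exI[of _ f], rule exI[of _ g]) (use f assms(2) in auto)
qed

lemma hasmat_sub:
 assumes "!!i. i < k ==> f i \<in> S & g i \<in> S & E (f i) (g i)" "inj_on f {..<k}" "inj_on g {..<k}"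
  "f ` {..<k} Int g ` {..<k} = {}" "A \<subseteq> {..<k::nat}" "card A = m"
 shows "hasmat m (f ` A Un g ` A)"
proof -
 have fA: "finite A" using assms(5) finite_subset by blast
 obtain h where h: "bij_betw h {..<m} A" using ex_bij_betw_nat_finite[OF fA] assms(6) by (auto simp: atLeast0LessThan)
 have hk: "h i \<in> A" "h i < k" if "i < m" for i using h that assms(5) by (auto simp: bij_betw_def)
 have "inj_on (f o h) {..<m}" "inj_on (g o h) {..<m}"
  using h assms(2,3,5) by (auto simp: bij_betw_def intro!: comp_inj_on elim: inj_on_subset)
 moreover have "(f o h) ` {..<m} Int (g o h) ` {..<m} = {}" using assms(4) hk by fastforce
 moreover have "\<forall>i<m. (f o h) i \<in> f ` A Un g ` A & (g o h) i \<in> f ` A Un g ` A & E ((f o h) i) ((g o h) i)"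
  using hk assms(1) by auto
 ultimately show ?thesis unfolding hasmat_def by blast
qed

text \<open>The ends of a maximal matching meet every edge.\<close>

lemma no_match_cover:
 assumes "finite S" "~ hasmat k S"
 shows "\<exists>C. C \<subseteq> S & card C <= 2 * k & sep (S - C) (S - C)"
 using assms(2)
proof (induction k)
 case 0
 have "hasmat 0 S" by (auto simp: hasmat_def)
 thus ?case using 0 by simp
next
 case (Suc k)
 show ?case
 proof (cases "hasmat k S")
  case False
  then obtain C where "C \<subseteq> S & card C <= 2 * k & sep (S - C) (S - C)" using Suc.IH by blast
  thus ?thesis by (intro exI[of _ C]) auto
 next
  case True
  then obtain f g where fg: "!!i. i < k ==> f i \<in> S & g i \<in> S & E (f i) (g i)" "inj_on f {..<k}" "inj_on g {..<k}"
   "f ` {..<k} Int g ` {..<k} = {}" unfolding hasmat_def by blast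
  define C where "C = f ` {..<k} Un g ` {..<k}"
  have "card C <= card (f ` {..<k}) + card (g ` {..<k})" unfolding C_def by (rule card_Un_le)
  also have "... <= k + k" by (intro add_mono) (metis card_image_le card_lessThan finite_lessThan)+
  finally have "card C <= 2 * Suc k" by simp
  moreover have "C \<subseteq> S" using fg(1) by (auto simp: C_def)
  moreover have "sep (S - C) (S - C)" unfolding sep_def
  proof (intro ballI notI)
   fix x y assume xy: "x \<in> S - C" "y \<in> S - C" "E x y"
   hence ne: "x ~= y" using E_irrefl by auto
   have "hasmat (Suc k) S" unfolding hasmat_def
   proof (rule exI[of _ "f(k := x)"], rule exI[of _ "g(k := y)"], intro conjI allI impI)
    fix i assume "i < Suc k"
    thus "(f(k := x)) i \<in> S" "(g(k := y)) i \<in> S" "E ((f(k := x)) i) ((g(k := y)) i)"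
     using fg(1)[of i] xy by (auto simp: less_Suc_eq)
   next
    have e: "{..<Suc k} = insert k {..<k}" by auto
    have im: "(f(k := x)) ` {..<k} = f ` {..<k}" "(g(k := y)) ` {..<k} = g ` {..<k}" by auto
    show "inj_on (f(k := x)) {..<Suc k}" unfolding e
     using fg(2) xy(1) by (auto simp: im C_def inj_on_def)
    show "inj_on (g(k := y)) {..<Suc k}" unfolding e
     using fg(3) xy(2) by (auto simp: im C_def inj_on_def)
    show "(f(k := x)) ` {..<Suc k} Int (g(k := y)) ` {..<Suc k} = {}" unfolding e image_insert im
     using fg(4) xy ne by (auto simp: C_def)
   qed
   thus False using Suc.prems by simp
  qed
  ultimately show ?thesis by blast
 qed
qed

text \<open>If every vertex of \<open>C\<close> lay inside more than \<open>2 ^ l + l\<close> different neighbourhoods, a path could be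
 extended greedily to \<open>l\<close> vertices.\<close>

lemma few_nbhds:
 assumes "finite C" "finite I" "C Int I = {}" "pfree l (C Un I)"
 shows "card ((%u. nb u C) ` I - {{}}) <= (2 ^ l + l) * card C"
 using assms
proof (induction "card C" arbitrary: C I)
 case 0
 hence "C = {}" by simp
 hence e: "(%u. nb u C) ` I - {{}} = {}" by (auto simp: nb_def)
 show ?case unfolding e by simp
next
 case (Suc k)
 let ?\<N> = "(%u. nb u C) ` I - {{}}"
 let ?K = "2 ^ l + l"
 show ?case
 proof (cases "\<exists>c\<in>C. card {X\<in>?\<N>. c \<in> X} <= ?K")
  case True
  then obtain c where c: "c \<in> C" "card {X\<in>?\<N>. c \<in> X} <= ?K" by blast
  \<comment> \<open>A vertex \<open>c\<close> lying in few neighbourhoods is removed together with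
    all vertices of \<open>I\<close> adjacent to it. Neighbourhoods that avoid \<open>c\<close>
    reappear unchanged on \<open>?C\<close>, and there are at most \<open>?K\<close> others.\<close>
  let ?C = "C - {c}" and ?I = "{u\<in>I. ~ E u c}"
  have k: "k = card ?C" using Suc.hyps(2) c Suc.prems(1) by simp
  have "card ((%u. nb u ?C) ` ?I - {{}}) <= ?K * card ?C"
  proof (rule Suc.hyps(1)[OF k])
   show "pfree l (?C Un ?I)" by (rule pfree_mono[OF Suc.prems(4)]) auto
  qed (use Suc.prems in auto)
  moreover have "{X\<in>?\<N>. c \<notin> X} \<subseteq> (%u. nb u ?C) ` ?I - {{}}"
  proof
   fix X assume X: "X \<in> {X\<in>?\<N>. c \<notin> X}"
   then obtain u where u: "u \<in> I" "X = nb u C" by blast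
   hence "~ E u c" using X c by auto
   hence "X = nb u ?C" using u by (auto simp: nb_def)
   thus "X \<in> (%u. nb u ?C) ` ?I - {{}}" using u X \<open>~ E u c\<close> by auto
  qed
  hence "card {X\<in>?\<N>. c \<notin> X} <= card ((%u. nb u ?C) ` ?I - {{}})"
   by (rule card_mono[rotated]) (use Suc.prems in auto)
  moreover have "card ?\<N> = card {X\<in>?\<N>. c \<in> X} + card {X\<in>?\<N>. c \<notin> X}"
   by (subst card_Un_disjoint[symmetric]) (use Suc.prems in "auto intro!: arg_cong[where f=card]")
  moreover have cC: "card C = Suc (card ?C)" using Suc.hyps(2) k by simp
  have "?K * card C = ?K + ?K * card ?C" unfolding cC by (rule mult_Suc_right)
  moreover note this
  ultimately show ?thesis using c(2) by linarith
 next
  case False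
  hence many: "!!c. c \<in> C ==> ?K < card {X\<in>?\<N>. c \<in> X}" by (meson not_le)
  have "C ~= {}" using Suc.hyps(2) by auto
  have "\<exists>xs. ispath (C Un I) xs & length xs = 2 * j + 1 & last xs \<in> C & card (set xs Int C) <= j + 1 & card (set xs Int I) <= j"
   if "j <= l" for j using that
  proof (induction j)
   case 0
   obtain c where "c \<in> C" using \<open>C ~= {}\<close> by blast
   moreover have "{c} Int I = {}" "{c} Int C = {c}" using \<open>c \<in> C\<close> Suc.prems(3) by auto
   ultimately show ?case by (intro exI[of _ "[c]"]) (auto simp: ispath_def)
  next
   case (Suc j)
   then obtain xs where xs: "ispath (C Un I) xs" "length xs = 2 * j + 1" "last xs \<in> C" "card (set xs Int C) <= j + 1" "card (set xs Int I) <= j"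
    by auto
   define c where "c = last xs"
   define A where "A = {X\<in>?\<N>. c \<in> X}"
   have fA: "finite A" using Suc.prems \<open>finite I\<close> by (simp add: A_def)
   \<comment> \<open>These are the neighbourhoods that cannot prolong the path: those inside the
     part of \<open>C\<close> already visited, and those of the vertices of \<open>I\<close> already
     visited.\<close>
   have "card (Pow (set xs Int C) Un (%u. nb u C) ` (set xs Int I)) <= card (Pow (set xs Int C)) + card ((%u. nb u C) ` (set xs Int I))"
    by (rule card_Un_le)
   also have "card (Pow (set xs Int C)) = 2 ^ card (set xs Int C)" by (rule card_Pow) simp
   also have "(2::nat) ^ card (set xs Int C) <= 2 ^ l" using xs(4) Suc.prems by (intro power_increasing) auto
   also have "card ((%u. nb u C) ` (set xs Int I)) <= card (set xs Int I)" by (rule card_image_le) simp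
   also have "... <= l" using xs(5) Suc.prems by simp
   finally have "card (Pow (set xs Int C) Un (%u. nb u C) ` (set xs Int I)) <= ?K" by simp
   note le = this
   have "~ A \<subseteq> Pow (set xs Int C) Un (%u. nb u C) ` (set xs Int I)"
   proof
    assume "A \<subseteq> Pow (set xs Int C) Un (%u. nb u C) ` (set xs Int I)"
    hence "card A <= card (Pow (set xs Int C) Un (%u. nb u C) ` (set xs Int I))" by (rule card_mono[rotated]) simp
    moreover have "?K < card A" unfolding A_def c_def by (rule many[OF xs(3)])
    ultimately show False using le by linarith
   qed
   then obtain X where X: "X \<in> A" "X \<notin> Pow (set xs Int C)" "X \<notin> (%u. nb u C) ` (set xs Int I)" by blast
   then obtain u where u: "u \<in> I" "X = nb u C" by (auto simp: A_def)
   have us: "u \<notin> set xs" using X(3) u by auto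
   have uc: "E c u" using X(1) u E_sym by (auto simp: A_def)
   have "~ X \<subseteq> set xs Int C" using X(2) by blast
   moreover have "X \<subseteq> C" using u nb_subset by blast
   ultimately obtain d where d: "d \<in> X" "d \<notin> set xs" by blast
   have dC: "d \<in> C" "E u d" using d u by auto
   have ud: "u ~= d" using u dC \<open>C Int I = {}\<close> by auto
   have "ispath (C Un I) (xs @ [u, d])" using xs(1) us d u dC uc ud by (auto simp: ispath_def successively_append_iff c_def)
   moreover have "card (set (xs @ [u, d]) Int C) <= Suc j + 1"
   proof -
    have "set (xs @ [u, d]) Int C = insert d (set xs Int C)" using u dC \<open>C Int I = {}\<close> by auto
    thus ?thesis using xs(4) by (simp add: card_insert_if)
   qed
   moreover have "card (set (xs @ [u, d]) Int I) <= Suc j"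
   proof -
    have "set (xs @ [u, d]) Int I = insert u (set xs Int I)" using u dC \<open>C Int I = {}\<close> by auto
    thus ?thesis using xs(5) by (simp add: card_insert_if)
   qed
   ultimately show ?case using xs(2) dC by (intro exI[of _ "xs @ [u, d]"]) auto
  qed
  from this[of l] obtain xs where "ispath (C Un I) xs" "length xs = 2 * l + 1" by blast
  thus ?thesis using pfree_short[OF Suc.prems(4)] by fastforce
 qed
qed

text \<open>As long as some value of \<open>\<phi>\<close> occurs \<open>N\<close> times, a bundle
  is taken out; at the end each of the at most \<open>k\<close> values is left on fewer than
  \<open>N\<close> vertices.\<close>

lemma bundles:
 assumes "finite I" "0 < N" "card (\<phi> ` I) <= k"
 shows "\<exists>\<L>. finite \<L> & (\<forall>L\<in>\<L>. L \<subseteq> I & card L = N & (\<forall>u\<in>L. \<forall>v\<in>L. \<phi> u = \<phi> v)) &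
   (\<forall>L\<in>\<L>. \<forall>L'\<in>\<L>. L ~= L' --> L Int L' = {}) & card (I - \<Union>\<L>) <= N * k"
 using assms
proof (induction "card I" arbitrary: I rule: less_induct)
 case less
 show ?case
 proof (cases "\<exists>y\<in>\<phi> ` I. N <= card {u\<in>I. \<phi> u = y}")
  case False
  have "card I = card (\<Union>y\<in>\<phi> ` I. {u\<in>I. \<phi> u = y})" by (rule arg_cong[where f=card]) auto
  also have "... <= (\<Sum>y\<in>\<phi> ` I. card {u\<in>I. \<phi> u = y})" by (rule card_UN_le) (use less in simp)
  also have "... <= (\<Sum>y\<in>\<phi> ` I. N)" by (rule sum_mono) (use False in force)
  also have "... = N * card (\<phi> ` I)" by simp
  also have "... <= N * k" using less.prems(3) by simp
  finally show ?thesis by (intro exI[of _ "{}"]) auto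
 next
  case True
  then obtain y where y: "N <= card {u\<in>I. \<phi> u = y}" by blast
  obtain L where L: "L \<subseteq> {u\<in>I. \<phi> u = y}" "card L = N" "finite L" using obtain_subset_with_card_n[OF y] by blast
  have lt: "card (I - L) < card I"
  proof (rule psubset_card_mono[OF less.prems(1)])
   show "I - L \<subset> I" using L less.prems(2) by (metis (no_types, lifting) Diff_disjoint Diff_subset Int_absorb2 card.empty inf_commute less_irrefl mem_Collect_eq psubsetI subset_iff)
  qed
  have "card (\<phi> ` (I - L)) <= card (\<phi> ` I)" by (rule card_mono) (use less.prems(1) in auto)
  hence "card (\<phi> ` (I - L)) <= k" using less.prems(3) by simp
  then obtain \<L> where \<L>: "finite \<L>" "!!L'. L' \<in> \<L> ==> L' \<subseteq> I - L & card L' = N & (\<forall>u\<in>L'. \<forall>v\<in>L'. \<phi> u = \<phi> v)"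
   "\<forall>L\<in>\<L>. \<forall>L'\<in>\<L>. L ~= L' --> L Int L' = {}" "card (I - L - \<Union>\<L>) <= N * k"
  proof -
   have "finite (I - L)" using less.prems(1) by simp
   from less.hyps[OF lt this less.prems(2) \<open>card (\<phi> ` (I - L)) <= k\<close>] show ?thesis
    by (elim exE conjE) (rule that, assumption, blast, assumption, assumption)
  qed
  have e: "I - \<Union>(insert L \<L>) = I - L - \<Union>\<L>" by auto
  show ?thesis
  proof (rule exI[of _ "insert L \<L>"], intro conjI)
   show "card (I - \<Union>(insert L \<L>)) <= N * k" unfolding e by (rule \<L>(4))
   show "\<forall>L'\<in>insert L \<L>. L' \<subseteq> I & card L' = N & (\<forall>u\<in>L'. \<forall>v\<in>L'. \<phi> u = \<phi> v)" using L \<L>(2) by blast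
   show "\<forall>L1\<in>insert L \<L>. \<forall>L'\<in>insert L \<L>. L1 ~= L' --> L1 Int L' = {}"
   proof -
    have "L Int L' = {}" if "L' \<in> \<L>" for L' using \<L>(2)[OF that] by blast
    thus ?thesis using \<L>(3) by (simp add: Int_commute)
   qed
  qed (use \<L>(1) in simp)
 qed
qed

section \<open>From local patterns in the classes to forbidden graphs\<close>

lemma cmpl_Un1: "cmpl (A Un B) T \<longleftrightarrow> cmpl A T & cmpl B T" by (auto simp: cmpl_def)
lemma cmpl_Un2: "cmpl T (A Un B) \<longleftrightarrow> cmpl T A & cmpl T B" by (auto simp: cmpl_def)

text \<open>Completes a small multipartite pattern inside the classes to a blow-up with
  \<open>N\<close> new vertices in each part. In this way a path or two matchings inside classes
  become forbidden graphs.\<close>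

lemma greedy_extend:
 assumes cp: "clpart r z V W P" and z0: "0 <= z" and
  sz: "real (r * (s + N)) * z + z <= 1 / (2 * r)" "real (N + s) <= real (card V) / (2 * r)" and
  S: "!!i. i < r ==> S i \<subseteq> P i & card (S i) <= s" "!!i j. i < r ==> j < r ==> i ~= j ==> cmpl (S i) (S j)"
 shows "\<exists>S'. blow r S' V & (\<forall>i<r. S i \<subseteq> S' i & S' i \<subseteq> P i & N <= card (S' i - S i))"
proof -
 have V: "finite V" "!!i. i < r ==> P i \<subseteq> V" using cp by (auto simp: clpart_def)
 have fP: "finite (P i)" if "i < r" for i using V(2)[OF that] V(1) finite_subset by blast
 define n where "n = real (card V)"
 have X: "real (r * (s + N)) * (z * n) + N <= card (P i - S i)" if i: "i < r" for i
 proof -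
  have "\<bar>real (card (P i)) - n / r\<bar> <= z * n" using cp i by (auto simp: clpart_def n_def)
  hence "n / r - z * n <= card (P i)" by linarith
  moreover have "(real (r * (s + N)) * z + z) * n <= 1 / (2 * r) * n" using sz(1) by (intro mult_right_mono) (auto simp: n_def)
  moreover have "n / r = 1 / (2 * r) * n + n / (2 * r)" by (simp add: field_simps)
  moreover have "card (P i) <= card (P i - S i) + card (S i)"
   using card_Un_le[of "P i - S i" "S i"] S(1)[OF i] by (simp add: Un_absorb2)
  hence "real (card (P i)) <= card (P i - S i) + s" using S(1)[OF i] by linarith
  ultimately show ?thesis using sz(2) by (simp add: algebra_simps n_def)
 qed
 have "\<exists>Z. \<forall>i<r. Z i \<subseteq> P i - S i & card (Z i) = N & (\<forall>j<r. i ~= j --> cmpl (Z i) (Z j)) & (\<forall>j<r. i ~= j --> cmpl (Z i) (S j))"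
 proof (rule greedy[where e="z * n" and P=P and s=s])
  show "P i - S i \<subseteq> P i & real (r * (s + N)) * (z * n) + N <= card (P i - S i)" if "i < r" for i
   using X[OF that] by blast
  show "0 <= z * n" using z0 by (simp add: n_def)
  show "real (ms v (P j)) <= z * n" if "i < r" "j < r" "i ~= j" "v \<in> P i" for i j v
   using cp that unfolding clpart_def n_def by blast
 qed (use fP S(1) in auto)
 then obtain Z where Z0: "\<forall>i<r. Z i \<subseteq> P i - S i & card (Z i) = N & (\<forall>j<r. i ~= j --> cmpl (Z i) (Z j)) & (\<forall>j<r. i ~= j --> cmpl (Z i) (S j))" ..
 have Z: "!!i. i < r ==> Z i \<subseteq> P i - S i & card (Z i) = N"
  "!!i j. i < r ==> j < r ==> i ~= j ==> cmpl (Z i) (Z j)" "!!i j. i < r ==> j < r ==> i ~= j ==> cmpl (Z i) (S j)"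
  using Z0 by simp_all
 show ?thesis
 proof (intro exI[of _ "%i. S i Un Z i"] conjI allI impI)
  show "blow r (%i. S i Un Z i) V" unfolding blow_def
  proof (intro conjI allI impI)
   fix i assume i: "i < r"
   show "S i Un Z i \<subseteq> V" using Z(1)[OF i] S(1)[OF i] V(2)[OF i] by blast
   thus "finite (S i Un Z i)" using V(1) finite_subset by blast
   fix j assume j: "j < r" "i ~= j"
   show "cmpl (S i Un Z i) (S j Un Z j)" unfolding cmpl_Un1 cmpl_Un2
    using Z(2)[OF i j] Z(3)[OF i j] cmpl_sym[OF Z(3)[OF j(1) i]] S(2)[OF i j] j by blast
  qed
  fix i assume i: "i < r"
  show "S i \<subseteq> S i Un Z i" "S i Un Z i \<subseteq> P i" using Z(1)[OF i] S(1)[OF i] by blast+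
  have "S i Un Z i - S i = Z i" using Z(1)[OF i] by blast
  thus "N <= card (S i Un Z i - S i)" using Z(1)[OF i] by simp
 qed
qed

lemma class_pfree:
 assumes cp: "clpart r z V W P" and z0: "0 <= z" and f1: "~ forb1 r l m V" and
  sz: "real (r * (l + m)) * z + z <= 1 / (2 * r)" "real (l + m) <= real (card V) / (2 * r)" and i: "i < r"
 shows "pfree l (P i)"
proof (rule ccontr)
 assume "~ pfree l (P i)"
 then obtain xs where xs: "ispath (P i) xs" "length xs = l" unfolding pfree_def by blast
 have cx: "card (set xs) = l" using xs by (simp add: ispath_def distinct_card)
 define S where "S = (%j. if j = i then set xs else {})"
 have "\<exists>S'. blow r S' V & (\<forall>j<r. S j \<subseteq> S' j & S' j \<subseteq> P j & m <= card (S' j - S j))"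
 proof (rule greedy_extend[OF cp z0, of l m])
  show "S j \<subseteq> P j & card (S j) <= l" if "j < r" for j using xs cx by (auto simp: S_def ispath_def)
  show "cmpl (S j) (S k)" if "j < r" "k < r" "j ~= k" for j k using that by (auto simp: S_def cmpl_def)
 qed (use sz in "auto simp: add.commute")
 then obtain S' where S': "blow r S' V" "!!j. j < r ==> S j \<subseteq> S' j & S' j \<subseteq> P j & m <= card (S' j - S j)" by blast
 have "forb1 r l m V" unfolding forb1_def
 proof (rule exI[of _ S'], rule exI[of _ i], intro conjI allI impI)
  have fS: "finite (S' j)" if "j < r" for j using S'(1) that by (simp add: blow_def)
  show "m <= card (S' j)" if "j < r" "j ~= i" for j using S'(2)[OF that(1)] that by (simp add: S_def)
  have "card (S' i) = card (S' i - S i) + card (S i)"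
   using S'(2)[OF i] fS[OF i] by (metis card_Diff_subset card_mono finite_subset le_add_diff_inverse2)
  thus "l + m <= card (S' i)" using S'(2)[OF i] cx by (simp add: S_def)
  have "ispath (S' i) xs" using xs S'(2)[OF i] by (auto simp: S_def ispath_def)
  thus "~ pfree l (S' i)" using xs(2) unfolding pfree_def by blast
 qed (use i S'(1) in auto)
 thus False using f1 by simp
qed

section \<open>Missing pairs between classes\<close>

lemma pe_UN1: assumes "!!i. i < r ==> finite (P i)" "!!i j. i < r ==> j < r ==> i ~= j ==> P i Int P j = {}"
 shows "pe (\<Union>i\<in>{..<r::nat}. P i) T = (\<Sum>i<r. pe (P i) T)"
 unfolding pe_def by (rule sum.UNION_disjoint) (use assms in auto)

lemma pe_UN2: assumes "!!i. i < r ==> finite (P i)" "!!i j. i < r ==> j < r ==> i ~= j ==> P i Int P j = {}"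
 shows "pe S (\<Union>i\<in>{..<r::nat}. P i) = (\<Sum>i<r. pe S (P i))"
proof -
 have "pe S (\<Union>i\<in>{..<r::nat}. P i) = (\<Sum>v\<in>S. \<Sum>i<r. dg v (P i))" unfolding pe_def using dg_UN[OF assms] by simp
 also have "... = (\<Sum>i<r. pe S (P i))" unfolding pe_def by (rule sum.swap)
 finally show ?thesis .
qed

definition mis :: "'a set => 'a set => nat" where "mis S T = (\<Sum>v\<in>S. ms v T)"

lemma pe_mis: "finite T ==> pe S T + mis S T = card S * card T"
 unfolding pe_def mis_def by (simp add: sum.distrib[symmetric] dg_ms)

text \<open>The classes carry at most \<open>l - 2\<close> inner pairs per vertex, and
  \<open>W\<close> accounts for at most \<open>2 * K\<close> per vertex. As the total reaches the
  quadratic Turan count, the missing pairs between classes and the squared deviations of the class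
  sizes together are at most linear.\<close>

lemma edge_count:
 assumes cp: "clpart r z V W P" and r: "0 < r" and l: "2 <= l" and W: "card W <= K"
  and pf: "!!i. i < r ==> pfree l (P i)" and e: "(1 - 1 / r) * (real (card V))\<^sup>2 <= real (pe V V)"
 shows "(\<Sum>i<r. \<Sum>j\<in>{..<r} - {i}. real (mis (P i) (P j))) + (\<Sum>i<r. (real (card (P i)) - real (card V - card W) / r)\<^sup>2)
   <= real (2 * K + l) * card V"
proof -
 have V: "finite V" "W \<subseteq> V" "V = W Un (\<Union>i<r. P i)" "!!i. i < r ==> P i Int W = {}"
  "!!i j. i < r ==> j < r ==> i ~= j ==> P i Int P j = {}" using cp unfolding clpart_def by blast+
 have fP: "finite (P i)" if "i < r" for i using V(1,3) that by (metis UN_upper finite_Un finite_subset lessThan_iff)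
 have fW: "finite W" using V(1,2) finite_subset by blast
 define n n' where "n = real (card V)" and "n' = real (card V - card W)"
 define U where "U = (\<Union>i<r. P i)"
 have fU: "finite U" using fP by (simp add: U_def)
 have VW: "V - W = U" using V(3,4) by (auto simp: U_def)
 have cU: "card U = card V - card W" unfolding VW[symmetric] by (rule card_Diff_subset[OF fW V(2)])
 have sumP: "(\<Sum>i<r. real (card (P i))) = n'"
 proof -
  have "card U = (\<Sum>i<r. card (P i))" unfolding U_def by (rule card_UN_disjoint) (use fP V(5) in auto)
  thus ?thesis using cU by (simp add: n'_def flip: of_nat_sum)
 qed
 have nn: "n' <= n" "0 <= n'" by (auto simp: n_def n'_def)
 have peU: "real (pe U U) = (\<Sum>i<r. \<Sum>j<r. real (pe (P i) (P j)))"
 proof -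
  have "pe U U = (\<Sum>i<r. pe (P i) U)" unfolding U_def by (rule pe_UN1) (use fP V(5) in auto)
  also have "... = (\<Sum>i<r. \<Sum>j<r. pe (P i) (P j))"
   unfolding U_def by (intro sum.cong refl pe_UN2) (use fP V(5) in auto)
  finally show ?thesis by simp
 qed
 have row: "(\<Sum>j<r. real (pe (P i) (P j))) <= real (l - 2) * card (P i) + (real (card (P i)) * n' - (real (card (P i)))\<^sup>2)
   - (\<Sum>j\<in>{..<r} - {i}. real (mis (P i) (P j)))" if i: "i < r" for i
 proof -
  have "(\<Sum>j<r. real (pe (P i) (P j))) = real (pe (P i) (P i)) + (\<Sum>j\<in>{..<r} - {i}. real (pe (P i) (P j)))"
   by (rule sum.remove) (use i in auto)
  also have "(\<Sum>j\<in>{..<r} - {i}. real (pe (P i) (P j))) = (\<Sum>j\<in>{..<r} - {i}. real (card (P i)) * card (P j) - mis (P i) (P j))"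
  proof (rule sum.cong[OF refl])
   fix j assume "j \<in> {..<r} - {i}"
   hence "pe (P i) (P j) + mis (P i) (P j) = card (P i) * card (P j)" by (intro pe_mis fP) auto
   hence "real (pe (P i) (P j)) + real (mis (P i) (P j)) = real (card (P i)) * card (P j)" by (simp flip: of_nat_add of_nat_mult)
   thus "real (pe (P i) (P j)) = real (card (P i)) * card (P j) - mis (P i) (P j)" by linarith
  qed
  also have "... = real (card (P i)) * (\<Sum>j\<in>{..<r} - {i}. real (card (P j))) - (\<Sum>j\<in>{..<r} - {i}. real (mis (P i) (P j)))"
   by (simp add: sum_subtractf sum_distrib_left)
  also have "(\<Sum>j\<in>{..<r} - {i}. real (card (P j))) = n' - card (P i)"
   using sum.remove[of "{..<r}" i "%j. real (card (P j))"] i sumP by simp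
  also have "pe (P i) (P i) <= (l - 2) * card (P i)" by (rule erdos_gallai[OF fP[OF i] pf[OF i] l])
  hence "real (pe (P i) (P i)) <= real (l - 2) * card (P i)" by (simp only: of_nat_le_iff flip: of_nat_mult)
  finally show ?thesis by (simp add: algebra_simps power2_eq_square)
 qed
 have "real (pe U U) <= (\<Sum>i<r. real (l - 2) * card (P i) + (real (card (P i)) * n' - (real (card (P i)))\<^sup>2)
   - (\<Sum>j\<in>{..<r} - {i}. real (mis (P i) (P j))))"
  unfolding peU by (rule sum_mono) (use row in simp)
 also have "... = real (l - 2) * n' + n' * n' - (\<Sum>i<r. (real (card (P i)))\<^sup>2) - (\<Sum>i<r. \<Sum>j\<in>{..<r} - {i}. real (mis (P i) (P j)))"
  using sumP by (simp add: sum.distrib sum_subtractf flip: sum_distrib_left sum_distrib_right)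
 finally have 1: "real (pe U U) <= real (l - 2) * n' + n' * n' - (\<Sum>i<r. (real (card (P i)))\<^sup>2) - (\<Sum>i<r. \<Sum>j\<in>{..<r} - {i}. real (mis (P i) (P j)))" .
 have sq: "(\<Sum>i<r. (real (card (P i)) - n' / r)\<^sup>2) = (\<Sum>i<r. (real (card (P i)))\<^sup>2) - n' * n' / r"
 proof -
  have "(\<Sum>i<r. (real (card (P i)) - n' / r)\<^sup>2) = (\<Sum>i<r. (real (card (P i)))\<^sup>2 + (n' / r)\<^sup>2 - 2 * (n' / r) * real (card (P i)))"
   by (rule sum.cong) (auto simp: power2_diff algebra_simps)
  also have "... = (\<Sum>i<r. (real (card (P i)))\<^sup>2) + r * (n' / r)\<^sup>2 - 2 * (n' / r) * n'"
   using sumP by (simp add: sum.distrib sum_subtractf flip: sum_distrib_left sum_divide_distrib)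
  also have "r * (n' / r)\<^sup>2 = n' * n' / r" using r by (simp add: power2_eq_square field_simps)
  also have "2 * (n' / r) * n' = 2 * (n' * n' / r)" by simp
  finally show ?thesis by simp
 qed
 have "pe V V = pe U U + 2 * pe W U + pe W W" using pe_split[OF V(1,2)] VW by simp
 moreover have "pe W V = pe W U + pe W W"
 proof -
  have "pe W (U Un W) = pe W U + pe W W" by (rule pe_Un2[OF fU fW]) (use VW in auto)
  thus ?thesis using V(3) by (simp add: U_def Un_commute)
 qed
 moreover have "pe W V <= K * card V" using pe_le[OF fW V(1)] W by (meson le_trans mult_le_mono1)
 ultimately have "pe V V <= pe U U + 2 * (K * card V)" by linarith
 hence "real (pe V V) <= real (pe U U) + 2 * K * n" unfolding n_def by (simp flip: of_nat_mult of_nat_add add: mult.assoc)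
 hence "(1 - 1 / r) * n\<^sup>2 <= real (pe U U) + 2 * K * n" using e by (simp add: n_def)
 moreover have "(1 - 1 / r) * (n' * n') <= (1 - 1 / r) * n\<^sup>2"
  unfolding power2_eq_square using nn r by (intro mult_left_mono mult_mono) (auto simp: field_simps)
 moreover have "real (l - 2) * n' <= real l * n" using nn by (intro mult_mono) auto
 moreover have "(1 - 1 / r) * (n' * n') = n' * n' - n' * n' / r" by (simp add: algebra_simps)
 ultimately have "(\<Sum>i<r. \<Sum>j\<in>{..<r} - {i}. real (mis (P i) (P j))) + (\<Sum>i<r. (real (card (P i)) - n' / r)\<^sup>2) <= real l * n + 2 * K * n"
  using 1 sq by linarith
 thus ?thesis by (simp add: n_def n'_def algebra_simps)
qed

text \<open>Two classes with linear matchings would yield \<open>F2\<close>, as only linearly many cross pairs are missing.\<close>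

lemma two_matchings:
 fixes \<kappa> c z :: real and k m r :: nat
 assumes cp: "clpart r z V W P" and z0: "0 <= z" and
  sz: "real (r * (2 * m + m)) * z + z <= 1 / (2 * real r)" "real (m + 2 * m) <= real (card V) / (2 * real r)" and
  ij: "i < r" "j < r" "i ~= j" and mt: "hasmat k (P i)" "hasmat k (P j)" and
  ka: "0 < \<kappa>" "\<kappa> * card V <= k" and D: "real (mis (P i) (P j)) <= c * card V" "0 < c" and
  big: "4 * m * c / \<kappa> + 2 * m <= \<kappa> * card V"
 shows "forb2 r m V"
proof -
 define n where "n = real (card V)"
 have V: "finite V" "!!i. i < r ==> P i \<subseteq> V" using cp by (auto simp: clpart_def)
 have fP: "finite (P i)" if "i < r" for i using V(2)[OF that] V(1) finite_subset by blast
 obtain f g where fg: "!!a. a < k ==> f a \<in> P i & g a \<in> P i & E (f a) (g a)" "inj_on f {..<k}" "inj_on g {..<k}"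
   "f ` {..<k} Int g ` {..<k} = {}" using mt(1) unfolding hasmat_def by blast
 obtain f' g' where fg': "!!a. a < k ==> f' a \<in> P j & g' a \<in> P j & E (f' a) (g' a)" "inj_on f' {..<k}" "inj_on g' {..<k}"
   "f' ` {..<k} Int g' ` {..<k} = {}" using mt(2) unfolding hasmat_def by blast
 define w where "w = (%a. ms (f a) (P j) + ms (g a) (P j))"
 \<comment> \<open>Markov's inequality: the matching edges miss at most \<open>c * n\<close>
   vertices in total and there are at least \<open>\<kappa> * n\<close> of them, so at most half can
   miss more than \<open>t\<close> vertices of \<open>P j\<close>.\<close>
 define t where "t = 2 * c / \<kappa>"
 have t0: "0 < t" using ka D by (simp add: t_def)
 define A where "A = {a\<in>{..<k}. real (w a) <= t}"
 have sw: "(\<Sum>a<k. w a) <= mis (P i) (P j)"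
 proof -
  have "(\<Sum>a<k. w a) = (\<Sum>v\<in>f ` {..<k}. ms v (P j)) + (\<Sum>v\<in>g ` {..<k}. ms v (P j))"
   by (simp add: w_def sum.distrib sum.reindex[OF fg(2)] sum.reindex[OF fg(3)])
  also have "... = (\<Sum>v\<in>f ` {..<k} Un g ` {..<k}. ms v (P j))" by (rule sum.union_disjoint[symmetric]) (use fg(4) in auto)
  also have "... <= mis (P i) (P j)" unfolding mis_def by (rule sum_mono2) (use fP[OF ij(1)] fg(1) in auto)
  finally show ?thesis .
 qed
 have cA: "k <= 2 * real (card A)"
 proof -
  have "real (card ({..<k} - A)) * t = (\<Sum>a\<in>{..<k} - A. t)" by simp
  also have "... <= (\<Sum>a\<in>{..<k} - A. real (w a))" by (rule sum_mono) (auto simp: A_def)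
  also have "... <= (\<Sum>a<k. real (w a))" by (rule sum_mono2) auto
  also have "... <= c * n" using sw D unfolding n_def by (simp flip: of_nat_sum)
  finally have "real (card ({..<k} - A)) * (2 * c) <= (\<kappa> * n) * c" using ka by (simp add: t_def field_simps)
  hence "real (card ({..<k} - A)) * 2 <= \<kappa> * n" using D(2) by (simp add: mult.assoc[symmetric])
  hence "real (card ({..<k} - A)) * 2 <= k" using ka unfolding n_def by linarith
  moreover have "card ({..<k} - A) = k - card A" by (subst card_Diff_subset) (auto simp: A_def)
  moreover have "card A <= k" using card_mono[of "{..<k}" A] by (auto simp: A_def)
  ultimately show ?thesis by (simp add: of_nat_diff)
 qed
 have mt0: "0 <= real m * t" using t0 by simp
 have bigk: "2 * (m * t) + 2 * m <= k"
 proof -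
  have "4 * m * c / \<kappa> = 2 * (m * t)" by (simp add: t_def)
  thus ?thesis using big ka by simp
 qed
 hence "2 * real m <= k" using mt0 by linarith
 hence "m <= card A" using cA by linarith
 then obtain A0 where A0: "A0 \<subseteq> A" "card A0 = m" "finite A0" using obtain_subset_with_card_n by metis
 have A0k: "A0 \<subseteq> {..<k}" using A0 by (auto simp: A_def)
 \<comment> \<open>Vertices of \<open>P j\<close> missed by the \<open>m\<close> chosen edges.
   Discarding all edges of the second matching that touch this bounded set leaves enough of
   them.\<close>
 define Mi where "Mi = (\<Union>a\<in>A0. {y\<in>P j. ~ E (f a) y} Un {y\<in>P j. ~ E (g a) y})"
 have fMi: "finite Mi" using A0(3) fP[OF ij(2)] by (auto simp: Mi_def)
 have cMi: "real (card Mi) <= m * t"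
 proof -
  have "card Mi <= (\<Sum>a\<in>A0. card ({y\<in>P j. ~ E (f a) y} Un {y\<in>P j. ~ E (g a) y}))" unfolding Mi_def by (rule card_UN_le[OF A0(3)])
  also have "... <= (\<Sum>a\<in>A0. w a)" by (rule sum_mono) (auto simp: w_def ms_def card_Un_le)
  finally have "real (card Mi) <= (\<Sum>a\<in>A0. real (w a))" by (simp flip: of_nat_sum)
  also have "... <= (\<Sum>a\<in>A0. t)" by (rule sum_mono) (use A0(1) in "auto simp: A_def")
  finally show ?thesis using A0(2) by simp
 qed
 define B where "B = {b\<in>{..<k}. f' b \<notin> Mi & g' b \<notin> Mi}"
 have "k <= card B + 2 * card Mi"
 proof -
  have "{..<k} = B Un ({b\<in>{..<k}. f' b \<in> Mi} Un {b\<in>{..<k}. g' b \<in> Mi})" by (auto simp: B_def)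
  hence "k = card (B Un ({b\<in>{..<k}. f' b \<in> Mi} Un {b\<in>{..<k}. g' b \<in> Mi}))" by (metis card_lessThan)
  also have "... <= card B + card ({b\<in>{..<k}. f' b \<in> Mi} Un {b\<in>{..<k}. g' b \<in> Mi})" by (rule card_Un_le)
  also have "card ({b\<in>{..<k}. f' b \<in> Mi} Un {b\<in>{..<k}. g' b \<in> Mi}) <= card {b\<in>{..<k}. f' b \<in> Mi} + card {b\<in>{..<k}. g' b \<in> Mi}" by (rule card_Un_le)
  also have "card {b\<in>{..<k}. f' b \<in> Mi} <= card Mi" by (rule card_inj_on_le[OF _ _ fMi]) (use fg'(2) in "auto elim: inj_on_subset")
  also have "card {b\<in>{..<k}. g' b \<in> Mi} <= card Mi" by (rule card_inj_on_le[OF _ _ fMi]) (use fg'(3) in "auto elim: inj_on_subset")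
  finally show ?thesis by simp
 qed
 hence "real k <= card B + 2 * real (card Mi)" by linarith
 hence "m <= card B" using cMi bigk by linarith
 then obtain B0 where B0: "B0 \<subseteq> B" "card B0 = m" "finite B0" using obtain_subset_with_card_n by metis
 have B0k: "B0 \<subseteq> {..<k}" using B0 by (auto simp: B_def)
 define Si where "Si = f ` A0 Un g ` A0"
 define Sj where "Sj = f' ` B0 Un g' ` B0"
 have hm: "hasmat m Si" "hasmat m Sj" unfolding Si_def Sj_def
  by (rule hasmat_sub[OF fg A0k A0(2)], assumption, rule hasmat_sub[OF fg' B0k B0(2)])
 have cS: "card Si <= 2 * m" "card Sj <= 2 * m"
 proof -
  have "card Si <= card (f ` A0) + card (g ` A0)" unfolding Si_def by (rule card_Un_le)
  also have "... <= m + m" using A0(2) card_image_le[OF A0(3), of f] card_image_le[OF A0(3), of g] by simp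
  finally show "card Si <= 2 * m" by simp
  have "card Sj <= card (f' ` B0) + card (g' ` B0)" unfolding Sj_def by (rule card_Un_le)
  also have "... <= m + m" using B0(2) card_image_le[OF B0(3), of f'] card_image_le[OF B0(3), of g'] by simp
  finally show "card Sj <= 2 * m" by simp
 qed
 have SP: "Si \<subseteq> P i" "Sj \<subseteq> P j" using fg(1) fg'(1) A0k B0k by (auto simp: Si_def Sj_def)
 have SS: "cmpl Si Sj" unfolding cmpl_def
 proof (intro ballI)
  fix x y assume x: "x \<in> Si" and y: "y \<in> Sj"
  have "y \<notin> Mi" using y B0(1) by (auto simp: Sj_def B_def)
  thus "E x y" using x y SP(2) by (auto simp: Si_def Mi_def)
 qed
 define S where "S = (%h. if h = i then Si else if h = j then Sj else {})"
 have "\<exists>S'. blow r S' V & (\<forall>h<r. S h \<subseteq> S' h & S' h \<subseteq> P h & m <= card (S' h - S h))"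
 proof (rule greedy_extend[OF cp z0 sz])
  show "S h \<subseteq> P h & card (S h) <= 2 * m" if "h < r" for h using SP cS by (auto simp: S_def)
  show "cmpl (S h) (S h')" if "h < r" "h' < r" "h ~= h'" for h h'
   using SS cmpl_sym[OF SS] that by (auto simp: S_def) (auto simp: cmpl_def)
 qed
 then obtain S' where S': "blow r S' V" "!!h. h < r ==> S h \<subseteq> S' h & S' h \<subseteq> P h & m <= card (S' h - S h)" by blast
 have "m <= card (S' h)" if "h < r" for h
 proof -
  have "finite (S' h)" using S'(1) that by (simp add: blow_def)
  hence "card (S' h - S h) <= card (S' h)" by (intro card_mono) auto
  thus ?thesis using S'(2)[OF that] by linarith
 qed
 moreover have "hasmat m (S' i)" "hasmat m (S' j)"
  using hm S'(2)[OF ij(1)] S'(2)[OF ij(2)] ij(3) by (auto simp: S_def elim: hasmat_mono)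
 ultimately show ?thesis unfolding forb2_def using S'(1) ij by blast
qed

text \<open>The edges that are lost or gained when \<open>V\<close> is split into the common neighbourhood of \<open>L\<close> and its
 complement. Vertices \<open>x\<close> outside \<open>L\<close>'s class that are not joined to all of \<open>L\<close> (the set \<open>E'\<close>) pay
 for themselves, because they miss most of their own class, which lies in that neighbourhood.\<close>

lemma bundle_ineq:
 fixes s :: real and P :: "'b => 'a set"
 assumes V: "finite V" "V = I Un (C Un W) Un O'" "I Int (C Un W) = {}" "I Int O' = {}" "(C Un W) Int O' = {}"
  and I: "sep I I" and L: "L \<subseteq> I" "u0 \<in> L" "!!u. u \<in> L ==> nb u (C Un W) = nb u0 (C Un W)"
  and cl: "!!x. x \<in> O' ==> x \<in> P (cl x) & P (cl x) \<subseteq> O' & real (card I) - s <= card (P (cl x))"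
 defines "E' \<equiv> O' - cn L V" and "X' \<equiv> (C Un W) Un O' - cn L V"
 shows "real (pe V V) <= pe (cn L V) (cn L V) + 2 * real (card (cn L V)) * card (V - cn L V) +
  2 * ((\<Sum>u\<in>I. real (dg u (C Un W))) - real (card I) * dg u0 (C Un W)) +
  2 * card E' * (s + card E') + 2 * (\<Sum>x\<in>E'. real (dg x (P (cl x)))) + pe X' X'"
proof -
 define A where "A = C Un W"
 define Ns where "Ns = cn L V"
 have fin: "finite I" "finite A" "finite O'" "finite Ns" "finite E'" "finite X'"
  using V(1,2) by (auto simp: A_def Ns_def E'_def X'_def cn_def)
 have VA: "V = I Un (A Un O')" "I Int (A Un O') = {}" "A Int O' = {}" using V by (auto simp: A_def)
 have NsI: "Ns Int I = {}" using I L(1,2) by (auto simp: Ns_def cn_def sep_def)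
 have NsA: "Ns Int A = nb u0 A"
 proof
  show "Ns Int A \<subseteq> nb u0 A" using L(2) by (auto simp: Ns_def cn_def)
  show "nb u0 A \<subseteq> Ns Int A" using L(3) V(2) by (auto simp: Ns_def cn_def A_def nb_def)
 qed
 have EX: "E' \<subseteq> X'" "E' \<subseteq> O'" by (auto simp: E'_def X'_def)
 have cNs: "real (card Ns) = real (card O') - real (card E') + real (dg u0 A)"
 proof -
  have "Ns = (Ns Int A) Un (O' - E')" using NsI VA by (auto simp: Ns_def E'_def cn_def)
  hence "card Ns = card ((Ns Int A) Un (O' - E'))" by simp
  also have "... = card (Ns Int A) + card (O' - E')" by (rule card_Un_disjoint) (use fin VA(3) in auto)
  also have "card (O' - E') = card O' - card E'" by (rule card_Diff_subset[OF fin(5) EX(2)])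
  finally show ?thesis using NsA card_mono[OF fin(3) EX(2)] by (simp add: dg_def of_nat_diff)
 qed
 have X: "V - Ns = I Un X'" "I Int X' = {}" using VA NsI by (auto simp: X'_def A_def Ns_def)
 have NX: "Ns Int X' = {}" "Ns Un X' = A Un O'" using VA NsI by (auto simp: X'_def A_def Ns_def cn_def)
 have NV: "Ns \<subseteq> V" by (auto simp: Ns_def cn_def)
 have 1: "pe V V = pe (V - Ns) (V - Ns) + 2 * pe Ns (V - Ns) + pe Ns Ns" by (rule pe_split[OF V(1) NV])
 have 2: "pe (V - Ns) (V - Ns) = pe X' X' + 2 * pe I X' + pe I I"
 proof -
  have "pe (V - Ns) (V - Ns) = pe (V - Ns - I) (V - Ns - I) + 2 * pe I (V - Ns - I) + pe I I"
   by (rule pe_split) (use V(1) X fin in auto)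
  moreover have "V - Ns - I = X'" using X by auto
  ultimately show ?thesis by simp
 qed
 have 3: "pe I I = 0" by (rule pe_sep[OF I])
 have 4: "pe Ns (V - Ns) = pe I Ns + pe X' Ns"
 proof -
  have "pe Ns (V - Ns) = pe (V - Ns) Ns" by (rule pe_sym) (use fin V(1) in auto)
  also have "... = pe I Ns + pe X' Ns" unfolding X(1) by (rule pe_Un1[OF fin(1,6) X(2)])
  finally show ?thesis .
 qed
 have 5: "pe I Ns + pe I X' = pe I (A Un O')" unfolding NX(2)[symmetric] by (rule pe_Un2[symmetric, OF fin(4,6) NX(1)])
 have 6: "pe I (A Un O') <= (\<Sum>u\<in>I. dg u A) + card I * card O'"
 proof -
  have "pe I (A Un O') = pe I A + pe I O'" by (rule pe_Un2[OF fin(2,3) VA(3)])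
  thus ?thesis using pe_le[OF fin(1,3)] by (simp add: pe_def)
 qed
 have 7: "pe X' Ns + (\<Sum>x\<in>E'. ms x Ns) <= card X' * card Ns"
 proof -
  have "(\<Sum>x\<in>E'. ms x Ns) <= mis X' Ns" unfolding mis_def by (rule sum_mono2[OF fin(6) EX(1)]) simp
  thus ?thesis using pe_mis[OF fin(4), of X'] by simp
 qed
 \<comment> \<open>The class of \<open>x\<close> lies in the common neighbourhood except for members
   of \<open>E'\<close>, and \<open>x\<close> misses all of it but its few inner neighbours.\<close>
 have 8: "real (card E') * (card I - s - card E') - (\<Sum>x\<in>E'. real (dg x (P (cl x)))) <= (\<Sum>x\<in>E'. real (ms x Ns))"
 proof -
  have "real (card E') * (card I - s - card E') - (\<Sum>x\<in>E'. real (dg x (P (cl x)))) = (\<Sum>x\<in>E'. card I - s - card E' - real (dg x (P (cl x))))"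
   by (simp add: sum_subtractf)
  also have "... <= (\<Sum>x\<in>E'. real (ms x Ns))"
  proof (rule sum_mono)
   fix x assume x: "x \<in> E'"
   hence xO: "x \<in> O'" using EX by auto
   have fPc: "finite (P (cl x))" using cl[OF xO] fin(3) finite_subset by blast
   have "P (cl x) - E' \<subseteq> Ns" using cl[OF xO] V(2) by (auto simp: E'_def Ns_def)
   hence "ms x (P (cl x) - E') <= ms x Ns" by (rule ms_mono[OF fin(4)])
   moreover have "dg x (P (cl x) - E') + ms x (P (cl x) - E') = card (P (cl x) - E')" by (rule dg_ms) (use fPc in simp)
   moreover have "dg x (P (cl x) - E') <= dg x (P (cl x))" by (rule dg_mono[OF fPc]) auto
   moreover have "card (P (cl x)) <= card (P (cl x) - E') + card E'"
    by (meson card_Diff_subset_Int diff_card_le_card_Diff fin(5) le_diff_conv)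
   ultimately have "card (P (cl x)) <= ms x Ns + dg x (P (cl x)) + card E'" by linarith
   moreover have "real (card I) - s <= card (P (cl x))" using cl[OF xO] by blast
   ultimately show "card I - s - card E' - real (dg x (P (cl x))) <= real (ms x Ns)" by linarith
  qed
  finally show ?thesis .
 qed
 have cX: "real (card (V - Ns)) = card I + card X'" unfolding X(1) by (simp add: card_Un_disjoint[OF fin(1,6) X(2)])
 have "pe V V = pe Ns Ns + pe X' X' + 2 * pe I (A Un O') + 2 * pe X' Ns" using 1 2 3 4 5 by linarith
 hence eq: "real (pe V V) = real (pe Ns Ns) + real (pe X' X') + 2 * real (pe I (A Un O')) + 2 * real (pe X' Ns)" by simp
 have 6: "real (pe I (A Un O')) <= (\<Sum>u\<in>I. real (dg u A)) + real (card I) * card O'" using 6 by (simp flip: of_nat_sum of_nat_mult of_nat_add)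
 have 7: "real (pe X' Ns) <= real (card X') * card Ns - (\<Sum>x\<in>E'. real (ms x Ns))" using 7
  by (simp add: le_diff_eq flip: of_nat_sum of_nat_mult of_nat_add)
 have "real (pe V V) <= real (pe Ns Ns) + real (pe X' X') + 2 * ((\<Sum>u\<in>I. real (dg u A)) + real (card I) * card O')
   + 2 * (real (card X') * card Ns - (real (card E') * (card I - s - card E') - (\<Sum>x\<in>E'. real (dg x (P (cl x))))))"
  unfolding eq by (intro add_mono order_refl mult_left_mono 6 order_trans[OF 7 diff_left_mono[OF 8]]) auto
 also have "... = pe Ns Ns + 2 * real (card Ns) * card (V - Ns) + 2 * ((\<Sum>u\<in>I. real (dg u A)) - real (card I) * dg u0 A) +
  2 * card E' * (s + card E') + 2 * (\<Sum>x\<in>E'. real (dg x (P (cl x)))) + pe X' X'"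
  unfolding cX cNs by (simp add: algebra_simps)
 finally show ?thesis unfolding A_def Ns_def .
qed

section \<open>Splitting off a bundle\<close>

text \<open>Averaging: every vertex of a bundle has the value of the representative, so
  \<open>card I\<close> times the sum of these values is at least \<open>card \<L>\<close> times the
  sum of \<open>a\<close> over all bundled vertices. Hence some bundle costs no more than the
  unbundled vertices plus the mean of \<open>q\<close>.\<close>

lemma avg_bundle:
 fixes a :: "'a => real" and q :: "'a set => real"
 assumes "finite I" "finite \<L>" "\<L> ~= {}" "0 < N" "!!L. L \<in> \<L> ==> L \<subseteq> I & card L = N & rep L \<in> L"
  "!!L u. L \<in> \<L> ==> u \<in> L ==> a u = a (rep L)"
  "!!L L'. L \<in> \<L> ==> L' \<in> \<L> ==> L ~= L' ==> L Int L' = {}" "!!u. u \<in> I ==> 0 <= a u"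
  "(\<Sum>L\<in>\<L>. q L) <= Q"
 shows "\<exists>L\<in>\<L>. ((\<Sum>u\<in>I. a u) - card I * a (rep L)) + q L <= (\<Sum>u\<in>I - \<Union>\<L>. a u) + Q / card \<L>"
proof (rule ccontr)
 assume "~ ?thesis"
 hence lt: "!!L. L \<in> \<L> ==> (\<Sum>u\<in>I - \<Union>\<L>. a u) + Q / card \<L> < ((\<Sum>u\<in>I. a u) - card I * a (rep L)) + q L" by (meson not_le)
 define M where "M = real (card \<L>)"
 have M0: "0 < M" using assms(2,3) by (simp add: M_def card_gt_0_iff)
 have fL: "finite L" if "L \<in> \<L>" for L using assms(1) assms(5)[OF that] finite_subset by blast
 have UI: "\<Union>\<L> \<subseteq> I" using assms(5) by blast
 have cU: "card (\<Union>\<L>) = N * card \<L>"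
 proof -
  have "card (\<Union>\<L>) = (\<Sum>L\<in>\<L>. card L)" by (rule card_Union_disjoint) (use assms(7) fL in "auto simp: pairwise_def disjnt_def")
  thus ?thesis using assms(5) by simp
 qed
 have sU: "(\<Sum>u\<in>\<Union>\<L>. a u) = N * (\<Sum>L\<in>\<L>. a (rep L))"
 proof -
  have "(\<Sum>u\<in>\<Union>\<L>. a u) = (\<Sum>L\<in>\<L>. \<Sum>u\<in>L. a u)"
   by (subst sum.Union_disjoint) (use assms(7) fL in auto)
  also have "... = (\<Sum>L\<in>\<L>. N * a (rep L))"
  proof (rule sum.cong[OF refl])
   fix L assume L: "L \<in> \<L>"
   have "(\<Sum>u\<in>L. a u) = (\<Sum>u\<in>L. a (rep L))" by (rule sum.cong) (use assms(6)[OF L] in auto)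
   thus "(\<Sum>u\<in>L. a u) = N * a (rep L)" using assms(5)[OF L] by simp
  qed
  finally show ?thesis by (simp add: sum_distrib_left)
 qed
 have sI: "(\<Sum>u\<in>I. a u) = (\<Sum>u\<in>I - \<Union>\<L>. a u) + (\<Sum>u\<in>\<Union>\<L>. a u)" by (rule sum.subset_diff[OF UI assms(1)])
 have "(\<Sum>L\<in>\<L>. (\<Sum>u\<in>I - \<Union>\<L>. a u) + Q / card \<L>) < (\<Sum>L\<in>\<L>. ((\<Sum>u\<in>I. a u) - card I * a (rep L)) + q L)"
  by (rule sum_strict_mono[OF assms(2,3)]) (rule lt)
 hence "M * (\<Sum>u\<in>I - \<Union>\<L>. a u) + Q < M * (\<Sum>u\<in>I. a u) - card I * (\<Sum>L\<in>\<L>. a (rep L)) + (\<Sum>L\<in>\<L>. q L)"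
  using M0 by (simp add: sum.distrib sum_subtractf M_def flip: sum_distrib_left) (simp add: algebra_simps)
 hence "card I * (\<Sum>L\<in>\<L>. a (rep L)) < M * (\<Sum>u\<in>\<Union>\<L>. a u)" using assms(9) sI by (simp add: algebra_simps)
 also have "... = (N * card \<L>) * (\<Sum>L\<in>\<L>. a (rep L))" using sU by (simp add: M_def algebra_simps)
 finally have "real (card I) * (\<Sum>L\<in>\<L>. a (rep L)) < real (card (\<Union>\<L>)) * (\<Sum>L\<in>\<L>. a (rep L))" using cU by simp
 moreover have "real (card (\<Union>\<L>)) * (\<Sum>L\<in>\<L>. a (rep L)) <= real (card I) * (\<Sum>L\<in>\<L>. a (rep L))"
 proof (rule mult_right_mono)
  show "0 <= (\<Sum>L\<in>\<L>. a (rep L))" by (rule sum_nonneg) (use assms(5,8) in blast)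
 qed (use card_mono[OF assms(1) UI] in simp)
 ultimately show False by simp
qed

text \<open>Selects a bundle for which the error terms of \<open>bundle_ineq\<close> are small. The
  inner degrees of vertices in \<open>E'\<close> are the critical ones: a vertex belongs to
  \<open>E'\<close> for at most \<open>z * n\<close> of the disjoint bundles, since each of these
  contains a different non-neighbour, and all inner degrees together are at most
  \<open>l * n\<close>.\<close>

lemma good_bundle:
 fixes s z :: real and r l K N \<tau> :: nat
 assumes cp: "clpart r z V W P" and z0: "0 <= z" and \<rho>: "\<rho> < r" and l: "2 <= l" and W: "card W <= K"
  and pf: "!!i. i < r ==> pfree l (P i)" and C: "C \<subseteq> P \<rho>" "sep (P \<rho> - C) (P \<rho> - C)"
  and s: "0 <= s" "!!j. j < r ==> real (card (P \<rho>)) - s <= card (P j)"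
  and Ls: "finite \<L>" "\<L> ~= {}" "0 < N" "!!L. L \<in> \<L> ==> L \<subseteq> P \<rho> - C & card L = N"
   "!!L u v. L \<in> \<L> ==> u \<in> L ==> v \<in> L ==> nb u (C Un W) = nb v (C Un W)"
   "!!L L'. L \<in> \<L> ==> L' \<in> \<L> ==> L ~= L' ==> L Int L' = {}"
   "!!L u. L \<in> \<L> ==> u \<in> L ==> ms u (\<Union>j\<in>{..<r} - {\<rho>}. P j) <= \<tau>"
 defines "L0 \<equiv> P \<rho> - C - \<Union>\<L>"
 shows "\<exists>L\<in>\<L>. real (pe V V) <= pe (cn L V) (cn L V) + 2 * real (card (cn L V)) * card (V - cn L V) +
   2 * (real (K + l) * card L0 + real l * card C + z * l * (real (card V))\<^sup>2 / card \<L>) +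
   2 * real (N * \<tau>) * (s + N * \<tau>) + real (2 * K * (K + card C + N * \<tau>) + l * card C + 2 * card C * (N * \<tau>) + (N * \<tau>)\<^sup>2)"
proof -
 have V: "finite V" "W \<subseteq> V" "V = W Un (\<Union>i<r. P i)" "!!i. i < r ==> P i Int W = {}"
  "!!i j. i < r ==> j < r ==> i ~= j ==> P i Int P j = {}" using cp unfolding clpart_def by blast+
 have fP: "finite (P i)" "P i \<subseteq> V" if "i < r" for i using V(1,3) that by (auto dest: finite_subset)
 have fW: "finite W" using V(1,2) finite_subset by blast
 define n where "n = real (card V)"
 define I where "I = P \<rho> - C"
 define O' where "O' = (\<Union>j\<in>{..<r} - {\<rho>}. P j)"
 have fin: "finite I" "finite C" "finite O'" using fP \<rho> C(1) by (auto simp: I_def O'_def dest: finite_subset)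
 have sI: "sep I I" using C(2) by (simp add: I_def)
 define cl where "cl = (%x. SOME j. j < r & j ~= \<rho> & x \<in> P j)"
 have cl: "cl x < r & cl x ~= \<rho> & x \<in> P (cl x)" if "x \<in> O'" for x
  unfolding cl_def by (rule someI_ex) (use that in "auto simp: O'_def")
 have cl2: "cl x = j" if "x \<in> P j" "j < r" "j ~= \<rho>" for x j
 proof (rule ccontr)
  assume "cl x ~= j"
  moreover have "x \<in> O'" using that by (auto simp: O'_def)
  ultimately show False using cl[of x] V(5)[of "cl x" j] that by auto
 qed
 define rep where "rep = (%L::'a set. SOME u. u \<in> L)"
 have rep: "rep L \<in> L" if "L \<in> \<L>" for L
 proof -
  have "L ~= {}" using Ls(3) Ls(4)[OF that] by auto
  thus ?thesis unfolding rep_def by (rule some_in_eq[THEN iffD2])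
 qed
 define a where "a = (%u. real (dg u (C Un W)))"
 define EE where "EE = (%L. O' - cn L V)"
 define q where "q = (%L. \<Sum>x\<in>EE L. real (dg x (P (cl x))))"
 have OV: "O' \<subseteq> V" using fP by (auto simp: O'_def)
 have owntot: "(\<Sum>x\<in>O'. real (dg x (P (cl x)))) <= l * n"
 proof -
  have "(\<Sum>x\<in>O'. real (dg x (P (cl x)))) = (\<Sum>j\<in>{..<r} - {\<rho>}. \<Sum>x\<in>P j. real (dg x (P (cl x))))"
   unfolding O'_def by (rule sum.UNION_disjoint) (use fP V(5) in auto)
  also have "... = (\<Sum>j\<in>{..<r} - {\<rho>}. real (pe (P j) (P j)))"
   unfolding pe_def of_nat_sum by (intro sum.cong refl) (use cl2 in auto)
  also have "... <= (\<Sum>j\<in>{..<r} - {\<rho>}. real (l * card (P j)))"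
  proof (rule sum_mono)
   fix j assume j: "j \<in> {..<r} - {\<rho>}"
   have "pe (P j) (P j) <= (l - 2) * card (P j)" by (rule erdos_gallai) (use fP pf j l in auto)
   also have "... <= l * card (P j)" by (rule mult_le_mono1) simp
   finally show "real (pe (P j) (P j)) <= real (l * card (P j))" by (simp only: of_nat_le_iff)
  qed
  also have "... = real (l * (\<Sum>j\<in>{..<r} - {\<rho>}. card (P j)))" by (simp add: sum_distrib_left)
  also have "(\<Sum>j\<in>{..<r} - {\<rho>}. card (P j)) = card O'" unfolding O'_def
   by (rule card_UN_disjoint[symmetric]) (use fP V(5) in auto)
  also have "real (l * card O') <= l * n" unfolding n_def using card_mono[OF V(1) OV] by (simp add: mult_left_mono)
  finally show ?thesis .
 qed
 have sq: "(\<Sum>L\<in>\<L>. q L) <= z * l * n\<^sup>2"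
 proof -
  have hit: "real (card {L\<in>\<L>. x \<in> EE L}) <= z * n" if x: "x \<in> O'" for x
  proof -
   define h where "h = (%L. SOME u. u \<in> L & ~ E x u)"
   have h: "h L \<in> L & ~ E x (h L)" if "L \<in> {L\<in>\<L>. x \<in> EE L}" for L
    unfolding h_def by (rule someI_ex) (use that x OV E_sym in "auto simp: EE_def cn_def")
   have "inj_on h {L\<in>\<L>. x \<in> EE L}"
   proof (rule inj_onI)
    fix L L' assume "L \<in> {L\<in>\<L>. x \<in> EE L}" "L' \<in> {L\<in>\<L>. x \<in> EE L}" "h L = h L'"
    thus "L = L'" using h[of L] h[of L'] Ls(6)[of L L'] by auto
   qed
   moreover have "h ` {L\<in>\<L>. x \<in> EE L} \<subseteq> {u\<in>P \<rho>. ~ E x u}" using h Ls(4) by fastforce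
   ultimately have "card {L\<in>\<L>. x \<in> EE L} <= card {u\<in>P \<rho>. ~ E x u}"
    by (rule card_inj_on_le) (use fP[OF \<rho>] in simp)
   also have "... = ms x (P \<rho>)" by (simp add: ms_def)
   finally have "real (card {L\<in>\<L>. x \<in> EE L}) <= ms x (P \<rho>)" by simp
   also have "... <= z * n" using cp cl[OF x] \<rho> unfolding clpart_def n_def by (metis (no_types, lifting))
   finally show ?thesis .
  qed
  have "(\<Sum>L\<in>\<L>. q L) = (\<Sum>L\<in>\<L>. \<Sum>x\<in>O'. if x \<in> EE L then real (dg x (P (cl x))) else 0)"
   unfolding q_def by (rule sum.cong[OF refl], subst sum.inter_restrict[symmetric]) (use fin in "auto simp: EE_def intro!: sum.cong")
  also have "... = (\<Sum>x\<in>O'. \<Sum>L\<in>\<L>. if x \<in> EE L then real (dg x (P (cl x))) else 0)" by (rule sum.swap)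
  also have "... = (\<Sum>x\<in>O'. real (dg x (P (cl x))) * card {L\<in>\<L>. x \<in> EE L})"
   by (rule sum.cong[OF refl]) (simp add: sum.If_cases[OF Ls(1)] Int_def)
  also have "... <= (\<Sum>x\<in>O'. real (dg x (P (cl x))) * (z * n))" by (rule sum_mono) (intro mult_left_mono hit, auto)
  also have "... = (\<Sum>x\<in>O'. real (dg x (P (cl x)))) * (z * n)" by (simp add: sum_distrib_right)
  also have "... <= (l * n) * (z * n)" by (rule mult_right_mono[OF owntot]) (use z0 in "simp add: n_def")
  finally show ?thesis by (simp add: power2_eq_square algebra_simps)
 qed
 have "\<exists>L\<in>\<L>. ((\<Sum>u\<in>I. a u) - card I * a (rep L)) + q L <= (\<Sum>u\<in>I - \<Union>\<L>. a u) + (z * l * n\<^sup>2) / card \<L>"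
 proof (rule avg_bundle[OF fin(1) Ls(1,2,3) _ _ Ls(6) _ sq])
  show "L \<subseteq> I & card L = N & rep L \<in> L" if "L \<in> \<L>" for L using Ls(4)[OF that] rep[OF that] by (simp add: I_def)
  show "a u = a (rep L)" if "L \<in> \<L>" "u \<in> L" for L u using Ls(5)[OF that rep[OF that(1)]] by (simp add: a_def dg_def)
  show "0 <= a u" for u by (simp add: a_def)
 qed
 then obtain L where L: "L \<in> \<L>" and Lq: "((\<Sum>u\<in>I. a u) - card I * a (rep L)) + q L <= (\<Sum>u\<in>I - \<Union>\<L>. a u) + (z * l * n\<^sup>2) / card \<L>" by blast
 define X' where "X' = (C Un W) Un O' - cn L V"
 have LI: "L \<subseteq> I" "card L = N" using Ls(4)[OF L] by (auto simp: I_def)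
 have fL: "finite L" using LI fin finite_subset by blast
 have main: "real (pe V V) <= pe (cn L V) (cn L V) + 2 * real (card (cn L V)) * card (V - cn L V) +
  2 * ((\<Sum>u\<in>I. real (dg u (C Un W))) - real (card I) * dg (rep L) (C Un W)) +
  2 * card (O' - cn L V) * (s + card (O' - cn L V)) + 2 * (\<Sum>x\<in>O' - cn L V. real (dg x (P (cl x)))) + pe ((C Un W) Un O' - cn L V) ((C Un W) Un O' - cn L V)"
 proof (rule bundle_ineq[OF V(1) _ _ _ _ sI LI(1) rep[OF L]])
  show "V = I Un (C Un W) Un O'" using V(3) C(1) \<rho> by (auto simp: I_def O'_def)
  show "I Int (C Un W) = {}" using V(4)[OF \<rho>] by (auto simp: I_def)
  show "I Int O' = {}" using V(5)[OF \<rho>] by (fastforce simp: I_def O'_def)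
  show "(C Un W) Int O' = {}" using V(4) V(5)[OF \<rho>] C(1) by (fastforce simp: O'_def)
  show "nb u (C Un W) = nb (rep L) (C Un W)" if "u \<in> L" for u by (rule Ls(5)[OF L that rep[OF L]])
  show "x \<in> P (cl x) & P (cl x) \<subseteq> O' & real (card I) - s <= card (P (cl x))" if "x \<in> O'" for x
  proof -
   have "card I <= card (P \<rho>)" unfolding I_def by (rule card_mono) (use fP \<rho> in auto)
   moreover have "real (card (P \<rho>)) - s <= card (P (cl x))" using s(2) cl[OF that] by blast
   ultimately show ?thesis using cl[OF that] by (auto simp: O'_def)
  qed
 qed
 have cE: "card (EE L) <= N * \<tau>"
 proof -
  have "EE L \<subseteq> (\<Union>u\<in>L. {x\<in>O'. ~ E u x})" using OV by (auto simp: EE_def cn_def)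
  hence "card (EE L) <= card (\<Union>u\<in>L. {x\<in>O'. ~ E u x})" by (rule card_mono[rotated]) (use fL fin in auto)
  also have "... <= (\<Sum>u\<in>L. ms u O')" unfolding ms_def by (rule card_UN_le[OF fL])
  also have "... <= (\<Sum>u\<in>L. \<tau>)" by (rule sum_mono) (use Ls(7)[OF L] in "simp add: O'_def")
  finally show ?thesis using LI by simp
 qed
 have fEE: "finite (EE L)" using fin by (simp add: EE_def)
 have peX: "pe X' X' <= 2 * K * (K + card C + N * \<tau>) + l * card C + 2 * card C * (N * \<tau>) + (N * \<tau>)\<^sup>2"
 proof -
  define Y where "Y = W Un (C Un EE L)"
  have WC: "W Int C = {}" "W Int EE L = {}" "C Int EE L = {}"
   using V(4) V(5)[OF \<rho>] C(1) \<rho> by (fastforce simp: EE_def O'_def)+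
  have fY: "finite Y" "finite (C Un EE L)" using fW fin fEE by (auto simp: Y_def)
  have "pe X' X' <= pe Y Y" by (rule pe_mono) (use fY in "auto simp: X'_def Y_def EE_def")
  also have "pe Y Y = pe (C Un EE L) (C Un EE L) + 2 * pe W (C Un EE L) + pe W W"
  proof -
   have "Y - W = C Un EE L" using WC by (auto simp: Y_def)
   moreover have "pe Y Y = pe (Y - W) (Y - W) + 2 * pe W (Y - W) + pe W W" by (rule pe_split[OF fY(1)]) (auto simp: Y_def)
   ultimately show ?thesis by simp
  qed
  also have "pe (C Un EE L) (C Un EE L) = pe (EE L) (EE L) + 2 * pe C (EE L) + pe C C"
  proof -
   have "(C Un EE L) - C = EE L" using WC by auto
   moreover have "pe (C Un EE L) (C Un EE L) = pe ((C Un EE L) - C) ((C Un EE L) - C) + 2 * pe C ((C Un EE L) - C) + pe C C"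
    by (rule pe_split[OF fY(2)]) auto
   ultimately show ?thesis by simp
  qed
  also have "pe C C <= l * card C"
  proof -
   have "pe C C <= (l - 2) * card C" by (rule erdos_gallai[OF fin(2) pfree_mono[OF pf[OF \<rho>] C(1)] l])
   also have "... <= l * card C" by (rule mult_le_mono1) simp
   finally show ?thesis .
  qed
  also have "pe (EE L) (EE L) <= (N * \<tau>)\<^sup>2"
   using pe_le[OF fEE fEE] cE mult_le_mono[OF cE cE] by (simp add: power2_eq_square)
  also have "pe C (EE L) <= card C * (N * \<tau>)" by (rule le_trans[OF pe_le[OF fin(2) fEE] mult_le_mono2[OF cE]])
  finally have p1: "pe X' X' <= (N * \<tau>)\<^sup>2 + 2 * (card C * (N * \<tau>)) + l * card C + 2 * pe W (C Un EE L) + pe W W" by simp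
  have p2: "2 * pe W (C Un EE L) + pe W W <= 2 * K * (K + card C + N * \<tau>)"
  proof -
   have "card (C Un EE L) <= card C + N * \<tau>" using card_Un_le[of C "EE L"] cE by linarith
   hence "pe W (C Un EE L) <= K * (card C + N * \<tau>)" using pe_le[OF fW fY(2)] W by (meson le_trans mult_le_mono)
   moreover have "pe W W <= K * K" using pe_le[OF fW fW] W by (meson le_trans mult_le_mono)
   ultimately have "2 * pe W (C Un EE L) + pe W W <= 2 * (K * (card C + N * \<tau>)) + 2 * (K * K)" by linarith
   also have "... = 2 * K * (K + card C + N * \<tau>)" by (simp add: algebra_simps)
   finally show ?thesis .
  qed
  have "2 * (card C * (N * \<tau>)) = 2 * card C * (N * \<tau>)" by simp
  thus ?thesis using p1 p2 by linarith
 qed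
 have left: "(\<Sum>u\<in>I - \<Union>\<L>. a u) <= real (K + l) * card L0 + real l * card C"
 proof -
  have fL0: "finite L0" using fin by (simp add: L0_def I_def)
  have dj: "C Int W = {}" using V(4)[OF \<rho>] C(1) by auto
  have "(\<Sum>u\<in>I - \<Union>\<L>. a u) = real (pe L0 (C Un W))" by (simp add: a_def pe_def L0_def I_def)
  also have "pe L0 (C Un W) = pe L0 C + pe L0 W" by (rule pe_Un2[OF fin(2) fW dj])
  also have "pe L0 W <= K * card L0" using pe_le[OF fL0 fW] W by (metis le_trans mult.commute mult_le_mono1)
  also have "pe L0 C <= l * (card L0 + card C)"
  proof -
   have "pe L0 C <= pe (L0 Un C) (L0 Un C)" by (rule pe_mono) (use fL0 fin in auto)
   also have "... <= (l - 2) * card (L0 Un C)"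
    by (rule erdos_gallai[OF _ pfree_mono[OF pf[OF \<rho>]] l]) (use fL0 fin C(1) in "auto simp: L0_def")
   also have "... <= l * (card L0 + card C)" by (rule mult_le_mono) (simp, rule card_Un_le)
   finally show ?thesis .
  qed
  finally show ?thesis by (simp add: algebra_simps)
 qed
 have "real (card (EE L)) * (s + card (EE L)) <= real (N * \<tau>) * (s + N * \<tau>)"
  using cE s(1) by (intro mult_mono) (auto simp del: of_nat_mult)
 moreover have "real (pe X' X') <= real (2 * K * (K + card C + N * \<tau>) + l * card C + 2 * card C * (N * \<tau>) + (N * \<tau>)\<^sup>2)"
  using peX by (simp only: of_nat_le_iff)
 moreover have EEL: "O' - cn L V = EE L" by (simp add: EE_def)
 have qL: "(\<Sum>x\<in>EE L. real (dg x (P (cl x)))) = q L" by (simp add: q_def)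
 have aL: "real (dg (rep L) (C Un W)) = a (rep L)" "(\<Sum>u\<in>I. real (dg u (C Un W))) = (\<Sum>u\<in>I. a u)" by (simp_all add: a_def)
 define be c0 T where "be = real (card (EE L)) * (s + card (EE L))" and
  "c0 = real (pe (cn L V) (cn L V)) + 2 * real (card (cn L V)) * card (V - cn L V)" and "T = (\<Sum>u\<in>I. a u) - card I * a (rep L)"
 have "real (pe V V) <= c0 + 2 * T + 2 * be + 2 * q L + real (pe X' X')"
  using main unfolding EEL qL aL X'_def[symmetric] by (simp add: be_def c0_def T_def)
 moreover have "T + q L <= (real (K + l) * card L0 + real l * card C) + z * l * n\<^sup>2 / card \<L>"
  using Lq left unfolding T_def by linarith
 moreover have "be = real (card (EE L)) * (s + card (EE L))" by (simp add: be_def)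
 ultimately have "real (pe V V) <= c0 +
   2 * (real (K + l) * card L0 + real l * card C + z * l * n\<^sup>2 / card \<L>) +
   2 * (real (N * \<tau>) * (s + N * \<tau>)) + real (2 * K * (K + card C + N * \<tau>) + l * card C + 2 * card C * (N * \<tau>) + (N * \<tau>)\<^sup>2)"
  by argo
 thus ?thesis using L by (intro bexI[of _ L]) (simp_all add: n_def mult.assoc c0_def)
qed

text \<open>By \<open>two_matchings\<close> some class has no linear matching and hence a small
  cover \<open>C\<close>. Most vertices of this class outside \<open>C\<close> miss at most
  \<open>\<tau>\<close> vertices of the other classes, and \<open>few_nbhds\<close> leaves few
  patterns on \<open>C\<close> and \<open>W\<close>. So nearly all of the class falls into bundles,
  and \<open>good_bundle\<close> applies.\<close>

lemma split_off:
 fixes r l m N :: nat and \<delta> :: real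
 assumes r: "2 <= r" and l: "3 <= l" and N: "0 < N" and d: "0 < \<delta>"
 shows "\<exists>n0. \<forall>V. finite V --> n0 <= card V --> mindeg r V --> ~ forb1 r l m V --> ~ forb2 r m V -->
   (1 - 1 / r) * (real (card V))\<^sup>2 <= pe V V -->
   (\<exists>L. L \<subseteq> V & card L = N & real (pe V V) <= pe (cn L V) (cn L V) + 2 * real (card (cn L V)) * card (V - cn L V) + \<delta> * card V)"
proof -
 \<comment> \<open>Serves \<open>class_pfree\<close>, which needs \<open>l + m\<close>, and
   \<open>two_matchings\<close>, which needs \<open>3 * m\<close>.\<close>
 define bb where "bb = r * (l + 3 * m) + 1"
 have bb: "0 < bb" by (simp add: bb_def)
 define z where "z = min (1 / (4 * real r * real bb)) (\<delta> / (32 * l * r * N))"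
 have z0: "0 < z" using d r l N bb by (simp add: z_def)
 have zz: "z * (4 * real r * real bb) <= 1" "z * (32 * l * r * N) <= \<delta>"
 proof -
  have "z <= 1 / (4 * real r * real bb)" by (simp add: z_def)
  moreover have "0 < 4 * real r * real bb" using r bb by (intro mult_pos_pos) auto
  ultimately show "z * (4 * real r * real bb) <= 1" by (simp add: pos_le_divide_eq)
  have "z <= \<delta> / (32 * l * r * N)" by (simp add: z_def)
  moreover have "0 < real (32 * l * r * N)" using r l N by simp
  ultimately show "z * (32 * l * r * N) <= \<delta>" by (simp add: pos_le_divide_eq)
 qed
 have zr: "real (r * b) * z + z <= 1 / (2 * real r)" if "b <= l + 3 * m" for b
 proof -
  have "r * b + 1 <= bb" using that by (simp add: bb_def)
  hence "real (r * b + 1) <= real bb" by (simp only: of_nat_le_iff)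
  hence "z * (4 * real r) * real (r * b + 1) <= z * (4 * real r) * real bb" using z0 by (intro mult_left_mono) auto
  hence "z * (4 * real r) * real (r * b + 1) <= 1" using zz(1) by (simp add: algebra_simps)
  hence "(real (r * b) * z + z) * (4 * real r) <= 1" by (simp add: algebra_simps)
  moreover have "0 <= (real (r * b) * z + z) * (2 * real r)" using z0 by simp
  ultimately have "(real (r * b) * z + z) * (2 * real r) <= 1" by linarith
  thus ?thesis using r by (simp add: field_simps)
 qed
 have z8: "z <= 1 / (8 * real r)" "z <= 1"
 proof -
  have "real (r * 1) * z + z <= 1 / (2 * real r)" by (rule zr) (use l in simp)
  hence "(real r * z + z) * (2 * real r) <= 1" using r by (simp add: field_simps)
  moreover have "4 * (z * (2 * real r)) <= (real r * z + z) * (2 * real r) + z * (2 * real r)"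
  proof -
   have "2 * z <= real r * z" using r z0 by (intro mult_right_mono) auto
   hence "4 * z <= (real r * z + z) + z" by linarith
   hence "4 * z * (2 * real r) <= ((real r * z + z) + z) * (2 * real r)" by (intro mult_right_mono) auto
   thus ?thesis by (simp add: algebra_simps)
  qed
  moreover have "4 * (z * (2 * real r)) <= 1"
  proof -
   have "1 <= r * (l + 3 * m)" using r l by (simp add: Suc_le_eq)
   hence "2 <= real bb" unfolding bb_def by linarith
   hence "z * (4 * real r) * 2 <= z * (4 * real r) * real bb" using z0 by (intro mult_left_mono) auto
   thus ?thesis using zz(1) by (simp add: algebra_simps)
  qed
  ultimately show "z <= 1 / (8 * real r)" using r by (simp add: field_simps)
  moreover have "1 / (8 * real r) <= 1" using r by (simp add: field_simps)
  ultimately show "z <= 1" by linarith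
 qed
 obtain K n1 where Kn: "\<forall>V. finite V --> n1 <= card V --> mindeg r V --> ~ forb1 r l m V -->
  (\<exists>W P. card W <= K & clpart r z V W P)"
  using class_partition[of r l z m] r l z0 z8(2) by auto
 define c where "c = real (2 * K + l)"
 have c0: "0 < c" using l by (simp add: c_def)
 \<comment> \<open>Fraction that may stay outside the bundles, once for vertices missing more than
   \<open>\<tau>\<close> others and once for patterns occurring too rarely.\<close>
 define k1 where "k1 = min (\<delta> / (32 * (K + l))) (1 / (16 * real r))"
 have k1: "0 < k1" "k1 * (32 * (K + l)) <= \<delta>" "k1 <= 1 / (16 * real r)"
 proof -
  show "0 < k1" using d r l by (simp add: k1_def)
  have "k1 <= \<delta> / (32 * (K + l))" by (simp add: k1_def)
  thus "k1 * (32 * (K + l)) <= \<delta>" using l by (simp add: field_simps)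
  show "k1 <= 1 / (16 * real r)" by (simp add: k1_def)
 qed
 \<comment> \<open>At most \<open>c * n\<close> pairs are missing, so at most \<open>k1 * n\<close>
   vertices can miss more than \<open>\<tau>\<close>.\<close>
 define \<tau> where "\<tau> = nat \<lceil>c / k1\<rceil>"
 have tau: "c <= k1 * \<tau>" "0 < \<tau>"
 proof -
  have "c / k1 <= \<tau>" unfolding \<tau>_def by linarith
  thus a: "c <= k1 * \<tau>" using k1 by (simp add: field_simps)
  thus "0 < \<tau>" using c0 k1 by (cases "\<tau> = 0") auto
 qed
 \<comment> \<open>Number of patterns on \<open>C\<close> and \<open>W\<close> per vertex of the
   cover.\<close>
 define b where "b = 2 ^ K * (2 ^ l + l)"
 have b0: "0 < b" by (simp add: b_def)
 \<comment> \<open>Relative size of the excluded matching. The cover then has at most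
   \<open>3 * ka * n\<close> vertices; the patterns it creates must fit into \<open>k1\<close>, the
   pairs it carries into \<open>\<delta>\<close>.\<close>
 define ka where "ka = min (k1 / (6 * N * b)) (\<delta> / (48 * (2 * K + l + 2 * N * \<tau>)))"
 have ka: "0 < ka" "ka * (6 * N * b) <= k1" "ka * (48 * (2 * K + l + 2 * N * \<tau>)) <= \<delta>"
 proof -
  have "0 < 6 * N * b" "0 < 48 * (2 * K + l + 2 * N * \<tau>)" using N b0 l by auto
  hence p: "0 < real (6 * N * b)" "0 < real (48 * (2 * K + l + 2 * N * \<tau>))" by (simp_all only: of_nat_0_less_iff)
  show "0 < ka" unfolding ka_def using p k1 d by (auto simp del: of_nat_mult of_nat_add)
  have "ka <= k1 / (6 * N * b)" "ka <= \<delta> / (48 * (2 * K + l + 2 * N * \<tau>))" by (auto simp: ka_def)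
  thus "ka * (6 * N * b) <= k1" "ka * (48 * (2 * K + l + 2 * N * \<tau>)) <= \<delta>" using p by (simp_all only: pos_le_divide_eq)
 qed
 have ka2: "ka * 6 <= k1"
 proof -
  have "1 * 1 <= N * b" using N b0 by (intro mult_le_mono) auto
  hence "ka * 6 * 1 <= ka * 6 * real (N * b)" using ka(1) by (intro mult_left_mono) (auto simp flip: of_nat_mult)
  thus ?thesis using ka(2) by (simp add: algebra_simps)
 qed
 \<comment> \<open>Allowed deviation of the class sizes, which is paid once for each of the at most
   \<open>N * \<tau>\<close> vertices missed by a bundle.\<close>
 define th where "th = \<delta> / (64 * N * \<tau>)"
 have th: "0 < th" "th * (64 * N * \<tau>) = \<delta>" using d N tau(2) by (auto simp: th_def)
 define R where "R = real (2 * r * (l + m)) + real (2 * r * (3 * m)) + (4 * m * c / ka + 2 * m) / ka + 2 / ka + 4 * c / th\<^sup>2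
  + N * 2 ^ K * 2 / k1 + 2 * (real (N * \<tau>))\<^sup>2 * 16 / \<delta> + (2 * K * (K + N * \<tau>) + (N * \<tau>)\<^sup>2) * 16 / \<delta>"
 show ?thesis
 proof (rule exI[of _ "max n1 (nat \<lceil>R\<rceil>)"], intro allI impI)
  fix V :: "'a set" assume V: "finite V" "max n1 (nat \<lceil>R\<rceil>) <= card V" "mindeg r V" "~ forb1 r l m V" "~ forb2 r m V"
   "(1 - 1 / r) * (real (card V))\<^sup>2 <= pe V V"
  define n where "n = real (card V)"
  have Rn: "R <= n" using V(2) unfolding n_def by linarith
  have nonneg: "0 <= real (2 * r * (l + m))" "0 <= real (2 * r * (3 * m))" "0 <= (4 * m * c / ka + 2 * m) / ka" "0 <= 2 / ka" "0 <= 4 * c / th\<^sup>2"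
    "0 <= N * 2 ^ K * 2 / k1" "0 <= 2 * (real (N * \<tau>))\<^sup>2 * 16 / \<delta>" "0 <= (2 * K * (K + N * \<tau>) + (N * \<tau>)\<^sup>2) * 16 / \<delta>"
   using c0 ka(1) th(1) k1(1) d by auto
  have Rs: "real (2 * r * (l + m)) <= n" "real (2 * r * (3 * m)) <= n" "(4 * m * c / ka + 2 * m) / ka <= n" "2 / ka <= n" "4 * c / th\<^sup>2 <= n"
    "N * 2 ^ K * 2 / k1 <= n" "2 * (real (N * \<tau>))\<^sup>2 * 16 / \<delta> <= n" "(2 * K * (K + N * \<tau>) + (N * \<tau>)\<^sup>2) * 16 / \<delta> <= n"
   using Rn nonneg unfolding R_def by argo+
  have n0: "0 < n"
  proof -
   have "0 < 2 / ka" using ka(1) by simp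
   thus ?thesis using Rs(4) by linarith
  qed
  have L1: "real (l + m) <= real (card V) / (2 * real r)" using Rs(1) r by (simp add: field_simps n_def)
  have L2: "real (m + 2 * m) <= real (card V) / (2 * real r)" using Rs(2) r by (simp add: field_simps n_def)
  have L3: "4 * m * c / ka + 2 * m <= ka * n" using Rs(3) ka(1) by (simp add: pos_divide_le_eq mult.commute)
  have L4: "2 <= ka * n" using Rs(4) ka(1) by (simp add: field_simps)
  have L5: "4 * c <= th\<^sup>2 * n" using Rs(5) th(1) by (simp add: field_simps)
  have L6: "N * 2 ^ K * 2 <= k1 * n" using Rs(6) k1(1) by (simp add: field_simps)
  have L7: "2 * (real (N * \<tau>))\<^sup>2 <= \<delta> / 16 * n" using Rs(7) d by (simp add: field_simps)
  have L8: "real (2 * K * (K + N * \<tau>) + (N * \<tau>)\<^sup>2) <= \<delta> / 16 * n" using Rs(8) d by (simp add: field_simps)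
  obtain W P where WP: "card W <= K" "clpart r z V W P" using Kn V by auto
  have VP: "W \<subseteq> V" "V = W Un (\<Union>i<r. P i)" "!!i. i < r ==> P i Int W = {}"
   "!!i j. i < r ==> j < r ==> i ~= j ==> P i Int P j = {}" using WP(2) unfolding clpart_def by blast+
  have fP: "finite (P i)" "P i \<subseteq> V" if "i < r" for i using V(1) VP(2) that by (auto dest: finite_subset)
  have fW: "finite W" using V(1) VP(1) finite_subset by blast
  have pf: "pfree l (P i)" if "i < r" for i
   by (rule class_pfree[OF WP(2) _ V(4) zr L1 that]) (use z0 in auto)
  have cnt: "(\<Sum>i<r. \<Sum>j\<in>{..<r} - {i}. real (mis (P i) (P j))) + (\<Sum>i<r. (real (card (P i)) - real (card V - card W) / r)\<^sup>2) <= c * n"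
   unfolding c_def n_def by (rule edge_count[OF WP(2) _ _ WP(1) pf V(6)]) (use r l in auto)
  have misb: "(\<Sum>j\<in>{..<r} - {i}. real (mis (P i) (P j))) <= c * n" if i: "i < r" for i
  proof -
   have "(\<Sum>j\<in>{..<r} - {i}. real (mis (P i) (P j))) <= (\<Sum>i<r. \<Sum>j\<in>{..<r} - {i}. real (mis (P i) (P j)))"
    by (rule member_le_sum[of i "{..<r}" "%i. \<Sum>j\<in>{..<r} - {i}. real (mis (P i) (P j))"]) (use i in "auto intro: sum_nonneg")
   moreover have "0 <= (\<Sum>i<r. (real (card (P i)) - real (card V - card W) / r)\<^sup>2)" by (rule sum_nonneg) simp
   ultimately show ?thesis using cnt by linarith
  qed
  have size: "\<bar>real (card (P i)) - real (card V - card W) / r\<bar> <= th * n / 2" if i: "i < r" for i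
  proof -
   have "(real (card (P i)) - real (card V - card W) / r)\<^sup>2 <= (\<Sum>i<r. (real (card (P i)) - real (card V - card W) / r)\<^sup>2)"
    by (rule member_le_sum[of i "{..<r}" "%i. (real (card (P i)) - real (card V - card W) / r)\<^sup>2"]) (use i in auto)
   moreover have "0 <= (\<Sum>i<r. \<Sum>j\<in>{..<r} - {i}. real (mis (P i) (P j)))" by (intro sum_nonneg) auto
   ultimately have "(real (card (P i)) - real (card V - card W) / r)\<^sup>2 <= c * n" using cnt by linarith
   also have "... <= (th * n / 2)\<^sup>2"
   proof -
    have "4 * c * n <= th\<^sup>2 * n * n" using L5 n0 by (intro mult_right_mono) auto
    thus ?thesis by (simp add: power2_eq_square algebra_simps)
   qed
   finally show ?thesis using th(1) n0 by (metis abs_le_square_iff abs_of_nonneg divide_nonneg_pos mult_nonneg_nonneg less_imp_le zero_less_numeral)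
  qed
  define k where "k = nat \<lceil>ka * n\<rceil>"
  have k: "ka * n <= k" "real k <= ka * n + 1" unfolding k_def using ka(1) n0 by (auto simp: of_nat_ceiling)
  \<comment> \<open>The classes \<open>0\<close> and \<open>1\<close> suffice: two classes with
    large matchings give \<open>F2\<close>.\<close>
  have "\<exists>\<rho><r. ~ hasmat k (P \<rho>)"
  proof (rule ccontr)
   assume "~ ?thesis"
   hence h: "hasmat k (P 0)" "hasmat k (P 1)" using r by auto
   have "real (mis (P 0) (P 1)) <= (\<Sum>j\<in>{..<r} - {0}. real (mis (P 0) (P j)))"
    by (rule member_le_sum[of 1 "{..<r} - {0}" "%j. real (mis (P 0) (P j))"]) (use r in auto)
   also have "... <= c * n" by (rule misb) (use r in simp)
   finally have mm: "real (mis (P 0) (P 1)) <= c * n" .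
   have "forb2 r m V"
    by (rule two_matchings[OF WP(2) _ _ L2 _ _ _ h ka(1) k(1)[unfolded n_def] mm[unfolded n_def] c0 L3[unfolded n_def]])
      (use z0 zr[of "2 * m + m"] r in auto)
   thus False using V(5) by simp
  qed
  then obtain \<rho> where \<rho>: "\<rho> < r" "~ hasmat k (P \<rho>)" by blast
  obtain C where C: "C \<subseteq> P \<rho>" "card C <= 2 * k" "sep (P \<rho> - C) (P \<rho> - C)" using no_match_cover[OF fP(1)[OF \<rho>(1)] \<rho>(2)] by blast
  have cC: "real (card C) <= 3 * ka * n" using C(2) k(2) L4 by linarith
  have fC: "finite C" using C(1) fP[OF \<rho>(1)] finite_subset by blast
  define O' where "O' = (\<Union>j\<in>{..<r} - {\<rho>}. P j)"
  define I where "I = P \<rho> - C"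
  define I' where "I' = {u\<in>I. ms u O' <= \<tau>}"
  have fI: "finite I" "finite I'" "I' \<subseteq> I" using fP[OF \<rho>(1)] by (auto simp: I_def I'_def)
  define \<phi> where "\<phi> = (%u. (nb u C, nb u W))"
  have patt: "card (\<phi> ` I') <= ((2 ^ l + l) * card C + 1) * 2 ^ K"
  proof -
   have "\<phi> ` I' \<subseteq> (insert {} ((%u. nb u C) ` I - {{}})) \<times> Pow W" using fI(3) by (auto simp: \<phi>_def)
   hence "card (\<phi> ` I') <= card ((insert {} ((%u. nb u C) ` I - {{}})) \<times> Pow W)" by (rule card_mono[rotated]) (use fI fW in auto)
   also have "... = card (insert {} ((%u. nb u C) ` I - {{}})) * card (Pow W)" by (rule card_cartesian_product)
   also have "... <= ((2 ^ l + l) * card C + 1) * 2 ^ K"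
   proof (rule mult_le_mono)
    have "card (insert {} ((%u. nb u C) ` I - {{}})) = Suc (card ((%u. nb u C) ` I - {{}}))" by (rule card_insert_disjoint) (use fI in auto)
    moreover have "card ((%u. nb u C) ` I - {{}}) <= (2 ^ l + l) * card C"
     by (rule few_nbhds[OF fC fI(1)]) (use C(1) pf[OF \<rho>(1)] in "auto simp: I_def Un_absorb1")
    ultimately show "card (insert {} ((%u. nb u C) ` I - {{}})) <= (2 ^ l + l) * card C + 1" by linarith
    show "card (Pow W) <= 2 ^ K" using WP(1) by (simp add: card_Pow[OF fW])
   qed
   finally show ?thesis .
  qed
  obtain \<L> where \<L>': "finite \<L>" "\<forall>L\<in>\<L>. L \<subseteq> I' & card L = N & (\<forall>u\<in>L. \<forall>v\<in>L. \<phi> u = \<phi> v)"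
   "\<forall>L\<in>\<L>. \<forall>L'\<in>\<L>. L ~= L' --> L Int L' = {}" "card (I' - \<Union>\<L>) <= N * (((2 ^ l + l) * card C + 1) * 2 ^ K)"
   using bundles[OF fI(2) N patt] by (elim exE conjE)
  have \<L>: "finite \<L>" "!!L. L\<in>\<L> ==> L \<subseteq> I' & card L = N & (\<forall>u\<in>L. \<forall>v\<in>L. \<phi> u = \<phi> v)"
   "!!L L'. L\<in>\<L> ==> L'\<in>\<L> ==> L ~= L' ==> L Int L' = {}" "card (I' - \<Union>\<L>) <= N * (((2 ^ l + l) * card C + 1) * 2 ^ K)"
   by (rule \<L>'(1), erule bspec[OF \<L>'(2)], use \<L>'(3) in blast, rule \<L>'(4))
  have IO: "real (card (I - I')) <= k1 * n"
  proof -
   have "real (card (I - I')) * \<tau> = (\<Sum>u\<in>I - I'. real \<tau>)" by simp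
   also have "... <= (\<Sum>u\<in>I - I'. real (ms u O'))" by (rule sum_mono) (auto simp: I'_def)
   also have "... <= (\<Sum>u\<in>P \<rho>. real (ms u O'))" by (rule sum_mono2) (use fP[OF \<rho>(1)] in "auto simp: I_def")
   also have "... <= (\<Sum>u\<in>P \<rho>. \<Sum>j\<in>{..<r} - {\<rho>}. real (ms u (P j)))"
   proof (rule sum_mono)
    fix u
    have "{x\<in>O'. ~ E u x} = (\<Union>j\<in>{..<r} - {\<rho>}. {x\<in>P j. ~ E u x})" by (auto simp: O'_def)
    hence "ms u O' <= (\<Sum>j\<in>{..<r} - {\<rho>}. ms u (P j))" unfolding ms_def by (simp add: card_UN_le)
    thus "real (ms u O') <= (\<Sum>j\<in>{..<r} - {\<rho>}. real (ms u (P j)))" by (simp flip: of_nat_sum)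
   qed
   also have "... = (\<Sum>j\<in>{..<r} - {\<rho>}. real (mis (P \<rho>) (P j)))" unfolding mis_def of_nat_sum by (rule sum.swap)
   also have "... <= c * n" by (rule misb[OF \<rho>(1)])
   also have "... <= k1 * \<tau> * n" using tau(1) n0 by (intro mult_right_mono) auto
   finally have "real (card (I - I')) * \<tau> <= (k1 * n) * \<tau>" by (simp add: algebra_simps)
   thus ?thesis using tau(2) by simp
  qed
  have IL: "real (card (I' - \<Union>\<L>)) <= k1 * n"
  proof -
   have "real (card (I' - \<Union>\<L>)) <= real (N * (((2 ^ l + l) * card C + 1) * 2 ^ K))" using \<L>(4) by (simp only: of_nat_le_iff)
   also have "... = real (N * b) * card C + N * 2 ^ K" by (simp add: b_def algebra_simps)
   also have "real (N * b) * card C <= real (N * b) * (3 * ka * n)" using cC by (intro mult_left_mono) auto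
   also have "... = (ka * (6 * N * b)) * n / 2" by simp
   also have "... <= k1 * n / 2" using ka(2) n0 by (intro divide_right_mono mult_right_mono) auto
   finally show ?thesis using L6 by simp
  qed
  define L0 where "L0 = P \<rho> - C - \<Union>\<L>"
  have cL0: "real (card L0) <= 2 * k1 * n"
  proof -
   have "L0 \<subseteq> (I - I') Un (I' - \<Union>\<L>)" by (auto simp: L0_def I_def)
   hence "card L0 <= card ((I - I') Un (I' - \<Union>\<L>))" by (rule card_mono[rotated]) (use fI in auto)
   also have "... <= card (I - I') + card (I' - \<Union>\<L>)" by (rule card_Un_le)
   finally show ?thesis using IO IL by linarith
  qed
  \<comment> \<open>The class has about \<open>n / r\<close> vertices, and all but a small fraction
    of them are grouped into bundles of \<open>N\<close>.\<close>
  have cL: "n / (2 * r * N) <= card \<L>"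
  proof -
   have UI: "\<Union>\<L> \<subseteq> P \<rho> - C" using \<L>'(2) fI(3) unfolding I_def by blast
   have fL: "finite L" if "L \<in> \<L>" for L using \<L>(2)[OF that] fI(2) finite_subset by blast
   have "card (\<Union>\<L>) = (\<Sum>L\<in>\<L>. card L)"
    by (rule card_Union_disjoint) (use \<L>(3) fL in "auto simp: pairwise_def disjnt_def")
   hence cU: "card (\<Union>\<L>) = N * card \<L>" using \<L>(2) by simp
   have "P \<rho> = C Un L0 Un \<Union>\<L>" using C(1) UI by (auto simp: L0_def)
   hence "card (P \<rho>) <= card C + card L0 + card (\<Union>\<L>)" by (metis card_Un_le le_trans add_le_mono1)
   moreover have "\<bar>real (card (P \<rho>)) - n / r\<bar> <= z * n" using WP(2) \<rho>(1) unfolding clpart_def n_def by blast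
   moreover have "z * n <= (n / r) / 8" using mult_right_mono[OF z8(1), of n] n0 by simp
   moreover have "k1 * n <= (n / r) / 16" using mult_right_mono[OF k1(3), of n] n0 by simp
   moreover have "ka * 6 * n <= k1 * n" using ka2 n0 by (intro mult_right_mono) auto
   moreover have "0 < n / r" using n0 r by simp
   moreover define q where "q = n / r"
   ultimately have "q / 2 <= N * card \<L>"
    using cC cL0 cU unfolding q_def[symmetric] by linarith
   hence "n / r / 2 <= N * card \<L>" by (simp only: q_def)
   thus ?thesis using N r by (simp add: field_simps)
  qed
  have L0p: "0 < real (card \<L>)"
  proof -
   have "0 < n / (2 * r * N)" using n0 N r by simp
   thus ?thesis using cL by linarith
  qed
  have "\<exists>L\<in>\<L>. real (pe V V) <= pe (cn L V) (cn L V) + 2 * real (card (cn L V)) * card (V - cn L V) +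
   2 * (real (K + l) * card (P \<rho> - C - \<Union>\<L>) + real l * card C + z * l * (real (card V))\<^sup>2 / card \<L>) +
   2 * real (N * \<tau>) * (th * n + N * \<tau>) + real (2 * K * (K + card C + N * \<tau>) + l * card C + 2 * card C * (N * \<tau>) + (N * \<tau>)\<^sup>2)"
  proof (rule good_bundle[OF WP(2) _ \<rho>(1) _ WP(1) pf C(1,3) _ _ \<L>(1) _ N])
   show "real (card (P \<rho>)) - th * n <= card (P j)" if "j < r" for j using size[OF \<rho>(1)] size[OF that] by linarith
   show "L \<subseteq> P \<rho> - C & card L = N" if "L \<in> \<L>" for L using \<L>(2)[OF that] fI(3) by (auto simp: I_def)
   show "nb u (C Un W) = nb v (C Un W)" if "L \<in> \<L>" "u \<in> L" "v \<in> L" for L u v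
   proof -
    have "\<phi> u = \<phi> v" using \<L>(2)[OF that(1)] that by blast
    moreover have "nb x (C Un W) = nb x C Un nb x W" for x by auto
    ultimately show ?thesis by (simp add: \<phi>_def)
   qed
   show "ms u (\<Union>j\<in>{..<r} - {\<rho>}. P j) <= \<tau>" if "L \<in> \<L>" "u \<in> L" for L u using \<L>(2)[OF that(1)] that(2) by (auto simp: I'_def O'_def)
   show "L Int L' = {}" if "L \<in> \<L>" "L' \<in> \<L>" "L ~= L'" for L L' by (rule \<L>(3)[OF that])
   show "\<L> ~= {}" using L0p by auto
  qed (use z0 l th n0 in auto)
  then obtain L where L: "L \<in> \<L>" and Lb: "real (pe V V) <= pe (cn L V) (cn L V) + 2 * real (card (cn L V)) * card (V - cn L V) +
   2 * (real (K + l) * card L0 + real l * card C + z * l * n\<^sup>2 / card \<L>) +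
   2 * real (N * \<tau>) * (th * n + N * \<tau>) + real (2 * K * (K + card C + N * \<tau>) + l * card C + 2 * card C * (N * \<tau>) + (N * \<tau>)\<^sup>2)"
   unfolding L0_def n_def by blast
  have e1: "real (K + l) * card L0 <= \<delta> / 16 * n"
  proof -
   have "real (K + l) * card L0 <= real (K + l) * (2 * k1 * n)" using cL0 by (intro mult_left_mono) auto
   also have "... = k1 * (32 * (K + l)) * n / 16" by simp
   also have "... <= \<delta> * n / 16" using k1(2) n0 by (intro divide_right_mono mult_right_mono) auto
   finally show ?thesis by simp
  qed
  have e2: "real (2 * K + l + 2 * N * \<tau>) * card C <= \<delta> / 16 * n"
  proof -
   have "real (2 * K + l + 2 * N * \<tau>) * card C <= real (2 * K + l + 2 * N * \<tau>) * (3 * ka * n)" using cC by (intro mult_left_mono) auto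
   also have "... = ka * (48 * (2 * K + l + 2 * N * \<tau>)) * n / 16" by simp
   also have "... <= \<delta> * n / 16" using ka(3) n0 by (intro divide_right_mono mult_right_mono) auto
   finally show ?thesis by simp
  qed
  have e3: "real l * card C <= \<delta> / 16 * n"
  proof -
   have "real l * card C <= real (2 * K + l + 2 * N * \<tau>) * card C" by (intro mult_right_mono) auto
   thus ?thesis using e2 by linarith
  qed
  have e4: "z * l * n\<^sup>2 / card \<L> <= \<delta> / 16 * n"
  proof -
   have "z * l * n\<^sup>2 / card \<L> <= z * l * n\<^sup>2 / (n / (2 * r * N))"
    by (rule divide_left_mono[OF cL]) (use z0 n0 L0p r N in auto)
   also have "... = z * (32 * l * r * N) * n / 16" using n0 r N by (simp add: field_simps power2_eq_square)
   also have "... <= \<delta> * n / 16" using zz(2) n0 by (intro divide_right_mono mult_right_mono) auto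
   finally show ?thesis by simp
  qed
  have e5: "2 * real (N * \<tau>) * (th * n + N * \<tau>) <= \<delta> / 16 * n + \<delta> / 16 * n"
  proof -
   have "2 * real (N * \<tau>) * (th * n + N * \<tau>) = th * (64 * N * \<tau>) * n / 32 + 2 * (real (N * \<tau>))\<^sup>2"
    by (simp add: algebra_simps power2_eq_square)
   also have "... = \<delta> * n / 32 + 2 * (real (N * \<tau>))\<^sup>2" using th(2) by simp
   also have "... <= \<delta> * n / 32 + \<delta> / 16 * n" using L7 by simp
   also have "... <= \<delta> / 16 * n + \<delta> / 16 * n" using mult_pos_pos[OF d n0] by simp
   finally show ?thesis .
  qed
  have e6: "real (2 * K * (K + card C + N * \<tau>) + l * card C + 2 * card C * (N * \<tau>) + (N * \<tau>)\<^sup>2) <= \<delta> / 16 * n + \<delta> / 16 * n"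
  proof -
   have "2 * K * (K + card C + N * \<tau>) + l * card C + 2 * card C * (N * \<tau>) + (N * \<tau>)\<^sup>2 = (2 * K + l + 2 * N * \<tau>) * card C + (2 * K * (K + N * \<tau>) + (N * \<tau>)\<^sup>2)"
    by (simp add: algebra_simps)
   hence "real (2 * K * (K + card C + N * \<tau>) + l * card C + 2 * card C * (N * \<tau>) + (N * \<tau>)\<^sup>2) = real (2 * K + l + 2 * N * \<tau>) * card C + real (2 * K * (K + N * \<tau>) + (N * \<tau>)\<^sup>2)"
    by (simp only: of_nat_add of_nat_mult)
   thus ?thesis using e2 L8 by linarith
  qed
  have "2 * (real (K + l) * card L0 + real l * card C + z * l * n\<^sup>2 / card \<L>) +
   2 * real (N * \<tau>) * (th * n + N * \<tau>) + real (2 * K * (K + card C + N * \<tau>) + l * card C + 2 * card C * (N * \<tau>) + (N * \<tau>)\<^sup>2) <= 10 * (\<delta> / 16 * n)"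
   using e1 e3 e4 e5 e6 by argo
  also have "... <= \<delta> * n" using d n0 by simp
  finally have "real (pe V V) <= pe (cn L V) (cn L V) + 2 * real (card (cn L V)) * card (V - cn L V) + \<delta> * card V"
   using Lb unfolding n_def by argo
  moreover have "L \<subseteq> V" "card L = N" using \<L>(2)[OF L] fI(3) fP(2)[OF \<rho>(1)] by (auto simp: I_def)
  ultimately show "\<exists>L. L \<subseteq> V & card L = N & real (pe V V) <= pe (cn L V) (cn L V) + 2 * real (card (cn L V)) * card (V - cn L V) + \<delta> * card V"
   by blast
 qed
qed

section \<open>The gap theorem\<close>

text \<open>The quadratic part on the left is maximal at \<open>y = (1 - 1 / r) * n\<close>, where
  it equals that on the right. The deviation \<open>z\<close> from this point costs a multiple of
  its square, which absorbs the linear term up to the square of \<open>\<sigma>\<close>.\<close>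

lemma turan_step_algebra:
 fixes n y r \<sigma> :: real
 assumes "2 <= r" "0 <= \<sigma>"
 shows "(1 - 1 / (r - 1)) * y\<^sup>2 + \<sigma> * y / (r - 1) + 2 * y * (n - y) <= (1 - 1 / r) * n\<^sup>2 + \<sigma> * n / r + \<sigma>\<^sup>2"
proof -
 define z where "z = y - (1 - 1 / r) * n"
 have r1: "r - 1 ~= 0" "r ~= 0" "0 < r - 1" using assms by auto
 have y: "y = z + (1 - 1 / r) * n" by (simp add: z_def)
 have a: "(1 - 1 / (r - 1)) * y\<^sup>2 + 2 * y * (n - y) = 2 * y * n - (r / (r - 1)) * y\<^sup>2"
  using r1 by (simp add: field_simps power2_eq_square)
 have b: "2 * y * n - (r / (r - 1)) * y\<^sup>2 = (1 - 1 / r) * n\<^sup>2 - (r / (r - 1)) * z\<^sup>2"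
 proof -
  have e: "r / (r - 1) * (1 - 1 / r) = 1" using r1 by (simp add: field_simps)
  have "(r / (r - 1)) * y\<^sup>2 = (r / (r - 1)) * z\<^sup>2 + 2 * z * n * (r / (r - 1) * (1 - 1 / r)) + (r / (r - 1) * (1 - 1 / r)) * (1 - 1 / r) * n\<^sup>2"
  proof -
   have "u * (z + v * n)\<^sup>2 = u * z\<^sup>2 + 2 * z * n * (u * v) + (u * v) * v * n\<^sup>2" for u v :: real
    by (simp add: power2_eq_square algebra_simps)
   thus ?thesis unfolding y .
  qed
  also have "... = (r / (r - 1)) * z\<^sup>2 + 2 * z * n + (1 - 1 / r) * n\<^sup>2" unfolding e by simp
  finally have "(r / (r - 1)) * y\<^sup>2 = (r / (r - 1)) * z\<^sup>2 + 2 * z * n + (1 - 1 / r) * n\<^sup>2" .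
  moreover have "2 * y * n = 2 * z * n + 2 * ((1 - 1 / r) * n\<^sup>2)" unfolding y by (simp add: power2_eq_square algebra_simps)
  ultimately show ?thesis by linarith
 qed
 have c: "\<sigma> * y / (r - 1) = \<sigma> * n / r + \<sigma> * z / (r - 1)"
  unfolding y using r1 by (simp add: field_simps)
 have d: "\<sigma> * z / (r - 1) - (r / (r - 1)) * z\<^sup>2 <= \<sigma>\<^sup>2"
 proof -
  have "0 <= (\<sigma> - z)\<^sup>2 + \<sigma> * \<sigma> * (r - 2) + z\<^sup>2 * (r - 1) + \<sigma> * z"
   if "0 <= z" using that assms by (intro add_nonneg_nonneg mult_nonneg_nonneg) auto
  moreover have "\<sigma> * z <= r * z\<^sup>2 + \<sigma>\<^sup>2 * (r - 1)"
  proof (cases "0 <= z")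
   case True
   have "2 * (\<sigma> * z) <= \<sigma>\<^sup>2 + z\<^sup>2" using sum_squares_bound[of \<sigma> z] by (simp add: power2_eq_square)
   moreover have "1 * z\<^sup>2 <= r * z\<^sup>2" "1 * \<sigma>\<^sup>2 <= (r - 1) * \<sigma>\<^sup>2" using assms by (intro mult_right_mono; simp)+
   moreover have "0 <= \<sigma> * z" using True assms by simp
   ultimately show ?thesis by (simp add: algebra_simps)
  next
   case False
   hence "\<sigma> * z <= 0" using assms by (intro mult_nonneg_nonpos) auto
   moreover have "0 <= r * z\<^sup>2" "0 <= \<sigma>\<^sup>2 * (r - 1)" using assms by auto
   ultimately show ?thesis by linarith
  qed
  ultimately have "\<sigma> * z <= r * z\<^sup>2 + \<sigma>\<^sup>2 * (r - 1)" by blast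
  hence "(\<sigma> * z - r * z\<^sup>2) / (r - 1) <= \<sigma>\<^sup>2" using r1 by (simp add: pos_divide_le_eq)
  thus ?thesis by (simp add: diff_divide_distrib)
 qed
 show ?thesis using a b c d by linarith
qed

text \<open>A smallest set beyond the bound satisfies \<open>mindeg\<close>, because removing one
  vertex lowers the bound by about \<open>2 * (1 - 1 / r) * n\<close>. So a bundle \<open>L\<close>
  can be split off, and the bound for one part less on its common neighbourhood contradicts the
  surplus. Only the small \<open>\<delta>\<close> is lost in the linear term.\<close>

lemma gap_step:
 fixes r l m N :: nat and \<sigma> \<delta> C :: real
 assumes r: "2 <= r" and l: "3 <= l" and N: "0 < N" and d: "0 < \<delta>" and s: "0 <= \<sigma>" and C: "0 <= C"
  and G: "!!V. finite V ==> G V ==> real (pe V V) <= (1 - 1 / (real r - 1)) * (real (card V))\<^sup>2 + \<sigma> * card V / (real r - 1) + C"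
  and H: "!!S V. H V ==> S \<subseteq> V ==> H S" "!!V. H V ==> ~ forb1 r l m V & ~ forb2 r m V"
   "!!L V. finite V ==> H V ==> L \<subseteq> V ==> card L = N ==> G (cn L V)"
 shows "\<exists>C'\<ge>0. \<forall>V. finite V --> H V -->
  real (pe V V) <= (1 - 1 / real r) * (real (card V))\<^sup>2 + (\<sigma> + \<delta>) * card V / real r + C'"
proof -
 obtain n0 where n0: "\<forall>V. finite V --> n0 <= card V --> mindeg r V --> ~ forb1 r l m V --> ~ forb2 r m V -->
   (1 - 1 / r) * (real (card V))\<^sup>2 <= pe V V -->
   (\<exists>L. L \<subseteq> V & card L = N & real (pe V V) <= pe (cn L V) (cn L V) + 2 * real (card (cn L V)) * card (V - cn L V) + \<delta> / r * card V)"
  using split_off[OF r l N, of "\<delta> / r" m] d r by auto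
 \<comment> \<open>The square of \<open>\<sigma>\<close> comes from
   \<open>turan_step_algebra\<close>; the square of \<open>n0\<close> covers sets too small for
   \<open>split_off\<close>.\<close>
 define C' where "C' = C + \<sigma>\<^sup>2 + (real n0)\<^sup>2"
 have C'0: "0 <= C'" using C by (simp add: C'_def)
 define B where "B = (%n::real. (1 - 1 / real r) * n\<^sup>2 + (\<sigma> + \<delta>) * n / real r + C')"
 have r1: "0 <= 1 - 1 / real r" "0 < real r" using r by auto
 have "real (pe V V) <= B (card V)" if "finite V" "H V" for V
  using that
 proof (induction "card V" arbitrary: V rule: less_induct)
  case less
  define n where "n = real (card V)"
  have nn: "0 <= (\<sigma> + \<delta>) * n / real r" "0 <= (1 - 1 / real r) * n\<^sup>2" using s d r1 by (auto simp: n_def)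
  show ?case
  proof (cases "n0 <= card V")
   case False
   have "pe V V <= card V * card V" by (rule pe_le) (use less in auto)
   also have "... <= n0 * n0" using False by (intro mult_le_mono) auto
   finally have "real (pe V V) <= real (n0 * n0)" by (simp only: of_nat_le_iff)
   also have "... <= C'" using C by (simp add: C'_def power2_eq_square)
   finally show ?thesis using nn by (simp add: B_def n_def)
  next
   case True
   show ?thesis
   proof (rule ccontr)
    assume "~ ?thesis"
    hence big: "B n < real (pe V V)" by (simp add: n_def)
    have f: "~ forb1 r l m V" "~ forb2 r m V" using H(2)[OF less.prems(2)] by auto
    have e: "(1 - 1 / r) * (real (card V))\<^sup>2 <= pe V V" using big nn C'0 unfolding B_def n_def by linarith
    have "mindeg r V" unfolding mindeg_def
    proof
     fix v assume v: "v \<in> V"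
     have cv: "card (V - {v}) < card V" using v less.prems(1) by (meson card_Diff1_less)
     have cv1: "real (card (V - {v})) = n - 1" using v less.prems(1) card_gt_0_iff[of V] by (auto simp: n_def of_nat_diff Suc_le_eq)
     have "real (pe (V - {v}) (V - {v})) <= B (n - 1)"
      using less.hyps[OF cv] less.prems(1) H(1)[OF less.prems(2), of "V - {v}"] cv1 by auto
     moreover have "real (pe V V) = real (pe (V - {v}) (V - {v})) + 2 * real (dg v V)"
      using pe_delete[OF less.prems(1) v] by simp
     moreover have "B n - B (n - 1) = (1 - 1 / r) * (2 * n - 1) + (\<sigma> + \<delta>) / r"
      by (simp add: B_def power2_eq_square algebra_simps diff_divide_distrib add_divide_distrib)
     moreover have "0 <= (\<sigma> + \<delta>) / r" using s d by simp
     ultimately have "(1 - 1 / r) * (2 * n - 1) <= 2 * real (dg v V)" using big by linarith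
     moreover have "(1 - 1 / r) * (2 * n - 1) = 2 * ((1 - 1 / r) * n) - (1 - 1 / r)" by (simp add: algebra_simps)
     moreover have "1 - 1 / real r <= 1" by simp
     ultimately show "(1 - 1 / r) * card V - 1 <= real (dg v V)" unfolding n_def[symmetric] by linarith
    qed
    then obtain L where L: "L \<subseteq> V" "card L = N"
     "real (pe V V) <= pe (cn L V) (cn L V) + 2 * real (card (cn L V)) * card (V - cn L V) + \<delta> / r * card V"
     using n0 less.prems(1) True f e by blast
    define y where "y = real (card (cn L V))"
    have fc: "finite (cn L V)" "cn L V \<subseteq> V" using less.prems(1) by (auto simp: cn_def)
    have "real (card (V - cn L V)) = n - y"
     using card_Diff_subset[OF fc] card_mono[OF less.prems(1) fc(2)] by (simp add: n_def y_def of_nat_diff)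
    hence "real (pe V V) <= ((1 - 1 / (real r - 1)) * y\<^sup>2 + \<sigma> * y / (real r - 1) + C) + 2 * y * (n - y) + \<delta> / r * n"
     using L(3) G[OF fc(1) H(3)[OF less.prems L(1,2)]] unfolding y_def n_def by simp
    also have "... <= (1 - 1 / r) * n\<^sup>2 + \<sigma> * n / r + \<sigma>\<^sup>2 + C + \<delta> / r * n"
     using turan_step_algebra[of r \<sigma> y n] r s by simp
    also have "... <= B n" using C by (simp add: B_def C'_def algebra_simps add_divide_distrib)
    finally show False using big by simp
   qed
  qed
 qed
 thus ?thesis unfolding B_def using C'0 by blast
qed

text \<open>The clique core; \<open>forbS\<close> is the hub core with hubs \<open>X\<close>,
  possible for even \<open>l\<close> only.\<close>

definition forbK :: "nat => nat => nat => nat => 'a set => bool" where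
 "forbK r l N k V \<longleftrightarrow> (\<exists>S i0. i0 < r & blow r S V & hasJK l N (S i0) & (\<forall>i<r. i ~= i0 --> k <= card (S i)))"
definition forbS :: "nat => nat => nat => 'a set => bool" where
 "forbS r l M V \<longleftrightarrow> (\<exists>S X. blow r S V & (\<forall>i<r. M <= card (S i)) & finite X & X \<subseteq> V & 2 * card X + 2 = l & (\<forall>i<r. cmpl X (S i)))"

definition bad :: "nat => nat => nat => nat => nat => 'a set => bool" where
 "bad r l m N k V \<longleftrightarrow> forb1 r l m V \<or> (2 <= r & forb2 r m V) \<or> forbK r l N k V \<or> forbS r l k V"

lemma blow_extend:
 assumes "blow r S (cn L V)" "L \<subseteq> V" "finite L"
 shows "blow (Suc r) (S(r := L)) V"
proof -
 have c: "cmpl (S i) L" if "i < r" for i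
  using assms(1) that cmpl_sym[OF cmpl_mono[OF cmpl_cn[of L V], of L "S i"]] by (auto simp: blow_def)
 show ?thesis unfolding blow_def
 proof (intro conjI allI impI)
  fix i assume i: "i < Suc r"
  show "(S(r := L)) i \<subseteq> V" "finite ((S(r := L)) i)"
   using assms i cn_subset[of L V] by (auto simp: blow_def less_Suc_eq)
  fix j assume j: "j < Suc r" "i ~= j"
  show "cmpl ((S(r := L)) i) ((S(r := L)) j)"
   using assms(1) i j c[of i] cmpl_sym[OF c[of j]] by (auto simp: blow_def less_Suc_eq)
 qed
qed

lemma bad_mono: "bad r l m N k S ==> S \<subseteq> V ==> bad r l m N k V"
proof -
 assume b: "bad r l m N k S" and s: "S \<subseteq> V"
 have bl: "blow r X S ==> blow r X V" for X using s by (auto simp: blow_def)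
 consider "forb1 r l m S" | "2 <= r" "forb2 r m S" | "forbK r l N k S" | "forbS r l k S" using b by (auto simp: bad_def)
 thus "bad r l m N k V"
 proof cases
  case 1 thus ?thesis using bl unfolding bad_def forb1_def by blast
 next
  case 2 thus ?thesis using bl unfolding bad_def forb2_def by blast
 next
  case 3 thus ?thesis using bl unfolding bad_def forbK_def by blast
 next
  case 4
  then obtain X Y where "blow r X S" "\<forall>i<r. k <= card (X i)" "finite Y & 2 * card Y + 2 = l & (\<forall>i<r. cmpl Y (X i))" "Y \<subseteq> S"
   unfolding forbS_def by blast
  moreover have "Y \<subseteq> V" using \<open>Y \<subseteq> S\<close> s by blast
  ultimately have "forbS r l k V" unfolding forbS_def using bl by blast
  thus ?thesis by (simp add: bad_def)
 qed
qed

text \<open>\<open>L\<close> is one more part for any blow-up inside its common neighbourhood, so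
  every excluded structure found there lifts from \<open>r\<close> to \<open>Suc r\<close> parts.
  Hubs inside \<open>cn L V\<close> are joined to \<open>L\<close> as well.\<close>

lemma bad_extend:
 assumes V: "finite V" and L: "L \<subseteq> V" "card L = K" "m <= K" "k <= K" "0 < r" and b: "bad r l m N k (cn L V)"
 shows "bad (Suc r) l m N k V"
proof -
 have fL: "finite L" using L V finite_subset by blast
 consider "forb1 r l m (cn L V)" | "2 <= r" "forb2 r m (cn L V)" | "forbK r l N k (cn L V)" | "forbS r l k (cn L V)" using b by (auto simp: bad_def)
 thus ?thesis
 proof cases
  case 1
  then obtain S i0 where S: "i0 < r" "blow r S (cn L V)" "\<forall>i<r. i ~= i0 --> m <= card (S i)" "l + m <= card (S i0)" "~ pfree l (S i0)"
   unfolding forb1_def by blast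
  have "forb1 (Suc r) l m V" unfolding forb1_def
   by (rule exI[of _ "S(r := L)"], rule exI[of _ i0]) (use S blow_extend[OF S(2) L(1) fL] L in "auto simp: less_Suc_eq")
  thus ?thesis by (simp add: bad_def)
 next
  case 2
  then obtain S i0 i1 where S: "i0 < r" "i1 < r" "i0 ~= i1" "blow r S (cn L V)" "\<forall>i<r. m <= card (S i)" "hasmat m (S i0)" "hasmat m (S i1)"
   unfolding forb2_def by blast
  have "forb2 (Suc r) m V" unfolding forb2_def
   by (rule exI[of _ "S(r := L)"], rule exI[of _ i0], rule exI[of _ i1]) (use S blow_extend[OF S(4) L(1) fL] L in "auto simp: less_Suc_eq")
  thus ?thesis using 2 by (simp add: bad_def)
 next
  case 3
  then obtain S i0 where S: "i0 < r" "blow r S (cn L V)" "hasJK l N (S i0)" "\<forall>i<r. i ~= i0 --> k <= card (S i)"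
   unfolding forbK_def by blast
  have "forbK (Suc r) l N k V" unfolding forbK_def
   by (rule exI[of _ "S(r := L)"], rule exI[of _ i0]) (use S blow_extend[OF S(2) L(1) fL] L in "auto simp: less_Suc_eq")
  thus ?thesis by (simp add: bad_def)
 next
  case 4
  then obtain S X where S: "blow r S (cn L V)" "\<forall>i<r. k <= card (S i)" "finite X" "X \<subseteq> cn L V" "2 * card X + 2 = l" "\<forall>i<r. cmpl X (S i)"
   unfolding forbS_def by blast
  have "cmpl X L" by (rule cmpl_sym, rule cmpl_mono[OF cmpl_cn _ S(4)]) simp
  hence "forbS (Suc r) l k V" unfolding forbS_def
   by (intro exI[of _ "S(r := L)"] exI[of _ X]) (use S blow_extend[OF S(1) L(1) fL] L cn_subset[of L V] in "auto simp: less_Suc_eq")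
  thus ?thesis by (simp add: bad_def)
 qed
qed

text \<open>The base case saves \<open>1 / B\<close> per vertex. Each of the \<open>r - 1\<close>
  steps gives back \<open>e = 1 / (2 * B * r)\<close>, so at least half of the saving
  remains.\<close>

theorem gap:
 fixes r l m N k :: nat
 assumes l: "3 <= l" and r: "1 <= r"
 shows "\<exists>g>0. \<exists>C. \<forall>V. finite V --> ~ bad r l m N k V -->
   real (pe V V) <= (1 - 1 / real r) * (real (card V))\<^sup>2 + (real l - 2 - g) * card V / real r + C"
proof -
 obtain B C where B: "0 < B" "\<forall>V. finite V --> pfree l V --> ~ hasJK l N V --> ~ hasKt l k V -->
   B * pe V V + card V <= B * (l - 2) * card V + C" using base_gap[OF l] by blast
 define s0 where "s0 = real l - 2 - 1 / B"
 have B1: "1 / real B <= 1" using B(1) by simp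
 have s0: "0 <= s0" using l B1 by (simp add: s0_def)
 define e where "e = 1 / (2 * real B * r)"
 have e0: "0 < e" using B(1) r by (simp add: e_def)
 have lev: "\<exists>C\<ge>0. \<forall>V. finite V --> ~ bad j l m N k V -->
   real (pe V V) <= (1 - 1 / real j) * (real (card V))\<^sup>2 + (s0 + (real j - 1) * e) * card V / real j + C" if "1 <= j" for j
  using that
 proof (induction j rule: nat_induct_at_least)
  case base
  define C1 where "C1 = real C + (real (l + m))\<^sup>2"
  have "real (pe V V) <= s0 * card V + C1" if V: "finite V" "~ bad 1 l m N k V" for V
  proof (cases "l + m <= card V")
   case False
   have "pe V V <= card V * card V" by (rule pe_le) (use V in auto)
   also have "... <= (l + m) * (l + m)" using False by (intro mult_le_mono) auto
   finally have "real (pe V V) <= real ((l + m) * (l + m))" by (simp only: of_nat_le_iff)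
   also have "... = (real (l + m))\<^sup>2" by (simp add: power2_eq_square)
   finally have "real (pe V V) <= C1" by (simp add: C1_def)
   moreover have "0 <= s0 * card V" using s0 by simp
   ultimately show ?thesis by linarith
  next
   case True
   have bl: "blow 1 (%_. S) V" if "S \<subseteq> V" for S using that V(1) finite_subset by (auto simp: blow_def)
   have "pfree l V"
   proof (rule ccontr)
    assume "~ pfree l V"
    hence "forb1 1 l m V" unfolding forb1_def using bl[of V] True by (intro exI[of _ "%_. V"] exI[of _ 0]) auto
    thus False using V(2) by (simp add: bad_def)
   qed
   moreover have "~ hasJK l N V"
   proof
    assume "hasJK l N V"
    hence "forbK 1 l N k V" unfolding forbK_def using bl[of V] by (intro exI[of _ "%_. V"] exI[of _ 0]) auto
    thus False using V(2) by (simp add: bad_def)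
   qed
   moreover have "~ hasKt l k V"
   proof
    assume "hasKt l k V"
    then obtain X Y where XY: "X \<subseteq> V" "Y \<subseteq> V" "finite Y" "cmpl X Y" "2 * card X + 2 = l" "finite X" "card Y = k"
     unfolding hasKt_def by blast
    have "forbS 1 l k V" unfolding forbS_def
     by (rule exI[of _ "%_. Y"], rule exI[of _ X]) (use XY bl[of Y] in auto)
    thus False using V(2) by (simp add: bad_def)
   qed
   ultimately have "B * pe V V + card V <= B * (l - 2) * card V + C" using B(2) V(1) by blast
   hence "real (B * pe V V + card V) <= real (B * (l - 2) * card V + C)" by (simp only: of_nat_le_iff)
   hence "real B * real (pe V V) + card V <= real B * (real l - 2) * card V + C" using l by (simp add: of_nat_diff)
   hence "real (pe V V) <= (real B * (real l - 2) * card V + C - card V) / B" using B(1) by (simp add: field_simps)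
   also have "... = s0 * card V + C / B" using B(1) by (simp add: s0_def field_simps)
   also have "C / B <= C / 1" using B(1) by (intro divide_left_mono) auto
   finally have "real (pe V V) <= s0 * card V + C" by simp
   moreover have "0 <= (real (l + m))\<^sup>2" by simp
   ultimately show ?thesis unfolding C1_def by linarith
  qed
  moreover have "0 <= C1" by (simp add: C1_def)
  ultimately show ?case by (intro exI[of _ C1]) auto
 next
  case (Suc j)
  obtain C1 where C1: "0 <= C1" "\<forall>V. finite V --> ~ bad j l m N k V -->
   real (pe V V) <= (1 - 1 / real j) * (real (card V))\<^sup>2 + (s0 + (real j - 1) * e) * card V / real j + C1" using Suc.IH by blast
  have "\<exists>C'\<ge>0. \<forall>V. finite V --> ~ bad (Suc j) l m N k V -->
   real (pe V V) <= (1 - 1 / real (Suc j)) * (real (card V))\<^sup>2 + ((s0 + (real j - 1) * e) + e) * card V / real (Suc j) + C'"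
  \<comment> \<open>The bundle becomes a part of every structure in \<open>bad\<close>, so it needs
    \<open>m\<close> and \<open>k\<close> vertices; the \<open>+ 1\<close> keeps it
    nonempty.\<close>
  proof (rule gap_step[where G="%V. ~ bad j l m N k V" and N="max m k + 1" and C=C1 and m=m, OF _ l _ e0 _ C1(1)])
   show "0 <= s0 + (real j - 1) * e" using s0 e0 Suc.hyps by simp
   show "~ bad (Suc j) l m N k S" if "~ bad (Suc j) l m N k V" "S \<subseteq> V" for S V using bad_mono that by blast
   show "~ forb1 (Suc j) l m V & ~ forb2 (Suc j) m V" if "~ bad (Suc j) l m N k V" for V
    using that Suc.hyps by (auto simp: bad_def)
   show "~ bad j l m N k (cn L V)" if "finite V" "~ bad (Suc j) l m N k V" "L \<subseteq> V" "card L = max m k + 1" for L V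
   proof -
    have "m <= max m k + 1" "k <= max m k + 1" by linarith+
    thus ?thesis using bad_extend[OF that(1,3,4), of m k j l N] that(2) Suc.hyps by auto
   qed
  qed (use C1(2) Suc.hyps in auto)
  moreover have "s0 + (real j - 1) * e + e = s0 + (real (Suc j) - 1) * e" by (simp add: algebra_simps)
  ultimately show ?case by simp
 qed
 obtain C1 where C1: "0 <= C1" "\<forall>V. finite V --> ~ bad r l m N k V -->
   real (pe V V) <= (1 - 1 / real r) * (real (card V))\<^sup>2 + (s0 + (real r - 1) * e) * card V / real r + C1" using lev[OF r] by blast
 define g where "g = 1 / (2 * real B)"
 have sg: "s0 + (real r - 1) * e <= real l - 2 - g"
 proof -
  have "(real r - 1) * e <= real r * e" using e0 by simp
  also have "real r * e = g" using r by (simp add: e_def g_def)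
  finally show ?thesis by (simp add: s0_def g_def)
 qed
 show ?thesis
 proof (rule exI[of _ g], intro conjI exI[of _ C1] allI impI)
  show "0 < g" using B(1) by (simp add: g_def)
  fix V assume V: "finite V" "~ bad r l m N k V"
  have "(s0 + (real r - 1) * e) * card V / real r <= (real l - 2 - g) * card V / real r"
   using sg by (intro divide_right_mono mult_right_mono) auto
  thus "real (pe V V) <= (1 - 1 / real r) * (real (card V))\<^sup>2 + (real l - 2 - g) * card V / real r + C1"
   using C1(2) V by fastforce
 qed
qed

section \<open>Cores force good colourings\<close>

definition forb3 :: "nat => nat => nat => 'a set => bool" where
 "forb3 r l m V \<longleftrightarrow> (\<exists>S i0 i1 Q Q' u v. i0 < r & i1 < r & i0 ~= i1 & blow r S V & (\<forall>i<r. m <= card (S i)) &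
   Q \<subseteq> S i0 & Q' \<subseteq> S i0 & Q Int Q' = {} & clique Q & clique Q' & card Q = l - 1 & card Q' = l - 1 &
   2 * (l - 1) + m <= card (S i0) & u \<in> S i1 & v \<in> S i1 & E u v & m + 2 <= card (S i1))"
definition forb4 :: "nat => nat => nat => 'a set => bool" where
 "forb4 r l m V \<longleftrightarrow> (\<exists>S i0 i1 Q Q'. i0 < r & i1 < r & i0 ~= i1 & blow r S V & (\<forall>i<r. m <= card (S i)) &
   Q \<subseteq> S i0 & Q' \<subseteq> S i1 & clique Q & clique Q' & card Q = l - 1 & card Q' = l - 1 &
   l - 1 + m <= card (S i0) & l - 1 + m <= card (S i1))"

text \<open>Colour \<open>0\<close> is the class of the graph \<open>H\<close>, the other colours are the parts of the Turan graph.\<close>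

definition gcol :: "nat => nat => 'a set => ('a => nat) => bool" where
 "gcol r l V c \<longleftrightarrow> (\<forall>v\<in>V. c v < r) & (\<forall>u\<in>V. \<forall>v\<in>V. E u v & c u = c v --> c u = 0) & pfree l {v\<in>V. c v = 0}"

section \<open>Edges at a clique core\<close>

text \<open>Used for the degrees of one vertex into the \<open>r\<close> parts of a core. A vertex
  missing one part can reach \<open>(r - 1) * k\<close> only by seeing the others fully; by
  \<open>sum_two_small\<close>, one that is poor in two parts stays strictly below.\<close>

lemma sum_one_zero:
 fixes d :: "nat => nat"
 assumes "!!i. i < r ==> d i <= k" "i0 < r" "d i0 = 0"
 shows "(\<Sum>i<r. d i) <= (r - 1) * k" "(\<Sum>i<r. d i) = (r - 1) * k ==> j < r ==> j ~= i0 ==> d j = k"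
proof -
 have s: "(\<Sum>i<r. d i) = (\<Sum>i\<in>{..<r} - {i0}. d i)" using sum.remove[of "{..<r}" i0 d] assms(2,3) by simp
 have c: "(\<Sum>i\<in>{..<r} - {i0}. k) = (r - 1) * k" using assms(2) by simp
 show a: "(\<Sum>i<r. d i) <= (r - 1) * k" unfolding s c[symmetric] by (rule sum_mono) (use assms(1) in auto)
 assume e: "(\<Sum>i<r. d i) = (r - 1) * k" and j: "j < r" "j ~= i0"
 show "d j = k"
  by (rule sum_mono_inv[of d "{..<r} - {i0}" "%_. k"]) (use e s c assms(1) j in auto)
qed

lemma sum_two_small:
 fixes d :: "nat => nat"
 assumes "!!i. i < r ==> d i <= k" "a < r" "b < r" "a ~= b" "d a + d b < k"
 shows "(\<Sum>i<r. d i) < (r - 1) * k"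
proof -
 have "(\<Sum>i<r. d i) = d a + (d b + (\<Sum>i\<in>{..<r} - {a} - {b}. d i))"
  using sum.remove[of "{..<r}" a d] sum.remove[of "{..<r} - {a}" b d] assms(2-4) by simp
 also have "(\<Sum>i\<in>{..<r} - {a} - {b}. d i) <= (\<Sum>i\<in>{..<r} - {a} - {b}. k)" by (rule sum_mono) (use assms(1) in auto)
 also have "... = (r - 2) * k" using assms(2-4) by (simp add: numeral_2_eq_2)
 finally have "(\<Sum>i<r. d i) < k + (r - 2) * k" using assms(5) by linarith
 moreover have "k + (r - 2) * k = (r - 1) * k"
 proof -
  obtain s where "r = Suc (Suc s)" using assms(2-4) by (metis Suc_lessE less_antisym less_zeroE not_less_zero old.nat.exhaust)
  thus ?thesis by simp
 qed
 ultimately show ?thesis by simp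
qed

text \<open>The right-hand side is what the best good graph gains at least from
  \<open>card V - r * k\<close> to \<open>card V\<close> vertices, see \<open>wt_max_step\<close>.
  Deleting the core costs no more than that, and equality makes every outside vertex attain its
  degree bound.\<close>

lemma inc_bound:
 assumes V: "finite V" and U: "U \<subseteq> V" "card U = r * k" and
  x: "!!x. x \<in> V - U ==> dg x U <= (r - 1) * k" and UU: "pe U U <= r * (r - 1) * k * k + (l - 2) * k"
 shows "pe U U + 2 * pe U (V - U) <= r * (r - 1) * k * k + (l - 2) * k + 2 * ((r - 1) * k * (card V - r * k))"
  "pe U U + 2 * pe U (V - U) = r * (r - 1) * k * k + (l - 2) * k + 2 * ((r - 1) * k * (card V - r * k)) ==>
   x0 \<in> V - U ==> dg x0 U = (r - 1) * k"
proof -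
 have fU: "finite U" using U(1) V finite_subset by blast
 have c: "card (V - U) = card V - r * k" using card_Diff_subset[OF fU U(1)] U(2) by simp
 have s: "pe U (V - U) = (\<Sum>x\<in>V - U. dg x U)" using pe_sym[OF fU, of "V - U"] V by (simp add: pe_def)
 have cs: "(\<Sum>x\<in>V - U. (r - 1) * k) = (r - 1) * k * (card V - r * k)" using c by simp
 have le: "pe U (V - U) <= (r - 1) * k * (card V - r * k)" unfolding s cs[symmetric] by (rule sum_mono) (rule x)
 show "pe U U + 2 * pe U (V - U) <= r * (r - 1) * k * k + (l - 2) * k + 2 * ((r - 1) * k * (card V - r * k))"
  using le UU by linarith
 assume e: "pe U U + 2 * pe U (V - U) = r * (r - 1) * k * k + (l - 2) * k + 2 * ((r - 1) * k * (card V - r * k))" and x0: "x0 \<in> V - U"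
 have e2: "(\<Sum>x\<in>V - U. dg x U) = (\<Sum>x\<in>V - U. (r - 1) * k)" using e le UU s cs by linarith
 show "dg x0 U = (r - 1) * k"
  by (rule sum_mono_inv[OF e2]) (use x x0 V in auto)
qed

lemma nb_full: "finite T ==> dg x T = card T ==> T \<subseteq> nb x T"
 unfolding dg_def using card_subset_eq[of T "nb x T"] nb_subset by auto

lemma pe_blow:
 assumes "blow r T V" "!!i. i < r ==> card (T i) = k"
 shows "card (\<Union>i<r. T i) = r * k"
  "pe (\<Union>i<r. T i) (\<Union>i<r. T i) = r * (r - 1) * k * k + (\<Sum>i<r. pe (T i) (T i))"
proof -
 have f: "finite (T i)" if "i < r" for i using assms(1) that by (simp add: blow_def)
 have d: "T i Int T j = {}" if "i < r" "j < r" "i ~= j" for i j by (rule blow_disj[OF assms(1) that])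
 have "card (\<Union>i<r. T i) = (\<Sum>i<r. card (T i))" by (rule card_UN_disjoint) (use f d in auto)
 thus "card (\<Union>i<r. T i) = r * k" using assms(2) by simp
 have "pe (\<Union>i<r. T i) (\<Union>i<r. T i) = (\<Sum>i<r. pe (T i) (\<Union>i<r. T i))" by (rule pe_UN1) (use f d in auto)
 also have "... = (\<Sum>i<r. \<Sum>j<r. pe (T i) (T j))" by (intro sum.cong refl pe_UN2) (use f d in auto)
 also have "... = (\<Sum>i<r. pe (T i) (T i) + (r - 1) * (k * k))"
 proof (rule sum.cong[OF refl])
  fix i assume i: "i \<in> {..<r}"
  have "(\<Sum>j<r. pe (T i) (T j)) = pe (T i) (T i) + (\<Sum>j\<in>{..<r} - {i}. pe (T i) (T j))" by (rule sum.remove) (use i in auto)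
  also have "(\<Sum>j\<in>{..<r} - {i}. pe (T i) (T j)) = (\<Sum>j\<in>{..<r} - {i}. k * k)"
  proof (rule sum.cong[OF refl])
   fix j assume j: "j \<in> {..<r} - {i}"
   have "cmpl (T i) (T j)" using assms(1) i j by (auto simp: blow_def)
   from pe_cmpl[OF this] show "pe (T i) (T j) = k * k" using assms(2) i j by simp
  qed
  also have "... = (r - 1) * (k * k)" using i by simp
  finally show "(\<Sum>j<r. pe (T i) (T j)) = pe (T i) (T i) + (r - 1) * (k * k)" .
 qed
 also have "... = r * (r - 1) * k * k + (\<Sum>i<r. pe (T i) (T i))" by (simp add: sum.distrib)
 finally show "pe (\<Union>i<r. T i) (\<Union>i<r. T i) = r * (r - 1) * k * k + (\<Sum>i<r. pe (T i) (T i))" .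
qed

text \<open>Many disjoint \<open>K_{l-1}\<close> in one part: every further vertex misses exactly one part entirely.\<close>

lemma exact_K:
 assumes V: "finite V" and l: "3 <= l" and f1: "~ forb1 r l m V" and f3: "~ forb3 r l m V" and r: "0 < r"
  and T: "blow r T V" "!!i. i < r ==> card (T i) = k" and C: "finite \<C>" "T 0 = \<Union>\<C>" "!!Q. Q \<in> \<C> ==> clique Q & card Q = l - 1"
   "!!Q Q'. Q \<in> \<C> ==> Q' \<in> \<C> ==> Q ~= Q' ==> Q Int Q' = {}" and N: "m + 2 < card \<C>" and k: "2 * m + 2 * l < k"
 defines "U \<equiv> \<Union>i<r. T i"
 shows "U \<subseteq> V" "card U = r * k"
  "pe U U + 2 * pe U (V - U) <= r * (r - 1) * k * k + (l - 2) * k + 2 * ((r - 1) * k * (card V - r * k))"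
  "pe U U + 2 * pe U (V - U) = r * (r - 1) * k * k + (l - 2) * k + 2 * ((r - 1) * k * (card V - r * k)) ==> \<exists>c. gcol r l V c"
proof -
 have fT: "finite (T i)" "T i \<subseteq> V" if "i < r" for i using T(1) that by (auto simp: blow_def)
 have dT: "T i Int T j = {}" if "i < r" "j < r" "i ~= j" for i j by (rule blow_disj[OF T(1) that])
 have cT: "cmpl (T i) (T j)" if "i < r" "j < r" "i ~= j" for i j using T(1) that by (simp add: blow_def)
 show UV: "U \<subseteq> V" using fT by (auto simp: U_def)
 show cU: "card U = r * k" unfolding U_def by (rule pe_blow(1)[OF T])
 have fQ: "finite Q" if "Q \<in> \<C>" for Q using C(2) fT[OF r] that by (metis Union_upper finite_subset)
 have dU: "dg v U = (\<Sum>i<r. dg v (T i))" for v unfolding U_def by (rule dg_UN) (use fT dT in auto)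
 have dk: "dg v (T i) <= k" if "i < r" for v i using dg_le_card[OF fT(1)[OF that], of v] T(2)[OF that] by simp
 obtain Q1 Q2 where Q12: "Q1 \<in> \<C>" "Q2 \<in> \<C>" "Q1 ~= Q2"
 proof -
  have "2 <= card \<C>" using N by simp
  then obtain D where "D \<subseteq> \<C>" "card D = 2" using obtain_subset_with_card_n by metis
  thus ?thesis using that by (metis card_2_iff insert_subset)
 qed
 have F3: "forb3 r l m V" if S: "blow r S V" "!!i. i < r ==> m <= card (S i)" "j0 < r" "j0 ~= 0" "Q \<in> \<C>" "Q' \<in> \<C>" "Q ~= Q'"
  "Q \<subseteq> S 0" "Q' \<subseteq> S 0" "2 * (l - 1) + m <= card (S 0)" "u \<in> S j0" "v \<in> S j0" "E u v" "m + 2 <= card (S j0)" for S j0 Q Q' u v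
  unfolding forb3_def
  by (rule exI[of _ S], rule exI[of _ 0], rule exI[of _ j0], rule exI[of _ Q], rule exI[of _ Q'], rule exI[of _ u], rule exI[of _ v])
    (use S r C in auto)
 \<comment> \<open>Otherwise \<open>x\<close>, added to \<open>T 0\<close> and followed by the
   clique of its neighbour, starts a path on \<open>l\<close> vertices.\<close>
 have K1: "nb x (T 0) = {}" if x: "x \<in> V - U" and big: "!!j. j < r ==> j ~= 0 ==> m <= dg x (T j)" for x
 proof (rule ccontr)
  assume "nb x (T 0) ~= {}"
  then obtain y Q where y: "y \<in> Q" "Q \<in> \<C>" "E x y" using C(2) by (auto simp: nb_def)
  obtain xs where xs: "ispath Q xs" "xs ~= []" "hd xs = y" "length xs = card Q"
   using clique_path_ex[of Q y] C(3)[OF y(2)] fQ[OF y(2)] y(1) by blast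
  define S where "S = (%j. if j = 0 then insert x (T 0) else nb x (T j))"
  have "blow r S V" unfolding blow_def
  proof (intro conjI allI impI)
   fix i assume i: "i < r"
   show "S i \<subseteq> V" "finite (S i)" using fT[OF i] fT[OF r] x by (auto simp: S_def)
   fix j assume j: "j < r" "i ~= j"
   show "cmpl (S i) (S j)" using cT[OF i j] cT[OF i r] cT[OF r j(1)] j E_sym by (auto simp: S_def cmpl_def)
  qed
  moreover have "x \<notin> T 0" using x r by (auto simp: U_def)
  hence "card (S 0) = Suc k" using fT[OF r] T(2)[OF r] by (simp add: S_def)
  moreover have "ispath (S 0) (x # xs)"
  proof -
   have "x \<notin> Q" using \<open>x \<notin> T 0\<close> C(2) y(2) by blast
   thus ?thesis using xs y C(2) by (cases xs) (auto simp: ispath_def S_def)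
  qed
  hence "~ pfree l (S 0)" unfolding pfree_def using xs(4) C(3)[OF y(2)] l by (metis Suc_diff_1 gr0I length_Cons not_numeral_le_zero)
  moreover have "\<forall>j<r. j ~= 0 --> m <= card (S j)" using big by (simp add: S_def dg_def)
  ultimately have "forb1 r l m V" unfolding forb1_def using r k by (intro exI[of _ S] exI[of _ 0]) auto
  thus False using f1 by simp
 qed
 \<comment> \<open>Otherwise \<open>x\<close>, added to \<open>T j0\<close>, has an edge there, and
   the two cliques in its neighbourhood complete \<open>F3\<close>.\<close>
 have K2: "nb x (T j0) = {}" if x: "x \<in> V - U" and j0: "j0 < r" "j0 ~= 0" and big: "!!j. j < r ==> j ~= 0 ==> j ~= j0 ==> m <= dg x (T j)"
  and Q: "Q \<in> \<C>" "Q' \<in> \<C>" "Q ~= Q'" "Q \<subseteq> nb x (T 0)" "Q' \<subseteq> nb x (T 0)" "2 * (l - 1) + m <= dg x (T 0)" for x j0 Q Q'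
 proof (rule ccontr)
  assume "nb x (T j0) ~= {}"
  then obtain y where y: "y \<in> T j0" "E x y" by (auto simp: nb_def)
  define S where "S = (%j. if j = j0 then insert x (T j0) else nb x (T j))"
  have xT: "x \<notin> T j0" using x j0 by (auto simp: U_def)
  have c0: "card (S j0) = Suc k" using fT[OF j0(1)] T(2)[OF j0(1)] xT by (simp add: S_def)
  have "blow r S V" unfolding blow_def
  proof (intro conjI allI impI)
   fix i assume i: "i < r"
   show "S i \<subseteq> V" "finite (S i)" using fT[OF i] fT[OF j0(1)] x by (auto simp: S_def)
   fix j assume j: "j < r" "i ~= j"
   show "cmpl (S i) (S j)" using cT[OF i j] cT[OF i j0(1)] cT[OF j0(1) j(1)] j E_sym by (auto simp: S_def cmpl_def)
  qed
  moreover have "m <= card (S i)" if "i < r" for i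
  proof (cases "i = j0")
   case True thus ?thesis using c0 k by simp
  next
   case False
   thus ?thesis using big[OF that] Q(6) by (cases "i = 0") (auto simp: S_def dg_def)
  qed
  ultimately have "forb3 r l m V"
   by (rule F3[OF _ _ j0 Q(1,2,3)]) (use Q(4,5,6) y c0 k j0 in "auto simp: S_def dg_def")
  thus False using f3 by simp
 qed
 \<comment> \<open>Either \<open>x\<close> misses one part entirely, or two parts together are so
   poor in neighbours of \<open>x\<close> that its degree stays strictly below the bound.\<close>
 have key: "dg x U <= (r - 1) * k & (dg x U = (r - 1) * k --> (\<exists>i<r. nb x (T i) = {} & (\<forall>j<r. j ~= i --> T j \<subseteq> nb x (T j))))" if x: "x \<in> V - U" for x
 proof -
  have concl: ?thesis if i: "i < r" "nb x (T i) = {}" for i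
  proof -
   have d0: "dg x (T i) = 0" using i by (simp add: dg_def)
   have "T j \<subseteq> nb x (T j)" if "dg x U = (r - 1) * k" "j < r" "j ~= i" for j
    by (rule nb_full[OF fT(1)[OF that(2)]]) (use sum_one_zero(2)[of r "%j. dg x (T j)" k i j, OF dk i(1) d0] that dU T(2) in auto)
   thus ?thesis using sum_one_zero(1)[of r "%j. dg x (T j)" k i, OF dk i(1) d0] dU i by auto
  qed
  have strict: ?thesis if "a < r" "b < r" "a ~= b" "dg x (T a) + dg x (T b) < k" for a b
   using sum_two_small[of r "%j. dg x (T j)" k a b, OF dk that] dU by simp
  show ?thesis
  proof (cases "\<forall>j<r. j ~= 0 --> m <= dg x (T j)")
   case True thus ?thesis using concl[OF r] K1[OF x] by blast
  next
   case False
   then obtain j0 where j0: "j0 < r" "j0 ~= 0" "dg x (T j0) < m" by (auto simp: not_le)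
   show ?thesis
   proof (cases "\<forall>j<r. j ~= 0 --> j ~= j0 --> m <= dg x (T j)")
    case False
    then obtain j1 where j1: "j1 < r" "j1 ~= j0" "dg x (T j1) < m" by (auto simp: not_le)
    show ?thesis by (rule strict[OF j0(1) j1(1)]) (use j0 j1 k in auto)
   next
    case big: True
    define F where "F = {Q\<in>\<C>. Q \<subseteq> nb x (T 0)}"
    have fF: "finite F" "F \<subseteq> \<C>" using C(1) by (auto simp: F_def)
    show ?thesis
    proof (cases "2 <= card F & 2 * (l - 1) + m <= dg x (T 0)")
     case True
     then obtain D where "D \<subseteq> F" "card D = 2" using obtain_subset_with_card_n by metis
     then obtain Q Q' where "Q \<in> F" "Q' \<in> F" "Q ~= Q'" by (metis card_2_iff insert_subset)
     hence "nb x (T j0) = {}" by (intro K2[OF x j0(1,2)]) (use big True in "auto simp: F_def")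
     thus ?thesis using concl[OF j0(1)] by blast
    next
     case no: False
     \<comment> \<open>If at most one clique lies inside the neighbourhood of \<open>x\<close>,
       every other clique contains a vertex missed by \<open>x\<close>. There are more than
       \<open>m\<close> of them, which outweighs the fewer than \<open>m\<close> neighbours in
       \<open>T j0\<close>.\<close>
     have "dg x (T 0) + (m + 1) <= k \<or> dg x (T 0) < 2 * (l - 1) + m"
     proof (cases "card F < 2")
      case True
      define h where "h = (%Q. SOME y. y \<in> Q & ~ E x y)"
      have h: "h Q \<in> Q & ~ E x (h Q)" if "Q \<in> \<C> - F" for Q
       unfolding h_def by (rule someI_ex) (use that C(2) in "auto simp: F_def nb_def")
      have "inj_on h (\<C> - F)"
      proof (rule inj_onI)
       fix Q Q' assume "Q \<in> \<C> - F" "Q' \<in> \<C> - F" "h Q = h Q'"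
       thus "Q = Q'" using h[of Q] h[of Q'] C(4)[of Q Q'] by auto
      qed
      moreover have "h ` (\<C> - F) \<subseteq> {y\<in>T 0. ~ E x y}" using h C(2) by blast
      ultimately have "card (\<C> - F) <= ms x (T 0)" unfolding ms_def
       by (rule card_inj_on_le) (use fT[OF r] in simp)
      moreover have "card (\<C> - F) = card \<C> - card F" by (rule card_Diff_subset[OF fF])
      moreover have "dg x (T 0) + ms x (T 0) = k" using dg_ms[OF fT(1)[OF r]] T(2)[OF r] by simp
      ultimately show ?thesis using True N by linarith
     next
      case False thus ?thesis using no by auto
     qed
     hence "dg x (T j0) + dg x (T 0) < k" using j0(3) k by linarith
     thus ?thesis using strict[OF j0(1) r j0(2)] by blast
    qed
   qed
  qed
 qed
 have indep: "sep (T j) (T j)" if j: "j < r" "j ~= 0" for j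
 proof (rule ccontr)
  assume "~ sep (T j) (T j)"
  then obtain u v where uv: "u \<in> T j" "v \<in> T j" "E u v" by (auto simp: sep_def)
  have q: "Q1 \<subseteq> T 0" "Q2 \<subseteq> T 0" using Q12 C(2) by auto
  have t: "2 * (l - 1) + m <= card (T 0)" "m + 2 <= card (T j)" "m <= card (T i)" if "i < r" for i
   using T(2)[OF r] T(2)[OF j(1)] T(2)[OF that] k l by auto
  have "forb3 r l m V"
   by (rule F3[OF T(1) t(3) j Q12 q t(1)[OF r] uv t(2)[OF r]])
  thus False using f3 by simp
 qed
 have T0: "pe (T 0) (T 0) <= (l - 2) * k"
 proof (rule erdos_gallai[OF fT(1)[OF r], of l, unfolded T(2)[OF r]])
  show "pfree l (T 0)"
  proof (rule ccontr)
   assume "~ pfree l (T 0)"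
   hence "forb1 r l m V" unfolding forb1_def using T r k by (intro exI[of _ T] exI[of _ 0]) auto
   thus False using f1 by simp
  qed
 qed (use l in simp)
 have sT: "(\<Sum>i<r. pe (T i) (T i)) = pe (T 0) (T 0)"
 proof -
  have "(\<Sum>i<r. pe (T i) (T i)) = pe (T 0) (T 0) + (\<Sum>i\<in>{..<r} - {0}. pe (T i) (T i))" by (rule sum.remove) (use r in auto)
  moreover have "(\<Sum>i\<in>{..<r} - {0}. pe (T i) (T i)) = 0" by (rule sum.neutral) (use pe_sep indep in auto)
  ultimately show ?thesis by simp
 qed
 have UU: "pe U U <= r * (r - 1) * k * k + (l - 2) * k" using pe_blow(2)[OF T] sT T0 by (simp add: U_def)
 have kx: "!!x. x \<in> V - U ==> dg x U <= (r - 1) * k" using key by blast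
 show "pe U U + 2 * pe U (V - U) <= r * (r - 1) * k * k + (l - 2) * k + 2 * ((r - 1) * k * (card V - r * k))"
  by (rule inc_bound(1)[OF V UV cU kx UU])
 assume e: "pe U U + 2 * pe U (V - U) = r * (r - 1) * k * k + (l - 2) * k + 2 * ((r - 1) * k * (card V - r * k))"
 have full: "\<exists>i<r. (\<forall>j<r. j ~= i --> (\<forall>y\<in>T j. E x y))" if x: "x \<in> V" for x
 proof (cases "x \<in> U")
  case True
  then obtain i where "i < r" "x \<in> T i" by (auto simp: U_def)
  thus ?thesis using cT[of i] by (intro exI[of _ i]) (auto simp: cmpl_def)
 next
  case False
  hence x': "x \<in> V - U" using x by simp
  have "dg x U = (r - 1) * k" by (rule inc_bound(2)[OF V UV cU kx UU e x'])
  then obtain i where "i < r" "\<forall>j<r. j ~= i --> T j \<subseteq> nb x (T j)" using key[OF x'] by blast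
  thus ?thesis by (intro exI[of _ i]) (auto simp: nb_def)
 qed
 \<comment> \<open>A vertex is coloured by a part such that it sees all other parts completely;
   equality in the count ensures that there is one.\<close>
 define c where "c = (%x. SOME i. i < r & (\<forall>j<r. j ~= i --> (\<forall>y\<in>T j. E x y)))"
 have c: "c x < r & (\<forall>j<r. j ~= c x --> (\<forall>y\<in>T j. E x y))" if "x \<in> V" for x
  unfolding c_def by (rule someI_ex) (use full[OF that] in blast)
 \<comment> \<open>Vertices of colour \<open>i\<close> may be added to \<open>T i\<close> without
   destroying the pattern. Hence an edge in a colour other than \<open>0\<close> gives
   \<open>F3\<close>, and a path in colour \<open>0\<close> gives \<open>F1\<close>.\<close>
 have bl: "blow r (T(i := D Un T i)) V" if i: "i < r" and D: "D \<subseteq> {x\<in>V. c x = i}" for i D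
  unfolding blow_def
 proof (intro conjI allI impI)
  have Di: "cmpl D (T j)" if "j < r" "j ~= i" for j using D c that by (fastforce simp: cmpl_def)
  fix a assume a: "a < r"
  show "(T(i := D Un T i)) a \<subseteq> V" "finite ((T(i := D Un T i)) a)" using fT[OF a] fT[OF i] D V by (auto dest: finite_subset)
  fix b assume b: "b < r" "a ~= b"
  show "cmpl ((T(i := D Un T i)) a) ((T(i := D Un T i)) b)"
   using cT[OF a b] cT[OF i b(1)] cT[OF a i] Di[OF b(1)] cmpl_sym[OF Di[OF a]] b by (auto simp: cmpl_Un1 cmpl_Un2)
 qed
 have mono: "card (T i) <= card (D Un T i)" if "i < r" "D \<subseteq> V" for i D
  by (rule card_mono) (use fT[OF that(1)] V that(2) in "auto dest: finite_subset")
 have "gcol r l V c" unfolding gcol_def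
 proof (intro conjI ballI impI)
  fix v assume "v \<in> V" thus "c v < r" using c by blast
 next
  fix u v assume u: "u \<in> V" and v: "v \<in> V" and uv: "E u v & c u = c v"
  show "c u = 0"
  proof (rule ccontr)
   assume n0: "c u ~= 0"
   let ?i = "c u" let ?S = "T(?i := {u, v} Un T ?i)"
   have i: "?i < r" using c[OF u] by blast
   have b: "blow r ?S V" by (rule bl[OF i]) (use u v uv in auto)
   have ci: "k <= card ({u, v} Un T ?i)" using mono[OF i, of "{u, v}"] T(2)[OF i] u v by simp
   have q: "Q1 \<subseteq> ?S 0" "Q2 \<subseteq> ?S 0" using Q12 C(2) n0 by auto
   have t: "2 * (l - 1) + m <= card (?S 0)" using T(2)[OF r] k n0 by auto
   have t2: "m + 2 <= card (?S ?i)" using ci k l by simp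
   have t3: "m <= card (?S j)" if "j < r" for j using T(2)[OF that] k ci by auto
   have "forb3 r l m V"
    by (rule F3[OF b t3 i n0 Q12 q t _ _ _ t2, of u v]) (use uv in auto)
   thus False using f3 by simp
  qed
 next
  show "pfree l {v \<in> V. c v = 0}"
  proof (rule ccontr)
   assume np: "~ pfree l {v \<in> V. c v = 0}"
   let ?D = "{v \<in> V. c v = 0}" let ?S = "T(0 := ?D Un T 0)"
   have "~ pfree l (?S 0)" using np pfree_mono[of l "?D Un T 0" ?D] by auto
   moreover have "k <= card (?D Un T 0)" using mono[OF r, of ?D] T(2)[OF r] by simp
   ultimately have "forb1 r l m V" unfolding forb1_def
    by (intro exI[of _ ?S] exI[of _ 0]) (use bl[OF r order_refl] T(2) k r in auto)
   thus False using f1 by simp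
  qed
 qed
 thus "\<exists>c. gcol r l V c" by blast
qed

section \<open>Good graphs contain no forbidden graph\<close>

text \<open>Consecutive vertices are not both in \<open>A\<close>. The induction charges the extra
  \<open>1\<close> only to paths that start in \<open>A\<close>.\<close>

lemma path_indep:
 assumes "sep A A" "ispath S xs"
 shows "2 * card (set xs Int A) <= length xs + 1"
proof -
 have "2 * card (set xs Int A) <= length xs + (if xs ~= [] & hd xs \<in> A then 1 else 0)"
  if "distinct xs" "successively E xs" for xs using that
 proof (induction xs)
  case Nil show ?case by simp
 next
  case (Cons a xs)
  have s: "successively E xs" using Cons.prems(2) by (cases xs) auto
  have IH: "2 * card (set xs Int A) <= length xs + (if xs ~= [] & hd xs \<in> A then 1 else 0)"
   using Cons.IH s Cons.prems(1) by simp
  show ?case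
  proof (cases "a \<in> A")
   case True
   have "xs ~= [] ==> E a (hd xs)" using Cons.prems(2) by (cases xs) auto
   hence "~ (xs ~= [] & hd xs \<in> A)" using True assms(1) by (auto simp: sep_def)
   hence IH': "2 * card (set xs Int A) <= length xs" using IH by (simp split: if_splits)
   have "card (set (a # xs) Int A) <= Suc (card (set xs Int A))"
    using True by (simp add: card_insert_if)
   thus ?thesis using IH' True by simp
  next
   case False
   hence "set (a # xs) Int A = set xs Int A" by auto
   thus ?thesis using IH False by (simp split: if_splits)
  qed
 qed
 from this[of xs] show ?thesis using assms(2) by (simp add: ispath_def split: if_splits)
qed

lemma sep_path:
 assumes "sep S T" "ispath (S Un T) xs"
 shows "set xs \<subseteq> S \<or> set xs \<subseteq> T"
proof -
 have "set xs \<subseteq> S \<or> set xs \<subseteq> T" if "set xs \<subseteq> S Un T" "successively E xs" for xs using that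
 proof (induction xs)
  case (Cons a xs)
  show ?case
  proof (cases xs)
   case Nil thus ?thesis using Cons.prems by auto
  next
   case (Cons b ys)
   have e: "E a b" "successively E xs" "E b a" using Cons.prems(2) Cons E_sym by auto
   have "a \<in> S Un T" using Cons.prems by simp
   moreover have "set xs \<subseteq> S \<or> set xs \<subseteq> T" using Cons.IH e Cons.prems by simp
   ultimately show ?thesis using e Cons assms(1) unfolding sep_def by auto
  qed
 qed simp
 thus ?thesis using assms(2) by (simp add: ispath_def)
qed

lemma pe_less_not_cmpl: assumes "finite S" "finite T" "~ cmpl S T" shows "pe S T < card S * card T"
proof -
 obtain x y where xy: "x \<in> S" "y \<in> T" "~ E x y" using assms(3) by (auto simp: cmpl_def)
 have "nb x T \<subset> T" using xy by (auto simp: nb_def)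
 hence "dg x T < card T" unfolding dg_def using assms(2) by (rule psubset_card_mono[rotated])
 hence "pe S T < (\<Sum>x\<in>S. card T)" unfolding pe_def
  by (intro sum_strict_mono_ex1) (use assms xy dg_le_card in auto)
 thus ?thesis by simp
qed

lemma parts_count:
 fixes r :: nat
 assumes f: "!!i. i < r ==> finite (P i)" and d: "!!i j. i < r ==> j < r ==> i ~= j ==> P i Int P j = {}"
  and V: "V = (\<Union>i<r. P i)"
 shows "pe V V = (\<Sum>i<r. pe (P i) (P i)) + (\<Sum>i<r. \<Sum>j\<in>{..<r} - {i}. pe (P i) (P j))"
  "pe V V <= (\<Sum>i<r. pe (P i) (P i)) + (\<Sum>i<r. \<Sum>j\<in>{..<r} - {i}. card (P i) * card (P j))"
  "(\<Sum>i<r. pe (P i) (P i)) + (\<Sum>i<r. \<Sum>j\<in>{..<r} - {i}. card (P i) * card (P j)) <= pe V V ==>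
   a < r ==> b < r ==> a ~= b ==> cmpl (P a) (P b)"
proof -
 have "pe V V = (\<Sum>i<r. pe (P i) V)" unfolding V by (rule pe_UN1) (use f d in auto)
 also have "... = (\<Sum>i<r. \<Sum>j<r. pe (P i) (P j))" unfolding V by (intro sum.cong refl pe_UN2) (use f d in auto)
 also have "... = (\<Sum>i<r. pe (P i) (P i) + (\<Sum>j\<in>{..<r} - {i}. pe (P i) (P j)))"
  by (rule sum.cong[OF refl], rule sum.remove) auto
 also have "... = (\<Sum>i<r. pe (P i) (P i)) + (\<Sum>i<r. \<Sum>j\<in>{..<r} - {i}. pe (P i) (P j))" by (rule sum.distrib)
 finally show e: "pe V V = (\<Sum>i<r. pe (P i) (P i)) + (\<Sum>i<r. \<Sum>j\<in>{..<r} - {i}. pe (P i) (P j))" .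
 have le: "(\<Sum>j\<in>{..<r} - {i}. pe (P i) (P j)) <= (\<Sum>j\<in>{..<r} - {i}. card (P i) * card (P j))" if "i < r" for i
  by (rule sum_mono) (use pe_le f that in auto)
 have "(\<Sum>i<r. \<Sum>j\<in>{..<r} - {i}. pe (P i) (P j)) <= (\<Sum>i<r. \<Sum>j\<in>{..<r} - {i}. card (P i) * card (P j))"
  by (rule sum_mono) (use le in auto)
 thus "pe V V <= (\<Sum>i<r. pe (P i) (P i)) + (\<Sum>i<r. \<Sum>j\<in>{..<r} - {i}. card (P i) * card (P j))" using e by linarith
 assume big: "(\<Sum>i<r. pe (P i) (P i)) + (\<Sum>i<r. \<Sum>j\<in>{..<r} - {i}. card (P i) * card (P j)) <= pe V V" and ab: "a < r" "b < r" "a ~= b"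
 show "cmpl (P a) (P b)"
 proof (rule ccontr)
  assume "~ cmpl (P a) (P b)"
  hence lt: "pe (P a) (P b) < card (P a) * card (P b)" by (intro pe_less_not_cmpl) (use f ab in auto)
  have "(\<Sum>j\<in>{..<r} - {a}. pe (P a) (P j)) < (\<Sum>j\<in>{..<r} - {a}. card (P a) * card (P j))"
   by (rule sum_strict_mono_ex1) (use pe_le f ab lt in auto)
  hence "(\<Sum>i<r. \<Sum>j\<in>{..<r} - {i}. pe (P i) (P j)) < (\<Sum>i<r. \<Sum>j\<in>{..<r} - {i}. card (P i) * card (P j))"
   by (intro sum_strict_mono_ex1) (use le ab in auto)
  thus False using big e by linarith
 qed
qed

lemma gcol_count:
 fixes r :: nat
 assumes V: "finite V" and g: "gcol r l V c" and r: "0 < r"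
 defines "P \<equiv> %i. {v\<in>V. c v = i}"
 shows "(\<Sum>i<r. card (P i)) = card V"
  "pe V V <= pe (P 0) (P 0) + (\<Sum>i<r. \<Sum>j\<in>{..<r} - {i}. card (P i) * card (P j))"
  "pe (P 0) (P 0) + (\<Sum>i<r. \<Sum>j\<in>{..<r} - {i}. card (P i) * card (P j)) <= pe V V ==> a < r ==> b < r ==> a ~= b ==> cmpl (P a) (P b)"
proof -
 have f: "finite (P i)" for i using V by (simp add: P_def)
 have d: "P i Int P j = {}" if "i ~= j" for i j using that by (auto simp: P_def)
 have U: "V = (\<Union>i<r. P i)" using g by (auto simp: P_def gcol_def)
 have "card V = (\<Sum>i<r. card (P i))" unfolding U by (rule card_UN_disjoint) (use f d in auto)
 thus "(\<Sum>i<r. card (P i)) = card V" by simp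
 have "(\<Sum>i<r. pe (P i) (P i)) = pe (P 0) (P 0) + (\<Sum>i\<in>{..<r} - {0}. pe (P i) (P i))" by (rule sum.remove) (use r in auto)
 moreover have "(\<Sum>i\<in>{..<r} - {0}. pe (P i) (P i)) = 0"
 proof (intro sum.neutral ballI pe_sep)
  fix i assume i: "i \<in> {..<r} - {0}"
  show "sep (P i) (P i)" unfolding sep_def
  proof (intro ballI notI)
   fix x y assume xy: "x \<in> P i" "y \<in> P i" "E x y"
   hence "x \<in> V" "y \<in> V" "c x = i" "c y = i" by (auto simp: P_def)
   hence "c x = 0" using g xy(3) unfolding gcol_def by metis
   thus False using i \<open>c x = i\<close> by simp
  qed
 qed
 ultimately have s: "(\<Sum>i<r. pe (P i) (P i)) = pe (P 0) (P 0)" by simp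
 note pc = parts_count[of r P V, OF f d U, unfolded s]
 show "pe V V <= pe (P 0) (P 0) + (\<Sum>i<r. \<Sum>j\<in>{..<r} - {i}. card (P i) * card (P j))" by (rule pc(2))
 show "pe (P 0) (P 0) + (\<Sum>i<r. \<Sum>j\<in>{..<r} - {i}. card (P i) * card (P j)) <= pe V V ==> a < r ==> b < r ==> a ~= b ==> cmpl (P a) (P b)"
  by (rule pc(3))
qed

text \<open>Different parts cannot share a nonzero colour, and only \<open>r - 1\<close> such
  colours exist, so some part lies in colour \<open>0\<close>. Any other part has few vertices of
  colour \<open>0\<close>, as these would alternate with that part along a path on \<open>l\<close>
  vertices. Now the count is exact: each of the other parts owns a single nonzero colour and is
  independent outside colour \<open>0\<close>.\<close>

lemma good_parts:
 fixes r :: nat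
 assumes g: "gcol r l V c" and S: "blow r S V" "!!i. i < r ==> l <= card (S i)" and r: "0 < r" and l: "2 <= l"
 shows "\<exists>a<r. S a \<subseteq> {v\<in>V. c v = 0} & (\<forall>b<r. b ~= a -->
  card (S b Int {v\<in>V. c v = 0}) < l div 2 & sep (S b - {v\<in>V. c v = 0}) (S b - {v\<in>V. c v = 0}))"
proof -
 let ?C = "{v\<in>V. c v = 0}"
 have fS: "finite (S i)" "S i \<subseteq> V" if "i < r" for i using S(1) that by (auto simp: blow_def)
 have cS: "cmpl (S i) (S j)" if "i < r" "j < r" "i ~= j" for i j using S(1) that by (simp add: blow_def)
 define w where "w = (%b. SOME x. x \<in> S b - ?C)"
 have w: "w b \<in> S b - ?C" if "~ S b \<subseteq> ?C" for b unfolding w_def by (rule someI_ex) (use that in blast)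
 have wV: "w b \<in> V" "0 < c (w b)" "c (w b) < r" if "b < r" "~ S b \<subseteq> ?C" for b
  using w[OF that(2)] fS(2)[OF that(1)] g by (auto simp: gcol_def)
 have same: "c x ~= c y" if "i < r" "j < r" "i ~= j" "x \<in> S i - ?C" "y \<in> S j" for x y i j
 proof
  assume e: "c x = c y"
  have "E x y" using cS[OF that(1,2,3)] that by (auto simp: cmpl_def)
  hence "c x = 0" using g e that fS[OF that(1)] fS[OF that(2)] unfolding gcol_def by blast
  thus False using that(4) fS(2)[OF that(1)] by auto
 qed
 define Bs where "Bs = {b\<in>{..<r}. ~ S b \<subseteq> ?C}"
 have inj: "inj_on (c o w) Bs"
 proof (rule inj_onI, rule ccontr)
  fix a b assume ab: "a \<in> Bs" "b \<in> Bs" "(c o w) a = (c o w) b" "a ~= b"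
  thus False using same[of a b "w a" "w b"] w[of a] w[of b] by (auto simp: Bs_def)
 qed
 have img: "(c o w) ` Bs \<subseteq> {0<..<r}"
 proof (rule image_subsetI)
  fix b assume "b \<in> Bs"
  hence "b < r" "~ S b \<subseteq> ?C" unfolding Bs_def by blast+
  thus "(c o w) b \<in> {0<..<r}" using wV by simp
 qed
 have "card Bs <= card {0<..<r}" by (rule card_inj_on_le[OF inj img]) simp
 hence "card Bs < r" using r by simp
 hence "Bs ~= {..<r}" by auto
 then obtain a where a: "a < r" "S a \<subseteq> ?C" by (auto simp: Bs_def)
 have small: "card (S b Int ?C) < l div 2" if b: "b < r" "b ~= a" for b
 proof (rule ccontr)
  assume "~ card (S b Int ?C) < l div 2"
  hence "~ pfree l ((S b Int ?C) Un S a)"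
   by (intro bip_not_pfree) (use fS[OF b(1)] fS[OF a(1)] cmpl_mono[OF cS[OF b(1) a(1) b(2)]] S(2)[OF a(1)] l in auto)
  moreover have "(S b Int ?C) Un S a \<subseteq> ?C" using a by auto
  moreover have "pfree l ?C" using g by (simp add: gcol_def)
  ultimately show False using pfree_mono by blast
 qed
 have BsE: "Bs = {..<r} - {a}"
 proof
  show "Bs \<subseteq> {..<r} - {a}" using a by (auto simp: Bs_def)
  show "{..<r} - {a} \<subseteq> Bs"
  proof
   fix b assume b: "b \<in> {..<r} - {a}"
   have "~ S b \<subseteq> ?C"
   proof
    assume "S b \<subseteq> ?C"
    hence "S b Int ?C = S b" by blast
    thus False using small[of b] S(2)[of b] b l by auto
   qed
   thus "b \<in> Bs" using b by (simp add: Bs_def)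
  qed
 qed
 have "card ((c o w) ` Bs) = card {0<..<r}" unfolding card_image[OF inj] using BsE a by simp
 hence surj: "(c o w) ` Bs = {0<..<r}" by (intro card_subset_eq img) auto
 have "sep (S b - ?C) (S b - ?C)" if b: "b < r" "b ~= a" for b
 proof -
  have col: "c x = c (w b)" if x: "x \<in> S b - ?C" for x
  proof -
   have "x \<in> V" using x fS(2)[OF b(1)] by blast
   hence "c x \<in> {0<..<r}" using x g by (auto simp: gcol_def)
   then obtain b' where b': "b' \<in> Bs" "c x = c (w b')" using surj by (metis (no_types, lifting) comp_apply imageE)
   have "b = b'" using same[of b b' x "w b'"] b' x b(1) w[of b'] by (auto simp: Bs_def)
   thus ?thesis using b' by simp
  qed
  show ?thesis unfolding sep_def
  proof (intro ballI notI)
   fix x y assume xy: "x \<in> S b - ?C" "y \<in> S b - ?C" "E x y"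
   have "c x = c y" using col[OF xy(1)] col[OF xy(2)] by simp
   hence "c x = 0" using g xy fS(2)[OF b(1)] unfolding gcol_def by blast
   thus False using xy fS(2)[OF b(1)] by auto
  qed
 qed
 thus ?thesis using a small by blast
qed

lemma clique_sep_card: assumes "clique Q" "finite Q" "sep (Q - C) (Q - C)" shows "card Q <= Suc (card (Q Int C))"
proof -
 have "card (Q - C) <= 1"
 proof (rule ccontr)
  assume "~ card (Q - C) <= 1"
  hence "2 <= card (Q - C)" by simp
  then obtain D where "D \<subseteq> Q - C" "card D = 2" using obtain_subset_with_card_n by metis
  then obtain x y where "x \<in> Q - C" "y \<in> Q - C" "x ~= y" by (metis card_2_iff insert_subset)
  thus False using assms by (auto simp: clique_def sep_def)
 qed
 moreover have "card Q = card (Q Int C) + card (Q - C)" using assms(2) by (metis Int_Diff_Un Int_Diff_disjoint card_Un_disjoint finite_Diff finite_Int)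
 ultimately show ?thesis by simp
qed

text \<open>By \<open>good_parts\<close> every part but one is independent up to fewer than
  \<open>l div 2\<close> vertices. This is too little for a path on \<open>l\<close> vertices, for
  \<open>m\<close> disjoint edges and for a clique \<open>K_{l-1}\<close>. If \<open>F3\<close> has
  its cliques in the exceptional part, its extra edge has an end of colour \<open>0\<close>, which
  prolongs a clique to a path on \<open>l\<close> vertices.\<close>

lemma gcol_not_forb:
 fixes r :: nat
 assumes V: "finite V" and g: "gcol r l V c" and r: "0 < r" and l: "3 <= l" and m: "2 * l <= m"
 shows "~ forb1 r l m V" "~ forb2 r m V" "~ forb3 r l m V" "~ forb4 r l m V"
proof -
 let ?C = "{v\<in>V. c v = 0}"
 have parts: "\<exists>a<r. S a \<subseteq> ?C & (\<forall>b<r. b ~= a --> card (S b Int ?C) < l div 2 & sep (S b - ?C) (S b - ?C))"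
  if "blow r S V" "!!i. i < r ==> m <= card (S i)" for S
  by (rule good_parts[OF g that(1) _ r]) (use that(2) m l in force)+
 have pC: "pfree l ?C" using g by (simp add: gcol_def)
 have clq: False if "clique Q" "Q \<subseteq> T" "finite T" "card Q = l - 1" "card (T Int ?C) < l div 2" "sep (T - ?C) (T - ?C)" for Q T
 proof -
  have fQ: "finite Q" using that finite_subset by blast
  have "card Q <= Suc (card (Q Int ?C))" by (rule clique_sep_card[OF that(1) fQ]) (use that(2,6) in "unfold sep_def, blast")
  moreover have "card (Q Int ?C) <= card (T Int ?C)" by (rule card_mono) (use that in auto)
  ultimately show False using that(4,5) l by linarith
 qed
 show "~ forb1 r l m V"
 proof
  assume "forb1 r l m V"
  then obtain S i0 where S: "i0 < r" "blow r S V" "\<forall>i<r. i ~= i0 --> m <= card (S i)" "l + m <= card (S i0)" "~ pfree l (S i0)"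
   unfolding forb1_def by blast
  have "m <= card (S i)" if "i < r" for i using S(3,4) that by (cases "i = i0") auto
  then obtain a where a: "a < r" "S a \<subseteq> ?C" "\<forall>b<r. b ~= a --> card (S b Int ?C) < l div 2 & sep (S b - ?C) (S b - ?C)"
   using parts[OF S(2)] by blast
  have "i0 ~= a" using S(5) pC pfree_mono a(2) by blast
  hence b: "card (S i0 Int ?C) < l div 2" "sep (S i0 - ?C) (S i0 - ?C)" using a(3) S(1) by blast+
  obtain xs where xs: "ispath (S i0) xs" "length xs = l" using S(5) by (auto simp: pfree_def)
  have "2 * card (set xs Int (S i0 - ?C)) <= l + 1" using path_indep[OF b(2) xs(1)] xs(2) by simp
  moreover have "card (set xs) = l" using xs distinct_card by (auto simp: ispath_def)
  moreover have "card (set xs) = card (set xs Int (S i0 - ?C)) + card (set xs Int (S i0 Int ?C))"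
   by (subst card_Un_disjoint[symmetric]) (use xs(1) in "auto simp: ispath_def intro!: arg_cong[where f=card]")
  moreover have "card (set xs Int (S i0 Int ?C)) <= card (S i0 Int ?C)"
   by (rule card_mono) (use S(1,2) in "auto simp: blow_def")
  ultimately show False using b(1) by linarith
 qed
 show "~ forb2 r m V"
 proof
  assume "forb2 r m V"
  then obtain S i0 i1 where S: "i0 < r" "i1 < r" "i0 ~= i1" "blow r S V" "\<forall>i<r. m <= card (S i)" "hasmat m (S i0)" "hasmat m (S i1)"
   unfolding forb2_def by blast
  obtain a where a: "a < r" "S a \<subseteq> ?C" "\<forall>b<r. b ~= a --> card (S b Int ?C) < l div 2 & sep (S b - ?C) (S b - ?C)"
   using parts[OF S(4)] S(5) by blast
  obtain b where b: "b < r" "b ~= a" "hasmat m (S b)" using S by metis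
  have s: "card (S b Int ?C) < l div 2" "sep (S b - ?C) (S b - ?C)" using a(3) b by blast+
  have fb: "finite (S b)" using S(4) b(1) by (simp add: blow_def)
  obtain f h where fh: "\<forall>i<m. f i \<in> S b & h i \<in> S b & E (f i) (h i)" "inj_on f {..<m}" "inj_on h {..<m}" "f ` {..<m} Int h ` {..<m} = {}"
   using b(3) unfolding hasmat_def by (elim exE conjE)
  define e where "e = (%i. if f i \<in> ?C then f i else h i)"
  have "inj_on e {..<m}"
  proof (rule inj_onI)
   fix i j assume "i \<in> {..<m}" "j \<in> {..<m}" "e i = e j"
   thus "i = j" using inj_onD[OF fh(2), of i j] inj_onD[OF fh(3), of i j] fh(4) by (auto simp: e_def split: if_splits)
  qed
  moreover have "e ` {..<m} \<subseteq> S b Int ?C"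
  proof (rule image_subsetI)
   fix i assume "i \<in> {..<m}"
   hence i: "f i \<in> S b" "h i \<in> S b" "E (f i) (h i)" using fh(1) by auto
   have "h i \<in> ?C" if "f i \<notin> ?C"
   proof (rule ccontr)
    assume "h i \<notin> ?C"
    thus False using s(2) i that unfolding sep_def by blast
   qed
   thus "e i \<in> S b Int ?C" using i by (simp add: e_def)
  qed
  ultimately have "card {..<m} <= card (S b Int ?C)" by (rule card_inj_on_le) (use fb in simp)
  thus False using s(1) m l by simp
 qed
 show "~ forb4 r l m V"
 proof
  assume "forb4 r l m V"
  then obtain S i0 i1 Q Q' where S: "i0 < r" "i1 < r" "i0 ~= i1" "blow r S V" "\<forall>i<r. m <= card (S i)"
   "Q \<subseteq> S i0" "Q' \<subseteq> S i1" "clique Q" "clique Q'" "card Q = l - 1" "card Q' = l - 1"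
   unfolding forb4_def by blast
  obtain a where a: "a < r" "S a \<subseteq> ?C" "\<forall>b<r. b ~= a --> card (S b Int ?C) < l div 2 & sep (S b - ?C) (S b - ?C)"
   using parts[OF S(4)] S(5) by blast
  obtain b R where b: "b < r" "b ~= a" "clique R" "R \<subseteq> S b" "card R = l - 1" using S by metis
  show False by (rule clq[OF b(3,4) _ b(5)]) (use a(3) b(1,2) S(4) in "auto simp: blow_def")
 qed
 show "~ forb3 r l m V"
 proof
  assume "forb3 r l m V"
  then obtain S i0 i1 Q Q' u v where S: "i0 < r" "i1 < r" "i0 ~= i1" "blow r S V" "\<forall>i<r. m <= card (S i)"
   "Q \<subseteq> S i0" "clique Q" "card Q = l - 1" and uv: "u \<in> S i1" "v \<in> S i1" "E u v"
   unfolding forb3_def by (elim exE conjE)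
  obtain a where a: "a < r" "S a \<subseteq> ?C" "\<forall>b<r. b ~= a --> card (S b Int ?C) < l div 2 & sep (S b - ?C) (S b - ?C)"
   using parts[OF S(4)] S(5) by blast
  have fi: "finite (S i0)" using S(1,4) by (simp add: blow_def)
  show False
  proof (cases "i0 = a")
   case False
   show False by (rule clq[OF S(7,6) fi S(8)]) (use a(3) S(1) False in auto)
  next
   case True
   hence "sep (S i1 - ?C) (S i1 - ?C)" using a(3) S(2,3) by blast
   then obtain x where x: "x \<in> S i1" "x \<in> ?C" using uv unfolding sep_def by blast
   have fQ: "finite Q" using fi S(6) finite_subset by blast
   have "Q ~= {}" using S(8) l by auto
   then obtain q where q: "q \<in> Q" by blast
   obtain xs where xs: "ispath Q xs" "xs ~= []" "hd xs = q" "length xs = card Q"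
    using clique_path_ex[OF S(7) fQ q] by blast
   have co: "cmpl (S i1) (S i0)" using S(1-4) by (simp add: blow_def)
   have "x \<notin> Q" using cmpl_disj[OF co] x S(6) by blast
   moreover have "E x q" using co x q S(6) by (auto simp: cmpl_def)
   moreover have "Q \<subseteq> ?C" using S(6) True a(2) by blast
   ultimately have "ispath ?C (x # xs)" using xs x by (cases xs) (auto simp: ispath_def)
   moreover have "length (x # xs) = l" using xs(4) S(8) l by simp
   ultimately show False using pC unfolding pfree_def by blast
  qed
 qed
qed

section \<open>The hub core\<close>

text \<open>A vertex of \<open>P\<close> with a neighbour in \<open>P\<close> has none in
  \<open>X\<close>, since otherwise an alternating path through all hubs could be continued into
  \<open>P\<close> up to \<open>l\<close> vertices. So a vertex counts either through the hubs, with
  at most \<open>2 * card X\<close> pairs, or inside \<open>P\<close>, where the Erdos-Gallai bound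
  allows the same amount \<open>l - 2\<close> on average.\<close>

lemma hub_class_bound:
 assumes fP: "finite P" and fX: "finite X" and l: "2 * card X + 2 = l" and X: "X ~= {}" and pf: "pfree l (P Un X)" and PX: "P Int X = {}"
  and B: "B \<subseteq> P" "cmpl X B" "l <= card B"
 shows "pe P P + 2 * pe P X <= 2 * card X * card P"
  "pe P P + 2 * pe P X = 2 * card X * card P ==> ~ sep P P ==> \<exists>Q. Q \<subseteq> P & clique Q & card Q = l - 1"
proof -
 have t: "1 <= card X" using X fX by (simp add: Suc_le_eq card_gt_0_iff)
 have fB: "finite B" using B fP finite_subset by blast
 define Y where "Y = {y\<in>P. nb y P ~= {}}"
 have no: "nb y X = {}" if y: "y \<in> Y" for y
 proof (rule ccontr)
  assume "nb y X ~= {}"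
  then obtain x where x: "x \<in> X" "E y x" by (auto simp: nb_def)
  obtain q where q: "q \<in> P" "E y q" using y by (auto simp: Y_def nb_def)
  have yP: "y \<in> P" using y by (simp add: Y_def)
  have c1: "card (X - {x}) = card X - 1" using x fX by simp
  have c2: "card B - 2 <= card (B - {y, q})"
   using diff_card_le_card_Diff[of "{y, q}" B] by (simp add: card_insert_if split: if_splits)
  have cm: "cmpl (X - {x}) (B - {y, q})" using B(2) by (auto simp: cmpl_def)
  \<comment> \<open>The alternating path has the \<open>card X - 1\<close> other hubs and
    \<open>card X\<close> vertices of \<open>B\<close>; with \<open>x\<close>, \<open>y\<close> and
    \<open>q\<close> it has \<open>2 * card X + 2 = l\<close> vertices.\<close>
  define h where "h = 2 * card X - 1"
  have h: "h div 2 <= card (X - {x})" "(h + 1) div 2 <= card (B - {y, q})" "odd h" using c1 c2 B(3) l t by (auto simp: h_def)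
  obtain xs where xs: "ispath ((X - {x}) Un (B - {y, q})) xs" "length xs = h" "xs ~= [] --> last xs \<in> B - {y, q}"
   using bip_path[OF _ _ cm h(1,2)] fX fB h(3) by auto
  have ne: "xs ~= []" using xs(2) h(3) by auto
  have lx: "E (last xs) x" using xs(3) ne B(2) x E_sym by (auto simp: cmpl_def)
  have yq: "y ~= q" using q E_irrefl by blast
  have E': "E x y" using x E_sym by blast
  have "set xs \<subseteq> (X - {x}) Un (B - {y, q})" using xs(1) by (simp add: ispath_def)
  moreover have "y \<notin> X" "q \<notin> X" "x \<notin> P" using PX yP q x by auto
  moreover have "ispath (P Un X) [x, y, q]" using E' q x yP yq \<open>x \<notin> P\<close> by (auto simp: ispath_def)
  moreover have "ispath (P Un X) xs" by (rule ispath_mono[OF xs(1)]) (use B in auto)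
  ultimately have "ispath ((P Un X) Un (P Un X)) (xs @ [x, y, q])"
   by (intro ispath_append) (use B(1) lx in auto)
  hence "ispath (P Un X) (xs @ [x, y, q])" by simp
  moreover have "length (xs @ [x, y, q]) = l" using xs(2) l t by (simp add: h_def)
  ultimately show False using pf unfolding pfree_def by blast
 qed
 have fY: "finite Y" "finite (P - Y)" "Y \<subseteq> P" using fP by (auto simp: Y_def)
 have s1: "sep Y (P - Y)" by (auto simp: sep_def Y_def nb_def dest: E_sym)
 have s2: "sep (P - Y) (P - Y)" by (auto simp: sep_def Y_def nb_def)
 have pP: "pe P P = pe Y Y" using pe_sep_split[OF fP fY(3) s1] pe_sep[OF s2] by simp
 have "pe P X = pe Y X + pe (P - Y) X" using pe_Un1[OF fY(1,2), of X] fY(3) by (simp add: Un_absorb1)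
 moreover have "pe Y X = 0" unfolding pe_def dg_def using no by simp
 moreover have "pe (P - Y) X <= card (P - Y) * card X" by (rule pe_le) (use fP fX in auto)
 ultimately have pX: "2 * pe P X <= 2 * card X * card (P - Y)" by (simp add: mult.commute)
 have pfY: "pfree l Y" by (rule pfree_mono[OF pf]) (use fY in auto)
 have l2: "l - 2 = 2 * card X" "3 <= l" using l t by auto
 have eg: "pe Y Y <= 2 * card X * card Y" using erdos_gallai[OF fY(1) pfY] l2 by simp
 have "card P = card Y + card (P - Y)" using fY fP by (metis card_Diff_subset card_mono le_add_diff_inverse)
 hence cs: "2 * card X * card P = 2 * card X * card Y + 2 * card X * card (P - Y)" by (simp add: add_mult_distrib2)
 show "pe P P + 2 * pe P X <= 2 * card X * card P" using pP pX eg cs by linarith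
 assume e: "pe P P + 2 * pe P X = 2 * card X * card P" and ns: "~ sep P P"
 have eY: "2 * card X * card Y <= pe Y Y" using e pP pX cs by linarith
 obtain u where u: "u \<in> Y" using ns by (auto simp: sep_def Y_def nb_def)
 obtain Q where Q: "Q \<subseteq> Y" "u \<in> Q" "conn Q" "sep Q (Y - Q)" using comp_ex[OF fY(1) u] by blast
 have fQ: "finite Q" "finite (Y - Q)" using Q fY finite_subset by auto
 have 1: "pe Y Y = pe Q Q + pe (Y - Q) (Y - Q)" by (rule pe_sep_split[OF fY(1) Q(1,4)])
 have 2: "pe (Y - Q) (Y - Q) <= 2 * card X * card (Y - Q)"
  using erdos_gallai[OF fQ(2) pfree_mono[OF pfY Diff_subset]] l2 by simp
 have "card Y = card Q + card (Y - Q)" using Q fQ fY by (metis card_Diff_subset card_mono le_add_diff_inverse)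
 hence "2 * card X * card Y = 2 * card X * card Q + 2 * card X * card (Y - Q)" by (simp add: add_mult_distrib2)
 hence "(l - 2) * card Q <= pe Q Q" using eY 1 2 l2 by simp
 hence "card Q = l - 1 & clique Q" by (intro erdos_gallai_eq) (use fQ pfree_mono[OF pfY Q(1)] l2 Q in auto)
 thus "\<exists>Q. Q \<subseteq> P & clique Q & card Q = l - 1" using Q(1) fY(3) by blast
qed

text \<open>The parts of the core are independent, but each hub sees \<open>k\<close> more vertices
  of it than any other outside vertex may, which makes up for the inner edges of a clique core.
  Equality in the deletion count gives classes for all vertices except the hubs, and
  \<open>hub_class_bound\<close> bounds their edges. If that bound is attained too, at most one
  class carries edges, since two would give \<open>F4\<close>.\<close>

lemma exact_S:
 fixes r :: nat
 assumes V: "finite V" and l: "3 <= l" and f1: "~ forb1 r l m V" and f4: "~ forb4 r l m V" and r: "0 < r"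
  and B: "blow r B V" "!!i. i < r ==> card (B i) = k" and k: "2 * m + 2 * l < k"
  and X: "X \<subseteq> V" "2 * card X + 2 = l" "!!i. i < r ==> cmpl X (B i)"
 defines "U \<equiv> \<Union>i<r. B i"
 shows "U \<subseteq> V" "card U = r * k"
  "pe U U + 2 * pe U (V - U) <= r * (r - 1) * k * k + (l - 2) * k + 2 * ((r - 1) * k * (card V - r * k))"
  "pe U U + 2 * pe U (V - U) = r * (r - 1) * k * k + (l - 2) * k + 2 * ((r - 1) * k * (card V - r * k)) ==>
   \<exists>p. (\<Sum>i<r. p i) + card X = card V &
    pe V V <= card X * (card X - 1) + 2 * card X * (\<Sum>i<r. p i) + (\<Sum>i<r. \<Sum>j\<in>{..<r} - {i}. p i * p j) &
    (pe V V = card X * (card X - 1) + 2 * card X * (\<Sum>i<r. p i) + (\<Sum>i<r. \<Sum>j\<in>{..<r} - {i}. p i * p j) --> (\<exists>c. gcol r l V c))"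
proof -
 have fB: "finite (B i)" "B i \<subseteq> V" if "i < r" for i using B(1) that by (auto simp: blow_def)
 have dB: "B i Int B j = {}" if "i < r" "j < r" "i ~= j" for i j by (rule blow_disj[OF B(1) that])
 have cB: "cmpl (B i) (B j)" if "i < r" "j < r" "i ~= j" for i j using B(1) that by (simp add: blow_def)
 have XB: "X Int B i = {}" if "i < r" for i by (rule cmpl_disj[OF X(3)[OF that]])
 have fX: "finite X" using X(1) V finite_subset by blast
 have t: "1 <= card X" using X(2) l by linarith
 hence Xne: "X ~= {}" by auto
 show UV: "U \<subseteq> V" using fB by (auto simp: U_def)
 show cU: "card U = r * k" unfolding U_def by (rule pe_blow(1)[OF B])
 have fU: "finite U" using UV V finite_subset by blast
 have XU: "X Int U = {}" using XB by (auto simp: U_def)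
 have dU: "dg v U = (\<Sum>i<r. dg v (B i))" for v unfolding U_def by (rule dg_UN) (use fB dB in auto)
 have dk: "dg v (B i) <= k" if "i < r" for v i using dg_le_card[OF fB(1)[OF that], of v] B(2)[OF that] by simp
 \<comment> \<open>An edge from \<open>y\<close> into \<open>B i\<close> continues an alternating
   path through all hubs by two vertices, to \<open>l\<close> in all.\<close>
 have K1: "nb y (B i) = {}" if y: "y \<in> V - X" and i: "i < r" and big: "!!j. j < r ==> j ~= i ==> m <= dg y (B j)" for y i
 proof (rule ccontr)
  assume "nb y (B i) ~= {}"
  then obtain b where b: "b \<in> B i" "E y b" by (auto simp: nb_def)
  define S where "S = (%j. if j = i then insert y (X Un B i) else nb y (B j))"
  have bl: "blow r S V" unfolding blow_def
  proof (intro conjI allI impI)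
   fix a assume a: "a < r"
   show "S a \<subseteq> V" "finite (S a)" using fB[OF a] fB[OF i] y fX X(1) by (auto simp: S_def)
   fix d assume d: "d < r" "a ~= d"
   have ci: "cmpl (insert y (X Un B i)) (nb y (B j))" if "j < r" "j ~= i" for j
    using X(3)[OF that(1)] cB[OF i that(1)] that by (auto simp: cmpl_def)
   show "cmpl (S a) (S d)"
   proof (cases "a = i")
    case True thus ?thesis using ci[of d] d by (simp add: S_def)
   next
    case na: False
    show ?thesis
    proof (cases "d = i")
     case True thus ?thesis using cmpl_sym[OF ci[OF a na]] na by (simp add: S_def)
    next
     case False thus ?thesis using na cmpl_mono[OF cB[OF a d] nb_subset nb_subset] by (simp add: S_def)
    qed
   qed
  qed
  have yb: "y ~= b" using b E_irrefl by blast
  have c2: "card (B i) - 2 <= card (B i - {y, b})"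
   using diff_card_le_card_Diff[of "{y, b}" "B i"] by (simp add: card_insert_if split: if_splits)
  have cm: "cmpl X (B i - {y, b})" using X(3)[OF i] by (auto simp: cmpl_def)
  define h where "h = 2 * card X"
  have h: "h div 2 <= card X" "(h + 1) div 2 <= card (B i - {y, b})" using c2 B(2)[OF i] X(2) k by (auto simp: h_def)
  obtain xs where xs: "ispath (X Un (B i - {y, b})) xs" "length xs = h" "xs ~= [] --> last xs \<in> (if even h then X else B i - {y, b})"
   using bip_path[OF fX _ cm h] fB(1)[OF i] by blast
  have ne: "xs ~= []" using xs(2) t by (auto simp: h_def)
  have lx: "E (last xs) b" using xs(3) ne X(3)[OF i] b by (auto simp: cmpl_def h_def)
  have "set xs \<subseteq> X Un (B i - {y, b})" using xs(1) by (simp add: ispath_def)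
  moreover have "b \<notin> X" "y \<notin> X" using XB[OF i] b y by auto
  moreover have "ispath (S i) [b, y]" using b yb E_sym by (auto simp: ispath_def S_def)
  moreover have "ispath (S i) xs" by (rule ispath_mono[OF xs(1)]) (auto simp: S_def)
  ultimately have "ispath (S i Un S i) (xs @ [b, y])" by (intro ispath_append) (use lx in auto)
  hence "ispath (S i) (xs @ [b, y])" by simp
  moreover have "length (xs @ [b, y]) = l" using xs(2) X(2) by (simp add: h_def)
  ultimately have np: "~ pfree l (S i)" unfolding pfree_def by blast
  have "card (B i) <= card (S i)" by (rule card_mono) (use fB[OF i] fX in "auto simp: S_def")
  hence "l + m <= card (S i)" using B(2)[OF i] k by simp
  moreover have "\<forall>j<r. j ~= i --> m <= card (S j)" using big by (simp add: S_def dg_def)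
  ultimately have "forb1 r l m V" unfolding forb1_def using i bl np by blast
  thus False using f1 by simp
 qed
 have indB: "nb y (B i) = {}" if "i < r" "y \<in> B i" for i y
 proof (rule K1)
  show "y \<in> V - X" using that fB XB by blast
  fix j assume j: "j < r" "j ~= i"
  have "nb y (B j) = B j" using cB[of i j] that j by (auto simp: cmpl_def)
  thus "m <= dg y (B j)" using B(2)[OF j(1)] k by (simp add: dg_def)
 qed (rule that)
 have key: "dg y U <= (r - 1) * k & (dg y U = (r - 1) * k --> (\<exists>i<r. nb y (B i) = {} & (\<forall>j<r. j ~= i --> B j \<subseteq> nb y (B j))))" if y: "y \<in> V - X" for y
 proof (cases "\<exists>i<r. \<forall>j<r. j ~= i --> m <= dg y (B j)")
  case True
  then obtain i where i: "i < r" "\<forall>j<r. j ~= i --> m <= dg y (B j)" by blast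
  have e: "nb y (B i) = {}" by (rule K1[OF y i(1)]) (use i(2) in blast)
  have d0: "dg y (B i) = 0" using e by (simp add: dg_def)
  have "B j \<subseteq> nb y (B j)" if "dg y U = (r - 1) * k" "j < r" "j ~= i" for j
   by (rule nb_full[OF fB(1)[OF that(2)]]) (use sum_one_zero(2)[of r "%j. dg y (B j)" k i j, OF dk i(1) d0] that dU B(2) in auto)
  thus ?thesis using sum_one_zero(1)[of r "%j. dg y (B j)" k i, OF dk i(1) d0] dU i e by auto
 next
  case False
  obtain a where a: "a < r" "a ~= 0" "dg y (B a) < m" using False r by (meson not_le)
  obtain b where b: "b < r" "b ~= a" "dg y (B b) < m" using False a(1) by (meson not_le)
  have "dg y U < (r - 1) * k"
   using sum_two_small[of r "%j. dg y (B j)" k a b, OF dk a(1) b(1)] dU a b k by simp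
  thus ?thesis by simp
 qed
 have sB: "(\<Sum>i<r. pe (B i) (B i)) = 0"
  by (intro sum.neutral ballI) (use indB in "auto simp: pe_def dg_def")
 have UU: "pe U U = r * (r - 1) * k * k" using pe_blow(2)[OF B] sB by (simp add: U_def)
 define W where "W = V - U - X"
 have W: "V - U = X Un W" "X Int W = {}" "finite W" using X(1) XU V by (auto simp: W_def)
 have cW: "card V = r * k + card X + card W"
 proof -
  have "card V = card U + card (V - U)" using card_Diff_subset[OF fU UV] card_mono[OF V UV] by simp
  thus ?thesis using W cU fX by (simp add: card_Un_disjoint)
 qed
 have pX: "pe X U = card X * (r * k)"
  using pe_cmpl[of X U] X(3) cU by (force simp: U_def cmpl_def)
 have UVU: "pe U (V - U) = card X * (r * k) + (\<Sum>y\<in>W. dg y U)"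
 proof -
  have "pe U (V - U) = pe (X Un W) U" unfolding W(1) by (rule pe_sym) (use fU fX W(3) in auto)
  also have "... = pe X U + pe W U" by (rule pe_Un1[OF fX W(3,2)])
  finally show ?thesis using pX by (simp add: pe_def)
 qed
 have WV: "y \<in> V - X" if "y \<in> W" for y using that by (auto simp: W_def)
 have sW: "(\<Sum>y\<in>W. dg y U) <= (\<Sum>y\<in>W. (r - 1) * k)" by (rule sum_mono) (use key WV in blast)
 have cs: "(\<Sum>y\<in>W. (r - 1) * k) = (r - 1) * k * card W" by simp
 \<comment> \<open>The surplus \<open>2 * card X * k\<close> of the hubs is the term
   \<open>(l - 2) * k\<close>.\<close>
 have tot: "(l - 2) * k + 2 * ((r - 1) * k * (card V - r * k)) = 2 * (card X * (r * k)) + 2 * ((r - 1) * k * card W)"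
 proof -
  have "card V - r * k = card X + card W" using cW by simp
  moreover have "l - 2 = 2 * card X" using X(2) by simp
  moreover obtain s where "r = Suc s" using r gr0_implies_Suc by blast
  ultimately show ?thesis by (simp add: algebra_simps)
 qed
 show "pe U U + 2 * pe U (V - U) <= r * (r - 1) * k * k + (l - 2) * k + 2 * ((r - 1) * k * (card V - r * k))"
  using UU UVU sW cs tot by linarith
 assume "pe U U + 2 * pe U (V - U) = r * (r - 1) * k * k + (l - 2) * k + 2 * ((r - 1) * k * (card V - r * k))"
 hence e2: "(\<Sum>y\<in>W. dg y U) = (\<Sum>y\<in>W. (r - 1) * k)" using UU UVU cs tot by linarith
 have eW: "dg y U = (r - 1) * k" if y: "y \<in> W" for y
  by (rule sum_mono_inv[OF e2]) (use key WV y W(3) in auto)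
 have full: "\<exists>i<r. nb y (B i) = {} & (\<forall>j<r. j ~= i --> B j \<subseteq> nb y (B j))" if y: "y \<in> V - X" for y
 proof (cases "y \<in> U")
  case True
  then obtain i where i: "i < r" "y \<in> B i" by (auto simp: U_def)
  have "B j \<subseteq> nb y (B j)" if "j < r" "j ~= i" for j using cB[of i j] i that by (auto simp: cmpl_def)
  thus ?thesis using indB[OF i] i(1) by blast
 next
  case False
  hence "y \<in> W" using y by (simp add: W_def)
  thus ?thesis using key[OF y] eW by blast
 qed
 define c where "c = (%y. SOME i. i < r & nb y (B i) = {} & (\<forall>j<r. j ~= i --> B j \<subseteq> nb y (B j)))"
 have c: "c y < r & nb y (B (c y)) = {} & (\<forall>j<r. j ~= c y --> B j \<subseteq> nb y (B j))" if "y \<in> V - X" for y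
  unfolding c_def by (rule someI_ex) (use full[OF that] in blast)
 define P where "P = (%i. {y\<in>V - X. c y = i})"
 have fP: "finite (P i)" "P i Int X = {}" "P i \<subseteq> V" for i using V by (auto simp: P_def)
 have dP: "P i Int P j = {}" if "i ~= j" for i j using that by (auto simp: P_def)
 have UP: "V - X = (\<Union>i<r. P i)" using c by (auto simp: P_def)
 have BP: "B i \<subseteq> P i" if i: "i < r" for i
 proof
  fix y assume y: "y \<in> B i"
  have yV: "y \<in> V - X" using y fB(2)[OF i] XB[OF i] by blast
  have "c y = i"
  proof (rule ccontr)
   assume "c y ~= i"
   hence "B i \<subseteq> nb y (B i)" using c[OF yV] i by blast
   hence "y \<in> nb y (B i)" using y by blast
   thus False using E_irrefl by simp
  qed
  thus "y \<in> P i" using yV by (simp add: P_def)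
 qed
 have cP: "k <= card (P i)" if "i < r" for i using card_mono[OF fP(1) BP[OF that]] B(2)[OF that] by simp
 have PB: "cmpl (P i) (B j)" if "i < r" "j < r" "j ~= i" for i j
  using c that by (fastforce simp: P_def cmpl_def)
 have pf: "pfree l (P i Un X)" if i: "i < r" for i
 proof (rule ccontr)
  assume np: "~ pfree l (P i Un X)"
  define S where "S = (%j. if j = i then P i Un X else B j)"
  have "blow r S V" unfolding blow_def
  proof (intro conjI allI impI)
   fix a assume a: "a < r"
   show "S a \<subseteq> V" "finite (S a)" using fB[OF a] fP fX X(1) by (auto simp: S_def)
   fix b assume b: "b < r" "a ~= b"
   have "cmpl (P i Un X) (B j)" if "j < r" "j ~= i" for j
    using X(3)[OF that(1)] PB[OF i that] by (simp add: cmpl_Un1)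
   thus "cmpl (S a) (S b)" using a b cB[OF a b] cmpl_sym by (simp add: S_def)
  qed
  moreover have "card (P i) <= card (P i Un X)" by (rule card_mono) (use fP fX in auto)
  hence "l + m <= card (S i)" using cP[OF i] k by (simp add: S_def)
  moreover have "\<forall>j<r. j ~= i --> m <= card (S j)" using B(2) k by (simp add: S_def)
  moreover have "~ pfree l (S i)" using np by (simp add: S_def)
  ultimately have "forb1 r l m V" unfolding forb1_def using i by blast
  thus False using f1 by simp
 qed
 note hub = hub_class_bound[OF fP(1) fX X(2) Xne pf fP(2) BP X(3)]
 have hub1: "pe (P i) (P i) + 2 * pe (P i) X <= 2 * card X * card (P i)" if "i < r" for i
  using hub(1)[OF that that that] B(2)[OF that] k by simp
 have hub2: "\<exists>Q. Q \<subseteq> P i & clique Q & card Q = l - 1" if "i < r" "pe (P i) (P i) + 2 * pe (P i) X = 2 * card X * card (P i)" "~ sep (P i) (P i)" for i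
  using hub(2)[OF that(1) that(1) that(1)] B(2)[OF that(1)] k that by simp
 define p where "p = (%i. card (P i))"
 have sp: "card (V - X) = (\<Sum>i<r. p i)" unfolding UP p_def by (rule card_UN_disjoint) (use fP dP in auto)
 hence cV: "(\<Sum>i<r. p i) + card X = card V" using card_Diff_subset[OF fX X(1)] card_mono[OF V X(1)] by simp
 have pV: "pe V V = pe (V - X) (V - X) + 2 * (\<Sum>i<r. pe (P i) X) + pe X X"
 proof -
  have "pe (V - X) X = (\<Sum>i<r. pe (P i) X)" unfolding UP by (rule pe_UN1) (use fP dP in auto)
  moreover have "pe X (V - X) = pe (V - X) X" by (rule pe_sym) (use fX V in auto)
  ultimately show ?thesis using pe_split[OF V X(1)] by simp
 qed
 have pXX: "pe X X <= card X * (card X - 1)"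
 proof -
  have "pe X X <= (\<Sum>x\<in>X. card X - 1)" unfolding pe_def
  proof (rule sum_mono)
   fix x assume "x \<in> X"
   thus "dg x X <= card X - 1" using dg_self_less[OF fX, of x] by simp
  qed
  thus ?thesis by simp
 qed
 have pp: "card (P i) = p i" for i by (simp add: p_def)
 have dP': "P i Int P j = {}" if "i < r" "j < r" "i ~= j" for i j by (rule dP[OF that(3)])
 note pc = parts_count[of r P "V - X", OF fP(1) dP' UP, unfolded pp]
 have hs: "(\<Sum>i<r. pe (P i) (P i) + 2 * pe (P i) X) <= (\<Sum>i<r. 2 * card X * p i)"
  by (rule sum_mono) (use hub1 in "auto simp: p_def")
 have sd: "(\<Sum>i<r. pe (P i) (P i) + 2 * pe (P i) X) = (\<Sum>i<r. pe (P i) (P i)) + 2 * (\<Sum>i<r. pe (P i) X)"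
  by (simp add: sum.distrib sum_distrib_left)
 have sm: "(\<Sum>i<r. 2 * card X * p i) = 2 * card X * (\<Sum>i<r. p i)" by (simp add: sum_distrib_left)
 have le: "pe V V <= card X * (card X - 1) + 2 * card X * (\<Sum>i<r. p i) + (\<Sum>i<r. \<Sum>j\<in>{..<r} - {i}. p i * p j)"
  using pV pXX pc(2) hs sd sm by linarith
 have "\<exists>c. gcol r l V c" if eq: "pe V V = card X * (card X - 1) + 2 * card X * (\<Sum>i<r. p i) + (\<Sum>i<r. \<Sum>j\<in>{..<r} - {i}. p i * p j)"
 proof -
  have "(\<Sum>i<r. pe (P i) (P i)) + (\<Sum>i<r. \<Sum>j\<in>{..<r} - {i}. p i * p j) <= pe (V - X) (V - X)"
   using eq pV pXX hs sd sm by linarith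
  hence cmp: "cmpl (P a) (P b)" if "a < r" "b < r" "a ~= b" for a b using pc(3) that by blast
  have hse: "(\<Sum>i<r. pe (P i) (P i) + 2 * pe (P i) X) = (\<Sum>i<r. 2 * card X * p i)"
   using eq pV pXX hs sd sm pc(2) by linarith
  have each: "pe (P i) (P i) + 2 * pe (P i) X = 2 * card X * card (P i)" if i: "i < r" for i
   using sum_mono_inv[OF hse, of i] hub1 i by (simp add: p_def)
  have one: "a = b" if ab: "a < r" "b < r" "~ sep (P a) (P a)" "~ sep (P b) (P b)" for a b
  proof (rule ccontr)
   assume ne: "a ~= b"
   obtain Q Q' where Q: "Q \<subseteq> P a" "clique Q" "card Q = l - 1" "Q' \<subseteq> P b" "clique Q'" "card Q' = l - 1"
    using hub2[OF ab(1) each[OF ab(1)] ab(3)] hub2[OF ab(2) each[OF ab(2)] ab(4)] by blast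
   have bl: "blow r P V" unfolding blow_def using fP cmp by blast
   have s: "m <= card (P i)" "l - 1 + m <= card (P i)" if "i < r" for i using cP[OF that] k by auto
   have "forb4 r l m V" unfolding forb4_def using ab(1,2) ne bl s Q by blast
   thus False using f4 by simp
  qed
  obtain i0 where i0: "i0 < r" "\<forall>j<r. j ~= i0 --> sep (P j) (P j)" using one r by metis
  \<comment> \<open>Exchanges the colours \<open>0\<close> and \<open>i0\<close> and gives colour
    \<open>0\<close> to the hubs.\<close>
  define c' where "c' = (%v. if v \<in> X then 0 else if c v = i0 then 0 else if c v = 0 then i0 else c v)"
  have c0: "v \<in> P i0 Un X" if "v \<in> V" "c' v = 0" for v using that by (auto simp: c'_def P_def split: if_splits)
  have "gcol r l V c'" unfolding gcol_def
  proof (intro conjI ballI impI)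
   fix v assume "v \<in> V" thus "c' v < r" using c[of v] i0(1) r by (auto simp: c'_def)
  next
   fix u v assume uv: "u \<in> V" "v \<in> V" "E u v & c' u = c' v"
   show "c' u = 0"
   proof (rule ccontr)
    assume n: "c' u ~= 0"
    hence s: "u \<notin> X" "c u ~= i0" "v \<notin> X" "c v ~= i0" using uv(3) by (auto simp: c'_def split: if_splits)
    hence "c u = c v" using uv(3) n by (auto simp: c'_def split: if_splits)
    hence "u \<in> P (c u)" "v \<in> P (c u)" using uv s by (auto simp: P_def)
    moreover have "c u < r" using c[of u] uv s by blast
    ultimately show False using i0(2) s uv(3) unfolding sep_def by blast
   qed
  next
   show "pfree l {v \<in> V. c' v = 0}" by (rule pfree_mono[OF pf[OF i0(1)]]) (use c0 in blast)
  qed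
  thus ?thesis by blast
 qed
 thus "\<exists>p. (\<Sum>i<r. p i) + card X = card V &
    pe V V <= card X * (card X - 1) + 2 * card X * (\<Sum>i<r. p i) + (\<Sum>i<r. \<Sum>j\<in>{..<r} - {i}. p i * p j) &
    (pe V V = card X * (card X - 1) + 2 * card X * (\<Sum>i<r. p i) + (\<Sum>i<r. \<Sum>j\<in>{..<r} - {i}. p i * p j) --> (\<exists>c. gcol r l V c))"
  using cV le by blast
qed

end

section \<open>The forbidden graphs\<close>

text \<open>The clause \<open>x ~= y\<close> makes the relation irreflexive for every graph record,
  simple or not; \<open>sgraph_all_eg\<close> relies on this.\<close>

definition eg :: "'a graph => 'a => 'a => bool" where
 "eg G x y \<longleftrightarrow> x ~= y & {x, y} \<in> edges G"

lemma inj_on_Plus: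
 "inj_on f (A <+> B) \<longleftrightarrow> inj_on (f o Inl) A & inj_on (f o Inr) B & (f o Inl) ` A Int (f o Inr) ` B = {}"
proof
 assume i: "inj_on f (A <+> B)"
 have "inj_on (f o Inl) A" "inj_on (f o Inr) B"
  by (auto intro!: comp_inj_on inj_on_subset[OF i])
 moreover have "(f o Inl) ` A Int (f o Inr) ` B = {}" using inj_onD[OF i] by fastforce
 ultimately show "inj_on (f o Inl) A & inj_on (f o Inr) B & (f o Inl) ` A Int (f o Inr) ` B = {}" by blast
next
 assume a: "inj_on (f o Inl) A & inj_on (f o Inr) B & (f o Inl) ` A Int (f o Inr) ` B = {}"
 show "inj_on f (A <+> B)"
 proof (rule inj_onI)
  fix x y assume "x \<in> A <+> B" "y \<in> A <+> B" "f x = f y"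
  moreover have "f (Inl u) ~= f (Inr v)" if "u \<in> A" "v \<in> B" for u v using a that by fastforce
  ultimately show "x = y" using inj_onD[OF conjunct1[OF a]] inj_onD[OF conjunct1[OF conjunct2[OF a]]]
   by (cases x; cases y) (fastforce simp: eq_commute)+
 qed
qed

lemma image_Plus: "f ` (A <+> B) = (f o Inl) ` A Un (f o Inr) ` B"
 by (auto simp: Plus_def)

locale gr =
 fixes G :: "'a graph"
 assumes simple: "simple_graph G"

sublocale gr \<subseteq> sgraph "eg G"
 by unfold_locales (auto simp: eg_def insert_commute)

context gr begin

lemma fin: "finite (verts G)" using simple by (simp add: simple_graph_def)

lemma edge_iff: "{x, y} \<in> edges G \<longleftrightarrow> eg G x y"
 using simple unfolding eg_def simple_graph_def by force

lemma eg_verts: "eg G x y ==> x \<in> verts G & y \<in> verts G"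
 using simple unfolding eg_def simple_graph_def by blast

lemma pe_card_edges: "pe (verts G) (verts G) = 2 * card (edges G)"
proof -
 let ?V = "verts G"
 have fE: "finite (edges G)" by (rule finite_subset[of _ "Pow ?V"]) (use simple fin in "auto simp: simple_graph_def")
 let ?P = "SIGMA x:?V. nb x ?V"
 have "pe ?V ?V = card ?P" using fin by (simp add: pe_def dg_def)
 also have "?P = (\<Union>e\<in>edges G. {(x, y). eg G x y & {x, y} = e})"
  using eg_verts edge_iff by auto
 also have "card ... = (\<Sum>e\<in>edges G. card {(x, y). eg G x y & {x, y} = e})"
 proof (rule card_UN_disjoint[OF fE])
  show "\<forall>e\<in>edges G. finite {(x, y). eg G x y & {x, y} = e}"
  proof
   fix e assume "e \<in> edges G"
   have "{(x, y). eg G x y & {x, y} = e} \<subseteq> ?V \<times> ?V" using eg_verts by auto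
   thus "finite {(x, y). eg G x y & {x, y} = e}" using fin finite_subset by blast
  qed
 qed auto
 also have "... = (\<Sum>e\<in>edges G. 2)"
 proof (rule sum.cong[OF refl])
  fix e assume e: "e \<in> edges G"
  then obtain a b where ab: "e = {a, b}" "a ~= b" using simple by (metis simple_graph_def card_2_iff)
  have "eg G a b" "eg G b a" using e ab edge_iff E_sym by auto
  hence "{(x, y). eg G x y & {x, y} = e} = {(a, b), (b, a)}" using ab by (auto simp: doubleton_eq_iff)
  thus "card {(x, y). eg G x y & {x, y} = e} = 2" using ab by simp
 qed
 finally show ?thesis by simp
qed

section \<open>Embeddings of unions, joins and Turan graphs\<close>

definition emb :: "('b => 'a) => 'b graph => bool" where
 "emb f F \<longleftrightarrow> inj_on f (verts F) & f ` verts F \<subseteq> verts G & (\<forall>e\<in>edges F. f ` e \<in> edges G)"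
text \<open>Only the image of an embedding matters to the other factors of a join, so unions and
  joins can be taken apart set by set.\<close>

definition iemb :: "'b graph => 'a set => bool" where "iemb F S \<longleftrightarrow> (\<exists>f. emb f F & f ` verts F = S)"

lemma contains_iemb: "contains_graph G F \<longleftrightarrow> (\<exists>S. iemb F S)"
 by (auto simp: contains_graph_def iemb_def emb_def)

lemma contains_nat_copy: "contains_graph G (nat_copy F) \<longleftrightarrow> contains_graph G F"
proof
 assume "contains_graph G (nat_copy F)"
 then obtain f where f: "inj_on f (to_nat ` verts F)" "f ` to_nat ` verts F \<subseteq> verts G" "\<forall>e\<in>(%e. to_nat ` e) ` edges F. f ` e \<in> edges G"
  by (auto simp: contains_graph_def nat_copy_def)
 show "contains_graph G F" unfolding contains_graph_def
  using f by (intro exI[of _ "f o to_nat"] conjI ballI) (auto simp: image_comp[symmetric] simp del: o_apply comp_apply intro!: comp_inj_on)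
next
 assume "contains_graph G F"
 then obtain f where f: "inj_on f (verts F)" "f ` verts F \<subseteq> verts G" "\<forall>e\<in>edges F. f ` e \<in> edges G"
  by (auto simp: contains_graph_def)
 have i: "(f o from_nat) ` to_nat ` A = f ` A" for A by (simp add: image_comp comp_def)
 have i': "(%x. f (from_nat x)) ` to_nat ` A = f ` A" for A by (simp add: image_image)
 have "inj_on (f o from_nat) (to_nat ` verts F)" using f(1) by (auto simp: inj_on_def)
 thus "contains_graph G (nat_copy F)" unfolding contains_graph_def
  by (intro exI[of _ "f o from_nat"]) (use f in "auto simp: nat_copy_def i i'")
qed

lemma iemb_sub: "iemb F S ==> S \<subseteq> verts G" by (auto simp: iemb_def emb_def)

lemma iemb_card: "iemb F S ==> card S = card (verts F)" by (auto simp: iemb_def emb_def card_image)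

lemma emb_union: "emb f (A \<union>\<^sub>g B) \<longleftrightarrow> emb (f o Inl) A & emb (f o Inr) B & (f o Inl) ` verts A Int (f o Inr) ` verts B = {}"
 unfolding emb_def disj_union_def by (simp add: inj_on_Plus image_Plus image_comp ball_Un) blast

lemma emb_join: "emb f (A \<otimes>\<^sub>g B) \<longleftrightarrow> emb (f o Inl) A & emb (f o Inr) B & cmpl ((f o Inl) ` verts A) ((f o Inr) ` verts B)"
proof -
 have "emb f (A \<otimes>\<^sub>g B) \<longleftrightarrow> emb f (A \<union>\<^sub>g B) & (\<forall>u\<in>verts A. \<forall>v\<in>verts B. eg G (f (Inl u)) (f (Inr v)))"
 proof -
  have "(\<forall>e\<in>{{Inl u, Inr v} |u v. u \<in> verts A & v \<in> verts B}. f ` e \<in> edges G) \<longleftrightarrow> (\<forall>u\<in>verts A. \<forall>v\<in>verts B. eg G (f (Inl u)) (f (Inr v)))"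
  proof (intro iffI ballI)
   fix u v assume a: "\<forall>e\<in>{{Inl u, Inr v} |u v. u \<in> verts A & v \<in> verts B}. f ` e \<in> edges G" "u \<in> verts A" "v \<in> verts B"
   have "{Inl u, Inr v} \<in> {{Inl u, Inr v} |u v. u \<in> verts A & v \<in> verts B}" using a(2,3) by blast
   hence "f ` {Inl u, Inr v} \<in> edges G" using a(1) by blast
   thus "eg G (f (Inl u)) (f (Inr v))" using edge_iff by simp
  next
   fix e assume a: "\<forall>u\<in>verts A. \<forall>v\<in>verts B. eg G (f (Inl u)) (f (Inr v))" "e \<in> {{Inl u, Inr v} |u v. u \<in> verts A & v \<in> verts B}"
   then obtain u v where "e = {Inl u, Inr v}" "u \<in> verts A" "v \<in> verts B" by blast
   thus "f ` e \<in> edges G" using a(1) edge_iff by simp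
  qed
  thus ?thesis unfolding emb_def graph_join_def by (simp add: disj_union_def ball_Un conj_assoc)
 qed
 also have "... \<longleftrightarrow> emb (f o Inl) A & emb (f o Inr) B & cmpl ((f o Inl) ` verts A) ((f o Inr) ` verts B)"
  unfolding emb_union using cmpl_disj[of "(f o Inl) ` verts A" "(f o Inr) ` verts B"] by (auto simp: cmpl_def)
 finally show ?thesis .
qed

lemma iemb_union: "iemb (A \<union>\<^sub>g B) U \<longleftrightarrow> (\<exists>S T. U = S Un T & S Int T = {} & iemb A S & iemb B T)"
proof
 assume "iemb (A \<union>\<^sub>g B) U"
 then obtain f where f: "emb f (A \<union>\<^sub>g B)" "f ` (verts A <+> verts B) = U" by (auto simp: iemb_def disj_union_def)
 show "\<exists>S T. U = S Un T & S Int T = {} & iemb A S & iemb B T"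
  by (rule exI[of _ "(f o Inl) ` verts A"], rule exI[of _ "(f o Inr) ` verts B"])
   (use f(1)[unfolded emb_union] f(2)[unfolded image_Plus] in "auto simp: iemb_def")
next
 assume "\<exists>S T. U = S Un T & S Int T = {} & iemb A S & iemb B T"
 then obtain f g where fg: "U = f ` verts A Un g ` verts B" "f ` verts A Int g ` verts B = {}" "emb f A" "emb g B"
  unfolding iemb_def by blast
 show "iemb (A \<union>\<^sub>g B) U" unfolding iemb_def emb_union
  by (rule exI[of _ "case_sum f g"]) (use fg in "simp add: disj_union_def image_Plus case_sum_o_inj")
qed

lemma iemb_join: "iemb (A \<otimes>\<^sub>g B) U \<longleftrightarrow> (\<exists>S T. U = S Un T & cmpl S T & iemb A S & iemb B T)"
proof
 assume "iemb (A \<otimes>\<^sub>g B) U"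
 then obtain f where f: "emb f (A \<otimes>\<^sub>g B)" "f ` (verts A <+> verts B) = U" by (auto simp: iemb_def graph_join_def)
 show "\<exists>S T. U = S Un T & cmpl S T & iemb A S & iemb B T"
  by (rule exI[of _ "(f o Inl) ` verts A"], rule exI[of _ "(f o Inr) ` verts B"])
   (use f(1)[unfolded emb_join] f(2)[unfolded image_Plus] in "auto simp: iemb_def")
next
 assume "\<exists>S T. U = S Un T & cmpl S T & iemb A S & iemb B T"
 then obtain f g where fg: "U = f ` verts A Un g ` verts B" "cmpl (f ` verts A) (g ` verts B)" "emb f A" "emb g B"
  unfolding iemb_def by blast
 show "iemb (A \<otimes>\<^sub>g B) U" unfolding iemb_def emb_join
  by (rule exI[of _ "case_sum f g"]) (use fg in "simp add: graph_join_def image_Plus case_sum_o_inj")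
qed

lemma enum_set: assumes "finite S" obtains f where "bij_betw f {..<card S} S"
 using ex_bij_betw_nat_finite[OF assms] by (metis atLeast0LessThan)

lemma iemb_edgeless: "iemb (edgeless_graph m) S \<longleftrightarrow> S \<subseteq> verts G & card S = m"
proof
 assume "iemb (edgeless_graph m) S"
 thus "S \<subseteq> verts G & card S = m" using iemb_sub iemb_card by (fastforce simp: edgeless_graph_def)
next
 assume S: "S \<subseteq> verts G & card S = m"
 hence "finite S" using fin finite_subset by blast
 then obtain f where "bij_betw f {..<card S} S" by (rule enum_set)
 thus "iemb (edgeless_graph m) S" using S by (auto simp: iemb_def emb_def edgeless_graph_def bij_betw_def)
qed

lemma iemb_complete: "iemb (complete_graph s) S \<longleftrightarrow> S \<subseteq> verts G & card S = s & clique S"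
proof
 assume i: "iemb (complete_graph s) S"
 then obtain f where f: "emb f (complete_graph s)" "S = f ` {..<s}" by (auto simp: iemb_def complete_graph_def)
 have "clique S" unfolding clique_def
 proof (intro ballI impI)
  fix x y assume "x \<in> S" "y \<in> S" "x ~= y"
  then obtain a b where ab: "a < s" "b < s" "x = f a" "y = f b" "a ~= b" using f(2) by auto
  have "{a, b} \<in> edges (complete_graph s)" using ab by (auto simp: complete_graph_def)
  hence "f ` {a, b} \<in> edges G" using f(1) unfolding emb_def by blast
  thus "eg G x y" using ab edge_iff by simp
 qed
 thus "S \<subseteq> verts G & card S = s & clique S" using i iemb_sub iemb_card[OF i] by (auto simp: complete_graph_def)
next
 assume S: "S \<subseteq> verts G & card S = s & clique S"
 hence "finite S" using fin finite_subset by blast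
 then obtain f where f: "bij_betw f {..<card S} S" by (rule enum_set)
 have "f ` e \<in> edges G" if ee: "e \<in> edges (complete_graph s)" for e
 proof -
  obtain i j where ij: "e = {i, j}" "i < s" "j < s" "i ~= j" using ee by (auto simp: complete_graph_def)
  have "f i ~= f j" "f i \<in> S" "f j \<in> S" using f ij S by (auto simp: bij_betw_def inj_on_def)
  hence "eg G (f i) (f j)" using S by (simp add: clique_def)
  thus ?thesis using ij edge_iff by simp
 qed
 thus "iemb (complete_graph s) S" using S f unfolding iemb_def emb_def
  by (intro exI[of _ f]) (auto simp: complete_graph_def bij_betw_def)
qed

lemma iemb_path: "iemb (path_graph l) S \<longleftrightarrow> (\<exists>xs. ispath (verts G) xs & length xs = l & set xs = S)"
proof
 assume i: "iemb (path_graph l) S"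
 then obtain f where f: "emb f (path_graph l)" "S = f ` {..<l}" by (auto simp: iemb_def path_graph_def)
 have e: "eg G (f i) (f (Suc i))" if "Suc i < l" for i
 proof -
  have "{i, Suc i} \<in> edges (path_graph l)" using that by (auto simp: path_graph_def)
  hence "f ` {i, Suc i} \<in> edges G" using f(1) unfolding emb_def by blast
  thus ?thesis using edge_iff by simp
 qed
 have "ispath (verts G) (map f [0..<l])" unfolding ispath_def
 proof (intro conjI)
  show "distinct (map f [0..<l])" using f(1) by (simp add: distinct_map emb_def path_graph_def atLeast0LessThan)
  show "set (map f [0..<l]) \<subseteq> verts G" using f(1) by (simp add: emb_def path_graph_def atLeast0LessThan)
  show "successively (eg G) (map f [0..<l])" using e by (simp add: successively_conv_nth)
 qed
 thus "\<exists>xs. ispath (verts G) xs & length xs = l & set xs = S" using f(2) by (intro exI[of _ "map f [0..<l]"]) (auto simp: atLeast0LessThan)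
next
 assume "\<exists>xs. ispath (verts G) xs & length xs = l & set xs = S"
 then obtain xs where xs: "ispath (verts G) xs" "length xs = l" "set xs = S" by blast
 have b: "bij_betw (%i. xs ! i) {..<l} S" using xs bij_betw_nth[of xs "{..<l}" S] by (simp add: ispath_def)
 have "(%i. xs ! i) ` e \<in> edges G" if ee: "e \<in> edges (path_graph l)" for e
 proof -
  obtain i where i: "e = {i, Suc i}" "Suc i < l" using ee by (auto simp: path_graph_def)
  have "eg G (xs ! i) (xs ! Suc i)" using xs i by (simp add: ispath_def successively_conv_nth)
  thus ?thesis using i edge_iff by simp
 qed
 thus "iemb (path_graph l) S" using b xs unfolding iemb_def emb_def
  by (intro exI[of _ "%i. xs ! i"]) (auto simp: path_graph_def bij_betw_def ispath_def)
qed

lemma contains_path: "contains_graph G (path_graph l) \<longleftrightarrow> ~ pfree l (verts G)"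
 unfolding contains_iemb iemb_path pfree_def by blast

lemma iemb_copies: "iemb (copies t H) S \<longleftrightarrow> (\<exists>T. (\<forall>i<t. iemb H (T i)) & (\<forall>i<t. \<forall>j<t. i ~= j --> T i Int T j = {}) & S = (\<Union>i<t. T i))"
proof
 assume "iemb (copies t H) S"
 then obtain f where f: "emb f (copies t H)" "S = f ` ({..<t} \<times> verts H)" by (auto simp: iemb_def copies_def)
 define T where "T = (%i. (%x. f (i, x)) ` verts H)"
 have inj: "inj_on f ({..<t} \<times> verts H)" using f(1) by (simp add: emb_def copies_def)
 have "iemb H (T i)" if i: "i < t" for i
 proof -
  have "inj_on (%x. f (i, x)) (verts H)" using inj i by (auto simp: inj_on_def)
  moreover have "(%x. f (i, x)) ` verts H \<subseteq> verts G" using f(1) i by (auto simp: emb_def copies_def)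
  moreover have "(%x. f (i, x)) ` e \<in> edges G" if "e \<in> edges H" for e
  proof -
   have "Pair i ` e \<in> edges (copies t H)" using that i by (auto simp: copies_def)
   hence "f ` Pair i ` e \<in> edges G" using f(1) unfolding emb_def by blast
   thus ?thesis by (simp add: image_comp comp_def)
  qed
  ultimately have "emb (%x. f (i, x)) H" by (simp add: emb_def)
  thus ?thesis unfolding iemb_def T_def by blast
 qed
 moreover have "T i Int T j = {}" if "i < t" "j < t" "i ~= j" for i j
  using inj that by (auto simp: T_def inj_on_def)
 moreover have "S = (\<Union>i<t. T i)" using f(2) by (auto simp: T_def)
 ultimately show "\<exists>T. (\<forall>i<t. iemb H (T i)) & (\<forall>i<t. \<forall>j<t. i ~= j --> T i Int T j = {}) & S = (\<Union>i<t. T i)" by blast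
next
 assume "\<exists>T. (\<forall>i<t. iemb H (T i)) & (\<forall>i<t. \<forall>j<t. i ~= j --> T i Int T j = {}) & S = (\<Union>i<t. T i)"
 then obtain T where T: "!!i. i < t ==> iemb H (T i)" "!!i j. i < t ==> j < t ==> i ~= j ==> T i Int T j = {}" "S = (\<Union>i<t. T i)"
  by (elim exE conjE) (rule, blast, blast, assumption)
 have "\<forall>i\<in>{..<t}. \<exists>f. emb f H & f ` verts H = T i" using T(1) by (auto simp: iemb_def)
 then obtain g where "\<forall>i\<in>{..<t}. emb (g i) H & g i ` verts H = T i" unfolding bchoice_iff ..
 hence g: "emb (g i) H" "g i ` verts H = T i" if "i < t" for i using that by auto
 define f where "f = (%(i, x). g i x)"
 have "inj_on f ({..<t} \<times> verts H)"
 proof (rule inj_onI)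
  fix p q assume pq: "p \<in> {..<t} \<times> verts H" "q \<in> {..<t} \<times> verts H" "f p = f q"
  obtain i x j y where ij: "p = (i, x)" "q = (j, y)" "i < t" "j < t" "x \<in> verts H" "y \<in> verts H" using pq by auto
  have "g i x \<in> T i" "g j y \<in> T j" using g(2) ij by blast+
  moreover have e: "g i x = g j y" using pq ij by (simp add: f_def)
  ultimately have "i = j" using T(2)[of i j] ij by auto
  moreover have "inj_on (g i) (verts H)" using g(1) ij by (simp add: emb_def)
  ultimately show "p = q" using e ij by (auto simp: inj_on_def)
 qed
 moreover have im: "f ` ({..<t} \<times> verts H) = S"
 proof -
  have "f ` ({..<t} \<times> verts H) = (\<Union>i<t. g i ` verts H)" by (auto simp: f_def)
  thus ?thesis using g(2) T(3) by simp
 qed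
 moreover have "S \<subseteq> verts G" using T(1,3) iemb_sub by auto
 moreover have "f ` e \<in> edges G" if ee: "e \<in> edges (copies t H)" for e
 proof -
  obtain i e' where e': "e = Pair i ` e'" "i < t" "e' \<in> edges H" using ee by (auto simp: copies_def)
  have "f ` e = g i ` e'" using e' by (auto simp: f_def image_comp comp_def)
  thus ?thesis using g(1)[OF e'(2)] e'(3) by (simp add: emb_def)
 qed
 ultimately show "iemb (copies t H) S" unfolding iemb_def emb_def by (intro exI[of _ f]) (auto simp: copies_def)
qed

text \<open>The parts are the images of the residue classes modulo \<open>s\<close>. Conversely,
  \<open>v\<close> goes to the element with number \<open>v div s\<close> in an enumeration of the
  part \<open>v mod s\<close>.\<close>

lemma iemb_turan: "iemb (turan_graph (m * s) s) S \<longleftrightarrow> (\<exists>T. blow s T (verts G) & (\<forall>j<s. card (T j) = m) & S = (\<Union>j<s. T j))"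
proof (cases "s = 0")
 case True thus ?thesis by (auto simp: iemb_def emb_def turan_graph_def blow_def)
next
 case False
 hence s: "0 < s" by simp
 have vt: "verts (turan_graph (m * s) s) = {..<m * s}" using s by (simp add: turan_graph_def)
 show ?thesis
 proof
  assume i: "iemb (turan_graph (m * s) s) S"
  then obtain f where f: "emb f (turan_graph (m * s) s)" "S = f ` {..<m * s}" using vt by (auto simp: iemb_def)
  define T where "T = (%j. f ` {v. v < m * s & v mod s = j})"
  have inj: "inj_on f {..<m * s}" using f(1) vt by (simp add: emb_def)
  have "blow s T (verts G)" unfolding blow_def
  proof (intro conjI allI impI)
   fix a assume "a < s"
   show Ta: "T a \<subseteq> verts G" using f(1) vt by (auto simp: emb_def T_def)
   show "finite (T a)" by (rule finite_subset[OF Ta fin])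
   fix b assume b: "a ~= b"
   show "cmpl (T a) (T b)" unfolding cmpl_def
   proof (intro ballI)
    fix x y assume "x \<in> T a" "y \<in> T b"
    then obtain u v where uv: "x = f u" "y = f v" "u < m * s" "v < m * s" "u mod s = a" "v mod s = b" by (auto simp: T_def)
    have "{u, v} \<in> edges (turan_graph (m * s) s)" using uv b s by (auto simp: turan_graph_def)
    hence "f ` {u, v} \<in> edges G" using f(1) unfolding emb_def by blast
    thus "eg G x y" using uv edge_iff by simp
   qed
  qed
  moreover have "card (T j) = m" if "j < s" for j
  proof -
   have "inj_on f {v. v < m * s & v mod s = j}" by (rule inj_on_subset[OF inj]) auto
   hence "card (T j) = card {v. v < m * s & v mod s = j}" unfolding T_def by (rule card_image)
   thus ?thesis using turan_part_card[OF that, of "m * s"] s by simp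
  qed
  moreover have "S = (\<Union>j<s. T j)"
  proof -
   have "{..<m * s} = (\<Union>j<s. {v. v < m * s & v mod s = j})" using s by auto
   hence "S = f ` (\<Union>j<s. {v. v < m * s & v mod s = j})" using f(2) by simp
   thus ?thesis unfolding T_def image_UN .
  qed
  ultimately show "\<exists>T. blow s T (verts G) & (\<forall>j<s. card (T j) = m) & S = (\<Union>j<s. T j)" by blast
 next
  assume "\<exists>T. blow s T (verts G) & (\<forall>j<s. card (T j) = m) & S = (\<Union>j<s. T j)"
  then obtain T where T: "blow s T (verts G)" "\<forall>j<s. card (T j) = m" "S = (\<Union>j<s. T j)" by blast
  have "\<forall>j\<in>{..<s}. \<exists>h. bij_betw h {..<m} (T j)"
  proof
   fix j assume j: "j \<in> {..<s}"
   hence "finite (T j)" using T(1) by (simp add: blow_def)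
   then obtain h where "bij_betw h {..<card (T j)} (T j)" by (rule enum_set)
   thus "\<exists>h. bij_betw h {..<m} (T j)" using T(2) j by auto
  qed
  then obtain h where "\<forall>j\<in>{..<s}. bij_betw (h j) {..<m} (T j)" unfolding bchoice_iff ..
  hence h: "bij_betw (h j) {..<m} (T j)" if "j < s" for j using that by simp
  define f where "f = (%v. h (v mod s) (v div s))"
  have dv: "v div s < m" if "v < m * s" for v using that s by (simp add: less_mult_imp_div_less)
  have fT: "f v \<in> T (v mod s)" if "v < m * s" for v
   using h[of "v mod s"] dv[OF that] s by (auto simp: f_def bij_betw_def)
  have "inj_on f {..<m * s}"
  proof (rule inj_onI)
   fix u v assume uv: "u \<in> {..<m * s}" "v \<in> {..<m * s}" "f u = f v"
   have e: "u mod s = v mod s"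
   proof (rule ccontr)
    assume "u mod s ~= v mod s"
    hence "T (u mod s) Int T (v mod s) = {}" using blow_disj[OF T(1)] s by simp
    moreover have "f u \<in> T (u mod s)" "f u \<in> T (v mod s)" using fT[of u] fT[of v] uv by auto
    ultimately show False by blast
   qed
   have "inj_on (h (u mod s)) {..<m}" using h[of "u mod s"] s by (simp add: bij_betw_def)
   hence "u div s = v div s" using uv e dv unfolding f_def inj_on_def by auto
   thus "u = v" using e by (metis div_mult_mod_eq)
  qed
  moreover have im: "f ` {..<m * s} = S"
  proof
   show "f ` {..<m * s} \<subseteq> S"
   proof (rule image_subsetI)
    fix v assume "v \<in> {..<m * s}"
    hence "f v \<in> T (v mod s)" "v mod s < s" using fT s by auto
    thus "f v \<in> S" using T(3) by blast
   qed
   show "S \<subseteq> f ` {..<m * s}"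
   proof
    fix y assume "y \<in> S"
    then obtain j where j: "j < s" "y \<in> T j" using T(3) by auto
    then obtain q where q: "q < m" "y = h j q" using h[OF j(1)] by (auto simp: bij_betw_def)
    have "Suc q * s <= m * s" using q by (intro mult_le_mono) auto
    hence "q * s + j < m * s" using j by simp
    moreover have "f (q * s + j) = y" using j q by (simp add: f_def)
    ultimately show "y \<in> f ` {..<m * s}" by blast
   qed
  qed
  moreover have "S \<subseteq> verts G" using T(1,3) by (auto simp: blow_def)
  moreover have "f ` e \<in> edges G" if ee: "e \<in> edges (turan_graph (m * s) s)" for e
  proof -
   obtain u v where uv: "e = {u, v}" "u < m * s" "v < m * s" "u mod s ~= v mod s" using ee s by (auto simp: turan_graph_def)
   have "cmpl (T (u mod s)) (T (v mod s))" using T(1) uv s by (simp add: blow_def)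
   hence "eg G (f u) (f v)" using fT uv by (simp add: cmpl_def)
   thus ?thesis using uv edge_iff by simp
  qed
  ultimately show "iemb (turan_graph (m * s) s) S" unfolding iemb_def emb_def using vt by (intro exI[of _ f]) auto
 qed
qed

end

text \<open>Brings two chosen parts to the positions \<open>0\<close> and \<open>1\<close>, where
  \<open>join2\<close> expects them. The second transposition moves \<open>0\<close> and
  \<open>i0\<close>; the first prepares position \<open>1\<close> with the index \<open>j\<close>
  that it will send to \<open>i1\<close>.\<close>

lemma two_perm:
 assumes "i0 < r" "i1 < r" "i0 ~= i1"
 shows "\<exists>\<pi>::nat => nat. \<pi> 0 = i0 & \<pi> 1 = i1 & (\<forall>i<r. \<pi> i < r) & inj_on \<pi> {..<r}"
proof -
 define sw where "sw = (%a b x::nat. if x = a then b else if x = b then a else x)"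
 define j where "j = sw 0 i0 i1"
 have j: "j ~= 0" "j < r" using assms by (auto simp: j_def sw_def)
 have inj: "inj (sw a b)" for a b by (auto simp: inj_def sw_def)
 define \<pi> where "\<pi> = sw 0 i0 o sw 1 j"
 have "\<pi> 0 = i0" using j by (simp add: \<pi>_def sw_def)
 moreover have "\<pi> 1 = i1" using assms by (auto simp: \<pi>_def sw_def j_def)
 moreover have "\<forall>i<r. \<pi> i < r" using assms j by (auto simp: \<pi>_def sw_def)
 moreover have "inj \<pi>" unfolding \<pi>_def by (rule inj_compose[OF inj inj])
 ultimately show ?thesis using inj_on_subset by blast
qed

lemma one_perm:
 assumes "i0 < r"
 shows "\<exists>\<pi>::nat => nat. \<pi> 0 = i0 & (\<forall>i<r. \<pi> i < r) & inj_on \<pi> {..<r}"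
 by (rule exI[of _ "%x. if x = 0 then i0 else if x = i0 then 0 else x"]) (use assms in "auto simp: inj_on_def")

context sgraph begin

lemma blow_perm: assumes "blow r S V" "\<forall>i<r. \<pi> i < r" "inj_on \<pi> {..<r}" shows "blow r (S o \<pi>) V"
 unfolding blow_def
proof (intro conjI allI impI)
 fix i assume i: "i < r"
 show "(S o \<pi>) i \<subseteq> V" "finite ((S o \<pi>) i)" using assms(1,2) i by (auto simp: blow_def)
 fix j assume j: "j < r" "i ~= j"
 have "\<pi> i ~= \<pi> j" using inj_onD[OF assms(3), of i j] i j by auto
 thus "cmpl ((S o \<pi>) i) ((S o \<pi>) j)" using assms(1,2) i j by (simp add: blow_def)
qed

lemma blow_Suc: "blow (Suc s) S V \<longleftrightarrow> S 0 \<subseteq> V & finite (S 0) & blow s (%i. S (Suc i)) V & (\<forall>j<s. cmpl (S 0) (S (Suc j)))"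
 unfolding blow_def All_less_Suc2 using cmpl_sym by auto

lemma blow_trim: assumes "blow s T V" "\<forall>j<s. m <= card (T j)"
 shows "\<exists>T'. blow s T' V & (\<forall>j<s. card (T' j) = m & T' j \<subseteq> T j)"
proof -
 have "\<forall>j\<in>{..<s}. \<exists>A. A \<subseteq> T j & card A = m" using assms(2) obtain_subset_with_card_n by (metis lessThan_iff)
 then obtain T' where T': "\<forall>j\<in>{..<s}. T' j \<subseteq> T j & card (T' j) = m" unfolding bchoice_iff ..
 have "blow s T' V" unfolding blow_def
 proof (intro conjI allI impI)
  fix i assume i: "i < s"
  have *: "T' i \<subseteq> T i" "T i \<subseteq> V" "finite (T i)" using T' assms(1) i by (auto simp: blow_def)
  thus "T' i \<subseteq> V" "finite (T' i)" using finite_subset by auto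
  fix j assume j: "j < s" "i ~= j"
  have "cmpl (T i) (T j)" "T' j \<subseteq> T j" using T' assms(1) i j by (auto simp: blow_def)
  thus "cmpl (T' i) (T' j)" using cmpl_mono *(1) by blast
 qed
 thus ?thesis using T' by auto
qed

end

context gr begin

text \<open>The first factor sits in part \<open>0\<close> and the Turan graph in the remaining
  parts, which may be larger than \<open>m\<close> because they can be trimmed.\<close>

lemma join1:
 "contains_graph G (A \<otimes>\<^sub>g turan_graph (m * s) s) \<longleftrightarrow>
  (\<exists>S P. blow (Suc s) S (verts G) & (\<forall>j<s. m <= card (S (Suc j))) & P \<subseteq> S 0 & iemb A P)" (is "?L \<longleftrightarrow> ?R")
proof
 assume ?L
 then obtain S T where ST: "cmpl S (\<Union>j<s. T j)" "iemb A S" "blow s T (verts G)" "\<forall>j<s. card (T j) = m"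
  unfolding contains_iemb iemb_join iemb_turan by blast
 have fS: "S \<subseteq> verts G" "finite S" using iemb_sub[OF ST(2)] fin finite_subset by auto
 have c: "\<forall>j<s. cmpl S (T j)" using ST(1) by (auto simp: cmpl_def)
 have "blow (Suc s) (case_nat S T) (verts G)" unfolding blow_Suc using fS c ST(3) by simp
 thus ?R using ST by (intro exI[of _ "case_nat S T"] exI[of _ S]) auto
next
 assume ?R
 then obtain S P where S: "blow (Suc s) S (verts G)" "\<forall>j<s. m <= card (S (Suc j))" "P \<subseteq> S 0" "iemb A P" by blast
 obtain T where T: "blow s T (verts G)" "\<forall>j<s. card (T j) = m & T j \<subseteq> S (Suc j)"
  using blow_trim[of s "%i. S (Suc i)"] S unfolding blow_Suc by blast
 have "cmpl P (\<Union>j<s. T j)" using S(1,3) T(2) unfolding blow_Suc cmpl_def by blast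
 thus ?L unfolding contains_iemb iemb_join iemb_turan using S(4) T by blast
qed

lemma join2:
 "contains_graph G (A \<otimes>\<^sub>g B \<otimes>\<^sub>g turan_graph (m * s) s) \<longleftrightarrow>
  (\<exists>S P Q. blow (Suc (Suc s)) S (verts G) & (\<forall>j<s. m <= card (S (Suc (Suc j)))) & P \<subseteq> S 0 & iemb A P & Q \<subseteq> S 1 & iemb B Q)" (is "?L \<longleftrightarrow> ?R")
proof
 assume ?L
 then obtain U S S' T where U: "U = S Un S'" "cmpl U (\<Union>j<s. T j)" and ST: "cmpl S S'" "iemb A S" "iemb B S'" "blow s T (verts G)" "\<forall>j<s. card (T j) = m"
  unfolding contains_iemb iemb_join iemb_turan by blast
 have fS: "S \<subseteq> verts G" "finite S" "S' \<subseteq> verts G" "finite S'" using iemb_sub[OF ST(2)] iemb_sub[OF ST(3)] fin finite_subset by auto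
 have c: "\<forall>j<s. cmpl S (T j)" "\<forall>j<s. cmpl S' (T j)" using U by (auto simp: cmpl_def)
 have "blow (Suc (Suc s)) (case_nat S (case_nat S' T)) (verts G)" unfolding blow_Suc All_less_Suc2 using fS c ST by simp
 thus ?R using ST by (intro exI[of _ "case_nat S (case_nat S' T)"] exI[of _ S] exI[of _ S']) auto
next
 assume ?R
 then obtain S P Q where S: "blow (Suc (Suc s)) S (verts G)" "\<forall>j<s. m <= card (S (Suc (Suc j)))" "P \<subseteq> S 0" "iemb A P" "Q \<subseteq> S 1" "iemb B Q" by blast
 have bl: "blow s (%i. S (Suc (Suc i))) (verts G)" "cmpl (S 0) (S 1)" "!!j. j < s ==> cmpl (S 0) (S (Suc (Suc j)))" "!!j. j < s ==> cmpl (S 1) (S (Suc (Suc j)))"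
  using S(1) by (auto simp: blow_Suc)
 obtain T where T: "blow s T (verts G)" "\<forall>j<s. card (T j) = m & T j \<subseteq> S (Suc (Suc j))"
  using blow_trim[OF bl(1)] S by blast
 have "cmpl (P Un Q) (\<Union>j<s. T j)" using S(3,5) T(2) bl(3,4) unfolding cmpl_def by blast
 moreover have "cmpl P Q" using cmpl_mono[OF bl(2) S(3,5)] .
 ultimately show ?L unfolding contains_iemb iemb_join iemb_turan using S(4,6) T by blast
qed

lemma iemb_extra:
 assumes "iemb A P" "P \<subseteq> S" "S \<subseteq> verts G" "card (verts A) + m <= card S"
 shows "\<exists>P'. P' \<subseteq> S & iemb (A \<union>\<^sub>g edgeless_graph m) P'"
proof -
 have fS: "finite S" "finite P" using assms(2,3) fin finite_subset by (metis finite_subset)+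
 have "m <= card (S - P)" using card_Diff_subset[OF fS(2) assms(2)] iemb_card[OF assms(1)] assms(4) by linarith
 then obtain M where M: "M \<subseteq> S - P" "card M = m" by (meson obtain_subset_with_card_n)
 have "iemb (edgeless_graph m) M" unfolding iemb_edgeless using M assms(3) by blast
 hence "iemb (A \<union>\<^sub>g edgeless_graph m) (P Un M)" unfolding iemb_union using assms(1) M(1) by blast
 moreover have "P Un M \<subseteq> S" using M(1) assms(2) by auto
 ultimately show ?thesis by (intro exI[of _ "P Un M"] conjI)
qed

lemma iemb_extra_D: "iemb (A \<union>\<^sub>g edgeless_graph m) U ==> \<exists>P. P \<subseteq> U & iemb A P"
 unfolding iemb_union by blast

lemma card_ge_iemb: "iemb A P ==> P \<subseteq> S ==> finite S ==> card (verts A) <= card S"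
 using iemb_card card_mono by metis

lemma card_verts:
 "finite (verts A) ==> card (verts (A \<union>\<^sub>g edgeless_graph m)) = card (verts A) + m"
 "card (verts (path_graph l)) = l" "card (verts (complete_graph s)) = s" "card (verts (copies t A)) = t * card (verts A)"
 "finite (verts (path_graph l))" "finite (verts (complete_graph s))" "finite (verts A) ==> finite (verts (copies t A))"
 by (simp_all add: disj_union_def edgeless_graph_def path_graph_def complete_graph_def copies_def card_Plus card_cartesian_product)

lemma F1_forb1: assumes "1 <= r" shows "contains_graph G (F1 l m r) \<longleftrightarrow> forb1 r l m (verts G)"
proof
 obtain s where s: "r = Suc s" using assms by (cases r) auto
 let ?A = "path_graph l \<union>\<^sub>g edgeless_graph m"
 {
  assume "contains_graph G (F1 l m r)"
  then obtain S P where S: "blow (Suc s) S (verts G)" "\<forall>j<s. m <= card (S (Suc j))" "P \<subseteq> S 0" "iemb ?A P"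
   unfolding F1_def contains_nat_copy s diff_Suc_1 join1 by blast
  have f: "finite (S 0)" using S(1) by (simp add: blow_Suc)
  have "l + m <= card (S 0)" using card_ge_iemb[OF S(4,3) f] by (simp add: card_verts)
  moreover have "~ pfree l (S 0)"
  proof -
   obtain P' where "P' \<subseteq> P" "iemb (path_graph l) P'" using iemb_extra_D[OF S(4)] by blast
   then obtain xs where "ispath (verts G) xs" "length xs = l" "set xs \<subseteq> S 0" unfolding iemb_path using S(3) by blast
   thus ?thesis unfolding pfree_def ispath_def by blast
  qed
  moreover have "m <= card (S i)" if "i < r" "i ~= 0" for i using S(2) that s by (cases i) auto
  ultimately show "forb1 r l m (verts G)" unfolding forb1_def using S(1) s by blast
 next
  assume "forb1 r l m (verts G)"
  then obtain S i0 where S: "i0 < r" "blow r S (verts G)" "\<forall>i<r. i ~= i0 --> m <= card (S i)" "l + m <= card (S i0)" "~ pfree l (S i0)"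
   unfolding forb1_def by blast
  obtain \<pi> where p: "\<pi> 0 = i0" "\<forall>i<r. \<pi> i < r" "inj_on \<pi> {..<r}" using one_perm[OF S(1)] by blast
  have bl: "blow (Suc s) (S o \<pi>) (verts G)" using blow_perm[OF S(2) p(2,3)] s by simp
  have m: "\<forall>j<s. m <= card ((S o \<pi>) (Suc j))"
  proof (intro allI impI)
   fix j assume j: "j < s"
   have "\<pi> (Suc j) ~= \<pi> 0" using inj_onD[OF p(3), of "Suc j" 0] j s by auto
   thus "m <= card ((S o \<pi>) (Suc j))" using S(3) p(1,2) j s by auto
  qed
  obtain xs where xs: "ispath (S i0) xs" "length xs = l" using S(5) by (auto simp: pfree_def)
  have sub: "S i0 \<subseteq> verts G" using S(1,2) by (simp add: blow_def)
  have "iemb (path_graph l) (set xs)" unfolding iemb_path using ispath_mono[OF xs(1) sub] xs(2) by blast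
  then obtain P where "P \<subseteq> S i0" "iemb ?A P" using iemb_extra[of "path_graph l" "set xs" "S i0" m] xs sub S(4) by (auto simp: card_verts ispath_def)
  thus "contains_graph G (F1 l m r)" unfolding F1_def contains_nat_copy s diff_Suc_1 join1 using bl m p(1) by (intro exI[of _ "S o \<pi>"]) auto
 }
qed

text \<open>The size bounds on \<open>A\<close> and \<open>B\<close> make the two distinguished
  parts large as well, so \<open>m \<le> card (S i)\<close> can be stated for all parts at
  once.\<close>

lemma join2_forb:
 assumes r: "2 <= r" and A: "m <= card (verts A)" and B: "m <= card (verts B)"
 shows "contains_graph G (A \<otimes>\<^sub>g B \<otimes>\<^sub>g turan_graph (m * (r - 2)) (r - 2)) \<longleftrightarrow>
  (\<exists>S i0 i1. i0 < r & i1 < r & i0 ~= i1 & blow r S (verts G) & (\<forall>i<r. m <= card (S i)) & (\<exists>P. P \<subseteq> S i0 & iemb A P) & (\<exists>Q. Q \<subseteq> S i1 & iemb B Q))"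
  (is "?L \<longleftrightarrow> ?R")
proof -
 obtain s where s: "r = Suc (Suc s)" using r by (metis Suc_le_D numeral_2_eq_2 Suc_le_mono)
 hence s2: "r - 2 = s" by simp
 show ?thesis
 proof
  assume ?L
  then obtain S P Q where S: "blow r S (verts G)" "\<forall>j<s. m <= card (S (Suc (Suc j)))" "P \<subseteq> S 0" "iemb A P" "Q \<subseteq> S 1" "iemb B Q"
   unfolding s2 join2 s[symmetric] by blast
  have f: "finite (S 0)" "finite (S 1)" using S(1) s by (simp_all add: blow_def)
  have m: "m <= card (S 0)" "m <= card (S 1)" using card_ge_iemb[OF S(4,3) f(1)] card_ge_iemb[OF S(6,5) f(2)] A B by auto
  have "m <= card (S i)" if "i < r" for i
  proof (cases "i < 2")
   case True
   hence "i = 0 \<or> i = 1" by auto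
   thus ?thesis using m by blast
  next
   case False
   then obtain j where "i = Suc (Suc j)" by (metis Suc_le_D numeral_2_eq_2 Suc_le_mono not_less)
   thus ?thesis using S(2) that s by auto
  qed
  thus ?R using S r by (intro exI[of _ S], rule_tac exI[of _ 0], rule_tac exI[of _ 1]) auto
 next
  assume ?R
  then obtain S i0 i1 P Q where S: "i0 < r" "i1 < r" "i0 ~= i1" "blow r S (verts G)" "\<forall>i<r. m <= card (S i)" "P \<subseteq> S i0" "iemb A P" "Q \<subseteq> S i1" "iemb B Q"
   by (elim exE conjE)
  obtain \<pi> where p: "\<pi> 0 = i0" "\<pi> 1 = i1" "\<forall>i<r. \<pi> i < r" "inj_on \<pi> {..<r}" using two_perm[OF S(1-3)] by blast
  have bl: "blow r (S o \<pi>) (verts G)" by (rule blow_perm[OF S(4) p(3,4)])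
  have "\<forall>j<s. m <= card ((S o \<pi>) (Suc (Suc j)))" using S(5) p(3) s by simp
  moreover have "P \<subseteq> (S o \<pi>) 0" "Q \<subseteq> (S o \<pi>) 1" using S p by auto
  ultimately show ?L unfolding s2 join2 s[symmetric] using bl S(7,9) by blast
 qed
qed

lemma iemb_mat_D: assumes "iemb (copies m (complete_graph 2)) P" shows "hasmat m P"
proof -
 obtain T where T: "\<forall>i<m. iemb (complete_graph 2) (T i)" "\<forall>i<m. \<forall>j<m. i ~= j --> T i Int T j = {}" "P = (\<Union>i<m. T i)"
  using assms unfolding iemb_copies by blast
 have "\<forall>i\<in>{..<m}. \<exists>p. T i = {fst p, snd p} & eg G (fst p) (snd p)"
 proof
  fix i assume "i \<in> {..<m}"
  hence "card (T i) = 2 & clique (T i)" using T(1) iemb_complete by auto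
  then obtain a b where "T i = {a, b}" "a ~= b" "clique (T i)" by (metis card_2_iff)
  thus "\<exists>p. T i = {fst p, snd p} & eg G (fst p) (snd p)" by (intro exI[of _ "(a, b)"]) (auto simp: clique_def)
 qed
 then obtain p where "\<forall>i\<in>{..<m}. T i = {fst (p i), snd (p i)} & eg G (fst (p i)) (snd (p i))" unfolding bchoice_iff ..
 hence p: "T i = {fst (p i), snd (p i)}" "eg G (fst (p i)) (snd (p i))" if "i < m" for i using that by auto
 have d: "i = j" if "i < m" "j < m" "x \<in> T i" "x \<in> T j" for i j x using T(2) that by blast
 have m1: "fst (p i) \<in> T i" "snd (p i) \<in> T i" "T i \<subseteq> P" if "i < m" for i using p(1)[OF that] T(3) that by auto
 show ?thesis unfolding hasmat_def
 proof (rule exI[of _ "fst o p"], rule exI[of _ "snd o p"], intro conjI allI impI)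
  fix i assume i: "i < m"
  show "(fst o p) i \<in> P" "(snd o p) i \<in> P" using m1[OF i] by auto
  show "eg G ((fst o p) i) ((snd o p) i)" using p(2)[OF i] by simp
 next
  show "inj_on (fst o p) {..<m}"
  proof (rule inj_onI)
   fix i j assume a: "i \<in> {..<m}" "j \<in> {..<m}" "(fst o p) i = (fst o p) j"
   thus "i = j" using d[of i j "fst (p i)"] m1[of i] m1[of j] by auto
  qed
  show "inj_on (snd o p) {..<m}"
  proof (rule inj_onI)
   fix i j assume a: "i \<in> {..<m}" "j \<in> {..<m}" "(snd o p) i = (snd o p) j"
   thus "i = j" using d[of i j "snd (p i)"] m1[of i] m1[of j] by auto
  qed
  show "(fst o p) ` {..<m} Int (snd o p) ` {..<m} = {}"
  proof (rule ccontr)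
   assume "(fst o p) ` {..<m} Int (snd o p) ` {..<m} ~= {}"
   then obtain i j where ij: "i < m" "j < m" "fst (p i) = snd (p j)" by auto
   hence "i = j" using d[of i j "fst (p i)"] m1[of i] m1[of j] by auto
   thus False using p(2)[of i] ij E_irrefl by simp
  qed
 qed
qed

lemma iemb_mat: assumes "hasmat m S" "S \<subseteq> verts G" shows "\<exists>P. P \<subseteq> S & iemb (copies m (complete_graph 2)) P"
proof -
 obtain f g where f: "\<forall>i<m. f i \<in> S & g i \<in> S & eg G (f i) (g i)" "inj_on f {..<m}" "inj_on g {..<m}" "f ` {..<m} Int g ` {..<m} = {}"
  using assms(1) unfolding hasmat_def by (elim exE conjE)
 define T where "T = (%i. {f i, g i})"
 have "iemb (complete_graph 2) (T i)" if i: "i < m" for i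
 proof -
  have e: "eg G (f i) (g i)" "eg G (g i) (f i)" "f i \<in> S" "g i \<in> S" using f(1) i E_sym by auto
  hence "f i ~= g i" using E_irrefl by metis
  thus ?thesis unfolding iemb_complete using e assms(2) by (auto simp: T_def clique_def)
 qed
 moreover have "T i Int T j = {}" if "i < m" "j < m" "i ~= j" for i j
  using inj_onD[OF f(2), of i j] inj_onD[OF f(3), of i j] f(4) that by (auto simp: T_def)
 ultimately have "iemb (copies m (complete_graph 2)) (\<Union>i<m. T i)" unfolding iemb_copies by blast
 thus ?thesis using f(1) by (intro exI[of _ "\<Union>i<m. T i"]) (auto simp: T_def)
qed

lemma F2_forb2: assumes r: "2 <= r" shows "contains_graph G (F2 m r) \<longleftrightarrow> forb2 r m (verts G)"
proof -
 have *: "(\<exists>P. P \<subseteq> S & iemb (copies m (complete_graph 2)) P) \<longleftrightarrow> hasmat m S" if "S \<subseteq> verts G" for S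
  using iemb_mat[OF _ that] iemb_mat_D hasmat_mono by blast
 have "contains_graph G (F2 m r) \<longleftrightarrow> (\<exists>S i0 i1. i0 < r & i1 < r & i0 ~= i1 & blow r S (verts G) & (\<forall>i<r. m <= card (S i)) &
  (\<exists>P. P \<subseteq> S i0 & iemb (copies m (complete_graph 2)) P) & (\<exists>Q. Q \<subseteq> S i1 & iemb (copies m (complete_graph 2)) Q))"
  unfolding F2_def contains_nat_copy by (rule join2_forb[OF r]) (simp_all add: card_verts)
 also have "... \<longleftrightarrow> forb2 r m (verts G)" unfolding forb2_def using * by (intro ex_cong1 conj_cong refl) (auto simp: blow_def)
 finally show ?thesis .
qed

lemma F4_forb4: assumes r: "2 <= r" shows "contains_graph G (F4 l m r) \<longleftrightarrow> forb4 r l m (verts G)"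
proof -
 let ?A = "complete_graph (l - 1) \<union>\<^sub>g edgeless_graph m"
 have *: "(\<exists>P. P \<subseteq> S & iemb ?A P) \<longleftrightarrow> l - 1 + m <= card S & (\<exists>Q. Q \<subseteq> S & clique Q & card Q = l - 1)" if S: "S \<subseteq> verts G" for S
 proof
  assume "\<exists>P. P \<subseteq> S & iemb ?A P"
  then obtain P where P: "P \<subseteq> S" "iemb ?A P" by blast
  have "finite S" using S fin finite_subset by blast
  hence "l - 1 + m <= card S" using card_ge_iemb[OF P(2,1)] by (simp add: card_verts)
  thus "l - 1 + m <= card S & (\<exists>Q. Q \<subseteq> S & clique Q & card Q = l - 1)" using iemb_extra_D[OF P(2)] P(1) unfolding iemb_complete by blast
 next
  assume a: "l - 1 + m <= card S & (\<exists>Q. Q \<subseteq> S & clique Q & card Q = l - 1)"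
  then obtain Q where Q: "Q \<subseteq> S" "clique Q" "card Q = l - 1" by blast
  hence "iemb (complete_graph (l - 1)) Q" unfolding iemb_complete using S by blast
  thus "\<exists>P. P \<subseteq> S & iemb ?A P" by (rule iemb_extra[OF _ Q(1) S]) (use a in "simp add: card_verts")
 qed
 have "contains_graph G (F4 l m r) \<longleftrightarrow> (\<exists>S i0 i1. i0 < r & i1 < r & i0 ~= i1 & blow r S (verts G) & (\<forall>i<r. m <= card (S i)) &
  (\<exists>P. P \<subseteq> S i0 & iemb ?A P) & (\<exists>Q. Q \<subseteq> S i1 & iemb ?A Q))"
  unfolding F4_def contains_nat_copy by (rule join2_forb[OF r]) (simp_all add: card_verts)
 also have "... \<longleftrightarrow> (\<exists>S i0 i1. i0 < r & i1 < r & i0 ~= i1 & blow r S (verts G) & (\<forall>i<r. m <= card (S i)) &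
  (l - 1 + m <= card (S i0) & (\<exists>Q. Q \<subseteq> S i0 & clique Q & card Q = l - 1)) & (l - 1 + m <= card (S i1) & (\<exists>Q. Q \<subseteq> S i1 & clique Q & card Q = l - 1)))"
  using * by (intro ex_cong1 conj_cong refl) (auto simp: blow_def)
 also have "... \<longleftrightarrow> forb4 r l m (verts G)" unfolding forb4_def by blast
 finally show ?thesis .
qed

lemma iemb_two: "iemb (copies 2 H) P \<longleftrightarrow> (\<exists>Q Q'. iemb H Q & iemb H Q' & Q Int Q' = {} & P = Q Un Q')"
proof
 assume "iemb (copies 2 H) P"
 then obtain T where T: "\<forall>i<(2::nat). iemb H (T i)" "\<forall>i<2. \<forall>j<2. i ~= j --> T i Int T j = {}" "P = (\<Union>i<2. T i)"
  unfolding iemb_copies by blast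
 have "P = T 0 Un T 1" using T(3) by (auto simp: less_2_cases_iff)
 moreover have "iemb H (T 0)" "iemb H (T 1)" "T 0 Int T 1 = {}" using T by auto
 ultimately show "\<exists>Q Q'. iemb H Q & iemb H Q' & Q Int Q' = {} & P = Q Un Q'" by blast
next
 assume "\<exists>Q Q'. iemb H Q & iemb H Q' & Q Int Q' = {} & P = Q Un Q'"
 then obtain Q Q' where Q: "iemb H Q" "iemb H Q'" "Q Int Q' = {}" "P = Q Un Q'" by blast
 show "iemb (copies 2 H) P" unfolding iemb_copies
  by (rule exI[of _ "case_nat Q (%_. Q')"]) (use Q in "auto simp: less_2_cases_iff")
qed

lemma F3_forb3: assumes r: "2 <= r" shows "contains_graph G (F3 l m r) \<longleftrightarrow> forb3 r l m (verts G)"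
proof -
 let ?A = "copies 2 (complete_graph (l - 1)) \<union>\<^sub>g edgeless_graph m"
 let ?B = "complete_graph 2 \<union>\<^sub>g edgeless_graph m"
 have A: "(\<exists>P. P \<subseteq> S & iemb ?A P) \<longleftrightarrow> 2 * (l - 1) + m <= card S &
  (\<exists>Q Q'. Q \<subseteq> S & Q' \<subseteq> S & Q Int Q' = {} & clique Q & clique Q' & card Q = l - 1 & card Q' = l - 1)" (is "_ \<longleftrightarrow> ?R S") if S: "S \<subseteq> verts G" for S
 proof
  assume "\<exists>P. P \<subseteq> S & iemb ?A P"
  then obtain P where P: "P \<subseteq> S" "iemb ?A P" by blast
  have "finite S" using S fin finite_subset by blast
  hence "2 * (l - 1) + m <= card S" using card_ge_iemb[OF P(2,1)] by (simp add: card_verts)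
  moreover obtain P' where P': "P' \<subseteq> P" "iemb (copies 2 (complete_graph (l - 1))) P'" using iemb_extra_D[OF P(2)] by (elim exE conjE)
  moreover obtain Q Q' where Q: "clique Q" "clique Q'" "card Q = l - 1" "card Q' = l - 1" "Q Int Q' = {}" "P' = Q Un Q'"
   using P'(2) unfolding iemb_two iemb_complete by (elim exE conjE)
  moreover have "Q \<subseteq> S" "Q' \<subseteq> S" using P(1) P'(1) Q(6) by auto
  ultimately show "?R S" by (intro conjI exI[of _ Q] exI[of _ Q'])
 next
  assume a: "?R S"
  then obtain Q Q' where Q: "Q \<subseteq> S" "Q' \<subseteq> S" "Q Int Q' = {}" "clique Q" "clique Q'" "card Q = l - 1" "card Q' = l - 1" by blast
  have "iemb (complete_graph (l - 1)) Q" "iemb (complete_graph (l - 1)) Q'" unfolding iemb_complete using Q S by auto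
  hence "iemb (copies 2 (complete_graph (l - 1))) (Q Un Q')" unfolding iemb_two using Q(3) by (intro exI[of _ Q] exI[of _ Q'] conjI refl)
  thus "\<exists>P. P \<subseteq> S & iemb ?A P" by (rule iemb_extra) (use Q S a in "auto simp: card_verts")
 qed
 have B: "(\<exists>P. P \<subseteq> S & iemb ?B P) \<longleftrightarrow> m + 2 <= card S & (\<exists>u v. u \<in> S & v \<in> S & eg G u v)" (is "_ \<longleftrightarrow> ?R S") if S: "S \<subseteq> verts G" for S
 proof
  assume "\<exists>P. P \<subseteq> S & iemb ?B P"
  then obtain P where P: "P \<subseteq> S" "iemb ?B P" by blast
  have "finite S" using S fin finite_subset by blast
  hence c: "m + 2 <= card S" using card_ge_iemb[OF P(2,1)] by (simp add: card_verts)
  obtain Q where Q: "Q \<subseteq> S" "card Q = 2" "clique Q" using iemb_extra_D[OF P(2)] P(1) unfolding iemb_complete by blast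
  then obtain a b where "Q = {a, b}" "a ~= b" by (metis card_2_iff)
  thus "?R S" using c Q by (auto simp: clique_def)
 next
  assume a: "?R S"
  then obtain u v where uv: "u \<in> S" "v \<in> S" "eg G u v" by blast
  have "u ~= v" "eg G v u" using uv E_irrefl E_sym by blast+
  hence "iemb (complete_graph 2) {u, v}" unfolding iemb_complete using uv S by (auto simp: clique_def)
  thus "\<exists>P. P \<subseteq> S & iemb ?B P" by (rule iemb_extra) (use uv S a in "auto simp: card_verts")
 qed
 have "contains_graph G (F3 l m r) \<longleftrightarrow> (\<exists>S i0 i1. i0 < r & i1 < r & i0 ~= i1 & blow r S (verts G) & (\<forall>i<r. m <= card (S i)) &
  (\<exists>P. P \<subseteq> S i0 & iemb ?A P) & (\<exists>Q. Q \<subseteq> S i1 & iemb ?B Q))"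
  unfolding F3_def contains_nat_copy by (rule join2_forb[OF r]) (simp_all add: card_verts)
 also have "... \<longleftrightarrow> (\<exists>S i0 i1. i0 < r & i1 < r & i0 ~= i1 & blow r S (verts G) & (\<forall>i<r. m <= card (S i)) &
  (2 * (l - 1) + m <= card (S i0) & (\<exists>Q Q'. Q \<subseteq> S i0 & Q' \<subseteq> S i0 & Q Int Q' = {} & clique Q & clique Q' & card Q = l - 1 & card Q' = l - 1)) &
  (m + 2 <= card (S i1) & (\<exists>u v. u \<in> S i1 & v \<in> S i1 & eg G u v)))"
  by (intro ex_cong1 conj_cong refl A B) (auto simp: blow_def)
 also have "... \<longleftrightarrow> forb3 r l m (verts G)" unfolding forb3_def by blast
 finally show ?thesis .
qed

lemma family_free_iff:
 assumes "2 <= r"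
 shows "family_free {F1 l m r, F2 m r, F3 l m r, F4 l m r} G \<longleftrightarrow>
  ~ forb1 r l m (verts G) & ~ forb2 r m (verts G) & ~ forb3 r l m (verts G) & ~ forb4 r l m (verts G)"
 unfolding family_free_def using F1_forb1 F2_forb2[OF assms] F3_forb3[OF assms] F4_forb4[OF assms] assms by auto

end

text \<open>Transport along an injective map that preserves and reflects edges on \<open>V\<close>;
  it connects the relation holding all graphs with a single graph, and a graph with its induced
  subgraphs and copies.\<close>

locale sgmap = A: sgraph E + B: sgraph E'
 for E :: "'a => 'a => bool" and E' :: "'b => 'b => bool" +
 fixes \<psi> :: "'a => 'b" and V :: "'a set"
 assumes inj: "inj_on \<psi> V" and hom: "x \<in> V ==> y \<in> V ==> E' (\<psi> x) (\<psi> y) = E x y"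
begin

lemma map_card: "S \<subseteq> V ==> card (\<psi> ` S) = card S"
 by (rule card_image, rule inj_on_subset[OF inj])

lemma map_pe: assumes "S \<subseteq> V" "T \<subseteq> V" shows "B.pe (\<psi> ` S) (\<psi> ` T) = A.pe S T"
proof -
 have "B.dg (\<psi> x) (\<psi> ` T) = A.dg x T" if x: "x \<in> S" for x
 proof -
  have "E' (\<psi> x) (\<psi> y) = E x y" if "y \<in> T" for y using hom[of x y] assms x that by blast
  hence "B.nb (\<psi> x) (\<psi> ` T) = \<psi> ` A.nb x T" unfolding B.nb_def A.nb_def by blast
  moreover have "A.nb x T \<subseteq> V" using A.nb_subset assms(2) by blast
  ultimately show ?thesis using map_card by (simp add: B.dg_def A.dg_def)
 qed
 thus ?thesis unfolding B.pe_def A.pe_def using inj_on_subset[OF inj assms(1)] by (simp add: sum.reindex)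
qed

lemma map_cmpl: "S \<subseteq> V ==> T \<subseteq> V ==> A.cmpl S T ==> B.cmpl (\<psi> ` S) (\<psi> ` T)"
 unfolding A.cmpl_def B.cmpl_def using hom by blast

lemma map_clique: "S \<subseteq> V ==> A.clique S ==> B.clique (\<psi> ` S)"
proof -
 assume S: "S \<subseteq> V" "A.clique S"
 have "E' (\<psi> x) (\<psi> y)" if "x \<in> S" "y \<in> S" "\<psi> x ~= \<psi> y" for x y
 proof -
  have "E x y" using that S(2) unfolding A.clique_def by metis
  thus ?thesis using hom[of x y] that S(1) by blast
 qed
 thus ?thesis by (auto simp: B.clique_def)
qed

lemma map_blow: assumes "A.blow r S V" shows "B.blow r (%i. \<psi> ` S i) (\<psi> ` V)"
 unfolding B.blow_def
proof (intro conjI allI impI)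
 fix i assume i: "i < r"
 have s: "S i \<subseteq> V" "finite (S i)" using assms i by (auto simp: A.blow_def)
 thus "\<psi> ` S i \<subseteq> \<psi> ` V" "finite (\<psi> ` S i)" by auto
 fix j assume j: "j < r" "i ~= j"
 have "S j \<subseteq> V" "A.cmpl (S i) (S j)" using assms i j by (auto simp: A.blow_def)
 thus "B.cmpl (\<psi> ` S i) (\<psi> ` S j)" using map_cmpl s by blast
qed

lemma map_pfree: assumes "S \<subseteq> V" "B.pfree l (\<psi> ` S)" shows "A.pfree l S"
 unfolding A.pfree_def
proof (intro allI impI)
 fix xs assume xs: "A.ispath S xs"
 have sub: "set xs \<subseteq> V" using xs assms(1) by (auto simp: A.ispath_def)
 have "successively E' (map \<psi> xs)" unfolding successively_map
  by (rule successively_mono[of E]) (use xs hom sub in "auto simp: A.ispath_def")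
 moreover have "distinct (map \<psi> xs)" using xs inj_on_subset[OF inj sub] by (simp add: distinct_map A.ispath_def)
 ultimately have "B.ispath (\<psi> ` S) (map \<psi> xs)" using xs by (auto simp: A.ispath_def B.ispath_def)
 thus "length xs ~= l" using assms(2) unfolding B.pfree_def by fastforce
qed

lemma map_hasmat: assumes "A.hasmat m S" "S \<subseteq> V" shows "B.hasmat m (\<psi> ` S)"
proof -
 obtain f g where f: "\<forall>i<m. f i \<in> S & g i \<in> S & E (f i) (g i)" "inj_on f {..<m}" "inj_on g {..<m}" "f ` {..<m} Int g ` {..<m} = {}"
  using assms(1) unfolding A.hasmat_def by (elim exE conjE)
 have sub: "f ` {..<m} \<subseteq> V" "g ` {..<m} \<subseteq> V" using f(1) assms(2) by auto
 have "(\<psi> o f) ` {..<m} Int (\<psi> o g) ` {..<m} = \<psi> ` (f ` {..<m} Int g ` {..<m})"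
  unfolding image_comp[symmetric] using inj_on_image_Int[OF inj sub] by simp
 hence d: "(\<psi> o f) ` {..<m} Int (\<psi> o g) ` {..<m} = {}" using f(4) by simp
 have i: "inj_on (\<psi> o f) {..<m}" "inj_on (\<psi> o g) {..<m}"
  using comp_inj_on[OF f(2) inj_on_subset[OF inj sub(1)]] comp_inj_on[OF f(3) inj_on_subset[OF inj sub(2)]] .
 have e: "(\<psi> o f) i \<in> \<psi> ` S & (\<psi> o g) i \<in> \<psi> ` S & E' ((\<psi> o f) i) ((\<psi> o g) i)" if "i < m" for i
  using f(1) that hom[of "f i" "g i"] assms(2) by auto
 show ?thesis unfolding B.hasmat_def using d i e by blast
qed

lemma map_hasJK: assumes "A.hasJK l N S" "S \<subseteq> V" shows "B.hasJK l N (\<psi> ` S)"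
proof -
 obtain \<C> where C: "finite \<C>" "card \<C> = N" "\<forall>Q\<in>\<C>. Q \<subseteq> S & A.clique Q & card Q = l - 1" "\<forall>Q\<in>\<C>. \<forall>Q'\<in>\<C>. Q ~= Q' --> Q Int Q' = {}"
  using assms(1) unfolding A.hasJK_def by (elim exE conjE)
 have sub: "Q \<subseteq> V" if "Q \<in> \<C>" for Q using C(3) that assms(2) by blast
 have "inj_on ((`) \<psi>) \<C>" by (rule inj_on_subset[OF inj_on_image_Pow[OF inj]]) (use sub in auto)
 hence m0: "card ((`) \<psi> ` \<C>) = N" using C(2) by (simp add: card_image)
 have m1: "P \<subseteq> \<psi> ` S & B.clique P & card P = l - 1" if P: "P \<in> (`) \<psi> ` \<C>" for P
 proof -
  obtain Q where Q: "Q \<in> \<C>" "P = \<psi> ` Q" using P by blast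
  thus ?thesis using C(3) map_clique[OF sub[OF Q(1)]] map_card[OF sub[OF Q(1)]] by auto
 qed
 have m2: "P Int P' = {}" if P: "P \<in> (`) \<psi> ` \<C>" "P' \<in> (`) \<psi> ` \<C>" "P ~= P'" for P P'
 proof -
  obtain Q Q' where Q: "Q \<in> \<C>" "P = \<psi> ` Q" "Q' \<in> \<C>" "P' = \<psi> ` Q'" using P by blast
  hence "Q Int Q' = {}" using C(4) P(3) by blast
  thus ?thesis using inj_on_image_Int[OF inj sub[OF Q(1)] sub[OF Q(3)]] Q by simp
 qed
 show ?thesis unfolding B.hasJK_def
 proof (intro exI conjI)
  show "finite ((`) \<psi> ` \<C>)" using C(1) by simp
  show "\<forall>Q\<in>(`) \<psi> ` \<C>. Q \<subseteq> \<psi> ` S & B.clique Q & card Q = l - 1" using m1 by (intro ballI)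
  show "\<forall>Q\<in>(`) \<psi> ` \<C>. \<forall>Q'\<in>(`) \<psi> ` \<C>. Q ~= Q' --> Q Int Q' = {}" using m2 by (intro ballI impI)
 qed (rule m0)
qed

lemma map_bad: assumes "A.bad r l m N k V" shows "B.bad r l m N k (\<psi> ` V)"
proof -
 have sub: "S i \<subseteq> V" if "A.blow r S V" "i < r" for S i using that by (auto simp: A.blow_def)
 consider "A.forb1 r l m V" | "2 <= r" "A.forb2 r m V" | "A.forbK r l N k V" | "A.forbS r l k V"
  using assms unfolding A.bad_def by blast
 thus ?thesis
 proof cases
  case 1
  then obtain S i0 where S: "i0 < r" "A.blow r S V" "\<forall>i<r. i ~= i0 --> m <= card (S i)" "l + m <= card (S i0)" "~ A.pfree l (S i0)"
   unfolding A.forb1_def by blast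
  have "~ B.pfree l (\<psi> ` S i0)" using map_pfree[OF sub[OF S(2,1)]] S(5) by blast
  hence "B.forb1 r l m (\<psi> ` V)" unfolding B.forb1_def
   using S(1,3,4) map_blow[OF S(2)] map_card[OF sub[OF S(2)]] by (intro exI[of _ "%i. \<psi> ` S i"] exI[of _ i0]) auto
  thus ?thesis by (simp add: B.bad_def)
 next
  case 2
  then obtain S i0 i1 where S: "i0 < r" "i1 < r" "i0 ~= i1" "A.blow r S V" "\<forall>i<r. m <= card (S i)" "A.hasmat m (S i0)" "A.hasmat m (S i1)"
   unfolding A.forb2_def by blast
  have "B.hasmat m (\<psi> ` S i0)" "B.hasmat m (\<psi> ` S i1)" using map_hasmat S(6,7) sub[OF S(4)] S(1,2) by auto
  hence "B.forb2 r m (\<psi> ` V)" unfolding B.forb2_def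
   using S(1-3,5) map_blow[OF S(4)] map_card[OF sub[OF S(4)]]
   by (intro exI[of _ "%i. \<psi> ` S i"], rule_tac exI[of _ i0], rule_tac exI[of _ i1]) auto
  thus ?thesis using 2 by (simp add: B.bad_def)
 next
  case 3
  then obtain S i0 where S: "i0 < r" "A.blow r S V" "A.hasJK l N (S i0)" "\<forall>i<r. i ~= i0 --> k <= card (S i)"
   unfolding A.forbK_def by blast
  have "B.forbK r l N k (\<psi> ` V)" unfolding B.forbK_def
   using S(1,4) map_blow[OF S(2)] map_card[OF sub[OF S(2)]] map_hasJK[OF S(3) sub[OF S(2,1)]]
   by (intro exI[of _ "%i. \<psi> ` S i"] exI[of _ i0]) auto
  thus ?thesis by (simp add: B.bad_def)
 next
  case 4
  then obtain S X where S: "A.blow r S V" "\<forall>i<r. k <= card (S i)" "finite X" "X \<subseteq> V" "2 * card X + 2 = l" "\<forall>i<r. A.cmpl X (S i)"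
   unfolding A.forbS_def by blast
  have "B.cmpl (\<psi> ` X) (\<psi> ` S i)" if "i < r" for i using map_cmpl[OF S(4) sub[OF S(1) that]] S(6) that by blast
  hence "B.forbS r l k (\<psi> ` V)" unfolding B.forbS_def
   using S(2-5) map_blow[OF S(1)] map_card[OF sub[OF S(1)]] map_card[OF S(4)]
   by (intro exI[of _ "%i. \<psi> ` S i"], rule_tac exI[of _ "\<psi> ` X"]) auto
  thus ?thesis by (simp add: B.bad_def)
 qed
qed

end

section \<open>Progressive induction\<close>

text \<open>One relation on a type of pairs contains all graphs at once, which makes the constants uniform.\<close>

definition all_eg :: "('a graph \<times> 'a) => ('a graph \<times> 'a) => bool" where
 "all_eg p q \<longleftrightarrow> fst p = fst q & eg (fst p) (snd p) (snd q)"

lemma sgraph_all_eg: "sgraph all_eg"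
 by unfold_locales (auto simp: all_eg_def eg_def insert_commute)

lemma gap_graphs:
 fixes r :: nat
 assumes l: "3 <= l" and r: "1 <= r"
 shows "\<exists>g>0. \<exists>C. \<forall>G :: 'a graph. simple_graph G --> ~ sgraph.bad (eg G) r l m N k (verts G) -->
  real (2 * card (edges G)) <= (1 - 1 / real r) * (real (card (verts G)))\<^sup>2 + (real l - 2 - g) * card (verts G) / real r + C"
proof -
 interpret A: sgraph "all_eg :: ('a graph \<times> 'a) => ('a graph \<times> 'a) => bool" by (rule sgraph_all_eg)
 obtain g C where g: "g > 0" "!!V. finite V ==> ~ A.bad r l m N k V ==>
   real (A.pe V V) <= (1 - 1 / real r) * (real (card V))\<^sup>2 + (real l - 2 - g) * card V / real r + C"
  using A.gap[OF l r, of m N k] by blast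
 have "real (2 * card (edges G)) <= (1 - 1 / real r) * (real (card (verts G)))\<^sup>2 + (real l - 2 - g) * card (verts G) / real r + C"
  if G: "simple_graph G" "~ sgraph.bad (eg G) r l m N k (verts G)" for G :: "'a graph"
 proof -
  interpret G: gr G by unfold_locales (rule G)
  let ?V = "Pair G ` verts G"
  interpret M: sgmap all_eg "eg G" snd ?V by unfold_locales (auto simp: inj_on_def all_eg_def)
  have s: "snd ` ?V = verts G" by force
  have "~ A.bad r l m N k ?V" using M.map_bad G(2) s by auto
  hence "real (A.pe ?V ?V) <= (1 - 1 / real r) * (real (card ?V))\<^sup>2 + (real l - 2 - g) * card ?V / real r + C"
   by (intro g(2)) (use G.fin in auto)
  moreover have "card ?V = card (verts G)" by (rule card_image) (simp add: inj_on_def)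
  moreover have "A.pe ?V ?V = 2 * card (edges G)" using M.map_pe[of ?V ?V] G.pe_card_edges unfolding s by simp
  ultimately show ?thesis by simp
 qed
 thus ?thesis using g(1) by blast
qed

definition induced :: "'a graph => 'a set => 'a graph" where
 "induced G U = \<lparr>verts = U, edges = {e \<in> edges G. e \<subseteq> U}\<rparr>"

context gr begin

lemma induced_simple: assumes "U \<subseteq> verts G" shows "simple_graph (induced G U)"
 using simple assms finite_subset by (auto simp: simple_graph_def induced_def)

lemma induced_contains: "U \<subseteq> verts G ==> contains_graph (induced G U) F ==> contains_graph G F"
 unfolding contains_graph_def induced_def by force

lemma induced_map: assumes "U \<subseteq> verts G" shows "sgmap (eg (induced G U)) (eg G) (%x. x) U"
proof -
 interpret I: gr "induced G U" by unfold_locales (rule induced_simple[OF assms])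
 show ?thesis by unfold_locales (auto simp: eg_def induced_def)
qed

lemma induced_edges: assumes "U \<subseteq> verts G" shows "2 * card (edges (induced G U)) = pe U U"
proof -
 interpret I: gr "induced G U" by unfold_locales (rule induced_simple[OF assms])
 interpret M: sgmap "eg (induced G U)" "eg G" "%x. x" U by (rule induced_map[OF assms])
 have "verts (induced G U) = U" by (simp add: induced_def)
 thus ?thesis using I.pe_card_edges M.map_pe[of U U] by simp
qed

lemma induced_path: assumes "U \<subseteq> verts G" "pfree l U" shows "family_free {path_graph l} (induced G U)"
proof -
 interpret I: gr "induced G U" by unfold_locales (rule induced_simple[OF assms(1)])
 interpret M: sgmap "eg (induced G U)" "eg G" "%x. x" U by (rule induced_map[OF assms(1)])
 have "I.pfree l U" using M.map_pfree[of U l] assms(2) by simp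
 thus ?thesis unfolding family_free_def using I.contains_path[of l] by (simp add: induced_def)
qed

lemma edges_bound: "2 * card (edges G) <= card (verts G) * card (verts G)"
 using pe_le[OF fin fin] pe_card_edges by simp

lemma path_free_iff: "family_free {path_graph l} G \<longleftrightarrow> pfree l (verts G)"
 unfolding family_free_def using contains_path by simp

end

text \<open>Twice the extremal number of the path on \<open>l\<close> vertices, to match the ordered
  pairs of \<open>pe\<close>.\<close>

definition path_ex :: "nat => nat => nat" where
 "path_ex l q = Max {2 * card (edges H) | H :: nat graph. simple_graph H & card (verts H) = q & family_free {path_graph l} H}"

lemma edges_set_finite: "finite {2 * card (edges H) | H :: nat graph. simple_graph H & card (verts H) = q & P H}"
proof (rule finite_subset[of _ "{..q * q}"])
 show "{2 * card (edges H) | H :: nat graph. simple_graph H & card (verts H) = q & P H} \<subseteq> {..q * q}"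
 proof safe
  fix H :: "nat graph" assume "simple_graph H"
  then interpret gr H by unfold_locales
  show "2 * card (edges H) <= card (verts H) * card (verts H)" by (rule edges_bound)
 qed
qed simp

lemma path_ex_ge:
 fixes H :: "nat graph"
 shows "simple_graph H ==> family_free {path_graph l} H ==> 2 * card (edges H) <= path_ex l (card (verts H))"
 unfolding path_ex_def by (rule Max_ge[OF edges_set_finite]) blast

lemma path_ex_attained:
 assumes "2 <= l"
 obtains H :: "nat graph" where "simple_graph H" "card (verts H) = q" "family_free {path_graph l} H" "2 * card (edges H) = path_ex l q"
proof -
 have "family_free {path_graph l} (edgeless_graph q)"
 proof -
  interpret gr "edgeless_graph q" by unfold_locales (rule simple_constructions)
  have "pfree l (verts (edgeless_graph q))" unfolding pfree_def
  proof (intro allI impI notI)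
   fix xs assume "ispath (verts (edgeless_graph q)) xs" "length xs = l"
   hence "eg (edgeless_graph q) (xs ! 0) (xs ! 1)" using assms by (simp add: ispath_def successively_conv_nth)
   thus False by (simp add: eg_def edgeless_graph_def)
  qed
  thus ?thesis by (simp add: path_free_iff)
 qed
 moreover have "card (verts (edgeless_graph q)) = q" by (simp add: edgeless_graph_def)
 ultimately have "{2 * card (edges H) | H :: nat graph. simple_graph H & card (verts H) = q & family_free {path_graph l} H} ~= {}"
  using simple_constructions(3)[of q] by blast
 from Max_in[OF edges_set_finite this] show ?thesis using that unfolding path_ex_def by force
qed

lemma path_ex_bound: assumes "2 <= l" shows "path_ex l q <= q * q"
proof -
 obtain H :: "nat graph" where H: "simple_graph H" "card (verts H) = q" "2 * card (edges H) = path_ex l q"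
  using path_ex_attained[OF assms, of q] by metis
 interpret gr H by unfold_locales (rule H)
 show ?thesis using edges_bound H by simp
qed

text \<open>A clique \<open>K_{l-1}\<close> on new vertices is put beside an extremal graph: it is
  too small for a path on \<open>l\<close> vertices, and no path leaves it.\<close>

lemma path_ex_clique: assumes l: "3 <= l" shows "path_ex l q + (l - 1) * (l - 2) <= path_ex l (q + (l - 1))"
proof -
 obtain H :: "nat graph" where H: "simple_graph H" "card (verts H) = q" "family_free {path_graph l} H" "2 * card (edges H) = path_ex l q"
  using path_ex_attained[of l q] l by auto
 interpret H: gr H by unfold_locales (rule H)
 have "infinite (UNIV - verts H)" using H.fin by (simp add: Diff_infinite_finite)
 then obtain Q where Q: "Q \<subseteq> UNIV - verts H" "card Q = l - 1" "finite Q" by (metis infinite_arbitrarily_large)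
 define K where "K = \<lparr>verts = verts H Un Q, edges = edges H Un {{x, y} | x y. x \<in> Q & y \<in> Q & x ~= y}\<rparr>"
 have sK: "simple_graph K" using H(1) Q(3) by (auto simp: simple_graph_def K_def)
 interpret K: gr K by unfold_locales (rule sK)
 have eH: "eg K x y = eg H x y" if "x \<in> verts H" "y \<in> verts H" for x y
  using that Q(1) by (auto simp: eg_def K_def doubleton_eq_iff)
 interpret M: sgmap "eg H" "eg K" "%x. x" "verts H" by unfold_locales (auto simp: eH)
 interpret M': sgmap "eg K" "eg H" "%x. x" "verts H" by unfold_locales (auto simp: eH)
 have eQ: "eg K x y" if "x \<in> Q" "y \<in> Q" "x ~= y" for x y using that by (auto simp: eg_def K_def)
 have sep: "K.sep (verts H) Q"
  unfolding K.sep_def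
 proof (intro ballI notI)
  fix x y assume xy: "x \<in> verts H" "y \<in> Q" "eg K x y"
  hence "{x, y} \<in> edges H \<or> (\<exists>a b. {x, y} = {a, b} & a \<in> Q & b \<in> Q)" by (auto simp: eg_def K_def)
  moreover have "{x, y} \<notin> edges H" using xy(2) Q(1) H(1) unfolding simple_graph_def by blast
  ultimately show False using xy(1,2) Q(1) by (auto simp: doubleton_eq_iff)
 qed
 have VK: "verts K = verts H Un Q" "verts H Int Q = {}" using Q(1) by (auto simp: K_def)
 have "K.pfree l (verts K)" unfolding K.pfree_def
 proof (intro allI impI notI)
  fix xs assume xs: "K.ispath (verts K) xs" "length xs = l"
  consider "set xs \<subseteq> verts H" | "set xs \<subseteq> Q" using K.sep_path[OF sep] xs(1) VK by auto
  thus False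
  proof cases
   case 1
   have "K.pfree l (verts H)" by (rule M'.map_pfree) (use H(3) H.path_free_iff in auto)
   thus False using 1 xs unfolding K.pfree_def K.ispath_def by blast
  next
   case 2
   have "card (set xs) = l" using xs distinct_card by (auto simp: K.ispath_def)
   thus False using card_mono[OF Q(3) 2] Q(2) l by simp
  qed
 qed
 hence "2 * card (edges K) <= path_ex l (card (verts K))" by (intro path_ex_ge[OF sK]) (simp add: K.path_free_iff)
 moreover have "card (verts K) = q + (l - 1)" unfolding VK(1) using card_Un_disjoint[OF H.fin Q(3) VK(2)] H(2) Q(2) by simp
 moreover have "K.pe (verts K) (verts K) = path_ex l q + (l - 1) * (l - 2)"
 proof -
  have d: "verts K - verts H = Q" using VK by auto
  have "K.pe (verts K) (verts K) = K.pe (verts H) (verts H) + K.pe Q Q"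
   using K.pe_sep_split[OF K.fin, of "verts H"] sep d VK by simp
  moreover have "K.pe (verts H) (verts H) = path_ex l q" using M.map_pe[of "verts H" "verts H"] H.pe_card_edges H(4) by simp
  moreover have "K.pe Q Q = (l - 1) * (l - 2)"
  proof -
   have "K.dg x Q = l - 2" if x: "x \<in> Q" for x
   proof -
    have "xa \<in> K.nb x Q \<longleftrightarrow> xa \<in> Q - {x}" for xa
     using eQ[OF x, of xa] K.E_irrefl[of x] by (cases "xa = x") auto
    hence "K.nb x Q = Q - {x}" by blast
    thus ?thesis using Q x by (simp add: K.dg_def)
   qed
   thus ?thesis using Q(2) by (simp add: K.pe_def)
  qed
  ultimately show ?thesis by simp
 qed
 ultimately show ?thesis using K.pe_card_edges by simp
qed

lemma path_ex_cliques: assumes l: "3 <= l" shows "path_ex l q + (l - 2) * (N * (l - 1)) <= path_ex l (q + N * (l - 1))"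
proof (induction N)
 case (Suc N)
 have e: "q + N * (l - 1) + (l - 1) = q + Suc N * (l - 1)" by simp
 have "path_ex l (q + N * (l - 1)) + (l - 1) * (l - 2) <= path_ex l (q + Suc N * (l - 1))"
  using path_ex_clique[OF l, of "q + N * (l - 1)"] unfolding e .
 moreover have "b * (Suc N * a) = b * (N * a) + a * b" for a b by (simp add: algebra_simps)
 ultimately show ?case using Suc.IH by simp
qed simp

text \<open>The graph has \<open>t\<close> vertices joined to everything and \<open>p\<close>
  independent ones. A path uses at most \<open>t\<close> of the former, hence at most
  \<open>t + 1\<close> of the latter, which is fewer than \<open>l = 2 * t + 2\<close> in
  all.\<close>

lemma path_ex_hubs: assumes l: "2 * t + 2 = l" shows "t * (t - 1) + 2 * t * p <= path_ex l (t + p)"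
proof -
 define K where "K = \<lparr>verts = {..<t + p}, edges = {{i, j} | i j. i < t + p & j < t & i ~= j}\<rparr>"
 have sK: "simple_graph K" by (auto simp: simple_graph_def K_def)
 interpret K: gr K by unfold_locales (rule sK)
 have e: "eg K x y \<longleftrightarrow> x ~= y & x < t + p & y < t + p & (x < t \<or> y < t)" for x y
  by (auto simp: eg_def K_def doubleton_eq_iff)
 have VK: "verts K = {..<t + p}" by (simp add: K_def)
 have sep: "K.sep {t..<t + p} {t..<t + p}" by (auto simp: K.sep_def e)
 have "K.pfree l (verts K)" unfolding K.pfree_def
 proof (intro allI impI notI)
  fix xs assume xs: "K.ispath (verts K) xs" "length xs = l"
  have "2 * card (set xs Int {t..<t + p}) <= l + 1" using K.path_indep[OF sep xs(1)] xs(2) by simp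
  moreover have "card (set xs Int {..<t}) <= t" using card_mono[of "{..<t}" "set xs Int {..<t}"] by simp
  moreover have "card (set xs) = l" using xs distinct_card by (auto simp: K.ispath_def)
  moreover have "card (set xs) <= card (set xs Int {t..<t + p}) + card (set xs Int {..<t})"
  proof -
   have "set xs = (set xs Int {t..<t + p}) Un (set xs Int {..<t})" using xs(1) VK by (auto simp: K.ispath_def)
   thus ?thesis by (metis card_Un_le)
  qed
  ultimately show False using l by linarith
 qed
 hence "2 * card (edges K) <= path_ex l (card (verts K))" by (intro path_ex_ge[OF sK]) (simp add: K.path_free_iff)
 moreover have "K.pe (verts K) (verts K) = t * (t - 1) + 2 * t * p"
 proof -
  have d: "verts K - {..<t} = {t..<t + p}" "{..<t} \<subseteq> verts K" using VK by auto
  have "K.cmpl {..<t} {t..<t + p}" by (auto simp: K.cmpl_def e)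
  hence "K.pe {..<t} {t..<t + p} = t * p" by (simp add: K.pe_cmpl)
  moreover have "K.pe {..<t} {..<t} = t * (t - 1)"
  proof -
   have "K.dg x {..<t} = t - 1" if x: "x < t" for x
   proof -
    have "K.nb x {..<t} = {..<t} - {x}" using x by (auto simp: e)
    thus ?thesis using x by (simp add: K.dg_def)
   qed
   thus ?thesis by (simp add: K.pe_def)
  qed
  ultimately show ?thesis using K.pe_split[OF K.fin d(2)] K.pe_sep[OF sep] d(1) by simp
 qed
 ultimately show ?thesis using K.pe_card_edges VK by simp
qed

section \<open>The number of edges of the best good graph\<close>

text \<open>Ordered pairs between different classes of a complete multipartite graph with class
  sizes \<open>p\<close>.\<close>

definition mix :: "nat => (nat => nat) => nat" where "mix r p = (\<Sum>i<r. \<Sum>j\<in>{..<r} - {i}. p i * p j)"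

lemma mix_squares: "mix r p + (\<Sum>i<r. p i * p i) = (\<Sum>i<r. p i) * (\<Sum>i<r. p i)"
proof -
 have "(\<Sum>i<r. p i) * (\<Sum>i<r. p i) = (\<Sum>i<r. \<Sum>j<r. p i * p j)" by (rule sum_product)
 also have "... = (\<Sum>i<r. p i * p i + (\<Sum>j\<in>{..<r} - {i}. p i * p j))"
  by (rule sum.cong[OF refl], rule sum.remove) auto
 finally show ?thesis by (simp add: mix_def sum.distrib)
qed

text \<open>Ordered pairs in the best good graph with class sizes \<open>p\<close>: class
  \<open>0\<close> is extremal for the path, and all edges between classes are present.\<close>

definition wt :: "nat => nat => (nat => nat) => nat" where "wt r l p = path_ex l (p 0) + mix r p"

definition wt_max :: "nat => nat => nat => nat" where "wt_max r l n = Max {wt r l p | p. (\<Sum>i<r. p i) = n}"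

lemma wt_finite: assumes "0 < r" "2 <= l" shows "finite {wt r l p | p. (\<Sum>i<r. p i) = n}"
proof (rule finite_subset[of _ "{..2 * (n * n)}"])
 show "{wt r l p | p. (\<Sum>i<r. p i) = n} \<subseteq> {..2 * (n * n)}"
 proof safe
  fix p :: "nat => nat"
  have "p 0 <= (\<Sum>i<r. p i)" by (rule member_le_sum) (use assms in auto)
  hence "p 0 * p 0 <= (\<Sum>i<r. p i) * (\<Sum>i<r. p i)" by (intro mult_le_mono) auto
  hence "path_ex l (p 0) <= (\<Sum>i<r. p i) * (\<Sum>i<r. p i)" using path_ex_bound[OF assms(2), of "p 0"] by linarith
  thus "wt r l p <= 2 * ((\<Sum>i<r. p i) * (\<Sum>i<r. p i))" unfolding wt_def using mix_squares[of r p] by linarith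
 qed
qed simp

lemma wt_max_ge: "0 < r ==> 2 <= l ==> wt r l p <= wt_max r l (\<Sum>i<r. p i)"
 unfolding wt_max_def by (rule Max_ge[OF wt_finite]) blast+

lemma wt_max_attained: assumes "0 < r" "2 <= l" obtains p where "(\<Sum>i<r. p i) = n" "wt r l p = wt_max r l n"
proof -
 have "(\<Sum>i<r. if i = 0 then n else 0) = n" using assms(1) by (simp add: sum.delta)
 hence "{wt r l p | p. (\<Sum>i<r. p i) = n} ~= {}" by blast
 from Max_in[OF wt_finite[OF assms] this] show ?thesis using that unfolding wt_max_def by force
qed

text \<open>Every class grows by \<open>k\<close>. As a multiple of \<open>l - 1\<close>, this
  growth can be made of whole cliques in class \<open>0\<close>, which gains the full
  \<open>(l - 2) * k\<close>.\<close>

lemma wt_max_step: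
 assumes r: "0 < r" and l: "3 <= l" and k: "k = N * (l - 1)"
 shows "wt_max r l n + (r * (r - 1) * k * k + (l - 2) * k + 2 * ((r - 1) * k * n)) <= wt_max r l (n + r * k)"
proof -
 obtain p where p: "(\<Sum>i<r. p i) = n" "wt r l p = wt_max r l n" using wt_max_attained[of r l n] r l by auto
 define q where "q = (%i. p i + k)"
 have sq: "(\<Sum>i<r. q i) = n + r * k" using p by (simp add: q_def sum.distrib)
 have "path_ex l (p 0) + (l - 2) * k <= path_ex l (q 0)" unfolding q_def k by (rule path_ex_cliques[OF l])
 moreover have "mix r q = mix r p + (r * (r - 1) * k * k + 2 * ((r - 1) * k * n))"
 proof -
  obtain s where s: "r = Suc s" using r gr0_implies_Suc by blast
  have "(\<Sum>i<r. q i * q i) = (\<Sum>i<r. p i * p i + 2 * k * p i + k * k)"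
   by (rule sum.cong[OF refl]) (simp add: q_def algebra_simps)
  also have "... = (\<Sum>i<r. p i * p i) + 2 * k * n + r * (k * k)" using p(1) by (simp add: sum.distrib sum_distrib_left[symmetric])
  finally have "mix r q + ((\<Sum>i<r. p i * p i) + 2 * k * n + r * (k * k)) = (n + r * k) * (n + r * k)" using mix_squares[of r q] sq by simp
  moreover have "mix r p + (\<Sum>i<r. p i * p i) = n * n" using mix_squares[of r p] p(1) by simp
  moreover have "(n + r * k) * (n + r * k) = n * n + (r * (r - 1) * k * k + 2 * ((r - 1) * k * n)) + (2 * k * n + r * (k * k))"
   unfolding s by (simp add: algebra_simps)
  ultimately show ?thesis by linarith
 qed
 ultimately have "wt r l p + (r * (r - 1) * k * k + (l - 2) * k + 2 * ((r - 1) * k * n)) <= wt r l q" by (simp add: wt_def)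
 moreover have "wt r l q <= wt_max r l (n + r * k)" using wt_max_ge[of r l q] r l sq by simp
 ultimately show ?thesis using p(2) by linarith
qed

text \<open>The hubs are counted into class \<open>0\<close>, where \<open>path_ex_hubs\<close>
  provides their edges; their edges to the other classes become edges between classes.\<close>

lemma wt_max_hubs:
 assumes r: "0 < r" and l: "2 * t + 2 = l"
 shows "t * (t - 1) + 2 * t * (\<Sum>i<r. p i) + mix r p <= wt_max r l ((\<Sum>i<r. p i) + t)"
proof -
 define q where "q = (%i. if i = 0 then t + p 0 else p i)"
 obtain s where s: "r = Suc s" using r gr0_implies_Suc by blast
 have sq: "(\<Sum>i<r. q i) = (\<Sum>i<r. p i) + t" unfolding s sum.lessThan_Suc_shift by (simp add: q_def)
 have qq: "(\<Sum>i<r. q i * q i) = (\<Sum>i<r. p i * p i) + 2 * t * p 0 + t * t"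
  unfolding s sum.lessThan_Suc_shift by (simp add: q_def algebra_simps)
 let ?n = "\<Sum>i<r. p i"
 have "mix r q + 2 * t * p 0 = mix r p + 2 * t * ?n"
 proof -
  have "mix r q + ((\<Sum>i<r. p i * p i) + 2 * t * p 0 + t * t) = (?n + t) * (?n + t)" using mix_squares[of r q] sq qq by simp
  moreover have "mix r p + (\<Sum>i<r. p i * p i) = ?n * ?n" by (rule mix_squares)
  moreover have "(?n + t) * (?n + t) = ?n * ?n + 2 * t * ?n + t * t" by (simp add: algebra_simps)
  ultimately show ?thesis by linarith
 qed
 moreover have "t * (t - 1) + 2 * t * p 0 <= path_ex l (q 0)" using path_ex_hubs[OF l, of "p 0"] by (simp add: q_def)
 ultimately have "t * (t - 1) + 2 * t * ?n + mix r p <= wt r l q" by (simp add: wt_def)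
 also have "... <= wt_max r l (?n + t)" using wt_max_ge[of r l q] r l sq by simp
 finally show ?thesis .
qed

lemma (in sgraph) parts_count_full:
 fixes r :: nat
 assumes f: "!!i. i < r ==> finite (P i)" and d: "!!i j. i < r ==> j < r ==> i ~= j ==> P i Int P j = {}"
  and V: "V = (\<Union>i<r. P i)" and c: "!!i j. i < r ==> j < r ==> i ~= j ==> cmpl (P i) (P j)"
 shows "pe V V = (\<Sum>i<r. pe (P i) (P i)) + mix r (%i. card (P i))"
proof -
 have "(\<Sum>i<r. \<Sum>j\<in>{..<r} - {i}. pe (P i) (P j)) = mix r (%i. card (P i))"
  unfolding mix_def by (intro sum.cong refl pe_cmpl c) auto
 thus ?thesis using parts_count(1)[of r P V, OF f d V] by simp
qed

lemma nat_copy_card: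
 "card (edges (nat_copy G)) = card (edges G)" "card (verts (nat_copy G)) = card (verts G)"
proof -
 have "inj_on ((`) to_nat) (edges G)" by (rule inj_onI) (simp add: inj_image_eq_iff)
 thus "card (edges (nat_copy G)) = card (edges G)" unfolding nat_copy_def by (simp add: card_image)
 show "card (verts (nat_copy G)) = card (verts G)" unfolding nat_copy_def by (simp add: card_image)
qed

lemma nat_copy_contains:
 fixes G :: "'a::countable graph"
 assumes "contains_graph (nat_copy G) F" shows "contains_graph G F"
proof -
 obtain f where f: "inj_on f (verts F)" "f ` verts F \<subseteq> to_nat ` verts G" "\<forall>e\<in>edges F. f ` e \<in> (%e. to_nat ` e) ` edges G"
  using assms by (auto simp: contains_graph_def nat_copy_def)
 have i: "inj_on (from_nat :: nat => 'a) (to_nat ` verts G)" by (auto simp: inj_on_def)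
 have "inj_on ((from_nat :: nat => 'a) o f) (verts F)" by (rule comp_inj_on[OF f(1) inj_on_subset[OF i f(2)]])
 moreover have "((from_nat :: nat => 'a) o f) ` verts F \<subseteq> verts G" using f(2) by fastforce
 moreover have "((from_nat :: nat => 'a) o f) ` e \<in> edges G" if "e \<in> edges F" for e
 proof -
  obtain e' where e': "e' \<in> edges G" "f ` e = to_nat ` e'" using f(3) \<open>e \<in> edges F\<close> by auto
  have "((from_nat :: nat => 'a) o f) ` e = from_nat ` (f ` e)" by (simp add: image_comp)
  also have "... = e'" unfolding e'(2) by (simp add: image_image)
  finally show ?thesis using e'(1) by simp
 qed
 ultimately show ?thesis unfolding contains_graph_def by blast
qed

abbreviation family :: "nat => nat => nat => nat graph set" where
 "family l m r \<equiv> {F1 l m r, F2 m r, F3 l m r, F4 l m r}"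

text \<open>Vertices are tagged with their class, so the first component of a vertex is itself the
  good colouring that \<open>gcol_not_forb\<close> needs.\<close>

lemma good_graph:
 assumes r: "2 <= r" and l: "3 <= l" and m: "2 * l <= m"
 shows "\<exists>G :: nat graph. simple_graph G & card (verts G) = (\<Sum>i<r. p i) & family_free (family l m r) G & 2 * card (edges G) = wt r l p"
proof -
 obtain H :: "nat graph" where H: "simple_graph H" "card (verts H) = p 0" "family_free {path_graph l} H" "2 * card (edges H) = path_ex l (p 0)"
  using path_ex_attained[of l "p 0"] l by auto
 interpret H: gr H by unfold_locales (rule H)
 define P where "P = (%i. if i = 0 then Pair 0 ` verts H else Pair i ` {..<p i})"
 define V where "V = (\<Union>i<r. P i)"
 define G where "G = \<lparr>verts = V, edges = {{u, v} | u v. u \<in> V & v \<in> V & (fst u ~= fst v \<or> fst u = 0 & fst v = 0 & eg H (snd u) (snd v))}\<rparr>"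
 have Pi: "x \<in> P i ==> fst x = i" for x i by (auto simp: P_def split: if_splits)
 have fP: "finite (P i)" for i using H.fin by (simp add: P_def)
 have dP: "P i Int P j = {}" if "i ~= j" for i j using Pi that by blast
 have cP: "card (P i) = p i" for i
  using H(2) by (simp add: P_def card_image inj_on_def)
 have fV: "finite V" using fP by (simp add: V_def)
 have sG: "simple_graph G"
  using fV H.E_irrefl by (auto simp: simple_graph_def G_def card_insert_if)
 interpret G: gr G by unfold_locales (rule sG)
 have VG: "verts G = V" by (simp add: G_def)
 have e: "eg G u v \<longleftrightarrow> fst u ~= fst v \<or> fst u = 0 & fst v = 0 & eg H (snd u) (snd v)" if uv: "u \<in> V" "v \<in> V" for u v
 proof
  assume "eg G u v"
  then obtain a b where "{u, v} = {a, b}" "fst a ~= fst b \<or> fst a = 0 & fst b = 0 & eg H (snd a) (snd b)"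
   by (auto simp: eg_def G_def)
  thus "fst u ~= fst v \<or> fst u = 0 & fst v = 0 & eg H (snd u) (snd v)" using H.E_sym by (auto simp: doubleton_eq_iff)
 next
  assume a: "fst u ~= fst v \<or> fst u = 0 & fst v = 0 & eg H (snd u) (snd v)"
  hence "{u, v} \<in> {{u, v} | u v. u \<in> V & v \<in> V & (fst u ~= fst v \<or> fst u = 0 & fst v = 0 & eg H (snd u) (snd v))}"
   using uv by blast
  hence "{u, v} \<in> edges G" by (simp add: G_def)
  thus "eg G u v" using G.edge_iff by simp
 qed
 have PV: "P i \<subseteq> V" if "i < r" for i using that by (auto simp: V_def)
 have r0: "0 < r" using r by simp
 have sP0: "snd ` P 0 = verts H" by (force simp: P_def)
 interpret M: sgmap "eg G" "eg H" snd "P 0"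
 proof unfold_locales
  show "inj_on snd (P 0)" by (auto simp: inj_on_def P_def)
  fix x y assume xy: "x \<in> P 0" "y \<in> P 0"
  show "eg H (snd x) (snd y) = eg G x y" using e[of x y] PV[OF r0] xy Pi by auto
 qed
 have pf: "G.pfree l (P 0)" by (rule M.map_pfree) (use H(3) H.path_free_iff sP0 in auto)
 have VP: "fst v < r & v \<in> P (fst v)" if v: "v \<in> V" for v
 proof -
  obtain i where i: "i < r" "v \<in> P i" using v unfolding V_def by blast
  thus ?thesis using Pi[OF i(2)] by simp
 qed
 have C0: "{v\<in>V. fst v = 0} = P 0"
 proof (rule set_eqI)
  fix v show "v \<in> {v\<in>V. fst v = 0} \<longleftrightarrow> v \<in> P 0" using VP[of v] Pi[of v 0] PV[OF r0] by auto
 qed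
 have "G.gcol r l V fst" unfolding G.gcol_def
 proof (intro conjI ballI impI)
  fix v assume "v \<in> V" thus "fst v < r" using VP by blast
 next
  fix u v assume "u \<in> V" "v \<in> V" "eg G u v & fst u = fst v" thus "fst u = 0" using e by auto
 next
  show "G.pfree l {v \<in> V. fst v = 0}" using pf C0 by simp
 qed
 from G.gcol_not_forb[OF fV this r0 l m] have "family_free (family l m r) G"
  unfolding G.family_free_iff[OF r] VG by blast
 hence "family_free (family l m r) (nat_copy G)" unfolding family_free_def using nat_copy_contains by blast
 moreover have "simple_graph (nat_copy G)" by (rule simple_nat_copy[OF sG])
 moreover have "card (verts (nat_copy G)) = (\<Sum>i<r. p i)"
 proof -
  have "card V = (\<Sum>i<r. card (P i))" unfolding V_def by (rule card_UN_disjoint) (use fP dP in auto)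
  thus ?thesis using nat_copy_card(2)[of G] VG cP by simp
 qed
 moreover have "2 * card (edges (nat_copy G)) = wt r l p"
 proof -
  have "G.pe V V = (\<Sum>i<r. G.pe (P i) (P i)) + mix r (%i. card (P i))"
  proof (rule G.parts_count_full[OF fP _ V_def])
   show "P i Int P j = {}" if "i ~= j" for i j by (rule dP[OF that])
   fix i j assume ij: "i < r" "j < r" "i ~= j"
   show "G.cmpl (P i) (P j)" unfolding G.cmpl_def
   proof (intro ballI)
    fix x y assume "x \<in> P i" "y \<in> P j"
    thus "eg G x y" using e[of x y] PV[OF ij(1)] PV[OF ij(2)] Pi ij(3) by blast
   qed
  qed
  moreover have "(\<Sum>i<r. G.pe (P i) (P i)) = G.pe (P 0) (P 0) + (\<Sum>i\<in>{..<r} - {0}. G.pe (P i) (P i))" by (rule sum.remove) (use r in auto)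
  moreover have "(\<Sum>i\<in>{..<r} - {0}. G.pe (P i) (P i)) = 0"
  proof (intro sum.neutral ballI G.pe_sep)
   fix i assume i: "i \<in> {..<r} - {0}"
   show "G.sep (P i) (P i)" unfolding G.sep_def
   proof (intro ballI notI)
    fix x y assume xy: "x \<in> P i" "y \<in> P i" "eg G x y"
    have "x \<in> V" "y \<in> V" "fst x = i" "fst y = i" using xy Pi PV[of i] i by blast+
    thus False using e[of x y] xy(3) i by simp
   qed
  qed
  moreover have "G.pe (P 0) (P 0) = path_ex l (p 0)" using M.map_pe[of "P 0" "P 0"] sP0 H.pe_card_edges H(4) by simp
  ultimately have "G.pe V V = wt r l p" using cP by (simp add: wt_def)
  thus ?thesis using nat_copy_card(1)[of G] G.pe_card_edges VG by simp
 qed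
 ultimately show ?thesis by blast
qed

text \<open>Twice the extremal number of the family.\<close>

definition ext :: "nat => nat => nat => nat => nat" where
 "ext r l m n = Max {2 * card (edges G) | G :: nat graph. simple_graph G & card (verts G) = n & family_free (family l m r) G}"

lemma ext_ge:
 fixes G :: "nat graph"
 shows "simple_graph G ==> family_free (family l m r) G ==> 2 * card (edges G) <= ext r l m (card (verts G))"
 unfolding ext_def by (rule Max_ge[OF edges_set_finite]) blast

lemma wt_max_le_ext:
 assumes r: "2 <= r" and l: "3 <= l" and m: "2 * l <= m"
 shows "wt_max r l n <= ext r l m n"
proof -
 obtain p where p: "(\<Sum>i<r. p i) = n" "wt r l p = wt_max r l n" using wt_max_attained[of r l n] r l by auto
 obtain G :: "nat graph" where "simple_graph G" "card (verts G) = (\<Sum>i<r. p i)" "family_free (family l m r) G" "2 * card (edges G) = wt r l p"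
  using good_graph[OF r l m, of p] by blast
 thus ?thesis using ext_ge[of G l m r] p by simp
qed

lemma ext_attained:
 assumes r: "2 <= r" and l: "3 <= l" and m: "2 * l <= m"
 obtains G :: "nat graph" where "simple_graph G" "card (verts G) = n" "family_free (family l m r) G" "2 * card (edges G) = ext r l m n"
proof -
 obtain p where p: "(\<Sum>i<r. p i) = n" "wt r l p = wt_max r l n" using wt_max_attained[of r l n] r l by auto
 obtain G :: "nat graph" where "simple_graph G" "card (verts G) = (\<Sum>i<r. p i)" "family_free (family l m r) G"
  using good_graph[OF r l m, of p] by blast
 hence "{2 * card (edges G) | G :: nat graph. simple_graph G & card (verts G) = n & family_free (family l m r) G} ~= {}" using p(1) by blast
 from Max_in[OF edges_set_finite this] show ?thesis using that unfolding ext_def by force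
qed

lemma extremal_ext:
 assumes "2 <= r" "3 <= l" "2 * l <= m" and G: "G \<in> extremal_graphs n (family l m r)"
 shows "simple_graph G" "card (verts G) = n" "family_free (family l m r) G" "2 * card (edges G) = ext r l m n"
proof -
 show s: "simple_graph G" "card (verts G) = n" "family_free (family l m r) G" using G unfolding extremal_graphs_def by blast+
 obtain K :: "nat graph" where K: "simple_graph K" "card (verts K) = n" "family_free (family l m r) K" "2 * card (edges K) = ext r l m n"
  using ext_attained[OF assms(1-3)] by blast
 have "card (edges K) <= card (edges G)" using G K unfolding extremal_graphs_def by blast
 thus "2 * card (edges G) = ext r l m n" using K(4) ext_ge[OF s(1,3)] s(2) by simp
qed

lemma ext_extremal:
 fixes G :: "nat graph"
 assumes "simple_graph G" "card (verts G) = n" "family_free (family l m r) G" "2 * card (edges G) = ext r l m n"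
 shows "G \<in> extremal_graphs n (family l m r)"
 unfolding extremal_graphs_def
proof (intro CollectI conjI allI impI)
 fix K :: "nat graph" assume K: "simple_graph K & card (verts K) = n & family_free (family l m r) K"
 thus "card (edges K) <= card (edges G)" using ext_ge[of K l m r] assms(4) by auto
qed (use assms in auto)

lemma (in sgraph) blow_mono: assumes "blow r S V" "!!i. i < r ==> T i \<subseteq> S i" shows "blow r T V"
 unfolding blow_def
proof (intro conjI allI impI)
 fix i assume i: "i < r"
 have s: "S i \<subseteq> V" "finite (S i)" "T i \<subseteq> S i" using assms i by (auto simp: blow_def)
 thus "T i \<subseteq> V" "finite (T i)" using finite_subset by auto
 fix j assume j: "j < r" "i ~= j"
 have "cmpl (S i) (S j)" using assms(1) i j by (simp add: blow_def)
 thus "cmpl (T i) (T j)" using cmpl_mono s(3) assms(2)[OF j(1)] by blast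
qed

text \<open>The core is trimmed to parts of size exactly \<open>k\<close>. If its deletion costs the
  full increment of \<open>wt_max_step\<close>, then \<open>exact_K\<close> or
  \<open>exact_S\<close> yields a good colouring. Otherwise the remaining graph has a surplus over
  \<open>wt_max\<close> that is larger by at least one.\<close>

lemma reduce:
 fixes G :: "nat graph"
 assumes r: "2 <= r" and l: "3 <= l" and N: "m + 2 < N" and k: "k = N * (l - 1)" "2 * m + 2 * l < k"
  and G: "simple_graph G" "family_free (family l m r) G" and b: "sgraph.bad (eg G) r l m N k (verts G)"
  and big: "wt_max r l (card (verts G)) <= 2 * card (edges G)"
 shows "(\<exists>c. sgraph.gcol (eg G) r l (verts G) c) \<or>
  r * k <= card (verts G) &
  2 * card (edges G) + 1 + wt_max r l (card (verts G) - r * k) <= wt_max r l (card (verts G)) + ext r l m (card (verts G) - r * k)"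
proof -
 interpret gr G by unfold_locales (rule G)
 let ?V = "verts G" let ?n = "card (verts G)"
 let ?inc = "r * (r - 1) * k * k + (l - 2) * k + 2 * ((r - 1) * k * (?n - r * k))"
 have r0: "0 < r" using r by simp
 have f: "~ forb1 r l m ?V" "~ forb2 r m ?V" "~ forb3 r l m ?V" "~ forb4 r l m ?V"
  using G(2) family_free_iff[OF r] by blast+
 have strict: "r * k <= ?n & 2 * card (edges G) + 1 + wt_max r l (?n - r * k) <= wt_max r l ?n + ext r l m (?n - r * k)"
  if U: "U \<subseteq> ?V" "card U = r * k" "pe U U + 2 * pe U (?V - U) < ?inc" for U
 proof -
  have le: "r * k <= ?n" using card_mono[OF fin U(1)] U(2) by simp
  have fU: "finite U" using U(1) fin finite_subset by blast
  have sub: "?V - U \<subseteq> ?V" by blast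
  have c: "card (?V - U) = ?n - r * k" using card_Diff_subset[OF fU U(1)] U(2) by simp
  have ff: "family_free (family l m r) (induced G (?V - U))" using G(2) induced_contains[OF sub] unfolding family_free_def by blast
  have "2 * card (edges (induced G (?V - U))) <= ext r l m (card (verts (induced G (?V - U))))"
   by (rule ext_ge[OF induced_simple[OF sub] ff])
  hence e: "pe (?V - U) (?V - U) <= ext r l m (?n - r * k)" using induced_edges[OF sub] c by (simp add: induced_def)
  have "wt_max r l (?n - r * k) + ?inc <= wt_max r l (?n - r * k + r * k)" by (rule wt_max_step[OF r0 l k(1)])
  hence w: "wt_max r l (?n - r * k) + ?inc <= wt_max r l ?n" using le by simp
  show ?thesis using le e w U(3) pe_split[OF fin U(1)] pe_card_edges by linarith
 qed
 consider "forbK r l N k ?V" | "forbS r l k ?V" using b f unfolding bad_def by blast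
 thus ?thesis
 proof cases
  case 1
  then obtain S i0 where S: "i0 < r" "blow r S ?V" "hasJK l N (S i0)" "\<forall>i<r. i ~= i0 --> k <= card (S i)"
   unfolding forbK_def by blast
  obtain \<C> where C: "finite \<C>" "card \<C> = N" "\<forall>Q\<in>\<C>. Q \<subseteq> S i0 & clique Q & card Q = l - 1" "\<forall>Q\<in>\<C>. \<forall>Q'\<in>\<C>. Q ~= Q' --> Q Int Q' = {}"
   using S(3) unfolding hasJK_def by (elim exE conjE)
  have fS: "finite (S i0)" using S(1,2) by (simp add: blow_def)
  have fQ: "finite Q" if "Q \<in> \<C>" for Q using C(3) fS that finite_subset by blast
  have "card (\<Union>Q\<in>\<C>. Q) = (\<Sum>Q\<in>\<C>. card Q)" by (rule card_UN_disjoint) (use C fQ in auto)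
  hence cU: "card (\<Union>\<C>) = k" using C(2,3) k(1) by simp
  have US: "\<Union>\<C> \<subseteq> S i0" using C(3) by blast
  have "k <= card (S i0)" using card_mono[OF fS US] cU by simp
  hence all: "k <= card (S i)" if "i < r" for i using S(4) that by (cases "i = i0") auto
  obtain \<pi> where p: "\<pi> 0 = i0" "\<forall>i<r. \<pi> i < r" "inj_on \<pi> {..<r}" using one_perm[OF S(1)] by blast
  have bl: "blow r (S o \<pi>) ?V" by (rule blow_perm[OF S(2) p(2,3)])
  obtain T' where T': "\<forall>j<r. card (T' j) = k & T' j \<subseteq> (S o \<pi>) j" using blow_trim[OF bl, of k] all p(2) by auto
  define T where "T = T'(0 := \<Union>\<C>)"
  have T: "blow r T ?V" by (rule blow_mono[OF bl]) (use T' US p(1) in "auto simp: T_def")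
  have cT: "card (T i) = k" if "i < r" for i using T' cU that by (simp add: T_def)
  have T0: "T 0 = \<Union>\<C>" by (simp add: T_def)
  note ex = exact_K[of ?V l r m T k \<C>, OF fin l f(1,3) r0 T cT C(1) T0 _ _ _ k(2)]
  have C': "!!Q. Q \<in> \<C> ==> clique Q & card Q = l - 1" "!!Q Q'. Q \<in> \<C> ==> Q' \<in> \<C> ==> Q ~= Q' ==> Q Int Q' = {}" "m + 2 < card \<C>"
   using C N by auto
  let ?U = "\<Union>i<r. T i"
  show ?thesis
  proof (cases "pe ?U ?U + 2 * pe ?U (?V - ?U) = ?inc")
   case True
   thus ?thesis using ex(4)[OF _ C'] by blast
  next
   case False
   hence "pe ?U ?U + 2 * pe ?U (?V - ?U) < ?inc" using ex(3)[OF _ C'] by auto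
   thus ?thesis using strict[OF ex(1)[OF _ C'] ex(2)[OF _ C']] by blast
  qed
 next
  case 2
  then obtain S X where S: "blow r S ?V" "\<forall>i<r. k <= card (S i)" "finite X" "X \<subseteq> ?V" "2 * card X + 2 = l" "\<forall>i<r. cmpl X (S i)"
   unfolding forbS_def by blast
  obtain B where B: "blow r B ?V" "\<forall>j<r. card (B j) = k & B j \<subseteq> S j" using blow_trim[OF S(1,2)] by blast
  have cB: "card (B i) = k" if "i < r" for i using B(2) that by blast
  have XB: "cmpl X (B i)" if "i < r" for i using cmpl_mono[of X "S i" X "B i"] S(6) B(2) that by blast
  note ex = exact_S[of ?V l r m B k X, OF fin l f(1,4) r0 B(1) cB k(2) S(4,5) XB]
  let ?U = "\<Union>i<r. B i"
  show ?thesis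
  proof (cases "pe ?U ?U + 2 * pe ?U (?V - ?U) = ?inc")
   case True
   then obtain p where p: "(\<Sum>i<r. p i) + card X = ?n"
    "pe ?V ?V <= card X * (card X - 1) + 2 * card X * (\<Sum>i<r. p i) + (\<Sum>i<r. \<Sum>j\<in>{..<r} - {i}. p i * p j)"
    "pe ?V ?V = card X * (card X - 1) + 2 * card X * (\<Sum>i<r. p i) + (\<Sum>i<r. \<Sum>j\<in>{..<r} - {i}. p i * p j) --> (\<exists>c. gcol r l ?V c)"
    using ex(4) by blast
   have "card X * (card X - 1) + 2 * card X * (\<Sum>i<r. p i) + mix r p <= wt_max r l ?n"
    using wt_max_hubs[OF r0 S(5), of p] p(1) by simp
   \<comment> \<open>Here \<open>big\<close> enters: the graph is at least as good as the best good
     graph, so the bound of \<open>exact_S\<close> must be attained.\<close>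
   hence "pe ?V ?V = card X * (card X - 1) + 2 * card X * (\<Sum>i<r. p i) + (\<Sum>i<r. \<Sum>j\<in>{..<r} - {i}. p i * p j)"
    using p(2) big pe_card_edges unfolding mix_def by linarith
   thus ?thesis using p(3) by blast
  next
   case False
   hence "pe ?U ?U + 2 * pe ?U (?V - ?U) < ?inc" using ex(3) by linarith
   thus ?thesis using strict[OF ex(1,2)] by blast
  qed
 qed
qed

lemma gcol_wt:
 fixes G :: "nat graph"
 assumes r: "2 <= r" and l: "3 <= l" and G: "simple_graph G" and c: "sgraph.gcol (eg G) r l (verts G) c"
 defines "P \<equiv> %i. {v\<in>verts G. c v = i}"
 shows "(\<Sum>i<r. card (P i)) = card (verts G)" "2 * card (edges G) <= sgraph.pe (eg G) (P 0) (P 0) + mix r (%i. card (P i))"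
  "sgraph.pe (eg G) (P 0) (P 0) <= path_ex l (card (P 0))"
  "wt r l (%i. card (P i)) <= wt_max r l (card (verts G))"
proof -
 interpret gr G by unfold_locales (rule G)
 have r0: "0 < r" using r by simp
 note gc = gcol_count[OF fin c r0]
 show s: "(\<Sum>i<r. card (P i)) = card (verts G)" using gc(1) by (simp add: P_def)
 show "2 * card (edges G) <= pe (P 0) (P 0) + mix r (%i. card (P i))"
  using gc(2) pe_card_edges by (simp add: P_def mix_def)
 have sub: "P 0 \<subseteq> verts G" by (auto simp: P_def)
 have "pfree l (P 0)" using c by (simp add: P_def gcol_def)
 hence "2 * card (edges (induced G (P 0))) <= path_ex l (card (verts (induced G (P 0))))"
  by (intro path_ex_ge induced_simple[OF sub] induced_path[OF sub])
 thus "pe (P 0) (P 0) <= path_ex l (card (P 0))" using induced_edges[OF sub] by (simp add: induced_def)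
 show "wt r l (%i. card (P i)) <= wt_max r l (card (verts G))"
  using wt_max_ge[of r l "%i. card (P i)"] s r0 l by simp
qed

lemma turan_increment:
 fixes r k x s :: real
 assumes "r > 0"
 shows "(1 - 1 / r) * (x + r * k)\<^sup>2 + s * (x + r * k) / r = (1 - 1 / r) * x\<^sup>2 + s * x / r + (r * (r - 1) * k * k + s * k + 2 * ((r - 1) * k * x))"
 using assms by (simp add: field_simps power2_eq_square)

text \<open>Steps of \<open>r * k\<close> vertices follow the quadratic function exactly, by
  \<open>turan_increment\<close>; only the start below \<open>r * k\<close> costs a
  constant.\<close>

lemma wt_max_lower:
 fixes r :: nat
 assumes r: "0 < r" and l: "3 <= l" and k: "k = N * (l - 1)" "0 < k"
 shows "\<exists>C. \<forall>n. (1 - 1 / real r) * (real n)\<^sup>2 + (real l - 2) * real n / real r - C <= real (wt_max r l n)"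
proof -
 define h where "h = (%x::real. (1 - 1 / real r) * x\<^sup>2 + (real l - 2) * x / real r)"
 have mono: "h x <= h y" if "0 <= x" "x <= y" for x y
 proof -
  have "0 <= 1 - 1 / real r" using r by simp
  hence "(1 - 1 / real r) * x\<^sup>2 <= (1 - 1 / real r) * y\<^sup>2" using that by (intro mult_left_mono power_mono)
  moreover have "(real l - 2) * x / real r <= (real l - 2) * y / real r" using that l by (intro divide_right_mono mult_left_mono) auto
  ultimately show ?thesis by (simp add: h_def)
 qed
 have "h (real n) - h (real (r * k)) <= real (wt_max r l n)" for n
 proof (induction n rule: less_induct)
  case (less n)
  show ?case
  proof (cases "n < r * k")
   case True
   have "h (real n) <= h (real (r * k))" by (rule mono) (use True in "simp_all del: of_nat_mult")
   thus ?thesis by simp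
  next
   case False
   define x where "x = n - r * k"
   have n: "n = x + r * k" "x < n" using False mult_pos_pos[OF r k(2)] unfolding x_def by linarith+
   have st: "wt_max r l x + (r * (r - 1) * k * k + (l - 2) * k + 2 * ((r - 1) * k * x)) <= wt_max r l n"
    using wt_max_step[OF r l k(1), of x] n(1) by simp
   have "real (r * (r - 1) * k * k + (l - 2) * k + 2 * ((r - 1) * k * x)) =
    real r * (real r - 1) * real k * real k + (real l - 2) * real k + 2 * ((real r - 1) * real k * real x)"
    using r l by (simp add: of_nat_diff)
   moreover have "h (real n) = h (real x) + (real r * (real r - 1) * real k * real k + (real l - 2) * real k + 2 * ((real r - 1) * real k * real x))"
    unfolding h_def n(1) using turan_increment[of "real r" "real x" "real k" "real l - 2"] r by simp
   moreover have "real (wt_max r l x) + real (r * (r - 1) * k * k + (l - 2) * k + 2 * ((r - 1) * k * x)) <= real (wt_max r l n)"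
    using st by (metis of_nat_add of_nat_le_iff)
   ultimately show ?thesis using less.IH[OF n(2)] by linarith
  qed
 qed
 thus ?thesis unfolding h_def by blast
qed

lemma eventually_good:
 assumes r: "2 <= r" and l: "3 <= l" and m: "2 * l <= m"
 shows "\<exists>n0. \<forall>n\<ge>n0. \<forall>G\<in>extremal_graphs n (family l m r). (\<exists>c. sgraph.gcol (eg G) r l (verts G) c) & wt_max r l n = ext r l m n"
proof -
 \<comment> \<open>Provides the more than \<open>m + 2\<close> cliques of \<open>exact_K\<close>,
   and \<open>k\<close> is at least \<open>2 * N\<close>, which exceeds
   \<open>2 * m + 2 * l\<close>.\<close>
 define N where "N = m + l + 3"
 define k where "k = N * (l - 1)"
 have r0: "0 < r" "1 <= r" using r by auto
 have N: "m + 2 < N" by (simp add: N_def)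
 have "N * 2 <= N * (l - 1)" by (rule mult_le_mono2) (use l in simp)
 hence k: "2 * m + 2 * l < k" by (simp add: k_def N_def)
 obtain g C where g: "g > 0" "!!G :: nat graph. simple_graph G ==> ~ sgraph.bad (eg G) r l m N k (verts G) ==>
  real (2 * card (edges G)) <= (1 - 1 / real r) * (real (card (verts G)))\<^sup>2 + (real l - 2 - g) * card (verts G) / real r + C"
  using gap_graphs[OF l r0(2), of m N k] by blast
 obtain C' where C': "!!n. (1 - 1 / real r) * (real n)\<^sup>2 + (real l - 2) * real n / real r - C' <= real (wt_max r l n)"
  using wt_max_lower[OF r0(1) l k_def] k by auto
 \<comment> \<open>Beyond \<open>n1\<close> the loss \<open>g * n / r\<close> of the gap theorem
   exceeds all constants, so an extremal graph must be \<open>bad\<close>.\<close>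
 obtain n1 :: nat where n1: "(C + C') * real r / g < real n1" using reals_Archimedean2 by blast
 define s where "s = r * k"
 have s0: "0 < s" using r k by (simp add: s_def)
 have step: "(\<exists>c. sgraph.gcol (eg G) r l (verts G) c) \<or> s <= n & ext r l m n + 1 + wt_max r l (n - s) <= wt_max r l n + ext r l m (n - s)"
  if n: "n1 <= n" and G: "G \<in> extremal_graphs n (family l m r)" for n G
 proof -
  note eG = extremal_ext[OF r l m G]
  have big: "wt_max r l (card (verts G)) <= 2 * card (edges G)" using wt_max_le_ext[OF r l m] eG by simp
  have "sgraph.bad (eg G) r l m N k (verts G)"
  proof (rule ccontr)
   assume "~ sgraph.bad (eg G) r l m N k (verts G)"
   from g(2)[OF eG(1) this] have a: "real (2 * card (edges G)) <= (1 - 1 / real r) * (real n)\<^sup>2 + (real l - 2 - g) * real n / real r + C"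
    using eG(2) by simp
   have "(real l - 2 - g) * real n / real r = (real l - 2) * real n / real r - g * real n / real r"
    by (simp add: left_diff_distrib diff_divide_distrib)
   moreover have "real (wt_max r l n) <= real (2 * card (edges G))" using big unfolding eG(2) of_nat_le_iff .
   ultimately have "g * real n / real r <= C + C'" using a C'[of n] by linarith
   hence "g * real n <= (C + C') * real r" using r0 by (simp add: field_simps)
   hence "real n <= (C + C') * real r / g" using g(1) by (simp add: field_simps)
   thus False using n1 n by linarith
  qed
  from reduce[OF r l N k_def k eG(1,3) this big] show ?thesis using eG by (simp add: s_def)
 qed
 have good_ext: "wt_max r l n = ext r l m n" if "G \<in> extremal_graphs n (family l m r)" "sgraph.gcol (eg G) r l (verts G) c" for n G c
 proof -
  note eG = extremal_ext[OF r l m that(1)]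
  note gw = gcol_wt[OF r l eG(1) that(2)]
  have "ext r l m n <= wt_max r l n" using gw(2-4) eG by (simp add: wt_def)
  thus ?thesis using wt_max_le_ext[OF r l m, of n] by simp
 qed
 define D where "D = (%n. ext r l m n - wt_max r l n)"
 have De: "ext r l m n = wt_max r l n + D n" for n using wt_max_le_ext[OF r l m, of n] by (simp add: D_def)
 have Dstep: "D n = 0 \<or> s <= n & D n + 1 <= D (n - s)" if n: "n1 <= n" for n
 proof -
  obtain G :: "nat graph" where "simple_graph G" "card (verts G) = n" "family_free (family l m r) G" "2 * card (edges G) = ext r l m n"
   using ext_attained[OF r l m] by blast
  hence G: "G \<in> extremal_graphs n (family l m r)" by (rule ext_extremal)
  from step[OF n G] show ?thesis
  proof
   assume "\<exists>c. sgraph.gcol (eg G) r l (verts G) c"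
   hence "wt_max r l n = ext r l m n" using good_ext[OF G] by blast
   thus ?thesis by (simp add: D_def)
  next
   assume "s <= n & ext r l m n + 1 + wt_max r l (n - s) <= wt_max r l n + ext r l m (n - s)"
   thus ?thesis using De[of n] De[of "n - s"] by simp
  qed
 qed
 \<comment> \<open>Every larger \<open>n\<close> descends into this initial range by steps of
   \<open>s\<close>, along which \<open>D\<close> is either zero at once or increases, so
   \<open>M\<close> bounds \<open>D\<close> everywhere.\<close>
 define M where "M = Max (D ` {..n1 + s})"
 have base: "D n <= M" for n
 proof (induction n rule: less_induct)
  case (less n)
  show ?case
  proof (cases "n <= n1 + s")
   case True thus ?thesis by (simp add: M_def)
  next
   case False
   have "D (n - s) <= M" by (rule less.IH) (use False s0 in auto)
   thus ?thesis using Dstep[of n] False by auto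
  qed
 qed
 have dec: "D n <= M - j" if "n1 + j * s <= n" for j n using that
 proof (induction j arbitrary: n)
  case 0 thus ?case using base by simp
 next
  case (Suc j)
  have "n1 + j * s <= n - s" using Suc.prems by simp
  hence "D (n - s) <= M - j" by (rule Suc.IH)
  thus ?case using Dstep[of n] Suc.prems by auto
 qed
 show ?thesis
 proof (rule exI[of _ "n1 + Suc M * s"], intro allI impI ballI)
  fix n G assume n: "n1 + Suc M * s <= n" and G: "G \<in> extremal_graphs n (family l m r)"
  \<comment> \<open>With no surplus left at \<open>n - s\<close>, the second alternative of
    \<open>step\<close> is impossible for \<open>n\<close>.\<close>
  have "D (n - s) = 0" using dec[of M "n - s"] n by simp
  moreover have "n1 <= n" using n by simp
  ultimately have "\<exists>c. sgraph.gcol (eg G) r l (verts G) c" using step[OF _ G] De[of n] De[of "n - s"] by force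
  thus "(\<exists>c. sgraph.gcol (eg G) r l (verts G) c) & wt_max r l n = ext r l m n" using good_ext[OF G] by blast
 qed
qed

section \<open>The structure of extremal graphs\<close>

text \<open>The sum of the sizes is fixed, so by \<open>mix_squares\<close> it suffices that the sum
  of the squares drops.\<close>

lemma mix_balance:
 assumes ij: "i < r" "j < r" "i ~= j" and p: "p j + 2 <= p i"
 defines "q \<equiv> p(i := p i - 1, j := p j + 1)"
 shows "(\<Sum>x<r. q x) = (\<Sum>x<r. p x)" "mix r p < mix r q"
proof -
 have split: "(\<Sum>x<r. f x) = f i + (f j + (\<Sum>x\<in>{..<r} - {i} - {j}. f x))" for f :: "nat => nat"
  using sum.remove[of "{..<r}" i f] sum.remove[of "{..<r} - {i}" j f] ij by simp
 have same: "(\<Sum>x\<in>{..<r} - {i} - {j}. f (q x)) = (\<Sum>x\<in>{..<r} - {i} - {j}. f (p x))" for f :: "nat => nat"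
  by (rule sum.cong) (auto simp: q_def)
 have qi: "q i = p i - 1" "q j = p j + 1" using ij(3) by (auto simp: q_def)
 show s: "(\<Sum>x<r. q x) = (\<Sum>x<r. p x)" using split[of q] split[of p] same[of "%x. x"] qi p by simp
 obtain d where d: "p i = p j + 2 + d" using p le_Suc_ex by blast
 have "q i * q i + q j * q j < p i * p i + p j * p j" unfolding qi d by (simp add: algebra_simps)
 hence "(\<Sum>x<r. q x * q x) < (\<Sum>x<r. p x * p x)"
  using split[of "%x. q x * q x"] split[of "%x. p x * p x"] same[of "%x. x * x"] by simp
 thus "mix r p < mix r q" using mix_squares[of r p] mix_squares[of r q] s by simp
qed

text \<open>For sizes that differ by at most one, the number of larger ones is their sum modulo
  \<open>R\<close>, as it is for the residue classes; \<open>\<sigma>\<close> matches larger with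
  larger.\<close>

lemma balanced_turan:
 fixes p :: "nat => nat"
 assumes R: "0 < R" and b: "!!i j. i < R ==> j < R ==> p i <= p j + 1"
 shows "\<exists>\<sigma>. bij_betw \<sigma> {..<R} {..<R} & (\<forall>i<R. p i = card {v. v < (\<Sum>i<R. p i) & v mod R = \<sigma> i})"
proof -
 define a where "a = Min (p ` {..<R})"
 have ne: "p ` {..<R} ~= {}" using R by auto
 obtain i0 where i0: "i0 < R" "p i0 = a" using Min_in[OF _ ne] by (auto simp: a_def)
 have lo: "a <= p i" if "i < R" for i using that by (simp add: a_def)
 define A where "A = {i\<in>{..<R}. p i = a + 1}"
 have pv: "p i = a + (if i \<in> A then 1 else 0)" if "i < R" for i
  using lo[OF that] b[OF that i0(1)] i0(2) that by (auto simp: A_def)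
 have A: "A \<subseteq> {..<R}" "finite A" "i0 \<notin> A" using i0 by (auto simp: A_def)
 hence "A \<subset> {..<R}" using i0(1) by auto
 hence bR: "card A < R" using psubset_card_mono[of "{..<R}" A] by simp
 have "(\<Sum>i<R. p i) = (\<Sum>i<R. a + (if i \<in> A then 1 else 0))" by (rule sum.cong) (use pv in auto)
 also have "... = R * a + card ({..<R} Int A)" by (simp add: sum.distrib sum.If_cases)
 also have "{..<R} Int A = A" using A by auto
 finally have n: "(\<Sum>i<R. p i) = R * a + card A" .
 have dm: "(\<Sum>i<R. p i) div R = a" "(\<Sum>i<R. p i) mod R = card A" unfolding n using R bR by simp_all
 obtain f where f: "bij_betw f A {..<card A}" using finite_same_card_bij[OF A(2), of "{..<card A}"] by auto
 have "card ({..<R} - A) = card {card A..<R}" using card_Diff_subset[OF A(2,1)] by simp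
 then obtain g where g: "bij_betw g ({..<R} - A) {card A..<R}" using finite_same_card_bij[of "{..<R} - A" "{card A..<R}"] by auto
 define \<sigma> where "\<sigma> = (%i. if i \<in> A then f i else g i)"
 have "bij_betw \<sigma> A {..<card A}" using f by (rule bij_betw_cong[THEN iffD1, rotated]) (simp add: \<sigma>_def)
 moreover have "bij_betw \<sigma> ({..<R} - A) {card A..<R}" using g by (rule bij_betw_cong[THEN iffD1, rotated]) (simp add: \<sigma>_def)
 ultimately have "bij_betw \<sigma> (A Un ({..<R} - A)) ({..<card A} Un {card A..<R})" by (rule bij_betw_combine) auto
 moreover have "A Un ({..<R} - A) = {..<R}" "{..<card A} Un {card A..<R} = {..<R}" using A bR by auto
 ultimately have s: "bij_betw \<sigma> {..<R} {..<R}" by simp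
 have "p i = card {v. v < (\<Sum>i<R. p i) & v mod R = \<sigma> i}" if i: "i < R" for i
 proof -
  have sR: "\<sigma> i < R" using s i by (auto simp: bij_betw_def)
  have "\<sigma> i < card A \<longleftrightarrow> i \<in> A"
   using f g i by (auto simp: \<sigma>_def bij_betw_def) (metis DiffI atLeastLessThan_iff imageI lessThan_iff linorder_not_less)
  thus ?thesis using turan_part_card[OF sR] dm pv[OF i] by simp
 qed
 thus ?thesis using s by blast
qed

lemma graph_isoI:
 assumes G: "simple_graph G" and J: "simple_graph J" and b: "bij_betw \<phi> (verts G) (verts J)"
  and e: "!!u v. u \<in> verts G ==> v \<in> verts G ==> eg J (\<phi> u) (\<phi> v) \<longleftrightarrow> eg G u v"
 shows "G \<cong>\<^sub>g J"
proof -
 interpret G: gr G by unfold_locales (rule G)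
 interpret J: gr J by unfold_locales (rule J)
 have "(%e. \<phi> ` e) ` edges G = edges J"
 proof (intro equalityI subsetI)
  fix x assume "x \<in> (%e. \<phi> ` e) ` edges G"
  then obtain y where y: "y \<in> edges G" "x = \<phi> ` y" by blast
  then obtain u v where uv: "y = {u, v}" using G by (metis simple_graph_def card_2_iff)
  hence "eg G u v" using y G.edge_iff by simp
  hence "eg J (\<phi> u) (\<phi> v)" using e G.eg_verts by blast
  thus "x \<in> edges J" using uv y J.edge_iff by simp
 next
  fix x assume x: "x \<in> edges J"
  then obtain s t where st: "x = {s, t}" using J by (metis simple_graph_def card_2_iff)
  hence est: "eg J s t" using x J.edge_iff by simp
  hence "s \<in> verts J" "t \<in> verts J" using J.eg_verts[of s t] by auto
  moreover have "verts J = \<phi> ` verts G" using b by (simp add: bij_betw_def)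
  ultimately obtain u v where uv: "u \<in> verts G" "v \<in> verts G" "s = \<phi> u" "t = \<phi> v" by blast
  hence "{u, v} \<in> edges G" using e est G.edge_iff by simp
  moreover have "x = \<phi> ` {u, v}" using st uv by simp
  ultimately show "x \<in> (%e. \<phi> ` e) ` edges G" by blast
 qed
 thus ?thesis using b unfolding graph_iso_def by blast
qed

lemma eg_join:
 "eg (A \<otimes>\<^sub>g B) (Inl a) (Inl a') \<longleftrightarrow> eg A a a'"
 "eg (A \<otimes>\<^sub>g B) (Inr b) (Inr b') \<longleftrightarrow> eg B b b'"
 "eg (A \<otimes>\<^sub>g B) (Inl a) (Inr b) \<longleftrightarrow> a \<in> verts A & b \<in> verts B"
 "eg (A \<otimes>\<^sub>g B) (Inr b) (Inl a) \<longleftrightarrow> a \<in> verts A & b \<in> verts B"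
proof -
 have l: "{Inl a, Inl a'} = Inl ` e \<longleftrightarrow> e = {a, a'}" for e and a a' :: 'a
  using inj_image_eq_iff[OF inj_Inl, of "{a, a'}" e] by auto
 have r: "{Inr b, Inr b'} = Inr ` e \<longleftrightarrow> e = {b, b'}" for e and b b' :: 'b
  using inj_image_eq_iff[OF inj_Inr, of "{b, b'}" e] by auto
 have lr: "{Inl a, Inl a'} ~= Inr ` e" "{Inr b, Inr b'} ~= Inl ` e'" "{Inl a, Inr b} ~= Inl ` e'" "{Inl a, Inr b} ~= Inr ` e" for e :: "'b set" and e' :: "'a set" and a a' :: 'a and b b' :: 'b
  by auto
 have E: "edges (A \<otimes>\<^sub>g B) = (%e. Inl ` e) ` edges A Un (%e. Inr ` e) ` edges B Un {{Inl u, Inr v} |u v. u \<in> verts A & v \<in> verts B}"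
  by (simp add: graph_join_def disj_union_def)
 show "eg (A \<otimes>\<^sub>g B) (Inl a) (Inl a') \<longleftrightarrow> eg A a a'"
  unfolding eg_def E by (auto simp: image_iff l lr doubleton_eq_iff)
 show "eg (A \<otimes>\<^sub>g B) (Inr b) (Inr b') \<longleftrightarrow> eg B b b'"
  unfolding eg_def E by (auto simp: image_iff r lr doubleton_eq_iff)
 show c: "eg (A \<otimes>\<^sub>g B) (Inl a) (Inr b) \<longleftrightarrow> a \<in> verts A & b \<in> verts B"
  unfolding eg_def E by (auto simp: image_iff lr doubleton_eq_iff)
 thus "eg (A \<otimes>\<^sub>g B) (Inr b) (Inl a) \<longleftrightarrow> a \<in> verts A & b \<in> verts B"
  unfolding eg_def by (simp add: insert_commute)
qed

lemma eg_turan: "0 < R ==> eg (turan_graph n R) u v \<longleftrightarrow> u < n & v < n & u mod R ~= v mod R"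
 by (auto simp: eg_def turan_graph_def doubleton_eq_iff)

theorem theorem1p6:
 fixes l m r :: nat
 assumes "l \<ge> 3" and "m \<ge> 2 * l" and "r \<ge> 2"
 shows "\<exists>n0. \<forall>n\<ge>n0. \<forall>G \<in> extremal_graphs n {F1 l m r, F2 m r, F3 l m r, F4 l m r}.
      \<exists>H :: nat graph. H \<in> extremal_graphs (card (verts H)) {path_graph l} \<and>
       G \<cong>\<^sub>g H \<otimes>\<^sub>g turan_graph (n - card (verts H)) (r - 1)"
proof -
 have l: "3 <= l" and m: "2 * l <= m" and r: "2 <= r" using assms by auto
 obtain n0 where n0: "\<forall>n\<ge>n0. \<forall>G\<in>extremal_graphs n (family l m r). (\<exists>c. sgraph.gcol (eg G) r l (verts G) c) & wt_max r l n = ext r l m n"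
  using eventually_good[OF r l m] by blast
 have "\<exists>H :: nat graph. H \<in> extremal_graphs (card (verts H)) {path_graph l} &
       G \<cong>\<^sub>g H \<otimes>\<^sub>g turan_graph (n - card (verts H)) (r - 1)"
  if n: "n0 <= n" and G: "G \<in> extremal_graphs n (family l m r)" for n G
 proof -
  note eG = extremal_ext[OF r l m G]
  obtain c where c: "sgraph.gcol (eg G) r l (verts G) c" and we: "wt_max r l n = ext r l m n" using n0 n G by blast
  interpret gr G by unfold_locales (rule eG)
  define P where "P = (%i. {v\<in>verts G. c v = i})"
  define p where "p = (%i. card (P i))"
  have Pv: "{v\<in>verts G. c v = i} = P i" "card (P i) = p i" for i by (simp_all add: P_def p_def)
  note gw = gcol_wt[OF r l eG(1) c, unfolded Pv]
  have r0: "0 < r" using r by simp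
  have gc: "!!a b. pe (P 0) (P 0) + mix r p <= pe (verts G) (verts G) ==> a < r ==> b < r ==> a ~= b ==> cmpl (P a) (P b)"
   using gcol_count(3)[OF fin c r0] unfolding P_def p_def mix_def by blast
  have p0: "card (P 0) = p 0" by (simp add: p_def)
  have wt: "wt r l p = path_ex l (p 0) + mix r p" by (simp add: wt_def)
  have eqs: "2 * card (edges G) = wt_max r l n" "wt r l p <= wt_max r l n" "2 * card (edges G) <= pe (P 0) (P 0) + mix r p" "pe (P 0) (P 0) <= path_ex l (p 0)"
   using gw(2-4) eG(2,4) we p0 by auto
  \<comment> \<open>The graph attains \<open>wt_max\<close>, so every inequality between its edge
    count, \<open>wt\<close> and \<open>wt_max\<close> is an equality.\<close>
  have e0: "pe (P 0) (P 0) = path_ex l (p 0)" and wmax: "wt r l p = wt_max r l n" using eqs wt by linarith+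
  have cm: "cmpl (P a) (P b)" if "a < r" "b < r" "a ~= b" for a b
   by (rule gc[OF _ that]) (use eqs e0 wt pe_card_edges in linarith)
  have sub: "P 0 \<subseteq> verts G" by (auto simp: P_def)
  define H where "H = induced G (P 0)"
  have sH: "simple_graph H" unfolding H_def by (rule induced_simple[OF sub])
  have vH: "verts H = P 0" by (simp add: H_def induced_def)
  have fH: "family_free {path_graph l} H" unfolding H_def by (rule induced_path[OF sub]) (use c in "simp add: P_def gcol_def")
  have eH: "2 * card (edges H) = path_ex l (p 0)" using induced_edges[OF sub] e0 by (simp add: H_def)
  have "H \<in> extremal_graphs (card (verts H)) {path_graph l}" unfolding extremal_graphs_def
  proof (intro CollectI conjI allI impI)
   fix K :: "nat graph" assume K: "simple_graph K & card (verts K) = card (verts H) & family_free {path_graph l} K"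
   hence "2 * card (edges K) <= path_ex l (p 0)" using path_ex_ge[of K l] vH p0 by auto
   thus "card (edges K) <= card (edges H)" using eH by linarith
  qed (use sH fH in auto)
  moreover have "G \<cong>\<^sub>g H \<otimes>\<^sub>g turan_graph (n - card (verts H)) (r - 1)"
  proof -
   define R where "R = r - 1"
   have R: "0 < R" "r = Suc R" using r by (auto simp: R_def)
   \<comment> \<open>Moving a vertex between classes other than \<open>0\<close> leaves the path
     term unchanged, so an imbalance would contradict the maximality of
     \<open>wt r l p\<close>.\<close>
   have bal: "p (Suc i) <= p (Suc j) + 1" if ij: "i < R" "j < R" for i j
   proof (rule ccontr)
    assume "~ p (Suc i) <= p (Suc j) + 1"
    hence big: "p (Suc j) + 2 <= p (Suc i)" by simp
    hence ne: "Suc i ~= Suc j" by auto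
    have lt: "Suc i < r" "Suc j < r" using ij R by auto
    define q where "q = p(Suc i := p (Suc i) - 1, Suc j := p (Suc j) + 1)"
    note mb = mix_balance[OF lt ne, of p, OF big, folded q_def]
    have "wt r l q <= wt_max r l n" using wt_max_ge[of r l q] r0 l mb(1) gw(1) eG(2) by simp
    moreover have "q 0 = p 0" by (simp add: q_def)
    ultimately show False using mb(2) wmax by (simp add: wt_def)
   qed
   define n' where "n' = (\<Sum>i<R. p (Suc i))"
   have "n = p 0 + n'" using gw(1) eG(2) unfolding R(2) sum.lessThan_Suc_shift n'_def by simp
   hence n': "n - card (verts H) = n'" using vH p0 by simp
   obtain \<sigma> where s: "bij_betw \<sigma> {..<R} {..<R}" "\<forall>i<R. p (Suc i) = card {v. v < n' & v mod R = \<sigma> i}"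
    using balanced_turan[OF R(1), of "%i. p (Suc i)"] bal unfolding n'_def by blast
   have "\<forall>i\<in>{..<R}. \<exists>h. bij_betw h (P (Suc i)) {v. v < n' & v mod R = \<sigma> i}"
   proof
    fix i assume "i \<in> {..<R}"
    hence "card (P (Suc i)) = card {v. v < n' & v mod R = \<sigma> i}" using s(2) by (simp add: p_def)
    moreover have "finite (P (Suc i))" using fin by (simp add: P_def)
    ultimately show "\<exists>h. bij_betw h (P (Suc i)) {v. v < n' & v mod R = \<sigma> i}" by (intro finite_same_card_bij) auto
   qed
   then obtain h where "\<forall>i\<in>{..<R}. bij_betw (h i) (P (Suc i)) {v. v < n' & v mod R = \<sigma> i}" unfolding bchoice_iff ..
   hence h: "bij_betw (h i) (P (Suc i)) {v. v < n' & v mod R = \<sigma> i}" if "i < R" for i using that by simp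
   \<comment> \<open>Colour \<open>0\<close> goes to \<open>H\<close>; class \<open>Suc i\<close>
     goes to the residue class \<open>\<sigma> i\<close> modulo \<open>R\<close>, numbered by
     \<open>h i\<close>.\<close>
   define \<phi> where "\<phi> = (%v. if c v = 0 then Inl v else Inr (h (c v - 1) v))"
   have cr: "c v < r" if "v \<in> verts G" for v using c that by (simp add: gcol_def)
   have cS: "c v - 1 < R & v \<in> P (Suc (c v - 1))" if "v \<in> verts G" "c v ~= 0" for v
    using cr[OF that(1)] that R by (auto simp: P_def)
   have hv: "h (c v - 1) v < n' & h (c v - 1) v mod R = \<sigma> (c v - 1)" if "v \<in> verts G" "c v ~= 0" for v
    using h[of "c v - 1"] cS[OF that] by (auto simp: bij_betw_def)
   let ?J = "H \<otimes>\<^sub>g turan_graph n' R"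
   have vJ: "verts ?J = P 0 <+> {..<n'}" using R vH by (simp add: graph_join_def turan_graph_def)
   have sinj: "\<sigma> i = \<sigma> j \<longleftrightarrow> i = j" if "i < R" "j < R" for i j using s(1) that by (auto simp: bij_betw_def inj_on_def)
   have bij: "bij_betw \<phi> (verts G) (verts ?J)" unfolding bij_betw_def
   proof
    show "inj_on \<phi> (verts G)"
    proof (rule inj_onI)
     fix u v assume uv: "u \<in> verts G" "v \<in> verts G" "\<phi> u = \<phi> v"
     show "u = v"
     proof (cases "c u = 0 \<or> c v = 0")
      case True thus ?thesis using uv(3) by (auto simp: \<phi>_def split: if_splits)
     next
      case False
      hence e: "h (c u - 1) u = h (c v - 1) v" using uv(3) by (simp add: \<phi>_def)
      hence "\<sigma> (c u - 1) = \<sigma> (c v - 1)" using hv[OF uv(1)] hv[OF uv(2)] False by metis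
      hence ce: "c u - 1 = c v - 1" using sinj cS uv False by blast
      have "inj_on (h (c u - 1)) (P (Suc (c u - 1)))" using h[of "c u - 1"] cS[OF uv(1)] False by (simp add: bij_betw_def)
      thus ?thesis using e ce cS[OF uv(1)] cS[OF uv(2)] False by (metis inj_onD)
     qed
    qed
    show "\<phi> ` verts G = verts ?J"
    proof (intro equalityI subsetI)
     fix x assume "x \<in> \<phi> ` verts G"
     then obtain v where "v \<in> verts G" "x = \<phi> v" by blast
     thus "x \<in> verts ?J" unfolding vJ using hv[of v] by (auto simp: \<phi>_def P_def)
    next
     fix x assume x: "x \<in> verts ?J"
     show "x \<in> \<phi> ` verts G"
     proof (cases x)
      case (Inl a)
      hence "a \<in> verts G" "\<phi> a = x" using x unfolding vJ by (auto simp: \<phi>_def P_def)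
      thus ?thesis by blast
     next
      case (Inr w)
      hence w: "w < n'" using x unfolding vJ by auto
      have "w mod R \<in> \<sigma> ` {..<R}" using s(1) R by (simp add: bij_betw_def)
      then obtain i where i: "i < R" "w mod R = \<sigma> i" by auto
      have "w \<in> h i ` P (Suc i)" using h[OF i(1)] w i(2) by (simp add: bij_betw_def)
      then obtain v where v: "v \<in> P (Suc i)" "w = h i v" by blast
      hence "v \<in> verts G" "\<phi> v = x" using Inr by (auto simp: \<phi>_def P_def)
      thus ?thesis by blast
     qed
    qed
   qed
   have "G \<cong>\<^sub>g ?J"
   proof (rule graph_isoI[OF eG(1) _ bij])
    show "simple_graph ?J" by (rule simple_graph_join[OF sH simple_constructions(4)])
    fix u v assume uv: "u \<in> verts G" "v \<in> verts G"
    have cross: "eg G x y" if "x \<in> verts G" "y \<in> verts G" "c x ~= c y" for x y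
     using cm[OF cr[OF that(1)] cr[OF that(2)] that(3)] that by (auto simp: cmpl_def P_def)
    have same: "~ eg G x y" if "x \<in> verts G" "y \<in> verts G" "c x = c y" "c x ~= 0" for x y
    proof
     assume "eg G x y"
     hence "c x = 0" using c that(1-3) unfolding gcol_def by blast
     thus False using that(4) by simp
    qed
    have inT: "h (c x - 1) x \<in> verts (turan_graph n' R)" if "x \<in> verts G" "c x ~= 0" for x
     using hv[OF that] R by (simp add: turan_graph_def)
    show "eg ?J (\<phi> u) (\<phi> v) \<longleftrightarrow> eg G u v"
    proof (cases "c u = 0")
     case u0: True
     show ?thesis
     proof (cases "c v = 0")
      case True
      have "eg H u v \<longleftrightarrow> eg G u v" using u0 True uv by (auto simp: H_def eg_def induced_def P_def)
      thus ?thesis using u0 True by (simp add: \<phi>_def eg_join)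
     next
      case False
      thus ?thesis using u0 uv cross[OF uv] inT[OF uv(2)] vH by (simp add: \<phi>_def eg_join P_def)
     qed
    next
     case u0: False
     show ?thesis
     proof (cases "c v = 0")
      case True
      thus ?thesis using u0 uv cross[OF uv] inT[OF uv(1)] vH by (simp add: \<phi>_def eg_join P_def)
     next
      case False
      have "eg ?J (\<phi> u) (\<phi> v) \<longleftrightarrow> \<sigma> (c u - 1) ~= \<sigma> (c v - 1)"
       using hv[OF uv(1) u0] hv[OF uv(2) False] u0 False by (simp add: \<phi>_def eg_join eg_turan[OF R(1)])
      also have "... \<longleftrightarrow> c u ~= c v" using sinj[of "c u - 1" "c v - 1"] cS[OF uv(1) u0] cS[OF uv(2) False] u0 False by auto
      also have "... \<longleftrightarrow> eg G u v" using cross[OF uv] same[OF uv] u0 by blast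
      finally show ?thesis .
     qed
    qed
   qed
   thus ?thesis unfolding n' R_def .
  qed
  ultimately show ?thesis by blast
 qed
 thus ?thesis by blast
qed

end
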